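(* Let $p$ be a prime and let $\mathcal{F}$ be a saturated fusion system on a finite $p$-group $S$. Then: (1) $\omega_{\mathcal{F}} \circ [T,\mathrm{incl}]^S_T = [T,\mathrm{incl}]^S_T \circ \omega_{O^p(\mathcal{F})}$ in $A(T,S)_{(p)}$, where $T$ is the hyperfocal subgroup of $\mathcal{F}$. (2) $\omega_{\mathcal{F}} = \omega_{N_{\mathcal{F}}(S)} \circ \omega_{O^{p'}(\mathcal{F})}$ in $A(S,S)_{(p)}$.
   Context: Fusion systems and saturation are in the standard sense of Broto--Levi--Oliver. A fusion subsystem of $\mathcal{F}$ on a subgroup $R\le S$ is a fusion system on $R$ all of whose morphisms are morphisms of $\mathcal{F}$. Subsystems used (definitions of Broto--Castellana--Grodal--Levi--Oliver). The hyperfocal subgroup of $\mathcal{F}$ is $T=\langle g^{-1}\alpha(g)\mid g\in P\le S,\ \alpha\in O^p(\mathrm{Aut}_{\mathcal{F}}(P))\rangle$. $O^p(\mathcal{F})$ is the unique saturated fusion subsystem of $\mathcal{F}$ on $T$ such that $\mathrm{Aut}_{O^p(\mathcal{F})}(P)\ge O^p(\mathrm{Aut}_{\mathcal{F}}(P))$ for all $P\le T$. $O^{p'}(\mathcal{F})$ is the unique smallest saturated fusion subsystem $\mathcal{F}_0$ of $\mathcal{F}$ on $S$ such that $\mathrm{Aut}_{\mathcal{F}_0}(P)\ge O^{p'}(\mathrm{Aut}_{\mathcal{F}}(P))$ for all $P\le S$. $N_{\mathcal{F}}(S)$ is the (saturated) fusion system on $S$ whose morphisms are the morphisms of $\mathcal{F}$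 that are restrictions of elements of $\mathrm{Aut}_{\mathcal{F}}(S)$. For a finite group $\Gamma$, $O^p(\Gamma)$ and $O^{p'}(\Gamma)$ are the smallest normal subgroups of $p$-power index, respectively of index prime to $p$. Burnside modules. For finite groups $G,H$, a $(G,H)$-biset is a set with commuting left $H$-action and right $G$-action. $A(G,H)$ is the Grothendieck group (under disjoint union) of isomorphism classes of finite $(G,H)$-bisets whose left $H$-action is free; $A(G,H)_{(p)}$ is its $p$-localization. For $K\le G$ and a homomorphism $\varphi\colon K\to H$, $[K,\varphi]_G^H$ (or $[K,\varphi]$) is the class of $H\times_{K,\varphi}G=(H\times G)/\sim$, where $(h,kg)\sim(h\varphi(k),g)$ for $k\in K$. These classes, over conjugacy classes of pairs $(K,\varphi)$ (conjugacy in both $G$ and $H$), form a basis of $A(G,H)$. The bilinear composition $A(H,K)\times A(G,H)\to A(G,K)$ is given on bisets by $X\circ Y=X\times_H Y$. The map $\mathrm{incl}$ denotes the relevant inclusion of subgroups. Characteristic idempotents. Let $\mathcal{F}$ be a fusion system on $S$. An element $X\in A(S,S)_{(p)}$ is $\mathcal{F}$-generated if it is a linear combination of basis elements $[P,\varphi]$ with $\varphi$ in $\mathcal{F}$. For a finite group $H$, $X\in A(S,H)_{(p)}$ is right $\mathcal{F}$-stable if $X\circ[P,\varphi]_P^S=X\circ[P,\mathrm{incl}]_P^S$ for all $P\le S$, $\varphi\in\mathrm{Hom}_{\mathcal{F}}(P,S)$; $X\in A(H,S)_{(p)}$ is left $\mathcal{F}$-stable if $[\varphi(P),\varphi^{-1}]_S^P\circ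 X=[P,\mathrm{id}]_S^P\circ X$ for all such $P,\varphi$. The augmentation $\epsilon\colon A(S,S)_{(p)}\to\mathbb{Z}_{(p)}$ is the linear map with $\epsilon([P,\varphi]_S^S)=|S/P|$. For $\mathcal{F}$ saturated, a characteristic idempotent for $\mathcal{F}$ is an idempotent of the ring $A(S,S)_{(p)}$ that is $\mathcal{F}$-generated, left and right $\mathcal{F}$-stable, and of augmentation prime to $p$. It is known that every saturated fusion system $\mathcal{F}$ has exactly one characteristic idempotent; it is denoted $\omega_{\mathcal{F}}$. *)

theory Defs
  imports Complex_Main "HOL-Algebra.Group_Action" "HOL-Algebra.Generated_Groups"
    "HOL-Computational_Algebra.Primes" "HOL-Library.Poly_Mapping"
begin

section \<open>Fusion systems\<close>

locale finite_p_group = group S for S (structure) +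
  fixes p :: nat
  assumes prime_p: "prime p"
    and finite_carrier: "finite (carrier S)"
    and order_p_power: "\<exists>n. order S = p ^ n"

text \<open>The homomorphisms \<open>P \<rightarrow> Q\<close> given by \<open>x \<mapsto> g x g\<^sup>-\<^sup>1\<close> with \<open>g\<close> in \<open>S\<close>. All
  homomorphisms with domain \<open>P\<close> are taken to be extensional on \<open>P\<close>.\<close>

definition conj_hom :: "('a, 'm) monoid_scheme \<Rightarrow> 'a set \<Rightarrow> 'a set \<Rightarrow> ('a \<Rightarrow> 'a) set" where
  "conj_hom S P Q = {(\<lambda>x\<in>P. g \<otimes>\<^bsub>S\<^esub> x \<otimes>\<^bsub>S\<^esub> inv\<^bsub>S\<^esub> g) | g.
     g \<in> carrier S \<and> (\<forall>x\<in>P. g \<otimes>\<^bsub>S\<^esub> x \<otimes>\<^bsub>S\<^esub> inv\<^bsub>S\<^esub> g \<in> Q)}"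

text \<open>\<open>F P Q\<close> is the morphism set from \<open>P\<close> to \<open>Q\<close>; its values are
  only relevant when \<open>P\<close> and \<open>Q\<close> are subgroups of \<open>S\<close>. Identities and inclusions are
  conjugations by \<open>\<one>\<close>. The last axiom says that each morphism is an isomorphism of the category
  followed by an inclusion.\<close>

locale fusion_system = finite_p_group S p for S (structure) and p +
  fixes F :: "'a set \<Rightarrow> 'a set \<Rightarrow> ('a \<Rightarrow> 'a) set"
  assumes conj_hom_subset:
      "\<lbrakk>subgroup P S; subgroup Q S\<rbrakk> \<Longrightarrow> conj_hom S P Q \<subseteq> F P Q"
    and injective_hom:
      "\<lbrakk>subgroup P S; subgroup Q S\<rbrakk> \<Longrightarrow>
        F P Q \<subseteq> mon (S\<lparr>carrier := P\<rparr>) (S\<lparr>carrier := Q\<rparr>) \<inter> extensional P"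
    and comp_closed:
      "\<lbrakk>subgroup P S; subgroup Q S; subgroup R S; \<phi> \<in> F P Q; \<psi> \<in> F Q R\<rbrakk> \<Longrightarrow>
        compose P \<psi> \<phi> \<in> F P R"
    and iso_factor:
      "\<lbrakk>subgroup P S; subgroup Q S; \<phi> \<in> F P Q\<rbrakk> \<Longrightarrow>
        \<phi> \<in> F P (\<phi> ` P) \<and> restrict (inv_into P \<phi>) (\<phi> ` P) \<in> F (\<phi> ` P) P"

definition aut_group :: "('a set \<Rightarrow> 'a set \<Rightarrow> ('a \<Rightarrow> 'a) set) \<Rightarrow> 'a set \<Rightarrow> ('a \<Rightarrow> 'a) monoid" where
  "aut_group F P = (BijGroup P)\<lparr>carrier := F P P\<rparr>"

definition group_centralizer :: "('a, 'm) monoid_scheme \<Rightarrow> 'a set \<Rightarrow> 'a set" where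
  "group_centralizer S P = {g \<in> carrier S. \<forall>x\<in>P. g \<otimes>\<^bsub>S\<^esub> x = x \<otimes>\<^bsub>S\<^esub> g}"

definition sylow_subgroup :: "nat \<Rightarrow> ('a, 'm) monoid_scheme \<Rightarrow> 'a set \<Rightarrow> bool" where
  "sylow_subgroup p G Q \<longleftrightarrow> subgroup Q G \<and> card Q = p ^ multiplicity p (order G)"

definition F_conjugate ::
  "('a, 'm) monoid_scheme \<Rightarrow> ('a set \<Rightarrow> 'a set \<Rightarrow> ('a \<Rightarrow> 'a) set) \<Rightarrow> 'a set \<Rightarrow> 'a set \<Rightarrow> bool" where
  "F_conjugate S F P Q \<longleftrightarrow> subgroup P S \<and> subgroup Q S \<and> (\<exists>\<phi>\<in>F P Q. \<phi> ` P = Q)"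

definition fully_centralized ::
  "('a, 'm) monoid_scheme \<Rightarrow> ('a set \<Rightarrow> 'a set \<Rightarrow> ('a \<Rightarrow> 'a) set) \<Rightarrow> 'a set \<Rightarrow> bool" where
  "fully_centralized S F P \<longleftrightarrow>
     (\<forall>Q. F_conjugate S F P Q \<longrightarrow> card (group_centralizer S Q) \<le> card (group_centralizer S P))"

definition fully_normalized ::
  "('a, 'm) monoid_scheme \<Rightarrow> ('a set \<Rightarrow> 'a set \<Rightarrow> ('a \<Rightarrow> 'a) set) \<Rightarrow> 'a set \<Rightarrow> bool" where
  "fully_normalized S F P \<longleftrightarrow>
     (\<forall>Q. F_conjugate S F P Q \<longrightarrow> card (normalizer S Q) \<le> card (normalizer S P))"

text \<open>\<open>N\<^sub>\<phi>\<close>: the \<open>g \<in> N\<^sub>S(P)\<close> with \<open>\<phi> c\<^sub>g \<phi>\<^sup>-\<^sup>1 \<in> Aut\<^sub>S(\<phi>(P))\<close>.\<close>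

definition extender ::
  "('a, 'm) monoid_scheme \<Rightarrow> 'a set \<Rightarrow> ('a \<Rightarrow> 'a) \<Rightarrow> 'a set" where
  "extender S P \<phi> = {g \<in> normalizer S P.
     (\<lambda>y\<in>\<phi> ` P. \<phi> (g \<otimes>\<^bsub>S\<^esub> inv_into P \<phi> y \<otimes>\<^bsub>S\<^esub> inv\<^bsub>S\<^esub> g)) \<in> conj_hom S (\<phi> ` P) (\<phi> ` P)}"

locale saturated_fusion_system = fusion_system +
  assumes sylow_axiom:
      "\<lbrakk>subgroup P S; fully_normalized S F P\<rbrakk> \<Longrightarrow>
        fully_centralized S F P \<and> sylow_subgroup p (aut_group F P) (conj_hom S P P)"
    and extension_axiom:
      "\<lbrakk>subgroup P S; \<phi> \<in> F P (carrier S); fully_centralized S F (\<phi> ` P)\<rbrakk> \<Longrightarrow>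
        \<exists>\<psi> \<in> F (extender S P \<phi>) (carrier S). restrict \<psi> P = \<phi>"

definition fusion_subsystem ::
  "('a, 'm) monoid_scheme \<Rightarrow> nat \<Rightarrow> ('a set \<Rightarrow> 'a set \<Rightarrow> ('a \<Rightarrow> 'a) set) \<Rightarrow> 'a set \<Rightarrow>
   ('a set \<Rightarrow> 'a set \<Rightarrow> ('a \<Rightarrow> 'a) set) \<Rightarrow> bool" where
  "fusion_subsystem S p F R E \<longleftrightarrow>
     subgroup R S \<and> fusion_system (S\<lparr>carrier := R\<rparr>) p E \<and>
     (\<forall>P Q. subgroup P (S\<lparr>carrier := R\<rparr>) \<and> subgroup Q (S\<lparr>carrier := R\<rparr>) \<longrightarrow> E P Q \<subseteq> F P Q)"

text \<open>\<open>O\<^sup>p(\<Gamma>)\<close> and \<open>O\<^sup>p\<^sup>'(\<Gamma>)\<close> for a finite group \<open>\<Gamma>\<close>, where \<open>LEAST\<close> refers to inclusion.\<close>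

definition O_p_residual :: "nat \<Rightarrow> ('a, 'm) monoid_scheme \<Rightarrow> 'a set" where
  "O_p_residual p \<Gamma> = (LEAST N. N \<lhd> \<Gamma> \<and> (\<exists>k. card (rcosets\<^bsub>\<Gamma>\<^esub> N) = p ^ k))"

definition O_p'_residual :: "nat \<Rightarrow> ('a, 'm) monoid_scheme \<Rightarrow> 'a set" where
  "O_p'_residual p \<Gamma> = (LEAST N. N \<lhd> \<Gamma> \<and> coprime p (card (rcosets\<^bsub>\<Gamma>\<^esub> N)))"

definition hyperfocal ::
  "('a, 'm) monoid_scheme \<Rightarrow> nat \<Rightarrow> ('a set \<Rightarrow> 'a set \<Rightarrow> ('a \<Rightarrow> 'a) set) \<Rightarrow> 'a set" where
  "hyperfocal S p F = generate S {inv\<^bsub>S\<^esub> g \<otimes>\<^bsub>S\<^esub> \<alpha> g | g \<alpha> P.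
     subgroup P S \<and> g \<in> P \<and> \<alpha> \<in> O_p_residual p (aut_group F P)}"

definition is_O_p_subsystem ::
  "('a, 'm) monoid_scheme \<Rightarrow> nat \<Rightarrow> ('a set \<Rightarrow> 'a set \<Rightarrow> ('a \<Rightarrow> 'a) set) \<Rightarrow>
   ('a set \<Rightarrow> 'a set \<Rightarrow> ('a \<Rightarrow> 'a) set) \<Rightarrow> bool" where
  "is_O_p_subsystem S p F E \<longleftrightarrow>
     (let T = hyperfocal S p F in
       fusion_subsystem S p F T E \<and> saturated_fusion_system (S\<lparr>carrier := T\<rparr>) p E \<and>
       (\<forall>P. subgroup P (S\<lparr>carrier := T\<rparr>) \<longrightarrow> O_p_residual p (aut_group F P) \<subseteq> E P P))"

definition saturated_of_index_prime_to_p ::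
  "('a, 'm) monoid_scheme \<Rightarrow> nat \<Rightarrow> ('a set \<Rightarrow> 'a set \<Rightarrow> ('a \<Rightarrow> 'a) set) \<Rightarrow>
   ('a set \<Rightarrow> 'a set \<Rightarrow> ('a \<Rightarrow> 'a) set) \<Rightarrow> bool" where
  "saturated_of_index_prime_to_p S p F E \<longleftrightarrow>
     fusion_subsystem S p F (carrier S) E \<and> saturated_fusion_system S p E \<and>
     (\<forall>P. subgroup P S \<longrightarrow> O_p'_residual p (aut_group F P) \<subseteq> E P P)"

definition is_O_p'_subsystem ::
  "('a, 'm) monoid_scheme \<Rightarrow> nat \<Rightarrow> ('a set \<Rightarrow> 'a set \<Rightarrow> ('a \<Rightarrow> 'a) set) \<Rightarrow>
   ('a set \<Rightarrow> 'a set \<Rightarrow> ('a \<Rightarrow> 'a) set) \<Rightarrow> bool" where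
  "is_O_p'_subsystem S p F E \<longleftrightarrow>
     saturated_of_index_prime_to_p S p F E \<and>
     (\<forall>E'. saturated_of_index_prime_to_p S p F E' \<longrightarrow>
       (\<forall>P Q. subgroup P S \<and> subgroup Q S \<longrightarrow> E P Q \<subseteq> E' P Q))"

definition normalizer_system ::
  "('a, 'm) monoid_scheme \<Rightarrow> ('a set \<Rightarrow> 'a set \<Rightarrow> ('a \<Rightarrow> 'a) set) \<Rightarrow>
   'a set \<Rightarrow> 'a set \<Rightarrow> ('a \<Rightarrow> 'a) set" where
  "normalizer_system S F P Q =
     {\<phi> \<in> F P Q. \<exists>\<alpha> \<in> F (carrier S) (carrier S). restrict \<alpha> P = \<phi>}"


section \<open>Bisets\<close>

text \<open>A \<open>(G, H)\<close>-biset carries a left action of \<open>H\<close> and a right action of \<open>G\<close>.\<close>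

record ('g, 'h, 'x) biset =
  points :: "'x set"
  lact :: "'h \<Rightarrow> 'x \<Rightarrow> 'x"
  ract :: "'x \<Rightarrow> 'g \<Rightarrow> 'x"

locale left_free_biset = G: group G + H: group H
  for G :: "('g, 'm) monoid_scheme" and H :: "('h, 'n) monoid_scheme" +
  fixes X :: "('g, 'h, 'x) biset"
  assumes finite_points: "finite (points X)"
    and lact_closed: "\<lbrakk>h \<in> carrier H; x \<in> points X\<rbrakk> \<Longrightarrow> lact X h x \<in> points X"
    and lact_one: "x \<in> points X \<Longrightarrow> lact X \<one>\<^bsub>H\<^esub> x = x"
    and lact_mult: "\<lbrakk>h \<in> carrier H; h' \<in> carrier H; x \<in> points X\<rbrakk> \<Longrightarrow>
      lact X (h \<otimes>\<^bsub>H\<^esub> h') x = lact X h (lact X h' x)"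
    and ract_closed: "\<lbrakk>g \<in> carrier G; x \<in> points X\<rbrakk> \<Longrightarrow> ract X x g \<in> points X"
    and ract_one: "x \<in> points X \<Longrightarrow> ract X x \<one>\<^bsub>G\<^esub> = x"
    and ract_mult: "\<lbrakk>g \<in> carrier G; g' \<in> carrier G; x \<in> points X\<rbrakk> \<Longrightarrow>
      ract X x (g \<otimes>\<^bsub>G\<^esub> g') = ract X (ract X x g) g'"
    and actions_commute: "\<lbrakk>h \<in> carrier H; g \<in> carrier G; x \<in> points X\<rbrakk> \<Longrightarrow>
      ract X (lact X h x) g = lact X h (ract X x g)"
    and left_free: "\<lbrakk>h \<in> carrier H; x \<in> points X; lact X h x = x\<rbrakk> \<Longrightarrow> h = \<one>\<^bsub>H\<^esub>"

definition biset_iso ::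
  "('g, 'm) monoid_scheme \<Rightarrow> ('h, 'n) monoid_scheme \<Rightarrow>
   ('g, 'h, 'x) biset \<Rightarrow> ('g, 'h, 'y) biset \<Rightarrow> bool" where
  "biset_iso G H X Y \<longleftrightarrow> (\<exists>f. bij_betw f (points X) (points Y) \<and>
     (\<forall>x\<in>points X. (\<forall>h\<in>carrier H. f (lact X h x) = lact Y h (f x)) \<and>
                   (\<forall>g\<in>carrier G. f (ract X x g) = ract Y (f x) g)))"

definition biset_union ::
  "('g, 'h, 'x) biset \<Rightarrow> ('g, 'h, 'y) biset \<Rightarrow> ('g, 'h, 'x + 'y) biset" where
  "biset_union X Y =
     \<lparr>points = points X <+> points Y,
      lact = (\<lambda>h. map_sum (lact X h) (lact Y h)),
      ract = (\<lambda>z g. map_sum (\<lambda>x. ract X x g) (\<lambda>y. ract Y y g) z)\<rparr>"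

text \<open>\<open>X \<times>\<^sub>H Y\<close>, the quotient of \<open>X \<times> Y\<close> by \<open>(x h, y) \<sim> (x, h y)\<close>, for an \<open>(H, K)\<close>-biset \<open>X\<close>
  and a \<open>(G, H)\<close>-biset \<open>Y\<close>. The given pairs already form an equivalence relation, as \<open>H\<close> is a
  group.\<close>

definition biset_product ::
  "('h, 'n) monoid_scheme \<Rightarrow> ('h, 'k, 'x) biset \<Rightarrow> ('g, 'h, 'y) biset \<Rightarrow>
   ('g, 'k, ('x \<times> 'y) set) biset" where
  "biset_product H X Y =
     \<lparr>points = (points X \<times> points Y) //
        {((ract X x h, y), (x, lact Y h y)) | x y h.
           x \<in> points X \<and> y \<in> points Y \<and> h \<in> carrier H},
      lact = (\<lambda>k C. (\<lambda>(x, y). (lact X k x, y)) ` C),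
      ract = (\<lambda>C g. (\<lambda>(x, y). (x, ract Y y g)) ` C)\<rparr>"

text \<open>\<open>H \<times>\<^bsub>(K,\<phi>)\<^esub> G\<close>, the quotient of \<open>H \<times> G\<close> by \<open>(h, k g) \<sim> (h \<phi>(k), g)\<close>; again the given
  pairs form an equivalence relation.\<close>

definition basis_biset ::
  "('g, 'm) monoid_scheme \<Rightarrow> ('h, 'n) monoid_scheme \<Rightarrow> 'g set \<Rightarrow> ('g \<Rightarrow> 'h) \<Rightarrow>
   ('g, 'h, ('h \<times> 'g) set) biset" where
  "basis_biset G H K \<phi> =
     \<lparr>points = (carrier H \<times> carrier G) //
        {((h, k \<otimes>\<^bsub>G\<^esub> g), (h \<otimes>\<^bsub>H\<^esub> \<phi> k, g)) | h k g.
           h \<in> carrier H \<and> k \<in> K \<and> g \<in> carrier G},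
      lact = (\<lambda>h' C. (\<lambda>(h, g). (h' \<otimes>\<^bsub>H\<^esub> h, g)) ` C),
      ract = (\<lambda>C g'. (\<lambda>(h, g). (h, g \<otimes>\<^bsub>G\<^esub> g')) ` C)\<rparr>"


section \<open>Burnside modules\<close>

text \<open>Every finite biset is isomorphic to one whose points are natural numbers, so an isomorphism
  class is represented by the set of its members with points in \<open>nat\<close>.\<close>

type_synonym ('g, 'h) biset_class = "('g, 'h, nat) biset set"

definition iso_class ::
  "('g, 'm) monoid_scheme \<Rightarrow> ('h, 'n) monoid_scheme \<Rightarrow> ('g, 'h, 'x) biset \<Rightarrow>
   ('g, 'h) biset_class" where
  "iso_class G H X = {Y. left_free_biset G H Y \<and> biset_iso G H X Y}"

definition iso_classes ::
  "('g, 'm) monoid_scheme \<Rightarrow> ('h, 'n) monoid_scheme \<Rightarrow> ('g, 'h) biset_class set" where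
  "iso_classes G H = {iso_class G H X | X :: ('g, 'h, nat) biset. left_free_biset G H X}"

definition Z_loc :: "nat \<Rightarrow> rat set" where
  "Z_loc p = {of_int a / of_int b | a b. \<not> int p dvd b}"

text \<open>\<open>A(G,H)\<^bsub>(p)\<^esub> = A(G,H) \<otimes> \<int>\<^bsub>(p)\<^esub>\<close> is the \<open>\<int>\<^bsub>(p)\<^esub>\<close>-module generated by the isomorphism
  classes subject to the relations \<open>[X \<squnion> Y] = [X] + [Y]\<close>. It is the quotient of the free
  \<open>\<int>\<^bsub>(p)\<^esub>\<close>-module on the isomorphism classes, whose additive group is
  \<open>formal_combs\<close>, by the subgroup generated by all \<open>\<int>\<^bsub>(p)\<^esub>\<close>-multiples of the
  relators. Its elements are cosets.\<close>

definition formal_combs ::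
  "nat \<Rightarrow> ('g, 'm) monoid_scheme \<Rightarrow> ('h, 'n) monoid_scheme \<Rightarrow>
   (('g, 'h) biset_class \<Rightarrow>\<^sub>0 rat) monoid" where
  "formal_combs p G H =
     \<lparr>carrier = {x. Poly_Mapping.keys x \<subseteq> iso_classes G H \<and>
                    (\<forall>a. Poly_Mapping.lookup x a \<in> Z_loc p)},
      monoid.mult = (+), one = 0\<rparr>"

definition union_relations ::
  "nat \<Rightarrow> ('g, 'm) monoid_scheme \<Rightarrow> ('h, 'n) monoid_scheme \<Rightarrow>
   (('g, 'h) biset_class \<Rightarrow>\<^sub>0 rat) set" where
  "union_relations p G H = generate (formal_combs p G H)
     {Poly_Mapping.single (iso_class G H (biset_union X Y)) r
        - Poly_Mapping.single (iso_class G H X) r - Poly_Mapping.single (iso_class G H Y) r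
      | (X :: ('g, 'h, nat) biset) (Y :: ('g, 'h, nat) biset) r.
        left_free_biset G H X \<and> left_free_biset G H Y \<and> r \<in> Z_loc p}"

type_synonym ('g, 'h) burnside_elem = "(('g, 'h) biset_class \<Rightarrow>\<^sub>0 rat) set"

definition burnside ::
  "nat \<Rightarrow> ('g, 'm) monoid_scheme \<Rightarrow> ('h, 'n) monoid_scheme \<Rightarrow> ('g, 'h) burnside_elem monoid" where
  "burnside p G H = formal_combs p G H Mod union_relations p G H"

definition burnside_class ::
  "nat \<Rightarrow> ('g, 'm) monoid_scheme \<Rightarrow> ('h, 'n) monoid_scheme \<Rightarrow>
   (('g, 'h) biset_class \<Rightarrow>\<^sub>0 rat) \<Rightarrow> ('g, 'h) burnside_elem" where
  "burnside_class p G H x = union_relations p G H #>\<^bsub>formal_combs p G H\<^esub> x"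

definition basis_elem ::
  "nat \<Rightarrow> ('g, 'm) monoid_scheme \<Rightarrow> ('h, 'n) monoid_scheme \<Rightarrow> 'g set \<Rightarrow> ('g \<Rightarrow> 'h) \<Rightarrow>
   ('g, 'h) burnside_elem" where
  "basis_elem p G H K \<phi> =
     burnside_class p G H (Poly_Mapping.single (iso_class G H (basis_biset G H K \<phi>)) 1)"

definition class_comp ::
  "('g, 'm) monoid_scheme \<Rightarrow> ('h, 'n) monoid_scheme \<Rightarrow> ('k, 'l) monoid_scheme \<Rightarrow>
   ('h, 'k) biset_class \<Rightarrow> ('g, 'h) biset_class \<Rightarrow> ('g, 'k) biset_class" where
  "class_comp G H K a b = (\<Union>X\<in>a. \<Union>Y\<in>b. iso_class G K (biset_product H X Y))"

definition formal_comp ::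
  "('g, 'm) monoid_scheme \<Rightarrow> ('h, 'n) monoid_scheme \<Rightarrow> ('k, 'l) monoid_scheme \<Rightarrow>
   (('h, 'k) biset_class \<Rightarrow>\<^sub>0 rat) \<Rightarrow> (('g, 'h) biset_class \<Rightarrow>\<^sub>0 rat) \<Rightarrow>
   (('g, 'k) biset_class \<Rightarrow>\<^sub>0 rat)" where
  "formal_comp G H K x y =
     (\<Sum>a\<in>Poly_Mapping.keys x. \<Sum>b\<in>Poly_Mapping.keys y.
        Poly_Mapping.single (class_comp G H K a b)
          (Poly_Mapping.lookup x a * Poly_Mapping.lookup y b))"

text \<open>The composition \<open>A(H,K)\<^bsub>(p)\<^esub> \<times> A(G,H)\<^bsub>(p)\<^esub> \<rightarrow> A(G,K)\<^bsub>(p)\<^esub>\<close>. All sets in the union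
  coincide.\<close>

definition burnside_comp ::
  "nat \<Rightarrow> ('g, 'm) monoid_scheme \<Rightarrow> ('h, 'n) monoid_scheme \<Rightarrow> ('k, 'l) monoid_scheme \<Rightarrow>
   ('h, 'k) burnside_elem \<Rightarrow> ('g, 'h) burnside_elem \<Rightarrow> ('g, 'k) burnside_elem" where
  "burnside_comp p G H K A B =
     (\<Union>x\<in>A. \<Union>y\<in>B. burnside_class p G K (formal_comp G H K x y))"


section \<open>Characteristic idempotents\<close>

text \<open>\<open>X = \<Sum> c\<^bsub>(P,\<phi>)\<^esub> [P,\<phi>]\<close>, summed over a finite set \<open>I\<close> of pairs.\<close>

definition is_basis_comb ::
  "nat \<Rightarrow> ('g, 'm) monoid_scheme \<Rightarrow> ('h, 'n) monoid_scheme \<Rightarrow> ('g set \<times> ('g \<Rightarrow> 'h)) set \<Rightarrow>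
   ('g set \<times> ('g \<Rightarrow> 'h) \<Rightarrow> rat) \<Rightarrow> ('g, 'h) burnside_elem \<Rightarrow> bool" where
  "is_basis_comb p G H I c X \<longleftrightarrow>
     finite I \<and> (\<forall>(P, \<phi>)\<in>I. subgroup P G \<and> \<phi> \<in> hom (G\<lparr>carrier := P\<rparr>) H) \<and> c ` I \<subseteq> Z_loc p \<and>
     X = burnside_class p G H
       (\<Sum>(P, \<phi>)\<in>I. Poly_Mapping.single (iso_class G H (basis_biset G H P \<phi>)) (c (P, \<phi>)))"

definition F_generated ::
  "('a, 'm) monoid_scheme \<Rightarrow> nat \<Rightarrow> ('a set \<Rightarrow> 'a set \<Rightarrow> ('a \<Rightarrow> 'a) set) \<Rightarrow>
   ('a, 'a) burnside_elem \<Rightarrow> bool" where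
  "F_generated S p F X \<longleftrightarrow>
     (\<exists>I c. is_basis_comb p S S I c X \<and> (\<forall>(P, \<phi>)\<in>I. \<phi> \<in> F P (carrier S)))"

definition right_stable ::
  "('a, 'm) monoid_scheme \<Rightarrow> nat \<Rightarrow> ('a set \<Rightarrow> 'a set \<Rightarrow> ('a \<Rightarrow> 'a) set) \<Rightarrow>
   ('h, 'n) monoid_scheme \<Rightarrow> ('a, 'h) burnside_elem \<Rightarrow> bool" where
  "right_stable S p F H X \<longleftrightarrow>
     (\<forall>P \<phi>. subgroup P S \<and> \<phi> \<in> F P (carrier S) \<longrightarrow>
        (let P' = S\<lparr>carrier := P\<rparr> in
          burnside_comp p P' S H X (basis_elem p P' S P \<phi>) =
          burnside_comp p P' S H X (basis_elem p P' S P (\<lambda>x\<in>P. x))))"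

definition left_stable ::
  "('a, 'm) monoid_scheme \<Rightarrow> nat \<Rightarrow> ('a set \<Rightarrow> 'a set \<Rightarrow> ('a \<Rightarrow> 'a) set) \<Rightarrow>
   ('h, 'n) monoid_scheme \<Rightarrow> ('h, 'a) burnside_elem \<Rightarrow> bool" where
  "left_stable S p F H X \<longleftrightarrow>
     (\<forall>P \<phi>. subgroup P S \<and> \<phi> \<in> F P (carrier S) \<longrightarrow>
        (let P' = S\<lparr>carrier := P\<rparr> in
          burnside_comp p H S P'
            (basis_elem p S P' (\<phi> ` P) (restrict (inv_into P \<phi>) (\<phi> ` P))) X =
          burnside_comp p H S P' (basis_elem p S P' P (\<lambda>x\<in>P. x)) X))"

text \<open>The linear map sending \<open>[P,\<phi>]\<close> to the index of \<open>P\<close> in \<open>S\<close>.\<close>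

definition augmentation ::
  "('a, 'm) monoid_scheme \<Rightarrow> nat \<Rightarrow> ('a, 'a) burnside_elem \<Rightarrow> rat" where
  "augmentation S p X = (THE r. \<exists>I c. is_basis_comb p S S I c X \<and>
     r = (\<Sum>(P, \<phi>)\<in>I. c (P, \<phi>) * of_nat (card (rcosets\<^bsub>S\<^esub> P))))"

definition characteristic_idempotent ::
  "('a, 'm) monoid_scheme \<Rightarrow> nat \<Rightarrow> ('a set \<Rightarrow> 'a set \<Rightarrow> ('a \<Rightarrow> 'a) set) \<Rightarrow>
   ('a, 'a) burnside_elem \<Rightarrow> bool" where
  "characteristic_idempotent S p F \<omega> \<longleftrightarrow>
     \<omega> \<in> carrier (burnside p S S) \<and>
     burnside_comp p S S S \<omega> \<omega> = \<omega> \<and>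
     F_generated S p F \<omega> \<and> left_stable S p F S \<omega> \<and> right_stable S p F S \<omega> \<and>
     \<not> (\<exists>z\<in>Z_loc p. augmentation S p \<omega> = of_nat p * z)"

end

theory Submission
  imports Defs "HOL-Algebra.Zassenhaus"
begin

text \<open>An element of \<open>A(G,H)\<^sub>(\<^sub>p\<^sub>)\<close> is determined by its marks, the linear extensions of the numbers of
  fixed points of twisted diagonal subgroups \<open>(Q, \<psi>)\<close>. Stability, idempotence and the augmentation
  condition force the mark of \<open>\<omega>\<^sub>F\<close> at \<open>(P, \<psi>)\<close> to be \<open>|S| / |F(P,S)|\<close> if \<open>\<psi>\<close> lies in \<open>F\<close>, and
  \<open>0\<close> otherwise. As marks of a composite are sums of products of marks, both identities become
  statements about numbers of factorizations \<open>\<psi> = a \<theta>\<close> with \<open>\<theta>\<close> in the subsystem \<open>E\<close> and \<open>a\<close> in the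
  group \<open>A\<close>, where \<open>A = S\<close> acts by conjugation in the first case and \<open>A = Aut\<^sub>F(S)\<close> in the second.
  Every \<open>\<psi>\<close> factors: by Alperin's fusion theorem it suffices to consider automorphisms of fully
  normalized subgroups, for which \<open>Aut\<^sub>F(P) = O\<^sup>p(Aut\<^sub>F(P)) Aut\<^sub>S(P)\<close>, respectively Frattini's argument
  and the extension axiom, apply. Since \<open>A\<close> leaves \<open>E\<close> invariant, all \<open>\<psi>\<close> have the same number of
  factorizations.\<close>

section \<open>Actions of finite \<open>p\<close>-groups\<close>

text \<open>Three points shape the argument. The value |S| / |F(P,S)| requires the common mark on
  F(P,S) to be nonzero; this comes from counting modulo p, where the sum of the marks at P over all
  maps P \<rightarrow> S behaves like |S| times the augmentation. The number of factorizations is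
  |A| |E(P,T)| / |F(P,S)|, because every pair (a, \<theta>) factors exactly one morphism; this
  quotient is precisely what turns the marks of the subsystem into those of F. Alperin's theorem
  involves all subgroups of S, while the first subsystem lives on T only; hence the factorization
  statement concerns P \<inter> T and also records that \<phi> matches P \<inter> T with \<phi>(P)
  \<inter> T. Invariance under A has two different sources: O^p(F) is generated by data that
  conjugation in S permutes, whereas O^{p'}(F) is contained in each of its conjugates by minimality,
  once these are known to be saturated.\<close>

lemma (in group_action) card_fixed_points_mod:
  assumes p: "prime p" and ord: "order G = p ^ k" and fin: "finite E"
  shows "card {x \<in> E. \<forall>g\<in>carrier G. \<phi> g x = x} mod p = card E mod p"
proof -
  interpret G: group G using group_hom group_hom.axioms(1) by auto
  let ?F = "{x \<in> E. \<forall>g\<in>carrier G. \<phi> g x = x}"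
  let ?O = "orbits G E \<phi>"
  have un: "\<Union>?O = E"
    using orbits_coverture by blast
  have fO: "finite ?O" "\<And>C. C \<in> ?O \<Longrightarrow> finite C"
    using fin un finite_UnionD finite_subset Union_upper by metis+
  have dj: "\<And>A B. A \<in> ?O \<Longrightarrow> B \<in> ?O \<Longrightarrow> A \<noteq> B \<Longrightarrow> A \<inter> B = {}"
    using disjoint_union by blast
  \<comment> \<open>An orbit has p-power size by the orbit-stabilizer theorem. If the size is 1, its
    point is fixed; otherwise p divides the size and no point of the orbit is fixed. In both cases
    \<open>C\<close> and \<open>C \<inter> ?F\<close> have the same size modulo p.\<close>
  have orbit_p: "int (card C) mod int p = int (card (C \<inter> ?F)) mod int p" if CO: "C \<in> ?O" for C
  proof -
    obtain x where x: "x \<in> E" "C = orbit G \<phi> x" using CO unfolding orbits_def by auto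
    have xC: "x \<in> C" using x orbit_refl by simp
    have "card C dvd p ^ k"
      using orbit_stabilizer_theorem[OF x(1)] ord x(2) by (metis dvd_triv_left)
    then obtain j where j: "card C = p ^ j" using p by (metis divides_primepow_nat)
    show ?thesis
    proof (cases "j = 0")
      case True
      then have "card C = 1" using j by simp
      then have C: "C = {x}" using xC by (metis card_1_singletonE singletonD)
      moreover have "\<phi> g x \<in> C" if "g \<in> carrier G" for g
        using that x(2) by (auto simp: orbit_def)
      ultimately have "x \<in> ?F" using x by auto
      then show ?thesis using C by simp
    next
      case False
      have "C \<inter> ?F = {}"
      proof (rule ccontr)
        assume "C \<inter> ?F \<noteq> {}"
        then obtain y where y: "y \<in> C" "y \<in> ?F" by auto
        then have "x \<in> orbit G \<phi> y" using orbit_sym x by auto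
        then have xy: "x = y" using y by (auto simp: orbit_def)
        have "C \<subseteq> {x}" using y(2) xy x(2) unfolding orbit_def by auto
        then have "C = {x}" using xC by auto
        then have "card C = 1" by simp
        then show False using j False prime_gt_1_nat[OF p] one_less_power[of p j] by simp
      qed
      then have "card (C \<inter> ?F) = 0" by (metis card.empty)
      moreover have "int p dvd int (card C)" using j False by (simp add: dvd_power)
      ultimately show ?thesis by simp
    qed
  qed
  have "int (card E) = (\<Sum>C\<in>?O. int (card C))"
    using card_Union_disjoint[of ?O] un fO dj by (simp add: pairwise_def disjnt_def)
  moreover have "int (card ?F) = (\<Sum>C\<in>?O. int (card (C \<inter> ?F)))"
  proof -
    have "?F = (\<Union>C\<in>?O. C \<inter> ?F)" using un by auto
    then have "card ?F = card (\<Union>C\<in>?O. C \<inter> ?F)" by simp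
    also have "\<dots> = (\<Sum>C\<in>?O. card (C \<inter> ?F))"
      by (rule card_UN_disjoint) (use fO dj in auto)
    finally show ?thesis by simp
  qed
  ultimately have "int (card E) mod int p = int (card ?F) mod int p"
    by (simp flip: mod_sum_eq[of "\<lambda>C. int (card C)" "int p" ?O] mod_sum_eq[of "\<lambda>C. int (card (C \<inter> ?F))" "int p" ?O]
      add: orbit_p)
  then have "int (card E mod p) = int (card ?F mod p)" by (simp only: of_nat_mod)
  then show ?thesis by linarith
qed

text \<open>Right multiplication by the inverse is a left action, which is the form that
  \<open>group_action\<close> requires.\<close>

lemma (in group) right_translation_action:
  assumes R: "subgroup R G"
  shows "group_action G (rcosets R) (\<lambda>g. \<lambda>C\<in>rcosets R. C #> inv g)"
proof -
  have sub: "C \<subseteq> carrier G" if "C \<in> rcosets R" for C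
    using that R rcosets_subset_PowG by auto
  have cl: "C #> g \<in> rcosets R" if C: "C \<in> rcosets R" and g: "g \<in> carrier G" for C g
  proof -
    obtain a where a: "a \<in> carrier G" "C = R #> a" using C by (auto simp: RCOSETS_def)
    then have "C #> g = R #> (a \<otimes> g)" using R g by (simp add: coset_mult_assoc subgroup.subset)
    then show ?thesis using a g R by (auto simp: RCOSETS_def)
  qed
  have bij: "(\<lambda>C\<in>rcosets R. C #> inv g) \<in> Bij (rcosets R)" if g: "g \<in> carrier G" for g
    unfolding Bij_def
    by (auto intro!: bij_betw_byWitness[of _ "\<lambda>C. C #> g"] simp: cl g coset_mult_assoc sub)
  show ?thesis
    unfolding group_action_def group_hom_def group_hom_axioms_def
  proof (intro conjI group_BijGroup is_group homI)
    fix x y assume xy: "x \<in> carrier G" "y \<in> carrier G"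
    show "(\<lambda>C\<in>rcosets R. C #> inv (x \<otimes> y)) =
      (\<lambda>C\<in>rcosets R. C #> inv x) \<otimes>\<^bsub>BijGroup (rcosets R)\<^esub> (\<lambda>C\<in>rcosets R. C #> inv y)"
      using xy bij
      by (auto simp: BijGroup_def compose_def fun_eq_iff restrict_def cl sub coset_mult_assoc inv_mult_group)
  qed (simp add: BijGroup_def bij)
qed

text \<open>The coset R g is fixed by right multiplication with D exactly if g D g^-1 lies in R.
  Hence the conjugating elements fill \<open>f\<close> cosets of R, where \<open>f\<close> counts
  the fixed points of the p-group D on the cosets, and \<open>f\<close> agrees modulo p with the
  index of R. Sylow conjugation, the growth of normalizers and the congruence for the augmentation
  all come from this count.\<close>

lemma (in group) card_conjugators_into_subgroup:
  assumes fin: "finite (carrier G)" and R: "subgroup R G" and D: "subgroup D G"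
    and p: "prime p" and cD: "card D = p ^ k"
  obtains f where "card {g \<in> carrier G. \<forall>d\<in>D. g \<otimes> d \<otimes> inv g \<in> R} = card R * f"
    and "f mod p = card (rcosets R) mod p"
proof -
  let ?E = "rcosets R"
  let ?A = "{g \<in> carrier G. \<forall>d\<in>D. g \<otimes> d \<otimes> inv g \<in> R}"
  interpret act: group_action "G\<lparr>carrier := D\<rparr>" ?E "\<lambda>g. \<lambda>C\<in>?E. C #> inv g"
    using right_translation_action[OF R] D group_action.induced_action by blast
  interpret R: subgroup R G by fact
  interpret D: subgroup D G by fact
  let ?F = "{C \<in> ?E. \<forall>d\<in>D. C #> inv d = C}"
  have finE: "finite ?E"
    using fin R rcosets_part_G by (metis finite_UnionD)
  have "?F = {x \<in> ?E. \<forall>g\<in>carrier (G\<lparr>carrier := D\<rparr>). (\<lambda>C\<in>?E. C #> inv g) x = x}" by auto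
  then have mod: "card ?F mod p = card ?E mod p"
    using act.card_fixed_points_mod[of p k] p cD finE by (simp add: order_def)
  have eq: "(R #> g) #> inv d = R #> g \<longleftrightarrow> g \<otimes> d \<otimes> inv g \<in> R" if "g \<in> carrier G" "d \<in> D" for g d
  proof -
    have d: "d \<in> carrier G" using that by simp
    have "(R #> g) #> inv d = R #> g \<longleftrightarrow> R #> (g \<otimes> inv d) = R #> g"
      using d that by (simp add: coset_mult_assoc R.subset)
    also have "\<dots> \<longleftrightarrow> g \<otimes> inv (g \<otimes> inv d) \<in> R"
      using R.rcos_module[OF is_group, of "g \<otimes> inv d" g] d that
      by (metis inv_closed is_group m_closed repr_independence R rcos_self R.rcos_module)
    also have "g \<otimes> inv (g \<otimes> inv d) = g \<otimes> d \<otimes> inv g"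
      using d that by (simp add: inv_mult_group m_assoc)
    finally show ?thesis .
  qed
  have "?A = \<Union>?F"
  proof
    show "?A \<subseteq> \<Union>?F"
    proof
      fix g assume g: "g \<in> ?A"
      then have "R #> g \<in> ?F" using eq R by (auto simp: RCOSETS_def)
      then show "g \<in> \<Union>?F" using g rcos_self R by blast
    qed
    show "\<Union>?F \<subseteq> ?A"
    proof
      fix g assume "g \<in> \<Union>?F"
      then obtain C where C: "C \<in> ?F" "g \<in> C" by auto
      then have g: "g \<in> carrier G" using rcosets_subset_PowG[OF R] by auto
      then have "C = R #> g" using C R.rcosets_carrier
        by (smt (verit) RCOSETS_def UN_E mem_Collect_eq singletonD repr_independence R)
      then show "g \<in> ?A" using C g eq by auto
    qed
  qed
  moreover have "card (\<Union>?F) = card R * card ?F"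
  proof (rule card_partition[symmetric])
    show "finite ?F" using finE by simp
    show "finite (\<Union>?F)" by (rule finite_subset[OF _ fin]) (use rcosets_subset_PowG[OF R] in auto)
    show "\<And>c. c \<in> ?F \<Longrightarrow> card c = card R" by (metis (no_types, lifting) mem_Collect_eq card_rcosets_equal R.subset)
    show "\<And>c1 c2. c1 \<in> ?F \<Longrightarrow> c2 \<in> ?F \<Longrightarrow> c1 \<noteq> c2 \<Longrightarrow> c1 \<inter> c2 = {}"
      using rcos_disjoint[OF R] by (metis (no_types, lifting) mem_Collect_eq pairwiseD disjnt_def)
  qed
  ultimately show ?thesis using mod by (intro that[of "card ?F"]) simp_all
qed

text \<open>Modulo p the number of fixed cosets is the index of R, so it is not zero. With R a Sylow
  subgroup this is Sylow's conjugation theorem; R may also be a normal subgroup of index prime to p,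
  as in Frattini's argument.\<close>

lemma (in group) p_subgroup_conjugate_into:
  assumes "finite (carrier G)" "subgroup R G" "subgroup D G" "prime p" "card D = p ^ k"
    and cop: "coprime p (card (rcosets R))"
  obtains g where "g \<in> carrier G" "\<And>d. d \<in> D \<Longrightarrow> g \<otimes> d \<otimes> inv g \<in> R"
proof -
  obtain f where f: "card {g \<in> carrier G. \<forall>d\<in>D. g \<otimes> d \<otimes> inv g \<in> R} = card R * f"
    and fm: "f mod p = card (rcosets R) mod p"
    using card_conjugators_into_subgroup assms by blast
  have "f \<noteq> 0"
    using fm cop assms(4) by (metis coprime_absorb_left mod_0 mod_0_imp_dvd not_prime_unit)
  moreover have "card R \<noteq> 0"
    using assms(1,2) by (metis card_0_eq empty_iff finite_subset subgroup.one_closed subgroup.subset)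
  ultimately have "{g \<in> carrier G. \<forall>d\<in>D. g \<otimes> d \<otimes> inv g \<in> R} \<noteq> {}"
    using f by (metis card.empty mult_is_0)
  then show ?thesis using that by blast
qed

lemma mem_normalizer_iff:
  assumes "group G" "P \<subseteq> carrier G"
  shows "g \<in> normalizer G P \<longleftrightarrow>
    g \<in> carrier G \<and> (\<lambda>x. g \<otimes>\<^bsub>G\<^esub> x \<otimes>\<^bsub>G\<^esub> inv\<^bsub>G\<^esub> g) ` P = P"
proof -
  have "g <#\<^bsub>G\<^esub> P #>\<^bsub>G\<^esub> inv\<^bsub>G\<^esub> g = (\<lambda>x. g \<otimes>\<^bsub>G\<^esub> x \<otimes>\<^bsub>G\<^esub> inv\<^bsub>G\<^esub> g) ` P"
    by (auto simp: l_coset_def r_coset_def)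
  then show ?thesis using assms by (auto simp: normalizer_def stabilizer_def)
qed

text \<open>An injective self-map of a finite set is onto, so a one-sided inclusion suffices to show
  that g normalizes P.\<close>

lemma (in group) conj_image_eq_of_subset:
  assumes "finite P" "P \<subseteq> carrier G" "g \<in> carrier G" "\<And>x. x \<in> P \<Longrightarrow> g \<otimes> x \<otimes> inv g \<in> P"
  shows "(\<lambda>x. g \<otimes> x \<otimes> inv g) ` P = P"
proof (rule card_subset_eq)
  have "inj_on (\<lambda>x. g \<otimes> x \<otimes> inv g) P"
    by (rule inj_onI, rule conjugation_is_inj[of g]) (use assms in auto)
  then show "card ((\<lambda>x. g \<otimes> x \<otimes> inv g) ` P) = card P" by (rule card_image)
qed (use assms in auto)

lemma (in group) subgroup_subset_normalizer:
  assumes "finite (carrier G)" "subgroup P G"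
  shows "P \<subseteq> normalizer G P"
proof
  interpret P: subgroup P G by fact
  fix g assume g: "g \<in> P"
  show "g \<in> normalizer G P"
    using g assms(1) conj_image_eq_of_subset[of P g] finite_subset[OF P.subset]
    by (simp add: mem_normalizer_iff[OF is_group P.subset] P.subset)
qed

text \<open>With R = D = P the conjugating elements form the normalizer, so |N(P)| = |P| f with f
  congruent to the index of P. That index is a positive power of p, so p divides the nonzero number
  f.\<close>

lemma (in group) p_group_normalizer_grows:
  assumes fin: "finite (carrier G)" and P: "subgroup P G" and p: "prime p"
    and ord: "order G = p ^ n" and ne: "P \<noteq> carrier G"
  shows "P \<subset> normalizer G P"
proof -
  interpret P: subgroup P G by fact
  have finP: "finite P" using fin P.subset finite_subset by blast
  have lag: "card (rcosets P) * card P = p ^ n" using lagrange[OF P] ord by simp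
  then obtain k where k: "card P = p ^ k" using p by (metis divides_primepow_nat dvd_triv_right)
  obtain j where j: "card (rcosets P) = p ^ j" using lag p by (metis divides_primepow_nat dvd_triv_left)
  have "j \<noteq> 0"
  proof
    assume "j = 0"
    then have "card P = card (carrier G)" using lag j ord by (simp add: order_def)
    then show False using ne fin P.subset by (metis card_subset_eq)
  qed
  obtain f where f: "card {g \<in> carrier G. \<forall>d\<in>P. g \<otimes> d \<otimes> inv g \<in> P} = card P * f"
    and fm: "f mod p = card (rcosets P) mod p"
    using card_conjugators_into_subgroup[OF fin P P p k] by blast
  have N: "{g \<in> carrier G. \<forall>d\<in>P. g \<otimes> d \<otimes> inv g \<in> P} = normalizer G P"
    using mem_normalizer_iff[OF is_group P.subset] conj_image_eq_of_subset[OF finP P.subset] by auto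
  have "p dvd f" using fm j \<open>j \<noteq> 0\<close>
    by (metis dvd_power_same dvd_refl mod_0_imp_dvd mod_mod_trivial dvd_imp_mod_0 dvd_power gr0I)
  have "card P < card (normalizer G P)"
  proof -
    have "P \<subseteq> normalizer G P" by (rule subgroup_subset_normalizer[OF fin P])
    then have "normalizer G P \<noteq> {}" using P.one_closed by fast
    moreover have "finite (normalizer G P)" using fin N by (metis (no_types, lifting) finite_subset mem_Collect_eq subsetI)
    ultimately have "card P * f > 0" using f N by (metis card_gt_0_iff)
    then have "f \<ge> p" "card P > 0" using \<open>p dvd f\<close> by (auto simp: dvd_imp_le)
    then have "f > 1" using prime_gt_1_nat[OF p] by linarith
    then show ?thesis using f N \<open>card P > 0\<close> by (metis nat_mult_less_cancel1 mult.right_neutral nat_mult_1_right)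
  qed
  then show ?thesis using subgroup_subset_normalizer[OF fin P] by auto
qed

section \<open>Marks of bisets\<close>

text \<open>The hypothesis says at once that \<open>a i \<mapsto> b i\<close> is well defined and
  that it is injective. Isomorphisms of orbits, parametrized by the acting groups, are built from
  it.\<close>

lemma ex_bij_betw_images:
  assumes "\<And>i j. i \<in> I \<Longrightarrow> j \<in> I \<Longrightarrow> a i = a j \<longleftrightarrow> b i = b j"
  obtains f where "bij_betw f (a ` I) (b ` I)" "\<And>i. i \<in> I \<Longrightarrow> f (a i) = b i"
proof -
  let ?f = "\<lambda>z. b (inv_into I a z)"
  have f: "?f (a i) = b i" if "i \<in> I" for i
  proof -
    have "inv_into I a (a i) \<in> I" "a (inv_into I a (a i)) = a i"
      using that by (auto intro: inv_into_into f_inv_into_f)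
    then show ?thesis using assms that by blast
  qed
  have "inj_on ?f (a ` I)"
    by (rule inj_onI) (use f assms in auto)
  moreover have "?f ` (a ` I) = b ` I"
    unfolding image_image using f by simp
  ultimately show ?thesis using that[of ?f] f by (simp add: bij_betw_def)
qed

text \<open>\<open>mark X Q \<chi> \<phi>\<close> counts the points \<open>x\<close> with \<open>x \<chi>(q) = \<phi>(q) x\<close> for all \<open>q \<in> Q\<close>. Two maps
  are used in place of a subgroup and a homomorphism so that restriction of actions becomes
  composition of maps.\<close>

definition mark :: "('g, 'h, 'x) biset \<Rightarrow> 'q set \<Rightarrow> ('q \<Rightarrow> 'g) \<Rightarrow> ('q \<Rightarrow> 'h) \<Rightarrow> nat" where
  "mark X Q \<chi> \<phi> = card {x \<in> points X. \<forall>q\<in>Q. ract X x (\<chi> q) = lact X (\<phi> q) x}"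

lemma mark_cong:
  "\<lbrakk>\<And>q. q \<in> Q \<Longrightarrow> \<chi> q = \<chi>' q; \<And>q. q \<in> Q \<Longrightarrow> \<phi> q = \<phi>' q\<rbrakk> \<Longrightarrow> mark X Q \<chi> \<phi> = mark X Q \<chi>' \<phi>'"
  unfolding mark_def by (rule arg_cong[where f = card]) auto

lemma mark_reindex: "mark X (f ` Q) \<chi> \<phi> = mark X Q (\<chi> \<circ> f) (\<phi> \<circ> f)"
  unfolding mark_def by simp

context left_free_biset
begin

lemma lact_inv_cancel:
  assumes "h \<in> carrier H" "x \<in> points X"
  shows "lact X (inv\<^bsub>H\<^esub> h) (lact X h x) = x" "lact X h (lact X (inv\<^bsub>H\<^esub> h) x) = x"
  using assms lact_mult[of "inv\<^bsub>H\<^esub> h" h x] lact_mult[of h "inv\<^bsub>H\<^esub> h" x] by (simp_all add: lact_one)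

lemma ract_inv_cancel:
  assumes "g \<in> carrier G" "x \<in> points X"
  shows "ract X (ract X x g) (inv\<^bsub>G\<^esub> g) = x" "ract X (ract X x (inv\<^bsub>G\<^esub> g)) g = x"
  using assms ract_mult[of "inv\<^bsub>G\<^esub> g" g x] ract_mult[of g "inv\<^bsub>G\<^esub> g" x] by (simp_all add: ract_one)

lemma lact_cancel:
  assumes "h \<in> carrier H" "x \<in> points X" "y \<in> points X"
  shows "lact X h x = lact X h y \<longleftrightarrow> x = y"
  using assms lact_inv_cancel(1) by metis

lemma lact_free:
  assumes "h \<in> carrier H" "h' \<in> carrier H" "x \<in> points X"
  shows "lact X h x = lact X h' x \<longleftrightarrow> h = h'"
proof
  assume eq: "lact X h x = lact X h' x"
  have "lact X (inv\<^bsub>H\<^esub> h' \<otimes>\<^bsub>H\<^esub> h) x = lact X (inv\<^bsub>H\<^esub> h') (lact X h' x)"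
    using assms eq by (simp add: lact_mult)
  also have "\<dots> = x" using assms lact_inv_cancel by simp
  finally have "inv\<^bsub>H\<^esub> h' \<otimes>\<^bsub>H\<^esub> h = \<one>\<^bsub>H\<^esub>" using assms left_free by simp
  then show "h = h'" using assms by (metis H.inv_closed H.inv_equality H.inv_inv)
qed simp

lemma restrict_points:
  assumes "A \<subseteq> points X"
    and "\<And>h x. h \<in> carrier H \<Longrightarrow> x \<in> A \<Longrightarrow> lact X h x \<in> A"
    and "\<And>g x. g \<in> carrier G \<Longrightarrow> x \<in> A \<Longrightarrow> ract X x g \<in> A"
  shows "left_free_biset G H (X\<lparr>points := A\<rparr>)"
proof unfold_locales
  show "finite (points (X\<lparr>points := A\<rparr>))" using assms(1) finite_points finite_subset by auto
qed (use assms lact_one lact_mult ract_one ract_mult actions_commute left_free in \<open>auto simp: subset_iff\<close>)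

text \<open>Inverse group elements show that the complement of an invariant set is
  invariant.\<close>

lemma restrict_points_Diff:
  assumes "A \<subseteq> points X"
    and "\<And>h x. h \<in> carrier H \<Longrightarrow> x \<in> A \<Longrightarrow> lact X h x \<in> A"
    and "\<And>g x. g \<in> carrier G \<Longrightarrow> x \<in> A \<Longrightarrow> ract X x g \<in> A"
  shows "left_free_biset G H (X\<lparr>points := points X - A\<rparr>)"
proof (rule restrict_points)
  fix h x assume "h \<in> carrier H" "x \<in> points X - A"
  then show "lact X h x \<in> points X - A"
    using assms(2)[of "inv\<^bsub>H\<^esub> h" "lact X h x"] lact_closed lact_inv_cancel by auto
next
  fix g x assume "g \<in> carrier G" "x \<in> points X - A"
  then show "ract X x g \<in> points X - A"
    using assms(3)[of "inv\<^bsub>G\<^esub> g" "ract X x g"] ract_closed ract_inv_cancel by auto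
qed auto

lemma mark_split:
  assumes "A \<subseteq> points X"
  shows "mark X Q \<chi> \<phi> = mark (X\<lparr>points := A\<rparr>) Q \<chi> \<phi> + mark (X\<lparr>points := points X - A\<rparr>) Q \<chi> \<phi>"
proof -
  have "{x \<in> points X. \<forall>q\<in>Q. ract X x (\<chi> q) = lact X (\<phi> q) x} =
     {x \<in> A. \<forall>q\<in>Q. ract X x (\<chi> q) = lact X (\<phi> q) x} \<union>
     {x \<in> points X - A. \<forall>q\<in>Q. ract X x (\<chi> q) = lact X (\<phi> q) x}"
    using assms by auto
  then show ?thesis unfolding mark_def using finite_points assms
    by (simp add: finite_subset card_Un_disjoint[symmetric] disjoint_iff)
qed

text \<open>The map x \<mapsto> t x s^-1 carries the fixed points of (\<chi>, \<phi>) to those of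
  the conjugate pair.\<close>

lemma mark_conj:
  assumes "s \<in> carrier G" "t \<in> carrier H" "\<chi> \<in> Q \<rightarrow> carrier G" "\<phi> \<in> Q \<rightarrow> carrier H"
  shows "mark X Q (\<lambda>q. s \<otimes>\<^bsub>G\<^esub> \<chi> q \<otimes>\<^bsub>G\<^esub> inv\<^bsub>G\<^esub> s) (\<lambda>q. t \<otimes>\<^bsub>H\<^esub> \<phi> q \<otimes>\<^bsub>H\<^esub> inv\<^bsub>H\<^esub> t) = mark X Q \<chi> \<phi>"
proof -
  let ?A = "{x \<in> points X. \<forall>q\<in>Q. ract X x (s \<otimes>\<^bsub>G\<^esub> \<chi> q \<otimes>\<^bsub>G\<^esub> inv\<^bsub>G\<^esub> s) = lact X (t \<otimes>\<^bsub>H\<^esub> \<phi> q \<otimes>\<^bsub>H\<^esub> inv\<^bsub>H\<^esub> t) x}"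
  let ?B = "{x \<in> points X. \<forall>q\<in>Q. ract X x (\<chi> q) = lact X (\<phi> q) x}"
  have key: "ract X (lact X t (ract X x (inv\<^bsub>G\<^esub> s))) (s \<otimes>\<^bsub>G\<^esub> a \<otimes>\<^bsub>G\<^esub> inv\<^bsub>G\<^esub> s) =
      lact X (t \<otimes>\<^bsub>H\<^esub> b \<otimes>\<^bsub>H\<^esub> inv\<^bsub>H\<^esub> t) (lact X t (ract X x (inv\<^bsub>G\<^esub> s))) \<longleftrightarrow> ract X x a = lact X b x"
    if x: "x \<in> points X" and ab: "a \<in> carrier G" "b \<in> carrier H" for x a b
  proof -
    have "ract X (lact X t (ract X x (inv\<^bsub>G\<^esub> s))) (s \<otimes>\<^bsub>G\<^esub> a \<otimes>\<^bsub>G\<^esub> inv\<^bsub>G\<^esub> s) =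
       lact X t (ract X (ract X x a) (inv\<^bsub>G\<^esub> s))"
      using x ab assms by (simp add: actions_commute ract_mult ract_inv_cancel ract_closed)
    moreover have "lact X (t \<otimes>\<^bsub>H\<^esub> b \<otimes>\<^bsub>H\<^esub> inv\<^bsub>H\<^esub> t) (lact X t (ract X x (inv\<^bsub>G\<^esub> s))) =
       lact X t (ract X (lact X b x) (inv\<^bsub>G\<^esub> s))"
      using x ab assms by (simp add: actions_commute lact_mult lact_inv_cancel ract_closed lact_closed)
    ultimately show ?thesis
      using x ab assms by (metis lact_cancel lact_closed ract_closed ract_inv_cancel(2) G.inv_closed)
  qed
  have "bij_betw (\<lambda>x. lact X t (ract X x (inv\<^bsub>G\<^esub> s))) ?B ?A"
  proof (rule bij_betw_byWitness[where f' = "\<lambda>x. lact X (inv\<^bsub>H\<^esub> t) (ract X x s)"])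
    show 1: "\<forall>x\<in>?B. lact X (inv\<^bsub>H\<^esub> t) (ract X (lact X t (ract X x (inv\<^bsub>G\<^esub> s))) s) = x"
      using assms by (auto simp: actions_commute ract_inv_cancel ract_closed lact_inv_cancel)
    have 2: "lact X t (ract X (lact X (inv\<^bsub>H\<^esub> t) (ract X x s)) (inv\<^bsub>G\<^esub> s)) = x" if "x \<in> points X" for x
      using assms that by (auto simp: actions_commute ract_inv_cancel ract_closed lact_inv_cancel)
    show "\<forall>x\<in>?A. lact X t (ract X (lact X (inv\<^bsub>H\<^esub> t) (ract X x s)) (inv\<^bsub>G\<^esub> s)) = x"
      using 2 by blast
    show "(\<lambda>x. lact X t (ract X x (inv\<^bsub>G\<^esub> s))) ` ?B \<subseteq> ?A"
    proof clarify
      fix x assume x: "x \<in> points X" "\<forall>q\<in>Q. ract X x (\<chi> q) = lact X (\<phi> q) x"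
      show "lact X t (ract X x (inv\<^bsub>G\<^esub> s)) \<in> points X \<and> (\<forall>q\<in>Q. ract X (lact X t (ract X x (inv\<^bsub>G\<^esub> s))) (s \<otimes>\<^bsub>G\<^esub> \<chi> q \<otimes>\<^bsub>G\<^esub> inv\<^bsub>G\<^esub> s) =
         lact X (t \<otimes>\<^bsub>H\<^esub> \<phi> q \<otimes>\<^bsub>H\<^esub> inv\<^bsub>H\<^esub> t) (lact X t (ract X x (inv\<^bsub>G\<^esub> s))))"
      proof (intro conjI ballI)
        fix q assume "q \<in> Q"
        then show "ract X (lact X t (ract X x (inv\<^bsub>G\<^esub> s))) (s \<otimes>\<^bsub>G\<^esub> \<chi> q \<otimes>\<^bsub>G\<^esub> inv\<^bsub>G\<^esub> s) =
         lact X (t \<otimes>\<^bsub>H\<^esub> \<phi> q \<otimes>\<^bsub>H\<^esub> inv\<^bsub>H\<^esub> t) (lact X t (ract X x (inv\<^bsub>G\<^esub> s)))"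
          using key[of x "\<chi> q" "\<phi> q"] x assms by (simp add: Pi_iff)
      qed (use x assms in \<open>simp add: lact_closed ract_closed\<close>)
    qed
    show "(\<lambda>x. lact X (inv\<^bsub>H\<^esub> t) (ract X x s)) ` ?A \<subseteq> ?B"
    proof clarify
      fix x assume x: "x \<in> points X" "\<forall>q\<in>Q. ract X x (s \<otimes>\<^bsub>G\<^esub> \<chi> q \<otimes>\<^bsub>G\<^esub> inv\<^bsub>G\<^esub> s) = lact X (t \<otimes>\<^bsub>H\<^esub> \<phi> q \<otimes>\<^bsub>H\<^esub> inv\<^bsub>H\<^esub> t) x"
      let ?y = "lact X (inv\<^bsub>H\<^esub> t) (ract X x s)"
      have y: "?y \<in> points X" using x assms by (simp add: lact_closed ract_closed)
      show "?y \<in> points X \<and> (\<forall>q\<in>Q. ract X ?y (\<chi> q) = lact X (\<phi> q) ?y)"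
      proof (intro conjI ballI)
        fix q assume "q \<in> Q"
        then show "ract X ?y (\<chi> q) = lact X (\<phi> q) ?y"
          using key[OF y, of "\<chi> q" "\<phi> q"] 2[OF x(1)] x(2) assms by (simp add: Pi_iff)
      qed (fact y)
    qed
  qed
  then show ?thesis unfolding mark_def by (rule bij_betw_same_card[symmetric])
qed

end

section \<open>Isomorphisms of bisets and the recognition of a biset by its marks\<close>

lemma biset_iso_refl: "biset_iso G H X X"
  unfolding biset_iso_def by (rule exI[of _ id]) simp

lemma biset_iso_sym:
  assumes X: "left_free_biset G H X" and "biset_iso G H X Y"
  shows "biset_iso G H Y X"
proof -
  interpret left_free_biset G H X by fact
  obtain f where f: "bij_betw f (points X) (points Y)"
    and l: "\<And>x h. x \<in> points X \<Longrightarrow> h \<in> carrier H \<Longrightarrow> f (lact X h x) = lact Y h (f x)"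
    and r: "\<And>x g. x \<in> points X \<Longrightarrow> g \<in> carrier G \<Longrightarrow> f (ract X x g) = ract Y (f x) g"
    using assms(2) unfolding biset_iso_def by blast
  let ?f = "inv_into (points X) f"
  have inv: "?f (f x) = x" if "x \<in> points X" for x
    using f that by (simp add: bij_betw_def)
  show ?thesis unfolding biset_iso_def
  proof (intro exI[of _ ?f] conjI ballI)
    show "bij_betw ?f (points Y) (points X)" using f by (rule bij_betw_inv_into)
    fix y assume "y \<in> points Y"
    then obtain x where x: "x \<in> points X" "y = f x" using f by (auto simp: bij_betw_def)
    show "?f (lact Y h y) = lact X h (?f y)" if "h \<in> carrier H" for h
      using that x inv l lact_closed by metis
    show "?f (ract Y y g) = ract X (?f y) g" if "g \<in> carrier G" for g
      using that x inv r ract_closed by metis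
  qed
qed

lemma biset_iso_trans:
  assumes "biset_iso G H X Y" and "biset_iso G H Y Z"
  shows "biset_iso G H X Z"
proof -
  obtain f where f: "bij_betw f (points X) (points Y)"
    "\<And>x h. x \<in> points X \<Longrightarrow> h \<in> carrier H \<Longrightarrow> f (lact X h x) = lact Y h (f x)"
    "\<And>x g. x \<in> points X \<Longrightarrow> g \<in> carrier G \<Longrightarrow> f (ract X x g) = ract Y (f x) g"
    using assms(1) unfolding biset_iso_def by blast
  obtain f' where f': "bij_betw f' (points Y) (points Z)"
    "\<And>x h. x \<in> points Y \<Longrightarrow> h \<in> carrier H \<Longrightarrow> f' (lact Y h x) = lact Z h (f' x)"
    "\<And>x g. x \<in> points Y \<Longrightarrow> g \<in> carrier G \<Longrightarrow> f' (ract Y x g) = ract Z (f' x) g"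
    using assms(2) unfolding biset_iso_def by blast
  show ?thesis unfolding biset_iso_def
    by (intro exI[of _ "f' \<circ> f"] conjI ballI)
      (use f f' bij_betwE[OF f(1)] in \<open>auto intro: bij_betw_trans\<close>)
qed

lemma mark_iso:
  assumes "left_free_biset G H X" and "biset_iso G H X Y"
    and "\<chi> \<in> Q \<rightarrow> carrier G" "\<phi> \<in> Q \<rightarrow> carrier H"
  shows "mark X Q \<chi> \<phi> = mark Y Q \<chi> \<phi>"
proof -
  interpret left_free_biset G H X by fact
  obtain f where f: "bij_betw f (points X) (points Y)"
    and l: "\<And>x h. x \<in> points X \<Longrightarrow> h \<in> carrier H \<Longrightarrow> f (lact X h x) = lact Y h (f x)"
    and r: "\<And>x g. x \<in> points X \<Longrightarrow> g \<in> carrier G \<Longrightarrow> f (ract X x g) = ract Y (f x) g"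
    using assms(2) unfolding biset_iso_def by blast
  have "f ` {x \<in> points X. \<forall>q\<in>Q. ract X x (\<chi> q) = lact X (\<phi> q) x} =
    {y \<in> points Y. \<forall>q\<in>Q. ract Y y (\<chi> q) = lact Y (\<phi> q) y}"
  proof -
    have eq: "ract X x (\<chi> q) = lact X (\<phi> q) x \<longleftrightarrow> ract Y (f x) (\<chi> q) = lact Y (\<phi> q) (f x)"
      if "x \<in> points X" "q \<in> Q" for x q
    proof -
      have q: "\<chi> q \<in> carrier G" "\<phi> q \<in> carrier H" using assms that by auto
      then have "ract X x (\<chi> q) \<in> points X" "lact X (\<phi> q) x \<in> points X"
        using that ract_closed lact_closed by auto
      then have "ract X x (\<chi> q) = lact X (\<phi> q) x \<longleftrightarrow> f (ract X x (\<chi> q)) = f (lact X (\<phi> q) x)"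
        using f by (auto simp: bij_betw_def inj_on_def)
      then show ?thesis using l r q that by simp
    qed
    have "points Y = f ` points X" using f by (simp add: bij_betw_def)
    then show ?thesis using eq by auto
  qed
  moreover have "inj_on f {x \<in> points X. \<forall>q\<in>Q. ract X x (\<chi> q) = lact X (\<phi> q) x}"
    using f by (auto simp: bij_betw_def intro: inj_on_subset)
  ultimately show ?thesis
    unfolding mark_def using card_image[of f "{x \<in> points X. \<forall>q\<in>Q. ract X x (\<chi> q) = lact X (\<phi> q) x}"] by simp
qed

text \<open>Membership in \<open>A\<close> is preserved in both directions, so the complement is
  invariant as well and the two partial isomorphisms can be joined by a case distinction.\<close>

lemma biset_iso_glue:
  assumes "A \<subseteq> points X" "B \<subseteq> points Y"
    and "biset_iso G H (X\<lparr>points := A\<rparr>) (Y\<lparr>points := B\<rparr>)"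
    and "biset_iso G H (X\<lparr>points := points X - A\<rparr>) (Y\<lparr>points := points Y - B\<rparr>)"
    and Acl: "\<And>h x. h \<in> carrier H \<Longrightarrow> x \<in> points X \<Longrightarrow> lact X h x \<in> A \<longleftrightarrow> x \<in> A"
      "\<And>g x. g \<in> carrier G \<Longrightarrow> x \<in> points X \<Longrightarrow> ract X x g \<in> A \<longleftrightarrow> x \<in> A"
  shows "biset_iso G H X Y"
proof -
  obtain f where f: "bij_betw f A B"
    and l: "\<And>x h. x \<in> A \<Longrightarrow> h \<in> carrier H \<Longrightarrow> f (lact X h x) = lact Y h (f x)"
    and r: "\<And>x g. x \<in> A \<Longrightarrow> g \<in> carrier G \<Longrightarrow> f (ract X x g) = ract Y (f x) g"
    using assms(3)[unfolded biset_iso_def, simplified] by blast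
  obtain f' where f': "bij_betw f' (points X - A) (points Y - B)"
    and l': "\<And>x h. x \<in> points X - A \<Longrightarrow> h \<in> carrier H \<Longrightarrow> f' (lact X h x) = lact Y h (f' x)"
    and r': "\<And>x g. x \<in> points X - A \<Longrightarrow> g \<in> carrier G \<Longrightarrow> f' (ract X x g) = ract Y (f' x) g"
    using assms(4)[unfolded biset_iso_def, simplified] by blast
  let ?f = "\<lambda>x. if x \<in> A then f x else f' x"
  have "bij_betw ?f A B = bij_betw f A B" by (rule bij_betw_cong) simp
  moreover have "bij_betw ?f (points X - A) (points Y - B) = bij_betw f' (points X - A) (points Y - B)"
    by (rule bij_betw_cong) simp
  ultimately have "bij_betw ?f (A \<union> (points X - A)) (B \<union> (points Y - B))"
    using f f' by (intro bij_betw_combine) auto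
  then have "bij_betw ?f (points X) (points Y)"
    using assms(1,2) by (simp add: Un_absorb1)
  moreover have "?f (lact X h x) = lact Y h (?f x)" if "x \<in> points X" "h \<in> carrier H" for x h
    using that Acl(1)[of h x] l[of x h] l'[of x h] by simp
  moreover have "?f (ract X x g) = ract Y (?f x) g" if "x \<in> points X" "g \<in> carrier G" for x g
    using that Acl(2)[of g x] r[of x g] r'[of x g] by simp
  ultimately show ?thesis unfolding biset_iso_def by blast
qed

text \<open>A transitive biset is determined by the stabilizer of a point: h x g = h' x g' holds if
  and only if x (g g'^-1) = (h^-1 h') x. Equality of the stabilizers of x and y thus makes h x g
  \<mapsto> h y g well defined and injective.\<close>

lemma biset_orbit_iso:
  assumes "left_free_biset G H X" "left_free_biset G H Y" "x \<in> points X" "y \<in> points Y"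
    and st: "\<And>g h. g \<in> carrier G \<Longrightarrow> h \<in> carrier H \<Longrightarrow>
      ract X x g = lact X h x \<longleftrightarrow> ract Y y g = lact Y h y"
  shows "biset_iso G H
    (X\<lparr>points := (\<lambda>(h, g). lact X h (ract X x g)) ` (carrier H \<times> carrier G)\<rparr>)
    (Y\<lparr>points := (\<lambda>(h, g). lact Y h (ract Y y g)) ` (carrier H \<times> carrier G)\<rparr>)"
proof -
  interpret X: left_free_biset G H X by fact
  interpret Y: left_free_biset G H Y by fact
  let ?I = "carrier H \<times> carrier G"
  let ?a = "\<lambda>(h, g). lact X h (ract X x g)"
  let ?b = "\<lambda>(h, g). lact Y h (ract Y y g)"
  have crit: "lact Z h (ract Z z g) = lact Z h' (ract Z z g') \<longleftrightarrow>
      ract Z z (g \<otimes>\<^bsub>G\<^esub> inv\<^bsub>G\<^esub> g') = lact Z (inv\<^bsub>H\<^esub> h \<otimes>\<^bsub>H\<^esub> h') z"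
    if Z: "left_free_biset G H Z" and z: "z \<in> points Z"
      and c: "h \<in> carrier H" "h' \<in> carrier H" "g \<in> carrier G" "g' \<in> carrier G"
    for Z z h h' g g'
  proof -
    interpret Z: left_free_biset G H Z by fact
    \<comment> \<open>The injective map w \<mapsto> h^-1 w g'^-1 leaves only a right factor on one
      side of the equation and only a left factor on the other.\<close>
    let ?T = "\<lambda>w. ract Z (lact Z (inv\<^bsub>H\<^esub> h) w) (inv\<^bsub>G\<^esub> g')"
    have T: "w = w' \<longleftrightarrow> ?T w = ?T w'" if "w \<in> points Z" "w' \<in> points Z" for w w'
      using that c by (metis Z.lact_cancel Z.lact_closed Z.ract_inv_cancel(2) X.H.inv_closed)
    have 1: "?T (lact Z h (ract Z z g)) = ract Z z (g \<otimes>\<^bsub>G\<^esub> inv\<^bsub>G\<^esub> g')"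
      using c z by (simp add: Z.lact_inv_cancel Z.ract_closed Z.ract_mult)
    have 2: "?T (lact Z h' (ract Z z g')) = lact Z (inv\<^bsub>H\<^esub> h \<otimes>\<^bsub>H\<^esub> h') z"
      using c z by (simp add: Z.ract_closed Z.lact_closed Z.lact_mult Z.actions_commute Z.ract_inv_cancel)
    have "lact Z h (ract Z z g) \<in> points Z" "lact Z h' (ract Z z g') \<in> points Z"
      using c z by (auto simp: Z.ract_closed Z.lact_closed)
    then show ?thesis using T 1 2 by metis
  qed
  have eq: "?a i = ?a j \<longleftrightarrow> ?b i = ?b j" if "i \<in> ?I" "j \<in> ?I" for i j
  proof -
    obtain h g h' g' where ij: "i = (h, g)" "j = (h', g')" by fastforce
    then show ?thesis using that crit[OF assms(1,3), of h h' g g'] crit[OF assms(2,4), of h h' g g']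
       st[of "g \<otimes>\<^bsub>G\<^esub> inv\<^bsub>G\<^esub> g'" "inv\<^bsub>H\<^esub> h \<otimes>\<^bsub>H\<^esub> h'"] by simp
  qed
  obtain f where f: "bij_betw f (?a ` ?I) (?b ` ?I)" and fa: "\<And>i. i \<in> ?I \<Longrightarrow> f (?a i) = ?b i"
    using ex_bij_betw_images[of ?I ?a ?b] eq by blast
  have fa': "f (lact X h (ract X x g)) = lact Y h (ract Y y g)" if "h \<in> carrier H" "g \<in> carrier G" for h g
    using fa[of "(h, g)"] that by simp
  show ?thesis unfolding biset_iso_def
  proof (intro exI[of _ f] conjI ballI)
    fix z assume "z \<in> points (X\<lparr>points := ?a ` ?I\<rparr>)"
    then obtain h g where hg: "h \<in> carrier H" "g \<in> carrier G" and z: "z = lact X h (ract X x g)" by auto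
    {
      fix k assume k: "k \<in> carrier H"
      have "f (lact X k z) = lact Y (k \<otimes>\<^bsub>H\<^esub> h) (ract Y y g)"
        using fa'[of "k \<otimes>\<^bsub>H\<^esub> h" g] hg k assms(3) z by (simp add: X.lact_mult X.ract_closed)
      then show "f (lact (X\<lparr>points := ?a ` ?I\<rparr>) k z) = lact (Y\<lparr>points := ?b ` ?I\<rparr>) k (f z)"
        using hg k assms(4) z fa' by (simp add: Y.lact_mult Y.ract_closed)
    next
      fix k assume k: "k \<in> carrier G"
      have "f (ract X z k) = lact Y h (ract Y y (g \<otimes>\<^bsub>G\<^esub> k))"
        using fa'[of h "g \<otimes>\<^bsub>G\<^esub> k"] hg k assms(3) z by (simp add: X.ract_mult X.ract_closed X.actions_commute)
      then show "f (ract (X\<lparr>points := ?a ` ?I\<rparr>) z k) = ract (Y\<lparr>points := ?b ` ?I\<rparr>) (f z) k"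
        using hg k assms(4) z fa' by (simp add: Y.ract_mult Y.ract_closed Y.actions_commute)
    }
  qed (use f in auto)
qed

text \<open>Bisets with the same marks are isomorphic: a point of \<open>X\<close> with largest stabilizer has the
  same stabilizer as some point of \<open>Y\<close>, and the two isomorphic orbits can be removed.\<close>

lemma (in left_free_biset) orbit_closed:
  assumes x: "x \<in> points X"
  defines "A \<equiv> (\<lambda>(h, g). lact X h (ract X x g)) ` (carrier H \<times> carrier G)"
  shows "A \<subseteq> points X" and "\<And>h z. \<lbrakk>h \<in> carrier H; z \<in> A\<rbrakk> \<Longrightarrow> lact X h z \<in> A"
    and "\<And>g z. \<lbrakk>g \<in> carrier G; z \<in> A\<rbrakk> \<Longrightarrow> ract X z g \<in> A"
proof -
  show "A \<subseteq> points X" unfolding A_def using x by (auto simp: lact_closed ract_closed)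
  fix k z assume "z \<in> A"
  then obtain h g where z: "h \<in> carrier H" "g \<in> carrier G" "z = lact X h (ract X x g)" unfolding A_def by auto
  show "lact X k z \<in> A" if "k \<in> carrier H"
    unfolding A_def using z x that
    by (intro rev_image_eqI[of "(k \<otimes>\<^bsub>H\<^esub> h, g)"]) (auto simp: lact_mult ract_closed)
next
  fix k z assume "z \<in> A"
  then obtain h g where z: "h \<in> carrier H" "g \<in> carrier G" "z = lact X h (ract X x g)" unfolding A_def by auto
  show "ract X z k \<in> A" if "k \<in> carrier G"
    unfolding A_def using z x that
    by (intro rev_image_eqI[of "(h, g \<otimes>\<^bsub>G\<^esub> k)"]) (auto simp: ract_mult ract_closed actions_commute)
qed

text \<open>When the left action is free, this subgroup of G \<times> H meets 1 \<times> H
  trivially, so it is the graph of a homomorphism from a subgroup of G to H: a twisted diagonal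
  subgroup.\<close>

definition biset_stab :: "('g, 'm) monoid_scheme \<Rightarrow> ('h, 'n) monoid_scheme \<Rightarrow> ('g, 'h, 'x) biset \<Rightarrow> 'x \<Rightarrow> ('g \<times> 'h) set" where
  "biset_stab G H X x = {(g, h). g \<in> carrier G \<and> h \<in> carrier H \<and> ract X x g = lact X h x}"

text \<open>The stabilizer of x is the graph of a map \<psi> on a subgroup Q, and x itself makes the
  mark of X at (Q, \<psi>) positive. The mark of Y is then positive too, and any point that it
  counts is stabilized by this graph.\<close>

lemma biset_stab_subset_of_marks:
  assumes "left_free_biset G H X" "left_free_biset G H Y"
    and marks: "\<And>Q \<psi>. subgroup Q G \<Longrightarrow> \<psi> \<in> Q \<rightarrow>\<^sub>E carrier H \<Longrightarrow> mark X Q (\<lambda>q. q) \<psi> = mark Y Q (\<lambda>q. q) \<psi>"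
    and x: "x \<in> points X"
  shows "\<exists>y\<in>points Y. biset_stab G H X x \<subseteq> biset_stab G H Y y"
proof -
  interpret X: left_free_biset G H X by fact
  interpret Y: left_free_biset G H Y by fact
  define Q where "Q = {g \<in> carrier G. \<exists>h\<in>carrier H. ract X x g = lact X h x}"
  \<comment> \<open>Freeness of the left action makes h unique, so the choice is forced and the
    graph of \<psi> is the whole stabilizer.\<close>
  define \<psi> where "\<psi> = (\<lambda>g\<in>Q. SOME h. h \<in> carrier H \<and> ract X x g = lact X h x)"
  have \<psi>: "\<psi> g \<in> carrier H \<and> ract X x g = lact X (\<psi> g) x" if "g \<in> Q" for g
  proof -
    have "\<exists>h. h \<in> carrier H \<and> ract X x g = lact X h x" using that by (auto simp: Q_def)
    then have "(SOME h. h \<in> carrier H \<and> ract X x g = lact X h x) \<in> carrier H \<and>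
      ract X x g = lact X (SOME h. h \<in> carrier H \<and> ract X x g = lact X h x) x"
      by (rule someI_ex)
    then show ?thesis using that by (simp add: \<psi>_def)
  qed
  have QE: "\<psi> \<in> Q \<rightarrow>\<^sub>E carrier H" using \<psi> by (auto simp: \<psi>_def)
  have Qsub: "subgroup Q G"
  proof (rule X.G.subgroupI)
    show "Q \<subseteq> carrier G" by (auto simp: Q_def)
    have "\<one>\<^bsub>G\<^esub> \<in> Q" unfolding Q_def using x by (auto simp: X.ract_one intro!: bexI[of _ "\<one>\<^bsub>H\<^esub>"] X.lact_one[symmetric])
    then show "Q \<noteq> {}" by blast
  next
    fix a assume "a \<in> Q"
    then obtain h where a: "a \<in> carrier G" "h \<in> carrier H" "ract X x a = lact X h x" by (auto simp: Q_def)
    have "lact X (inv\<^bsub>H\<^esub> h) x = lact X (inv\<^bsub>H\<^esub> h) (ract X (ract X x a) (inv\<^bsub>G\<^esub> a))"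
      using X.ract_inv_cancel(1)[OF a(1) x] by simp
    also have "\<dots> = lact X (inv\<^bsub>H\<^esub> h) (lact X h (ract X x (inv\<^bsub>G\<^esub> a)))"
      using a x by (simp add: X.actions_commute)
    also have "\<dots> = ract X x (inv\<^bsub>G\<^esub> a)" using a x by (simp add: X.lact_inv_cancel X.ract_closed)
    finally show "inv\<^bsub>G\<^esub> a \<in> Q" using a by (auto simp: Q_def intro!: bexI[of _ "inv\<^bsub>H\<^esub> h"])
  next
    fix a b assume "a \<in> Q" "b \<in> Q"
    then obtain h k where a: "a \<in> carrier G" "h \<in> carrier H" "ract X x a = lact X h x"
      and b: "b \<in> carrier G" "k \<in> carrier H" "ract X x b = lact X k x" by (auto simp: Q_def)
    have "ract X x (a \<otimes>\<^bsub>G\<^esub> b) = lact X (h \<otimes>\<^bsub>H\<^esub> k) x"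
      using a b x by (simp add: X.ract_mult X.actions_commute X.lact_mult)
    then show "a \<otimes>\<^bsub>G\<^esub> b \<in> Q" using a b by (auto simp: Q_def)
  qed
  have "x \<in> {x \<in> points X. \<forall>q\<in>Q. ract X x q = lact X (\<psi> q) x}" using x \<psi> by auto
  then have "mark X Q (\<lambda>q. q) \<psi> > 0"
    unfolding mark_def using X.finite_points by (subst card_gt_0_iff) auto
  then have "mark Y Q (\<lambda>q. q) \<psi> > 0" using marks Qsub QE by simp
  then obtain y where y: "y \<in> points Y" "\<And>q. q \<in> Q \<Longrightarrow> ract Y y q = lact Y (\<psi> q) y"
    unfolding mark_def using Y.finite_points by (subst (asm) card_gt_0_iff) auto
  have "biset_stab G H X x \<subseteq> biset_stab G H Y y"
  proof clarify
    fix g h assume gh: "(g, h) \<in> biset_stab G H X x"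
    then have "g \<in> Q" by (auto simp: Q_def biset_stab_def)
    moreover have "\<psi> g = h"
      using \<psi>[OF \<open>g \<in> Q\<close>] gh x X.lact_free[of "\<psi> g" h x] by (auto simp: biset_stab_def)
    ultimately show "(g, h) \<in> biset_stab G H Y y" using y gh by (auto simp: biset_stab_def)
  qed
  then show ?thesis using y by blast
qed

theorem biset_iso_of_marks:
  assumes "left_free_biset G H X" "left_free_biset G H Y" "finite (carrier G)" "finite (carrier H)"
    and "\<And>Q \<psi>. subgroup Q G \<Longrightarrow> \<psi> \<in> Q \<rightarrow>\<^sub>E carrier H \<Longrightarrow> mark X Q (\<lambda>q. q) \<psi> = mark Y Q (\<lambda>q. q) \<psi>"
  shows "biset_iso G H X Y"
  using assms
proof (induction "card (points X)" arbitrary: X Y rule: less_induct)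
  case (less X Y)
  interpret X: left_free_biset G H X by (rule less.prems(1))
  interpret Y: left_free_biset G H Y by (rule less.prems(2))
  note marks = less.prems(5)
  show ?case
  proof (cases "points X = {}")
    case True
    have "points Y = {}"
    proof (rule ccontr)
      assume "points Y \<noteq> {}"
      then obtain y where "y \<in> points Y" by auto
      then show False
        using biset_stab_subset_of_marks[OF less.prems(2,1), of y] marks True by auto
    qed
    then show ?thesis using True unfolding biset_iso_def by (auto simp: bij_betw_def)
  next
    case False
    have fin: "finite (biset_stab G H X x)" for x
      by (rule finite_subset[of _ "carrier G \<times> carrier H"]) (use less.prems in \<open>auto simp: biset_stab_def\<close>)
    have finY: "finite (biset_stab G H Y y)" for y
      by (rule finite_subset[of _ "carrier G \<times> carrier H"]) (use less.prems in \<open>auto simp: biset_stab_def\<close>)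
    obtain x where x: "x \<in> points X"
      and max: "\<And>z. z \<in> points X \<Longrightarrow> card (biset_stab G H X z) \<le> card (biset_stab G H X x)"
      using obtains_MAX[OF X.finite_points False, of "\<lambda>x. card (biset_stab G H X x)"]
        Max_ge[OF finite_imageI[OF X.finite_points]] by (metis imageI)
    obtain y where y: "y \<in> points Y" "biset_stab G H X x \<subseteq> biset_stab G H Y y"
      using biset_stab_subset_of_marks[OF less.prems(1,2) _ x] marks by blast
    obtain z where z: "z \<in> points X" "biset_stab G H Y y \<subseteq> biset_stab G H X z"
      using biset_stab_subset_of_marks[OF less.prems(2,1) _ y(1)] marks by metis
    \<comment> \<open>From x the argument passes to y in Y and back to z in X with growing
      stabilizers; maximality at x forces equality.\<close>
    have "card (biset_stab G H Y y) \<le> card (biset_stab G H X x)"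
      using z max[of z] card_mono[OF fin z(2)] by linarith
    then have st: "biset_stab G H X x = biset_stab G H Y y"
      using y(2) finY by (metis card_seteq)
    let ?A = "(\<lambda>(h, g). lact X h (ract X x g)) ` (carrier H \<times> carrier G)"
    let ?B = "(\<lambda>(h, g). lact Y h (ract Y y g)) ` (carrier H \<times> carrier G)"
    have st': "ract X x g = lact X h x \<longleftrightarrow> ract Y y g = lact Y h y" if "g \<in> carrier G" "h \<in> carrier H" for g h
    proof -
      have "(g, h) \<in> biset_stab G H X x \<longleftrightarrow> (g, h) \<in> biset_stab G H Y y" using st by simp
      then show ?thesis using that by (simp add: biset_stab_def)
    qed
    have iso: "biset_iso G H (X\<lparr>points := ?A\<rparr>) (Y\<lparr>points := ?B\<rparr>)"
      by (rule biset_orbit_iso[OF less.prems(1,2) x y(1) st'])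
    note cX = X.orbit_closed[OF x] and cY = Y.orbit_closed[OF y(1)]
    have fA: "left_free_biset G H (X\<lparr>points := ?A\<rparr>)" using X.restrict_points[OF cX(1)] cX by blast
    have fA': "left_free_biset G H (X\<lparr>points := points X - ?A\<rparr>)" using X.restrict_points_Diff[OF cX(1)] cX by blast
    have fB': "left_free_biset G H (Y\<lparr>points := points Y - ?B\<rparr>)" using Y.restrict_points_Diff[OF cY(1)] cY by blast
    have "x \<in> ?A" using x by (intro rev_image_eqI[of "(\<one>\<^bsub>H\<^esub>, \<one>\<^bsub>G\<^esub>)"]) (auto simp: X.lact_one X.ract_one)
    then have "points X - ?A \<subset> points X" using x by blast
    then have smaller: "card (points (X\<lparr>points := points X - ?A\<rparr>)) < card (points X)"
      using X.finite_points psubset_card_mono by simp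
    have "biset_iso G H (X\<lparr>points := points X - ?A\<rparr>) (Y\<lparr>points := points Y - ?B\<rparr>)"
    proof (rule less.hyps[OF smaller fA' fB' less.prems(3,4)])
      fix Q :: "'a set" and \<psi> assume Q: "subgroup Q G" and \<psi>: "\<psi> \<in> Q \<rightarrow>\<^sub>E carrier H"
      have "mark (X\<lparr>points := ?A\<rparr>) Q (\<lambda>q. q) \<psi> = mark (Y\<lparr>points := ?B\<rparr>) Q (\<lambda>q. q) \<psi>"
        by (rule mark_iso[OF fA iso]) (use subgroup.subset[OF Q] \<psi> in auto)
      then show "mark (X\<lparr>points := points X - ?A\<rparr>) Q (\<lambda>q. q) \<psi> = mark (Y\<lparr>points := points Y - ?B\<rparr>) Q (\<lambda>q. q) \<psi>"
        using marks[OF Q \<psi>] X.mark_split[OF cX(1), of Q "\<lambda>q. q" \<psi>] Y.mark_split[OF cY(1), of Q "\<lambda>q. q" \<psi>] by linarith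
    qed
    then show ?thesis
    proof (rule biset_iso_glue[OF cX(1) cY(1) iso])
      fix h w assume "h \<in> carrier H" "w \<in> points X"
      then show "lact X h w \<in> ?A \<longleftrightarrow> w \<in> ?A"
        using cX(2)[of h w] cX(2)[of "inv\<^bsub>H\<^esub> h" "lact X h w"] X.lact_inv_cancel[of h w] by (metis X.H.inv_closed)
    next
      fix g w assume "g \<in> carrier G" "w \<in> points X"
      then show "ract X w g \<in> ?A \<longleftrightarrow> w \<in> ?A"
        using cX(3)[of g w] cX(3)[of "inv\<^bsub>G\<^esub> g" "ract X w g"] X.ract_inv_cancel[of g w] by (metis X.G.inv_closed)
    qed
  qed
qed

section \<open>Composition of bisets\<close>

text \<open>The class of (x, y) in the product over H, as an image of H. The parametrization is
  injective when Y is left free, so every class has |H| elements; this is the source of the factor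
  |H| in the mark formula for products.\<close>

definition prod_class :: "('h, 'n) monoid_scheme \<Rightarrow> ('h, 'k, 'x) biset \<Rightarrow> ('g, 'h, 'y) biset \<Rightarrow> 'x \<Rightarrow> 'y \<Rightarrow> ('x \<times> 'y) set" where
  "prod_class H X Y x y = (\<lambda>h. (ract X x (inv\<^bsub>H\<^esub> h), lact Y h y)) ` carrier H"

locale composable_bisets = X: left_free_biset H K X + Y: left_free_biset G H Y
  for G :: "('g, 'm) monoid_scheme" and H :: "('h, 'n) monoid_scheme" and K :: "('k, 'l) monoid_scheme"
    and X :: "('h, 'k, 'x) biset" and Y :: "('g, 'h, 'y) biset" +
  assumes finH: "finite (carrier H)"
begin

abbreviation "cls \<equiv> prod_class H X Y"

lemma prod_class_self: "x \<in> points X \<Longrightarrow> y \<in> points Y \<Longrightarrow> (x, y) \<in> cls x y"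
  unfolding prod_class_def
  by (rule rev_image_eqI[of "\<one>\<^bsub>H\<^esub>"]) (auto simp: X.ract_one Y.lact_one)

lemma prod_class_mem_iff:
  assumes "x \<in> points X" "y \<in> points Y"
  shows "(x', y') \<in> cls x y \<longleftrightarrow>
    x' \<in> points X \<and> y' \<in> points Y \<and> (\<exists>h\<in>carrier H. x = ract X x' h \<and> y' = lact Y h y)"
proof
  assume "(x', y') \<in> cls x y"
  then obtain h where "h \<in> carrier H" "x' = ract X x (inv\<^bsub>H\<^esub> h)" "y' = lact Y h y"
    by (auto simp: prod_class_def)
  then show "x' \<in> points X \<and> y' \<in> points Y \<and> (\<exists>h\<in>carrier H. x = ract X x' h \<and> y' = lact Y h y)"
    using assms by (auto simp: X.ract_closed Y.lact_closed X.ract_inv_cancel intro!: bexI[of _ h])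
next
  assume "x' \<in> points X \<and> y' \<in> points Y \<and> (\<exists>h\<in>carrier H. x = ract X x' h \<and> y' = lact Y h y)"
  then obtain h where "x' \<in> points X" "h \<in> carrier H" "x = ract X x' h" "y' = lact Y h y" by blast
  then show "(x', y') \<in> cls x y"
    unfolding prod_class_def by (intro rev_image_eqI[of h]) (auto simp: X.ract_inv_cancel)
qed

lemma prod_class_eq:
  assumes "x \<in> points X" "y \<in> points Y" and "(x', y') \<in> cls x y"
  shows "cls x' y' = cls x y"
proof -
  obtain h where h: "x' \<in> points X" "h \<in> carrier H" "x = ract X x' h" "y' = lact Y h y"
    using assms prod_class_mem_iff by blast
  have y': "y' \<in> points Y" using h assms by (simp add: Y.lact_closed)
  show ?thesis
  proof (intro subset_antisym subrelI)
    fix a b assume "(a, b) \<in> cls x' y'"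
    then obtain k where k: "a \<in> points X" "b \<in> points Y" "k \<in> carrier H" "x' = ract X a k" "b = lact Y k y'"
      using prod_class_mem_iff h y' by blast
    then show "(a, b) \<in> cls x y"
      unfolding prod_class_mem_iff[OF assms(1,2)] using h assms
      by (auto intro!: bexI[of _ "k \<otimes>\<^bsub>H\<^esub> h"] simp: X.ract_mult Y.lact_mult)
  next
    fix a b assume "(a, b) \<in> cls x y"
    then obtain k where k: "a \<in> points X" "b \<in> points Y" "k \<in> carrier H" "x = ract X a k" "b = lact Y k y"
      using prod_class_mem_iff assms by blast
    have "x' = ract X a (k \<otimes>\<^bsub>H\<^esub> inv\<^bsub>H\<^esub> h)"
    proof -
      have "x' = ract X (ract X x' h) (inv\<^bsub>H\<^esub> h)" using h by (simp add: X.ract_inv_cancel)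
      also have "\<dots> = ract X (ract X a k) (inv\<^bsub>H\<^esub> h)" using h(3) k(4) by simp
      also have "\<dots> = ract X a (k \<otimes>\<^bsub>H\<^esub> inv\<^bsub>H\<^esub> h)" using k h by (simp add: X.ract_mult)
      finally show ?thesis .
    qed
    moreover have "b = lact Y (k \<otimes>\<^bsub>H\<^esub> inv\<^bsub>H\<^esub> h) y'"
      using k h assms by (simp add: Y.lact_mult Y.lact_inv_cancel Y.lact_closed)
    ultimately show "(a, b) \<in> cls x' y'"
      unfolding prod_class_mem_iff[OF h(1) y'] using h k by blast
  qed
qed

lemma prod_class_eq_iff:
  assumes "x \<in> points X" "y \<in> points Y" "x' \<in> points X" "y' \<in> points Y"
  shows "cls x' y' = cls x y \<longleftrightarrow> (\<exists>h\<in>carrier H. x = ract X x' h \<and> y' = lact Y h y)"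
  using assms prod_class_eq prod_class_self prod_class_mem_iff by metis

text \<open>The class of a pair under the given relation is its orbit \<open>cls\<close>. From here
  on the quotient is handled through \<open>cls\<close> only.\<close>

lemma points_biset_product:
  "points (biset_product H X Y) = (\<lambda>(x, y). cls x y) ` (points X \<times> points Y)"
proof -
  let ?r = "{((ract X x h, y), (x, lact Y h y)) | x y h. x \<in> points X \<and> y \<in> points Y \<and> h \<in> carrier H}"
  have "?r `` {(x, y)} = cls x y" if "x \<in> points X" "y \<in> points Y" for x y
  proof (rule Set.set_eqI)
    fix z :: "'x \<times> 'y"
    obtain x' y' where z: "z = (x', y')" by fastforce
    show "z \<in> ?r `` {(x, y)} \<longleftrightarrow> z \<in> cls x y"
      unfolding z prod_class_mem_iff[OF that] using that Y.lact_closed by blast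
  qed
  then have "(points X \<times> points Y) // ?r = (\<lambda>(x, y). cls x y) ` (points X \<times> points Y)"
    unfolding quotient_def by force
  then show ?thesis by (simp add: biset_product_def)
qed

lemma lact_biset_product:
  assumes "x \<in> points X" "y \<in> points Y" "k \<in> carrier K"
  shows "lact (biset_product H X Y) k (cls x y) = cls (lact X k x) y"
proof -
  have "lact X k (ract X x h) = ract X (lact X k x) h" if "h \<in> carrier H" for h
    using assms that by (simp add: X.actions_commute)
  then show ?thesis
    unfolding biset_product_def prod_class_def by (auto simp: image_image intro!: image_cong)
qed

lemma ract_biset_product:
  assumes "x \<in> points X" "y \<in> points Y" "g \<in> carrier G"
  shows "ract (biset_product H X Y) (cls x y) g = cls x (ract Y y g)"
proof -
  have "ract Y (lact Y h y) g = lact Y h (ract Y y g)" if "h \<in> carrier H" for h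
    using assms that by (simp add: Y.actions_commute)
  then show ?thesis
    unfolding biset_product_def prod_class_def by (auto simp: image_image intro!: image_cong)
qed

lemma left_free_biset_product: "left_free_biset G K (biset_product H X Y)"
proof -
  have pt: "\<exists>x y. x \<in> points X \<and> y \<in> points Y \<and> C = cls x y" if "C \<in> points (biset_product H X Y)" for C
    using that unfolding points_biset_product by auto
  have ptI: "cls x y \<in> points (biset_product H X Y)" if "x \<in> points X" "y \<in> points Y" for x y
    using that unfolding points_biset_product by auto
  note s = lact_biset_product ract_biset_product ptI X.lact_closed X.ract_closed Y.lact_closed Y.ract_closed
  show ?thesis
  proof unfold_locales
    show "finite (points (biset_product H X Y))"
      unfolding points_biset_product using X.finite_points Y.finite_points by simp
  next
    fix h C assume "h \<in> carrier K" "C \<in> points (biset_product H X Y)"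
    then show "lact (biset_product H X Y) h C \<in> points (biset_product H X Y)"
      using pt[of C] s by auto
  next
    fix C assume "C \<in> points (biset_product H X Y)"
    then show "lact (biset_product H X Y) \<one>\<^bsub>K\<^esub> C = C" using pt[of C] s X.lact_one by auto
  next
    fix h h' C assume "h \<in> carrier K" "h' \<in> carrier K" "C \<in> points (biset_product H X Y)"
    then show "lact (biset_product H X Y) (h \<otimes>\<^bsub>K\<^esub> h') C = lact (biset_product H X Y) h (lact (biset_product H X Y) h' C)"
      using pt[of C] s X.lact_mult by auto
  next
    fix g C assume "g \<in> carrier G" "C \<in> points (biset_product H X Y)"
    then show "ract (biset_product H X Y) C g \<in> points (biset_product H X Y)"
      using pt[of C] s by auto
  next
    fix C assume "C \<in> points (biset_product H X Y)"
    then show "ract (biset_product H X Y) C \<one>\<^bsub>G\<^esub> = C" using pt[of C] s Y.ract_one by auto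
  next
    fix g g' C assume "g \<in> carrier G" "g' \<in> carrier G" "C \<in> points (biset_product H X Y)"
    then show "ract (biset_product H X Y) C (g \<otimes>\<^bsub>G\<^esub> g') = ract (biset_product H X Y) (ract (biset_product H X Y) C g) g'"
      using pt[of C] s Y.ract_mult by auto
  next
    fix h g C assume "h \<in> carrier K" "g \<in> carrier G" "C \<in> points (biset_product H X Y)"
    then show "ract (biset_product H X Y) (lact (biset_product H X Y) h C) g =
        lact (biset_product H X Y) h (ract (biset_product H X Y) C g)"
      using pt[of C] s by auto
  next
    fix k C assume k: "k \<in> carrier K" and C: "C \<in> points (biset_product H X Y)"
      and eq: "lact (biset_product H X Y) k C = C"
    obtain x y where xy: "x \<in> points X" "y \<in> points Y" "C = cls x y" using pt[OF C] by blast
    have "cls (lact X k x) y = cls x y" using eq k xy s by simp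
    \<comment> \<open>Freeness passes from the factors to the product one at a time: that of Y
      forces h to be trivial, and that of X then forces k to be trivial.\<close>
    then obtain h where h: "h \<in> carrier H" "x = ract X (lact X k x) h" "y = lact Y h y"
      using prod_class_eq_iff xy k X.lact_closed by blast
    then have "h = \<one>\<^bsub>H\<^esub>" using xy Y.left_free by metis
    then have "lact X k x = x" using h xy k by (simp add: X.ract_one X.lact_closed)
    then show "k = \<one>\<^bsub>K\<^esub>" using xy k X.left_free by blast
  qed
qed

lemma card_prod_class:
  assumes "x \<in> points X" "y \<in> points Y"
  shows "card (cls x y) = card (carrier H)"
  unfolding prod_class_def
  by (rule card_image) (use assms Y.lact_free in \<open>auto intro!: inj_onI\<close>)

lemma mark_biset_product:
  assumes Q: "finite Q" and \<chi>: "\<chi> \<in> Q \<rightarrow> carrier G" and \<phi>: "\<phi> \<in> Q \<rightarrow> carrier K"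
  shows "card (carrier H) * mark (biset_product H X Y) Q \<chi> \<phi> =
    (\<Sum>\<theta>\<in>Q \<rightarrow>\<^sub>E carrier H. mark X Q \<theta> \<phi> * mark Y Q \<chi> \<theta>)"
proof -
  let ?P = "biset_product H X Y"
  let ?F = "{C \<in> points ?P. \<forall>q\<in>Q. ract ?P C (\<chi> q) = lact ?P (\<phi> q) C}"
  let ?fx = "\<lambda>\<theta>. {x \<in> points X. \<forall>q\<in>Q. ract X x (\<theta> q) = lact X (\<phi> q) x}"
  let ?fy = "\<lambda>\<theta>. {y \<in> points Y. \<forall>q\<in>Q. ract Y y (\<chi> q) = lact Y (\<theta> q) y}"
  have fixed: "(\<forall>q\<in>Q. ract ?P (cls x y) (\<chi> q) = lact ?P (\<phi> q) (cls x y)) \<longleftrightarrow>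
      (\<exists>\<theta>\<in>Q \<rightarrow>\<^sub>E carrier H. x \<in> ?fx \<theta> \<and> y \<in> ?fy \<theta>)" if xy: "x \<in> points X" "y \<in> points Y" for x y
  proof -
    have "ract ?P (cls x y) (\<chi> q) = lact ?P (\<phi> q) (cls x y) \<longleftrightarrow>
        (\<exists>h\<in>carrier H. ract X x h = lact X (\<phi> q) x \<and> ract Y y (\<chi> q) = lact Y h y)" if "q \<in> Q" for q
    proof -
      have q: "\<chi> q \<in> carrier G" "\<phi> q \<in> carrier K" using that \<chi> \<phi> by auto
      then have "ract ?P (cls x y) (\<chi> q) = lact ?P (\<phi> q) (cls x y) \<longleftrightarrow>
        cls x (ract Y y (\<chi> q)) = cls (lact X (\<phi> q) x) y"
        using xy by (simp add: lact_biset_product ract_biset_product)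
      also have "\<dots> \<longleftrightarrow> (\<exists>h\<in>carrier H. lact X (\<phi> q) x = ract X x h \<and> ract Y y (\<chi> q) = lact Y h y)"
        using q xy by (simp add: prod_class_eq_iff X.lact_closed Y.ract_closed)
      finally show ?thesis by metis
    qed
    then have "(\<forall>q\<in>Q. ract ?P (cls x y) (\<chi> q) = lact ?P (\<phi> q) (cls x y)) \<longleftrightarrow>
       (\<forall>q\<in>Q. \<exists>h. h \<in> carrier H \<and> ract X x h = lact X (\<phi> q) x \<and> ract Y y (\<chi> q) = lact Y h y)" by auto
    also have "\<dots> \<longleftrightarrow> (\<exists>\<theta>\<in>Q \<rightarrow>\<^sub>E carrier H. x \<in> ?fx \<theta> \<and> y \<in> ?fy \<theta>)" (is "?l \<longleftrightarrow> ?r")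
    proof
      assume ?l
      then obtain \<theta> where \<theta>: "\<And>q. q \<in> Q \<Longrightarrow> \<theta> q \<in> carrier H \<and> ract X x (\<theta> q) = lact X (\<phi> q) x \<and> ract Y y (\<chi> q) = lact Y (\<theta> q) y"
        by metis
      then show ?r using xy by (intro bexI[of _ "restrict \<theta> Q"]) auto
    next
      assume ?r
      then obtain \<theta> where \<theta>: "\<theta> \<in> Q \<rightarrow>\<^sub>E carrier H" "x \<in> ?fx \<theta>" "y \<in> ?fy \<theta>" by blast
      show ?l
      proof
        fix q assume "q \<in> Q"
        then show "\<exists>h. h \<in> carrier H \<and> ract X x h = lact X (\<phi> q) x \<and> ract Y y (\<chi> q) = lact Y h y"
          using \<theta> by (intro exI[of _ "\<theta> q"]) auto
      qed
    qed
    finally show ?thesis .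
  qed
  have fins: "finite (points X)" "finite (points Y)" using X.finite_points Y.finite_points .
  have "card (carrier H) * card ?F = card (\<Union>?F)"
  proof (rule card_partition)
    show "finite ?F" using left_free_biset.finite_points[OF left_free_biset_product] by simp
    have "\<Union>?F \<subseteq> points X \<times> points Y"
      unfolding points_biset_product using prod_class_mem_iff by fastforce
    then show "finite (\<Union>?F)" by (rule finite_subset) (use fins in simp)
    show "card c = card (carrier H)" if "c \<in> ?F" for c
      using that card_prod_class unfolding points_biset_product by auto
    show "c1 \<inter> c2 = {}" if c: "c1 \<in> ?F" "c2 \<in> ?F" "c1 \<noteq> c2" for c1 c2
    proof (rule ccontr)
      assume "c1 \<inter> c2 \<noteq> {}"
      then obtain a b where ab: "(a, b) \<in> c1" "(a, b) \<in> c2" by auto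
      obtain x y x' y' where "x \<in> points X" "y \<in> points Y" "c1 = cls x y" "x' \<in> points X" "y' \<in> points Y" "c2 = cls x' y'"
        using c unfolding points_biset_product by auto
      then show False using ab prod_class_eq c(3) by metis
    qed
  qed
  also have "\<Union>?F = (\<Union>\<theta>\<in>Q \<rightarrow>\<^sub>E carrier H. ?fx \<theta> \<times> ?fy \<theta>)"
  proof (intro subset_antisym subrelI)
    fix x y assume "(x, y) \<in> \<Union>?F"
    then obtain C where C: "C \<in> ?F" "(x, y) \<in> C" by blast
    then obtain x' y' where x'y': "x' \<in> points X" "y' \<in> points Y" "C = cls x' y'"
      unfolding points_biset_product by auto
    then have xy: "x \<in> points X" "y \<in> points Y" "cls x y = C" using C prod_class_mem_iff prod_class_eq by blast+
    then show "(x, y) \<in> (\<Union>\<theta>\<in>Q \<rightarrow>\<^sub>E carrier H. ?fx \<theta> \<times> ?fy \<theta>)" using fixed[OF xy(1,2)] C(1) by blast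
  next
    fix x y assume "(x, y) \<in> (\<Union>\<theta>\<in>Q \<rightarrow>\<^sub>E carrier H. ?fx \<theta> \<times> ?fy \<theta>)"
    then obtain \<theta> where \<theta>: "\<theta> \<in> Q \<rightarrow>\<^sub>E carrier H" "x \<in> ?fx \<theta>" "y \<in> ?fy \<theta>" by blast
    then have xy: "x \<in> points X" "y \<in> points Y" by auto
    then have "cls x y \<in> ?F" using fixed[OF xy] \<theta> unfolding points_biset_product by blast
    then show "(x, y) \<in> \<Union>?F" using prod_class_self[OF xy] by blast
  qed
  also have "card \<dots> = (\<Sum>\<theta>\<in>Q \<rightarrow>\<^sub>E carrier H. card (?fx \<theta> \<times> ?fy \<theta>))"
  proof (rule card_UN_disjoint)
    show "finite (Q \<rightarrow>\<^sub>E carrier H)" using Q finH by (simp add: finite_PiE)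
    show "\<forall>\<theta>\<in>Q \<rightarrow>\<^sub>E carrier H. finite (?fx \<theta> \<times> ?fy \<theta>)" using fins by simp
    show "\<forall>\<theta>\<in>Q \<rightarrow>\<^sub>E carrier H. \<forall>\<eta>\<in>Q \<rightarrow>\<^sub>E carrier H. \<theta> \<noteq> \<eta> \<longrightarrow> (?fx \<theta> \<times> ?fy \<theta>) \<inter> (?fx \<eta> \<times> ?fy \<eta>) = {}"
    proof (intro ballI impI)
      fix \<theta> \<eta> assume t: "\<theta> \<in> Q \<rightarrow>\<^sub>E carrier H" "\<eta> \<in> Q \<rightarrow>\<^sub>E carrier H" "\<theta> \<noteq> \<eta>"
      show "(?fx \<theta> \<times> ?fy \<theta>) \<inter> (?fx \<eta> \<times> ?fy \<eta>) = {}"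
      proof (rule ccontr)
        assume "(?fx \<theta> \<times> ?fy \<theta>) \<inter> (?fx \<eta> \<times> ?fy \<eta>) \<noteq> {}"
        then obtain y where y: "y \<in> ?fy \<theta>" "y \<in> ?fy \<eta>" by blast
        have "\<theta> = \<eta>"
        proof (rule PiE_ext[OF t(1,2)])
          fix q assume q: "q \<in> Q"
          then have "\<theta> q \<in> carrier H" "\<eta> q \<in> carrier H" using t by auto
          then show "\<theta> q = \<eta> q" using y q Y.lact_free[of "\<theta> q" "\<eta> q" y] by auto
        qed
        then show False using t by simp
      qed
    qed
  qed
  finally show ?thesis by (simp add: mark_def card_cartesian_product)
qed

end

section \<open>Marks of the basis bisets\<close>

text \<open>\<open>H \<times>\<^bsub>(K,\<phi>)\<^esub> G\<close> is the composite over \<open>K\<close> of the \<open>(K, H)\<close>-biset \<open>H\<close>, where \<open>K\<close> acts through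
  \<open>\<phi>\<close>, and the \<open>(G, K)\<close>-biset \<open>G\<close>.\<close>

abbreviation (input) along_biset :: "('h, 'n) monoid_scheme \<Rightarrow> ('g \<Rightarrow> 'h) \<Rightarrow> ('g, 'h, 'h) biset" where
  "along_biset H \<phi> \<equiv> \<lparr>points = carrier H, lact = monoid.mult H, ract = (\<lambda>h k. h \<otimes>\<^bsub>H\<^esub> \<phi> k)\<rparr>"

abbreviation (input) regular_biset :: "('g, 'm) monoid_scheme \<Rightarrow> ('g, 'g, 'g) biset" where
  "regular_biset G \<equiv> \<lparr>points = carrier G, lact = monoid.mult G, ract = monoid.mult G\<rparr>"

locale basis_pair = G: group G + H: group H
  for G :: "('g, 'm) monoid_scheme" and H :: "('h, 'n) monoid_scheme" +
  fixes K \<phi>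
  assumes finite_G: "finite (carrier G)" and finite_H: "finite (carrier H)"
    and sub: "subgroup K G" and hom: "\<phi> \<in> hom (G\<lparr>carrier := K\<rparr>) H"

sublocale basis_pair \<subseteq> composable_bisets G "G\<lparr>carrier := K\<rparr>" H "along_biset H \<phi>" "regular_biset G"
proof -
  interpret K: group "G\<lparr>carrier := K\<rparr>" using sub G.subgroup_imp_group by blast
  interpret S: subgroup K G by (rule sub)
  interpret hom: group_hom "G\<lparr>carrier := K\<rparr>" H \<phi> by unfold_locales (rule hom)
  have h: "\<phi> k \<in> carrier H" if "k \<in> K" for k using hom.hom_closed that by simp
  have m: "\<phi> (k \<otimes>\<^bsub>G\<^esub> k') = \<phi> k \<otimes>\<^bsub>H\<^esub> \<phi> k'" if "k \<in> K" "k' \<in> K" for k k' using hom.hom_mult that by simp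
  have o: "\<phi> \<one>\<^bsub>G\<^esub> = \<one>\<^bsub>H\<^esub>" using hom.hom_one by simp
  have "left_free_biset (G\<lparr>carrier := K\<rparr>) H (along_biset H \<phi>)"
    by unfold_locales (use finite_H h m o in \<open>auto simp: H.m_assoc\<close>)
  moreover have "left_free_biset G (G\<lparr>carrier := K\<rparr>) (regular_biset G)"
    by unfold_locales (use finite_G in \<open>auto simp: G.m_assoc\<close>)
  moreover have "finite K" using finite_G S.subset finite_subset by blast
  ultimately show "composable_bisets G (G\<lparr>carrier := K\<rparr>) H (along_biset H \<phi>) (regular_biset G)"
    by (simp add: composable_bisets_def composable_bisets_axioms_def)
qed

context basis_pair
begin

lemma hom_in_carrier: "k \<in> K \<Longrightarrow> \<phi> k \<in> carrier H"
  using hom by (auto simp: hom_def)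

text \<open>Both relations consist of the same pairs: one lists them in the opposite order, and
  replacing k by its inverse exchanges the order.\<close>

lemma basis_biset_eq_product:
  "basis_biset G H K \<phi> = biset_product (G\<lparr>carrier := K\<rparr>) (along_biset H \<phi>) (regular_biset G)"
proof -
  interpret S: subgroup K G by (rule sub)
  let ?l = "{((h, k \<otimes>\<^bsub>G\<^esub> g), (h \<otimes>\<^bsub>H\<^esub> \<phi> k, g)) | h k g. h \<in> carrier H \<and> k \<in> K \<and> g \<in> carrier G}"
  let ?r = "{((h \<otimes>\<^bsub>H\<^esub> \<phi> k, g), (h, k \<otimes>\<^bsub>G\<^esub> g)) | h g k. h \<in> carrier H \<and> g \<in> carrier G \<and> k \<in> K}"
  interpret hom: group_hom "G\<lparr>carrier := K\<rparr>" H \<phi>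
    using hom sub by (simp add: group_hom_def group_hom_axioms_def G.subgroup_imp_group H.is_group)
  have inv: "\<phi> (inv\<^bsub>G\<^esub> k) = inv\<^bsub>H\<^esub> \<phi> k" if "k \<in> K" for k
    using hom.hom_inv[of k] that G.m_inv_consistent[OF sub] by simp
  have "?l = ?r"
  proof (intro subset_antisym subsetI)
    fix z assume "z \<in> ?l"
    then obtain h k g where z: "z = ((h, k \<otimes>\<^bsub>G\<^esub> g), (h \<otimes>\<^bsub>H\<^esub> \<phi> k, g))" "h \<in> carrier H" "k \<in> K" "g \<in> carrier G" by blast
    then have "z = (((h \<otimes>\<^bsub>H\<^esub> \<phi> k) \<otimes>\<^bsub>H\<^esub> \<phi> (inv\<^bsub>G\<^esub> k), k \<otimes>\<^bsub>G\<^esub> g), (h \<otimes>\<^bsub>H\<^esub> \<phi> k, inv\<^bsub>G\<^esub> k \<otimes>\<^bsub>G\<^esub> (k \<otimes>\<^bsub>G\<^esub> g)))"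
      using hom_in_carrier[of k] by (simp add: inv H.m_assoc G.m_assoc[symmetric])
    moreover have "h \<otimes>\<^bsub>H\<^esub> \<phi> k \<in> carrier H" "k \<otimes>\<^bsub>G\<^esub> g \<in> carrier G" "inv\<^bsub>G\<^esub> k \<in> K"
      using z hom_in_carrier[of k] by auto
    ultimately show "z \<in> ?r" by blast
  next
    fix z assume "z \<in> ?r"
    then obtain h g k where z: "z = ((h \<otimes>\<^bsub>H\<^esub> \<phi> k, g), (h, k \<otimes>\<^bsub>G\<^esub> g))" "h \<in> carrier H" "g \<in> carrier G" "k \<in> K" by blast
    then have "z = ((h \<otimes>\<^bsub>H\<^esub> \<phi> k, inv\<^bsub>G\<^esub> k \<otimes>\<^bsub>G\<^esub> (k \<otimes>\<^bsub>G\<^esub> g)), ((h \<otimes>\<^bsub>H\<^esub> \<phi> k) \<otimes>\<^bsub>H\<^esub> \<phi> (inv\<^bsub>G\<^esub> k), k \<otimes>\<^bsub>G\<^esub> g))"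
      using hom_in_carrier[of k] by (simp add: inv H.m_assoc G.m_assoc[symmetric])
    moreover have "h \<otimes>\<^bsub>H\<^esub> \<phi> k \<in> carrier H" "k \<otimes>\<^bsub>G\<^esub> g \<in> carrier G" "inv\<^bsub>G\<^esub> k \<in> K"
      using z hom_in_carrier[of k] by auto
    ultimately show "z \<in> ?l" by blast
  qed
  then show ?thesis by (simp add: basis_biset_def biset_product_def)
qed

lemma left_free_basis_biset: "left_free_biset G H (basis_biset G H K \<phi>)"
  unfolding basis_biset_eq_product by (rule left_free_biset_product)

text \<open>A pair (h, g) that is fixed for some \<theta> determines \<theta> as the conjugate of
  \<chi> by g, so the sum over \<theta> in the product formula collapses to a count of
  pairs.\<close>

lemma mark_basis_biset:
  assumes Q: "finite Q" and \<chi>: "\<chi> \<in> Q \<rightarrow> carrier G" and \<psi>: "\<psi> \<in> Q \<rightarrow> carrier H"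
  shows "card K * mark (basis_biset G H K \<phi>) Q \<chi> \<psi> =
    card {(h, g) \<in> carrier H \<times> carrier G. \<forall>q\<in>Q. g \<otimes>\<^bsub>G\<^esub> \<chi> q \<otimes>\<^bsub>G\<^esub> inv\<^bsub>G\<^esub> g \<in> K \<and>
      \<psi> q = h \<otimes>\<^bsub>H\<^esub> \<phi> (g \<otimes>\<^bsub>G\<^esub> \<chi> q \<otimes>\<^bsub>G\<^esub> inv\<^bsub>G\<^esub> g) \<otimes>\<^bsub>H\<^esub> inv\<^bsub>H\<^esub> h}"
    (is "_ = card ?A")
proof -
  interpret S: subgroup K G by (rule sub)
  let ?hx = "\<lambda>\<theta>. {h \<in> carrier H. \<forall>q\<in>Q. h \<otimes>\<^bsub>H\<^esub> \<phi> (\<theta> q) = \<psi> q \<otimes>\<^bsub>H\<^esub> h}"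
  let ?gy = "\<lambda>\<theta>. {g \<in> carrier G. \<forall>q\<in>Q. g \<otimes>\<^bsub>G\<^esub> \<chi> q = \<theta> q \<otimes>\<^bsub>G\<^esub> g}"
  have gy: "g \<in> ?gy \<theta> \<longleftrightarrow> g \<in> carrier G \<and> (\<forall>q\<in>Q. \<theta> q = g \<otimes>\<^bsub>G\<^esub> \<chi> q \<otimes>\<^bsub>G\<^esub> inv\<^bsub>G\<^esub> g)"
    if "\<theta> \<in> Q \<rightarrow>\<^sub>E K" for \<theta> g
  proof -
    have "\<theta> q \<in> carrier G" "\<chi> q \<in> carrier G" if "q \<in> Q" for q using that \<open>\<theta> \<in> Q \<rightarrow>\<^sub>E K\<close> \<chi> S.subset by auto
    then show ?thesis using G.inv_solve_right by auto
  qed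
  have hx: "h \<in> ?hx \<theta> \<longleftrightarrow> h \<in> carrier H \<and> (\<forall>q\<in>Q. \<psi> q = h \<otimes>\<^bsub>H\<^esub> \<phi> (\<theta> q) \<otimes>\<^bsub>H\<^esub> inv\<^bsub>H\<^esub> h)"
    if "\<theta> \<in> Q \<rightarrow>\<^sub>E K" for \<theta> h
  proof -
    have "\<phi> (\<theta> q) \<in> carrier H" "\<psi> q \<in> carrier H" if "q \<in> Q" for q
      using that \<open>\<theta> \<in> Q \<rightarrow>\<^sub>E K\<close> \<psi> hom_in_carrier by auto
    then show ?thesis using H.inv_solve_right by auto
  qed
  have "?A = (\<Union>\<theta>\<in>Q \<rightarrow>\<^sub>E K. ?hx \<theta> \<times> ?gy \<theta>)"
  proof (intro subset_antisym subrelI)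
    fix h g assume hg: "(h, g) \<in> ?A"
    let ?t = "\<lambda>q\<in>Q. g \<otimes>\<^bsub>G\<^esub> \<chi> q \<otimes>\<^bsub>G\<^esub> inv\<^bsub>G\<^esub> g"
    have t: "?t \<in> Q \<rightarrow>\<^sub>E K" using hg by auto
    have "h \<in> ?hx ?t" "g \<in> ?gy ?t" unfolding hx[OF t] gy[OF t] using hg by auto
    then show "(h, g) \<in> (\<Union>\<theta>\<in>Q \<rightarrow>\<^sub>E K. ?hx \<theta> \<times> ?gy \<theta>)" using t by blast
  next
    fix h g assume "(h, g) \<in> (\<Union>\<theta>\<in>Q \<rightarrow>\<^sub>E K. ?hx \<theta> \<times> ?gy \<theta>)"
    then obtain \<theta> where \<theta>: "\<theta> \<in> Q \<rightarrow>\<^sub>E K" "h \<in> ?hx \<theta>" "g \<in> ?gy \<theta>" by blast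
    have "g \<otimes>\<^bsub>G\<^esub> \<chi> q \<otimes>\<^bsub>G\<^esub> inv\<^bsub>G\<^esub> g = \<theta> q" "\<theta> q \<in> K" "\<psi> q = h \<otimes>\<^bsub>H\<^esub> \<phi> (\<theta> q) \<otimes>\<^bsub>H\<^esub> inv\<^bsub>H\<^esub> h" if "q \<in> Q" for q
      using \<theta>(2,3) PiE_mem[OF \<theta>(1) that] that unfolding hx[OF \<theta>(1)] gy[OF \<theta>(1)] by auto
    then show "(h, g) \<in> ?A" using \<theta>(2,3) by auto
  qed
  also have "card \<dots> = (\<Sum>\<theta>\<in>Q \<rightarrow>\<^sub>E K. card (?hx \<theta> \<times> ?gy \<theta>))"
  proof (rule card_UN_disjoint)
    show "finite (Q \<rightarrow>\<^sub>E K)" using Q finH by (simp add: finite_PiE)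
    show "\<forall>\<theta>\<in>Q \<rightarrow>\<^sub>E K. finite (?hx \<theta> \<times> ?gy \<theta>)" using finite_G finite_H by simp
    show "\<forall>\<theta>\<in>Q \<rightarrow>\<^sub>E K. \<forall>\<eta>\<in>Q \<rightarrow>\<^sub>E K. \<theta> \<noteq> \<eta> \<longrightarrow> (?hx \<theta> \<times> ?gy \<theta>) \<inter> (?hx \<eta> \<times> ?gy \<eta>) = {}"
    proof (intro ballI impI)
      fix \<theta> \<eta> assume t: "\<theta> \<in> Q \<rightarrow>\<^sub>E K" "\<eta> \<in> Q \<rightarrow>\<^sub>E K" "\<theta> \<noteq> \<eta>"
      have "\<not> (g \<in> ?gy \<theta> \<and> g \<in> ?gy \<eta>)" for g
        unfolding gy[OF t(1)] gy[OF t(2)] using t PiE_ext[OF t(1,2)] by metis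
      then show "(?hx \<theta> \<times> ?gy \<theta>) \<inter> (?hx \<eta> \<times> ?gy \<eta>) = {}" by blast
    qed
  qed
  also have "\<dots> = card K * mark (basis_biset G H K \<phi>) Q \<chi> \<psi>"
    using mark_biset_product[OF Q \<chi> \<psi>]
    unfolding basis_biset_eq_product by (simp add: mark_def card_cartesian_product)
  finally show ?thesis by simp
qed

end

section \<open>Marks on Burnside modules\<close>

text \<open>Isomorphism classes contain only bisets on natural numbers. This copy is how composites,
  unions and basis bisets, whose points have other types, reach \<open>iso_classes\<close>.\<close>

lemma left_free_biset_nat_copy:
  fixes X :: "('g, 'h, 'x) biset"
  assumes "left_free_biset G H X"
  obtains Y :: "('g, 'h, nat) biset" where "left_free_biset G H Y" "biset_iso G H X Y"
proof -
  interpret X: left_free_biset G H X by fact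
  obtain f where f: "bij_betw f (points X) {0..<card (points X)}"
    using ex_bij_betw_finite_nat[OF X.finite_points] by blast
  let ?i = "inv_into (points X) f"
  let ?Y = "\<lparr>points = f ` points X, lact = (\<lambda>h n. f (lact X h (?i n))), ract = (\<lambda>n g. f (ract X (?i n) g))\<rparr>"
  have i: "?i (f x) = x" if "x \<in> points X" for x using f that by (simp add: bij_betw_def)
  have inj: "f x = f y \<longleftrightarrow> x = y" if "x \<in> points X" "y \<in> points X" for x y
    using f that by (auto simp: bij_betw_def inj_on_def)
  have "left_free_biset G H ?Y"
    by unfold_locales (auto simp: X.finite_points i inj X.lact_closed X.ract_closed X.lact_one X.ract_one
      X.lact_mult X.ract_mult X.actions_commute dest: X.left_free)
  moreover have "biset_iso G H X ?Y"
    unfolding biset_iso_def using f by (intro exI[of _ f]) (auto simp: i bij_betw_def)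
  ultimately show ?thesis by (rule that)
qed

lemma left_free_biset_union:
  assumes "left_free_biset G H X" "left_free_biset G H Y"
  shows "left_free_biset G H (biset_union X Y)"
proof -
  interpret X: left_free_biset G H X by fact
  interpret Y: left_free_biset G H Y by fact
  show ?thesis
    by unfold_locales (auto simp: biset_union_def X.finite_points Y.finite_points X.lact_closed X.ract_closed
      X.lact_one X.ract_one X.lact_mult X.ract_mult X.actions_commute Y.lact_closed Y.ract_closed
      Y.lact_one Y.ract_one Y.lact_mult Y.ract_mult Y.actions_commute dest: X.left_free Y.left_free)
qed

lemma mark_biset_union:
  assumes "finite (points X)" "finite (points Y)"
  shows "mark (biset_union X Y) Q \<chi> \<phi> = mark X Q \<chi> \<phi> + mark Y Q \<chi> \<phi>"
proof -
  have "{z \<in> points (biset_union X Y). \<forall>q\<in>Q. ract (biset_union X Y) z (\<chi> q) = lact (biset_union X Y) (\<phi> q) z} =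
    {x \<in> points X. \<forall>q\<in>Q. ract X x (\<chi> q) = lact X (\<phi> q) x} <+> {y \<in> points Y. \<forall>q\<in>Q. ract Y y (\<chi> q) = lact Y (\<phi> q) y}"
    by (auto simp: biset_union_def)
  then show ?thesis using assms by (simp add: mark_def card_Plus)
qed

text \<open>It represents zero, which makes a single class a difference of two classes.\<close>

definition empty_biset :: "('g, 'h, nat) biset" where
  "empty_biset = \<lparr>points = {}, lact = (\<lambda>h x. x), ract = (\<lambda>x g. x)\<rparr>"

lemma left_free_empty_biset: "group G \<Longrightarrow> group H \<Longrightarrow> left_free_biset G H empty_biset"
  by (simp add: left_free_biset_def left_free_biset_axioms_def empty_biset_def)

lemma iso_class_cong:
  assumes "left_free_biset G H X" "biset_iso G H X Y"
  shows "iso_class G H X = iso_class G H Y"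
  unfolding iso_class_def
  using biset_iso_trans[OF assms(2)] biset_iso_trans[OF biset_iso_sym[OF assms]] by blast

lemma iso_class_mem_iso_classes:
  assumes "left_free_biset G H X"
  shows "iso_class G H X \<in> iso_classes G H"
proof -
  obtain Y :: "(_, _, nat) biset" where "left_free_biset G H Y" "biset_iso G H X Y"
    using left_free_biset_nat_copy[OF assms] by blast
  then show ?thesis using iso_class_cong[OF assms] unfolding iso_classes_def by blast
qed

text \<open>The choice does not matter for classes of left free bisets, since isomorphic bisets have
  the same marks.\<close>

definition class_mark :: "('g, 'h) biset_class \<Rightarrow> 'q set \<Rightarrow> ('q \<Rightarrow> 'g) \<Rightarrow> ('q \<Rightarrow> 'h) \<Rightarrow> nat" where
  "class_mark a Q \<chi> \<phi> = mark (SOME X. X \<in> a) Q \<chi> \<phi>"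

lemma class_mark_iso_class:
  assumes "left_free_biset G H X" "\<chi> \<in> Q \<rightarrow> carrier G" "\<phi> \<in> Q \<rightarrow> carrier H"
  shows "class_mark (iso_class G H X) Q \<chi> \<phi> = mark X Q \<chi> \<phi>"
proof -
  obtain Y :: "(_, _, nat) biset" where "left_free_biset G H Y" "biset_iso G H X Y"
    using left_free_biset_nat_copy[OF assms(1)] by blast
  then have "Y \<in> iso_class G H X" by (simp add: iso_class_def)
  then have "(SOME X'. X' \<in> iso_class G H X) \<in> iso_class G H X" by (rule someI)
  then have "biset_iso G H X (SOME X'. X' \<in> iso_class G H X)" by (simp only: iso_class_def mem_Collect_eq)
  then show ?thesis
    unfolding class_mark_def by (rule mark_iso[OF assms(1) _ assms(2,3), symmetric])
qed

definition fmark :: "(('g, 'h) biset_class \<Rightarrow>\<^sub>0 rat) \<Rightarrow> 'q set \<Rightarrow> ('q \<Rightarrow> 'g) \<Rightarrow> ('q \<Rightarrow> 'h) \<Rightarrow> rat" where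
  "fmark x Q \<chi> \<phi> = (\<Sum>a\<in>Poly_Mapping.keys x. Poly_Mapping.lookup x a * of_nat (class_mark a Q \<chi> \<phi>))"

lemma fmark_add: "fmark (x + y) Q \<chi> \<phi> = fmark x Q \<chi> \<phi> + fmark y Q \<chi> \<phi>"
  unfolding fmark_def by (rule setsum_keys_plus_distrib) (auto simp: distrib_right)

lemma fmark_zero [simp]: "fmark 0 Q \<chi> \<phi> = 0"
  by (simp add: fmark_def)

lemma fmark_uminus: "fmark (- x) Q \<chi> \<phi> = - fmark x Q \<chi> \<phi>"
  using fmark_add[of x "- x" Q \<chi> \<phi>] by simp

lemma fmark_diff: "fmark (x - y) Q \<chi> \<phi> = fmark x Q \<chi> \<phi> - fmark y Q \<chi> \<phi>"
  using fmark_add[of "x - y" y Q \<chi> \<phi>] by simp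

lemma fmark_sum: "fmark (\<Sum>i\<in>I. f i) Q \<chi> \<phi> = (\<Sum>i\<in>I. fmark (f i) Q \<chi> \<phi>)"
  by (induction I rule: infinite_finite_induct) (auto simp: fmark_add)

lemma fmark_single: "fmark (Poly_Mapping.single a r) Q \<chi> \<phi> = r * of_nat (class_mark a Q \<chi> \<phi>)"
  by (cases "r = 0") (auto simp: fmark_def)

lemma sum_single_lookup: "(\<Sum>a\<in>Poly_Mapping.keys x. Poly_Mapping.single a (Poly_Mapping.lookup x a)) = x"
  by (rule poly_mapping_eqI) (simp add: lookup_sum lookup_single when_def sum.delta in_keys_iff)

section \<open>The coefficient ring of p-local integers\<close>

lemma Z_loc_of_int [simp]: "1 < p \<Longrightarrow> of_int a \<in> Z_loc p"
proof -
  assume "1 < p"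
  then have "\<not> int p dvd 1" by simp
  moreover have "(of_int a :: rat) = of_int a / of_int 1" by simp
  ultimately show ?thesis unfolding Z_loc_def by blast
qed

lemma Z_loc_uminus: "x \<in> Z_loc p \<Longrightarrow> - x \<in> Z_loc p"
proof -
  assume "x \<in> Z_loc p"
  then obtain a b where "x = of_int a / of_int b" "\<not> int p dvd b" by (auto simp: Z_loc_def)
  then have "- x = of_int (- a) / of_int b" by simp
  then show ?thesis using \<open>\<not> int p dvd b\<close> unfolding Z_loc_def by blast
qed

lemma Z_loc_add:
  assumes p: "prime p" and "x \<in> Z_loc p" "y \<in> Z_loc p"
  shows "x + y \<in> Z_loc p"
proof -
  obtain a b c d where x: "x = of_int a / of_int b" "\<not> int p dvd b" and y: "y = of_int c / of_int d" "\<not> int p dvd d"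
    using assms by (auto simp: Z_loc_def)
  have "b \<noteq> 0" "d \<noteq> 0" using x y by auto
  then have "x + y = of_int (a * d + c * b) / of_int (b * d)" using x y by (simp add: field_simps)
  moreover have "\<not> int p dvd b * d" using x y p by (simp add: prime_dvd_mult_iff)
  ultimately show ?thesis unfolding Z_loc_def by blast
qed

lemma Z_loc_mult:
  assumes p: "prime p" and "x \<in> Z_loc p" "y \<in> Z_loc p"
  shows "x * y \<in> Z_loc p"
proof -
  obtain a b c d where x: "x = of_int a / of_int b" "\<not> int p dvd b" and y: "y = of_int c / of_int d" "\<not> int p dvd d"
    using assms by (auto simp: Z_loc_def)
  have "x * y = of_int (a * c) / of_int (b * d)" using x y by simp
  moreover have "\<not> int p dvd b * d" using x y p by (simp add: prime_dvd_mult_iff)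
  ultimately show ?thesis unfolding Z_loc_def by blast
qed

lemma Z_loc_0: "prime p \<Longrightarrow> 0 \<in> Z_loc p" using Z_loc_of_int[of p 0] prime_gt_1_nat by simp
lemma Z_loc_1: "prime p \<Longrightarrow> 1 \<in> Z_loc p" using Z_loc_of_int[of p 1] prime_gt_1_nat by simp

text \<open>The factor 1 / b is kept apart because it becomes the common coefficient
  \<open>u\<close> when a combination is reduced to a difference of two bisets.\<close>

lemma Z_loc_common_denominator:
  assumes p: "prime p" and "finite A" "\<And>a. a \<in> A \<Longrightarrow> f a \<in> Z_loc p"
  obtains b n where "\<not> int p dvd b" "\<And>a. a \<in> A \<Longrightarrow> f a = of_int (n a) * (1 / of_int b)"
proof -
  have "\<exists>b n. \<not> int p dvd b \<and> (\<forall>a\<in>A. f a = of_int (n a) * (1 / of_int b))"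
    using assms(2,3)
  proof (induction A rule: finite_induct)
    case empty
    have "\<not> int p dvd 1" using prime_gt_1_nat[OF p] by simp
    then show ?case by blast
  next
    case (insert x A)
    then obtain b n where bn: "\<not> int p dvd b" "\<forall>a\<in>A. f a = of_int (n a) * (1 / of_int b)" by auto
    obtain c d where x: "f x = of_int c / of_int d" "\<not> int p dvd d" using insert.prems[of x] by (auto simp: Z_loc_def)
    have nz: "b \<noteq> 0" "d \<noteq> 0" using x bn by auto
    have "\<not> int p dvd b * d" using x bn p by (simp add: prime_dvd_mult_iff)
    moreover have "\<forall>a\<in>insert x A. f a = of_int (if a = x then c * b else n a * d) * (1 / of_int (b * d))"
      using bn x nz by auto
    ultimately show ?case by (rule_tac exI[of _ "b * d"], rule_tac exI[of _ "\<lambda>a. if a = x then c * b else n a * d"]) blast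
  qed
  then show ?thesis using that by blast
qed

section \<open>The quotient by the union relations, detected by marks\<close>

locale burnside_module = G: group G + H: group H
  for G :: "('g, 'm) monoid_scheme" and H :: "('h, 'n) monoid_scheme" +
  fixes p :: nat
  assumes finite_G: "finite (carrier G)" and finite_H: "finite (carrier H)" and prime_p: "prime p"
begin

abbreviation "FC \<equiv> formal_combs p G H"
abbreviation "R \<equiv> union_relations p G H"

lemma mem_FC: "x \<in> carrier FC \<longleftrightarrow> Poly_Mapping.keys x \<subseteq> iso_classes G H \<and> (\<forall>a. Poly_Mapping.lookup x a \<in> Z_loc p)"
  by (simp add: formal_combs_def)

lemma FC_add: "x \<in> carrier FC \<Longrightarrow> y \<in> carrier FC \<Longrightarrow> x + y \<in> carrier FC"
  unfolding mem_FC using Poly_Mapping.keys_add[of x y] Z_loc_add[OF prime_p] by (auto simp: lookup_add)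

lemma FC_uminus: "x \<in> carrier FC \<Longrightarrow> - x \<in> carrier FC"
  unfolding mem_FC by (auto simp: Z_loc_uminus)

lemma FC_zero: "0 \<in> carrier FC"
  unfolding mem_FC using Z_loc_0[OF prime_p] by simp

lemma FC_single: "a \<in> iso_classes G H \<Longrightarrow> r \<in> Z_loc p \<Longrightarrow> Poly_Mapping.single a r \<in> carrier FC"
  unfolding mem_FC using Z_loc_0[OF prime_p] by (auto simp: lookup_single when_def)

lemma FC_sum: "(\<And>i. i \<in> I \<Longrightarrow> f i \<in> carrier FC) \<Longrightarrow> (\<Sum>i\<in>I. f i) \<in> carrier FC"
  by (induction I rule: infinite_finite_induct) (auto simp: FC_zero FC_add)

lemma group_FC: "group FC"
proof (rule groupI)
  fix x assume x: "x \<in> carrier FC"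
  show "\<exists>y\<in>carrier FC. y \<otimes>\<^bsub>FC\<^esub> x = \<one>\<^bsub>FC\<^esub>"
    using FC_uminus[OF x] by (intro bexI[of _ "- x"]) (auto simp: formal_combs_def)
qed (use FC_add FC_zero in \<open>auto simp: formal_combs_def add.assoc\<close>)

sublocale FC: group FC by (rule group_FC)

lemma FC_inv: "x \<in> carrier FC \<Longrightarrow> inv\<^bsub>FC\<^esub> x = - x"
  using FC_uminus[of x] by (intro FC.inv_equality) (auto simp: formal_combs_def)

lemma FC_mult [simp]: "x \<otimes>\<^bsub>FC\<^esub> y = x + y" and FC_one [simp]: "\<one>\<^bsub>FC\<^esub> = 0"
  by (simp_all add: formal_combs_def)

lemma relator_FC:
  assumes "left_free_biset G H X" "left_free_biset G H Y" "r \<in> Z_loc p"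
  shows "Poly_Mapping.single (iso_class G H (biset_union X Y)) r
        - Poly_Mapping.single (iso_class G H X) r - Poly_Mapping.single (iso_class G H Y) r \<in> carrier FC"
  using assms FC_add FC_uminus
  by (metis FC_single iso_class_mem_iso_classes left_free_biset_union diff_conv_add_uminus)

lemma subgroup_R: "subgroup R FC"
  unfolding union_relations_def by (rule FC.generate_is_subgroup) (use relator_FC in auto)

lemma R_add: "x \<in> R \<Longrightarrow> y \<in> R \<Longrightarrow> x + y \<in> R"
  using subgroup.m_closed[OF subgroup_R] by simp
lemma R_uminus: "x \<in> R \<Longrightarrow> - x \<in> R"
  using subgroup.m_inv_closed[OF subgroup_R, of x] FC_inv[of x] subgroup.mem_carrier[OF subgroup_R, of x] by simp
lemma R_zero: "0 \<in> R"
  using subgroup.one_closed[OF subgroup_R] by simp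
lemma R_FC: "x \<in> R \<Longrightarrow> x \<in> carrier FC"
  using subgroup.subset[OF subgroup_R] by auto
lemma R_diff: "x \<in> R \<Longrightarrow> y \<in> R \<Longrightarrow> x - y \<in> R"
  using R_add[of x "- y"] R_uminus by simp

lemma relator_R:
  fixes X Y :: "('g, 'h, nat) biset"
  assumes "left_free_biset G H X" "left_free_biset G H Y" "r \<in> Z_loc p"
  shows "Poly_Mapping.single (iso_class G H (biset_union X Y)) r
        - Poly_Mapping.single (iso_class G H X) r - Poly_Mapping.single (iso_class G H Y) r \<in> R"
  unfolding union_relations_def by (rule generate.incl) (use assms in blast)

lemma fmark_R:
  assumes "x \<in> R" "\<chi> \<in> Q \<rightarrow> carrier G" "\<phi> \<in> Q \<rightarrow> carrier H"
  shows "fmark x Q \<chi> \<phi> = 0"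
proof -
  \<comment> \<open>Membership in the carrier is carried along because inverses in \<open>FC\<close>
    are identified with negatives only there.\<close>
  have gen: "fmark x Q \<chi> \<phi> = 0 \<and> x \<in> carrier FC" if gen: "x \<in> {Poly_Mapping.single (iso_class G H (biset_union X Y)) r
        - Poly_Mapping.single (iso_class G H X) r - Poly_Mapping.single (iso_class G H Y) r
      | (X :: ('g, 'h, nat) biset) (Y :: ('g, 'h, nat) biset) r.
        left_free_biset G H X \<and> left_free_biset G H Y \<and> r \<in> Z_loc p}" for x
  proof -
    obtain X Y :: "('g, 'h, nat) biset" and r where x: "left_free_biset G H X" "left_free_biset G H Y" "r \<in> Z_loc p"
      "x = Poly_Mapping.single (iso_class G H (biset_union X Y)) r
        - Poly_Mapping.single (iso_class G H X) r - Poly_Mapping.single (iso_class G H Y) r" using gen by blast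
    have "x \<in> carrier FC" unfolding x(4) by (rule relator_FC[OF x(1-3)])
    moreover have "fmark x Q \<chi> \<phi> = 0"
      unfolding x(4) using mark_biset_union[OF left_free_biset.finite_points left_free_biset.finite_points, OF x(1,2), of Q \<chi> \<phi>]
      by (simp add: fmark_diff fmark_single distrib_left class_mark_iso_class[OF _ assms(2,3)] left_free_biset_union x(1,2))
    ultimately show ?thesis by blast
  qed
  show ?thesis using assms(1) unfolding union_relations_def
  proof (induction rule: generate.induct)
    case (inv h) then show ?case using gen FC_inv by (simp add: fmark_uminus)
  qed (use gen in \<open>auto simp: fmark_add\<close>)
qed

text \<open>Modulo the relations a formal combination with coefficients in \<open>u \<int>\<close> is \<open>u\<close> times a
  difference of two bisets.\<close>

lemma integral_comb_mod_R:
  assumes u: "u \<in> Z_loc p" and I: "finite I" "\<And>a. a \<in> I \<Longrightarrow> a \<in> iso_classes G H"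
  obtains X Y :: "('g, 'h, nat) biset" where "left_free_biset G H X" "left_free_biset G H Y"
    "(\<Sum>a\<in>I. Poly_Mapping.single a (of_int (n a) * u)) -
       (Poly_Mapping.single (iso_class G H X) u - Poly_Mapping.single (iso_class G H Y) u) \<in> R"
proof -
  let ?s = "\<lambda>X. Poly_Mapping.single (iso_class G H X) u"
  \<comment> \<open>\<open>D\<close> collects the combinations that are congruent to u times a
    difference of two bisets. It contains u times each class and is closed under sums and negatives,
    so it contains the given combination.\<close>
  define D where "D = {z. \<exists>(X :: ('g, 'h, nat) biset) (Y :: ('g, 'h, nat) biset). left_free_biset G H X \<and> left_free_biset G H Y \<and> z - (?s X - ?s Y) \<in> R}"
  have E: "left_free_biset G H empty_biset" by (rule left_free_empty_biset) unfold_locales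
  have un: "\<exists>W :: ('g, 'h, nat) biset. left_free_biset G H W \<and> ?s W - ?s X - ?s Y \<in> R"
    if XY: "left_free_biset G H X" "left_free_biset G H Y" for X Y :: "('g, 'h, nat) biset"
  proof -
    obtain W :: "('g, 'h, nat) biset" where W: "left_free_biset G H W" "biset_iso G H (biset_union X Y) W"
      using left_free_biset_nat_copy[OF left_free_biset_union[OF XY]] by blast
    then have "iso_class G H (biset_union X Y) = iso_class G H W"
      using iso_class_cong[OF left_free_biset_union[OF XY]] by blast
    then show ?thesis using relator_R[OF XY u] W by auto
  qed
  have D0: "0 \<in> D"
  proof -
    have "0 - (?s empty_biset - ?s empty_biset) \<in> R" using R_zero by simp
    then show ?thesis unfolding D_def using E by blast
  qed
  have Dadd: "z + z' \<in> D" if "z \<in> D" "z' \<in> D" for z z'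
  proof -
    obtain X Y X' Y' :: "('g, 'h, nat) biset" where z: "left_free_biset G H X" "left_free_biset G H Y" "z - (?s X - ?s Y) \<in> R"
      and z': "left_free_biset G H X'" "left_free_biset G H Y'" "z' - (?s X' - ?s Y') \<in> R"
      using \<open>z \<in> D\<close> \<open>z' \<in> D\<close> unfolding D_def by blast
    obtain W :: "('g, 'h, nat) biset" where W: "left_free_biset G H W" "?s W - ?s X - ?s X' \<in> R"
      using un[OF z(1) z'(1)] by blast
    obtain W' :: "('g, 'h, nat) biset" where W': "left_free_biset G H W'" "?s W' - ?s Y - ?s Y' \<in> R"
      using un[OF z(2) z'(2)] by blast
    have "(z + z') - (?s W - ?s W') = (z - (?s X - ?s Y)) + (z' - (?s X' - ?s Y')) - (?s W - ?s X - ?s X') + (?s W' - ?s Y - ?s Y')"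
      by (simp add: algebra_simps)
    then have "(z + z') - (?s W - ?s W') \<in> R" using R_add[OF R_diff[OF R_add[OF z(3) z'(3)] W(2)] W'(2)] by (simp only:)
    then show ?thesis unfolding D_def using W(1) W'(1) by blast
  qed
  have Dneg: "- z \<in> D" if zD: "z \<in> D" for z
  proof -
    obtain X Y :: "('g, 'h, nat) biset" where z: "left_free_biset G H X" "left_free_biset G H Y" "z - (?s X - ?s Y) \<in> R"
      using zD unfolding D_def by blast
    have "- z - (?s Y - ?s X) = - (z - (?s X - ?s Y))" by simp
    then have "- z - (?s Y - ?s X) \<in> R" using R_uminus z by metis
    then show ?thesis unfolding D_def using z by blast
  qed
  \<comment> \<open>The union of two empty bisets is empty, so the relator formed from them is -u
    times the class of the empty biset.\<close>
  have Empty: "?s empty_biset \<in> R"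
  proof -
    obtain W :: "('g, 'h, nat) biset" where W: "left_free_biset G H W" "biset_iso G H (biset_union empty_biset empty_biset) W"
      using left_free_biset_nat_copy[OF left_free_biset_union[OF E E]] by blast
    have "biset_iso G H (biset_union empty_biset empty_biset :: ('g, 'h, nat + nat) biset) (empty_biset :: ('g, 'h, nat) biset)"
      unfolding biset_iso_def by (auto simp: biset_union_def empty_biset_def bij_betw_def Plus_def)
    then have "iso_class G H (biset_union empty_biset empty_biset :: ('g, 'h, nat + nat) biset) = iso_class G H (empty_biset :: ('g, 'h, nat) biset)"
      by (rule iso_class_cong[OF left_free_biset_union[OF E E]])
    then show ?thesis using R_uminus[OF relator_R[OF E E u]] by simp
  qed
  have D1: "Poly_Mapping.single a u \<in> D" if "a \<in> iso_classes G H" for a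
  proof -
    obtain X :: "('g, 'h, nat) biset" where X: "left_free_biset G H X" "a = iso_class G H X"
      using \<open>a \<in> iso_classes G H\<close> unfolding iso_classes_def by blast
    have "Poly_Mapping.single a u - (?s X - ?s empty_biset) \<in> R" using X Empty by simp
    then show ?thesis unfolding D_def using X E by blast
  qed
  have Dnat: "Poly_Mapping.single a (of_nat k * u) \<in> D" if "a \<in> iso_classes G H" for a k
  proof (induction k)
    case (Suc k)
    have "Poly_Mapping.single a (of_nat (Suc k) * u) = Poly_Mapping.single a u + Poly_Mapping.single a (of_nat k * u)"
      by (simp add: single_add[symmetric] algebra_simps)
    then show ?case using Dadd D1 Suc that by metis
  qed (simp add: D0)
  have Dint: "Poly_Mapping.single a (of_int k * u) \<in> D" if "a \<in> iso_classes G H" for a k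
  proof (cases k)
    case (nonneg m) then show ?thesis using Dnat[OF that, of m] by simp
  next
    case (neg m)
    then have "Poly_Mapping.single a (of_int k * u) = - Poly_Mapping.single a (of_nat (Suc m) * u)"
      by (simp only: single_uminus[symmetric] of_int_minus of_int_of_nat_eq mult_minus_left)
    then show ?thesis using Dneg Dnat[OF that, of "Suc m"] by metis
  qed
  have "(\<Sum>a\<in>I. Poly_Mapping.single a (of_int (n a) * u)) \<in> D"
    using I by (induction I rule: finite_induct) (auto intro: D0 Dadd Dint)
  then show ?thesis unfolding D_def using that by blast
qed

text \<open>Injectivity of the mark homomorphism, which rests on \<open>biset_iso_of_marks\<close>.
  Modulo the relations z is u ([X] - [Y]) with u nonzero; vanishing marks of z make the marks of X
  and Y agree, so X and Y are isomorphic.\<close>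

lemma mem_R_of_fmark:
  assumes z: "z \<in> carrier FC"
    and 0: "\<And>Q \<psi>. subgroup Q G \<Longrightarrow> \<psi> \<in> Q \<rightarrow>\<^sub>E carrier H \<Longrightarrow> fmark z Q (\<lambda>q. q) \<psi> = 0"
  shows "z \<in> R"
proof -
  obtain b n where bn: "\<not> int p dvd b" "\<And>a. a \<in> Poly_Mapping.keys z \<Longrightarrow> Poly_Mapping.lookup z a = of_int (n a) * (1 / of_int b)"
    using Z_loc_common_denominator[OF prime_p, of "Poly_Mapping.keys z" "Poly_Mapping.lookup z"] z mem_FC by auto
  define u :: rat where "u = 1 / of_int b"
  have "u = of_int 1 / of_int b" by (simp add: u_def)
  then have u: "u \<in> Z_loc p" using bn(1) unfolding Z_loc_def by blast
  have u0: "u \<noteq> 0" using bn(1) by (auto simp: u_def)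
  have "z = (\<Sum>a\<in>Poly_Mapping.keys z. Poly_Mapping.single a (of_int (n a) * u))"
    by (subst sum_single_lookup[of z, symmetric]) (rule sum.cong, use bn(2) in \<open>auto simp: u_def\<close>)
  moreover obtain X Y :: "('g, 'h, nat) biset" where XY: "left_free_biset G H X" "left_free_biset G H Y"
    "(\<Sum>a\<in>Poly_Mapping.keys z. Poly_Mapping.single a (of_int (n a) * u)) -
       (Poly_Mapping.single (iso_class G H X) u - Poly_Mapping.single (iso_class G H Y) u) \<in> R"
    by (rule integral_comb_mod_R[OF u finite_keys, of z n]) (use z mem_FC in blast)+
  ultimately have zR: "z - (Poly_Mapping.single (iso_class G H X) u - Poly_Mapping.single (iso_class G H Y) u) \<in> R" by simp
  have "biset_iso G H X Y"
  proof (rule biset_iso_of_marks[OF XY(1,2) finite_G finite_H])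
    fix Q \<psi> assume Q: "subgroup Q G" and \<psi>: "\<psi> \<in> Q \<rightarrow>\<^sub>E carrier H"
    have c: "(\<lambda>q. q) \<in> Q \<rightarrow> carrier G" "\<psi> \<in> Q \<rightarrow> carrier H" using subgroup.subset[OF Q] \<psi> by auto
    have "u = 0 \<or> mark Y Q (\<lambda>q. q) \<psi> = mark X Q (\<lambda>q. q) \<psi>"
      using fmark_R[OF zR c] 0[OF Q \<psi>] class_mark_iso_class[OF XY(1) c] class_mark_iso_class[OF XY(2) c]
      by (simp add: fmark_diff fmark_single right_diff_distrib)
    then show "mark X Q (\<lambda>q. q) \<psi> = mark Y Q (\<lambda>q. q) \<psi>" using u0 by simp
  qed
  then have "iso_class G H X = iso_class G H Y" by (rule iso_class_cong[OF XY(1)])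
  then show ?thesis using zR by simp
qed

lemma burnside_class_mem_iff:
  "x' \<in> burnside_class p G H x \<longleftrightarrow> x' - x \<in> R"
proof
  assume "x' \<in> burnside_class p G H x"
  then show "x' - x \<in> R" by (auto simp: burnside_class_def r_coset_def)
next
  assume "x' - x \<in> R"
  then have "\<exists>h\<in>R. x' = h + x" by (intro bexI[of _ "x' - x"]) simp_all
  then show "x' \<in> burnside_class p G H x" by (simp add: burnside_class_def r_coset_def)
qed

lemma burnside_class_eqI:
  assumes "x - y \<in> R"
  shows "burnside_class p G H x = burnside_class p G H y"
proof (rule Set.set_eqI)
  fix z
  show "z \<in> burnside_class p G H x \<longleftrightarrow> z \<in> burnside_class p G H y"
    unfolding burnside_class_mem_iff using R_diff[of "z - y" "x - y"] R_add[of "z - x" "x - y"] assms by auto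
qed

lemma burnside_carrier: "carrier (burnside p G H) = burnside_class p G H ` carrier FC"
  by (auto simp: burnside_def burnside_class_def FactGroup_def RCOSETS_def)

end

text \<open>All representatives of a coset have the same marks because marks vanish on the
  relations.\<close>

definition elem_mark :: "('g, 'h) burnside_elem \<Rightarrow> 'q set \<Rightarrow> ('q \<Rightarrow> 'g) \<Rightarrow> ('q \<Rightarrow> 'h) \<Rightarrow> rat" where
  "elem_mark A Q \<chi> \<phi> = fmark (SOME x. x \<in> A) Q \<chi> \<phi>"

context burnside_module
begin

lemma fmark_cong_class:
  assumes "x' \<in> burnside_class p G H x" "\<chi> \<in> Q \<rightarrow> carrier G" "\<phi> \<in> Q \<rightarrow> carrier H"
  shows "fmark x' Q \<chi> \<phi> = fmark x Q \<chi> \<phi>"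
  using fmark_R[of "x' - x" \<chi> Q \<phi>] assms by (simp add: burnside_class_mem_iff fmark_diff)

lemma elem_mark_burnside_class:
  assumes "\<chi> \<in> Q \<rightarrow> carrier G" "\<phi> \<in> Q \<rightarrow> carrier H"
  shows "elem_mark (burnside_class p G H x) Q \<chi> \<phi> = fmark x Q \<chi> \<phi>"
proof -
  have "x \<in> burnside_class p G H x" by (simp add: burnside_class_mem_iff R_zero)
  then have "(SOME x'. x' \<in> burnside_class p G H x) \<in> burnside_class p G H x" by (rule someI)
  then show ?thesis unfolding elem_mark_def using fmark_cong_class assms by blast
qed

text \<open>Both identities of the final theorem are proved by this criterion. Pairs whose first map
  is the inclusion of a subgroup of G suffice, because the stabilizer of a point in a left free
  biset is a graph over such a subgroup.\<close>

theorem burnside_elem_eqI: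
  assumes A: "A \<in> carrier (burnside p G H)" and B: "B \<in> carrier (burnside p G H)"
    and eq: "\<And>Q \<psi>. subgroup Q G \<Longrightarrow> \<psi> \<in> Q \<rightarrow>\<^sub>E carrier H \<Longrightarrow> elem_mark A Q (\<lambda>q. q) \<psi> = elem_mark B Q (\<lambda>q. q) \<psi>"
  shows "A = B"
proof -
  obtain x y where xy: "x \<in> carrier FC" "A = burnside_class p G H x" "y \<in> carrier FC" "B = burnside_class p G H y"
    using A B burnside_carrier by auto
  have "x - y \<in> carrier FC" using FC_add[of x "- y"] FC_uminus xy by simp
  moreover have "fmark (x - y) Q (\<lambda>q. q) \<psi> = 0" if "subgroup Q G" "\<psi> \<in> Q \<rightarrow>\<^sub>E carrier H" for Q \<psi>
  proof -
    have "(\<lambda>q. q) \<in> Q \<rightarrow> carrier G" "\<psi> \<in> Q \<rightarrow> carrier H" using subgroup.subset[OF that(1)] that(2) by auto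
    then show ?thesis using eq[OF that] xy(2,4) elem_mark_burnside_class[of "\<lambda>q. q" Q \<psi>] by (simp add: fmark_diff)
  qed
  ultimately have "x - y \<in> R" by (rule mem_R_of_fmark)
  then show ?thesis using burnside_class_eqI xy by simp
qed

end

section \<open>Composition in Burnside modules\<close>

locale burnside_composition = GH: burnside_module G H p + HK: burnside_module H K p
  for G :: "('g, 'm) monoid_scheme" and H :: "('h, 'n) monoid_scheme" and K :: "('k, 'l) monoid_scheme" and p
begin

sublocale GK: burnside_module G K p
  by unfold_locales (rule GH.finite_G HK.finite_H GH.prime_p)+

lemma composable:
  assumes "left_free_biset H K X" "left_free_biset G H Y"
  shows "composable_bisets G H K X Y"
  using assms GH.finite_H by (simp add: composable_bisets_def composable_bisets_axioms_def)

text \<open>The marks of a composite depend only on the marks of its factors, so the isomorphism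
  follows from \<open>biset_iso_of_marks\<close> without a map between the sets of classes.\<close>

lemma biset_product_cong:
  assumes X: "left_free_biset H K X" "left_free_biset H K X'" "biset_iso H K X X'"
    and Y: "left_free_biset G H Y" "left_free_biset G H Y'" "biset_iso G H Y Y'"
  shows "biset_iso G K (biset_product H X Y) (biset_product H X' Y')"
proof -
  interpret A: composable_bisets G H K X Y using composable X Y by blast
  interpret B: composable_bisets G H K X' Y' using composable X Y by blast
  show ?thesis
  proof (rule biset_iso_of_marks[OF A.left_free_biset_product B.left_free_biset_product GH.finite_G HK.finite_H])
    fix Q \<psi> assume Q: "subgroup Q G" and \<psi>: "\<psi> \<in> Q \<rightarrow>\<^sub>E carrier K"
    have c: "finite Q" "(\<lambda>q. q) \<in> Q \<rightarrow> carrier G" "\<psi> \<in> Q \<rightarrow> carrier K"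
      using subgroup.subset[OF Q] \<psi> GH.finite_G finite_subset by auto
    have "(\<Sum>\<theta>\<in>Q \<rightarrow>\<^sub>E carrier H. mark X Q \<theta> \<psi> * mark Y Q (\<lambda>q. q) \<theta>) = (\<Sum>\<theta>\<in>Q \<rightarrow>\<^sub>E carrier H. mark X' Q \<theta> \<psi> * mark Y' Q (\<lambda>q. q) \<theta>)"
    proof (rule sum.cong[OF refl])
      fix \<theta> assume "\<theta> \<in> Q \<rightarrow>\<^sub>E carrier H"
      then have "\<theta> \<in> Q \<rightarrow> carrier H" by auto
      then show "mark X Q \<theta> \<psi> * mark Y Q (\<lambda>q. q) \<theta> = mark X' Q \<theta> \<psi> * mark Y' Q (\<lambda>q. q) \<theta>"
        using mark_iso[OF X(1,3) _ c(3)] mark_iso[OF Y(1,3) c(2)] by simp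
    qed
    then have "card (carrier H) * mark (biset_product H X Y) Q (\<lambda>q. q) \<psi> = card (carrier H) * mark (biset_product H X' Y') Q (\<lambda>q. q) \<psi>"
      using A.mark_biset_product[OF c] B.mark_biset_product[OF c] by simp
    moreover have "card (carrier H) > 0" using GH.finite_H GH.H.one_closed by (auto simp: card_gt_0_iff)
    ultimately show "mark (biset_product H X Y) Q (\<lambda>q. q) \<psi> = mark (biset_product H X' Y') Q (\<lambda>q. q) \<psi>" by simp
  qed
qed

lemma class_comp_iso_class:
  fixes X Y :: "(_, _, nat) biset"
  assumes X: "left_free_biset H K X" and Y: "left_free_biset G H Y"
  shows "class_comp G H K (iso_class H K X) (iso_class G H Y) = iso_class G K (biset_product H X Y)"
proof -
  have "iso_class G K (biset_product H X' Y') = iso_class G K (biset_product H X Y)"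
    if "X' \<in> iso_class H K X" "Y' \<in> iso_class G H Y" for X' Y'
  proof -
    have "left_free_biset G K (biset_product H X Y)"
      using composable[OF X Y] by (rule composable_bisets.left_free_biset_product)
    then show ?thesis
      using that iso_class_cong biset_product_cong[OF X _ _ Y] by (metis (no_types, lifting) iso_class_def mem_Collect_eq)
  qed
  moreover have "X \<in> iso_class H K X" "Y \<in> iso_class G H Y" using X Y by (auto simp: iso_class_def biset_iso_refl)
  ultimately show ?thesis unfolding class_comp_def by blast
qed

lemma class_comp_closed:
  assumes "a \<in> iso_classes H K" "b \<in> iso_classes G H"
  shows "class_comp G H K a b \<in> iso_classes G K"
proof -
  obtain X Y :: "(_, _, nat) biset" where "left_free_biset H K X" "a = iso_class H K X" "left_free_biset G H Y" "b = iso_class G H Y"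
    using assms unfolding iso_classes_def by auto
  then show ?thesis
    using class_comp_iso_class iso_class_mem_iso_classes composable composable_bisets.left_free_biset_product by metis
qed

lemma class_mark_class_comp:
  assumes "a \<in> iso_classes H K" "b \<in> iso_classes G H"
    and Q: "finite Q" "\<chi> \<in> Q \<rightarrow> carrier G" "\<phi> \<in> Q \<rightarrow> carrier K"
  shows "card (carrier H) * class_mark (class_comp G H K a b) Q \<chi> \<phi> =
    (\<Sum>\<theta>\<in>Q \<rightarrow>\<^sub>E carrier H. class_mark a Q \<theta> \<phi> * class_mark b Q \<chi> \<theta>)"
proof -
  obtain X Y :: "(_, _, nat) biset" where XY: "left_free_biset H K X" "a = iso_class H K X" "left_free_biset G H Y" "b = iso_class G H Y"
    using assms unfolding iso_classes_def by blast
  interpret A: composable_bisets G H K X Y using composable XY by blast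
  have "class_mark a Q \<theta> \<phi> * class_mark b Q \<chi> \<theta> = mark X Q \<theta> \<phi> * mark Y Q \<chi> \<theta>" if "\<theta> \<in> Q \<rightarrow>\<^sub>E carrier H" for \<theta>
  proof -
    have "\<theta> \<in> Q \<rightarrow> carrier H" using that by auto
    then show ?thesis using XY Q by (simp add: class_mark_iso_class)
  qed
  then show ?thesis
    using A.mark_biset_product[OF Q] XY Q class_mark_iso_class[OF A.left_free_biset_product Q(2,3)]
    by (simp add: class_comp_iso_class)
qed

lemma formal_comp_closed:
  assumes "x \<in> carrier HK.FC" "y \<in> carrier GH.FC"
  shows "formal_comp G H K x y \<in> carrier GK.FC"
  unfolding formal_comp_def
  using assms by (intro GK.FC_sum GK.FC_single class_comp_closed Z_loc_mult[OF GH.prime_p])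
    (auto simp: HK.mem_FC GH.mem_FC)

lemma fmark_formal_comp:
  assumes x: "x \<in> carrier HK.FC" and y: "y \<in> carrier GH.FC"
    and Q: "finite Q" "\<chi> \<in> Q \<rightarrow> carrier G" "\<phi> \<in> Q \<rightarrow> carrier K"
  shows "of_nat (card (carrier H)) * fmark (formal_comp G H K x y) Q \<chi> \<phi> =
    (\<Sum>\<theta>\<in>Q \<rightarrow>\<^sub>E carrier H. fmark x Q \<theta> \<phi> * fmark y Q \<chi> \<theta>)"
proof -
  let ?kx = "Poly_Mapping.keys x" and ?ky = "Poly_Mapping.keys y"
  let ?lx = "Poly_Mapping.lookup x" and ?ly = "Poly_Mapping.lookup y"
  have cm: "(of_nat (card (carrier H)) :: rat) * of_nat (class_mark (class_comp G H K a b) Q \<chi> \<phi>) =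
    (\<Sum>\<theta>\<in>Q \<rightarrow>\<^sub>E carrier H. of_nat (class_mark a Q \<theta> \<phi>) * of_nat (class_mark b Q \<chi> \<theta>))"
    if "a \<in> ?kx" "b \<in> ?ky" for a b
    using class_mark_class_comp[of a b Q \<chi> \<phi>] that x y Q
    by (auto simp: HK.mem_FC GH.mem_FC subset_iff of_nat_mult[symmetric] of_nat_sum[symmetric] simp del: of_nat_mult of_nat_sum)
  have "of_nat (card (carrier H)) * fmark (formal_comp G H K x y) Q \<chi> \<phi> =
    (\<Sum>a\<in>?kx. \<Sum>b\<in>?ky. ?lx a * ?ly b * (of_nat (card (carrier H)) * of_nat (class_mark (class_comp G H K a b) Q \<chi> \<phi>)))"
    unfolding formal_comp_def by (simp add: fmark_sum fmark_single sum_distrib_left mult.assoc mult.left_commute)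
  also have "\<dots> = (\<Sum>a\<in>?kx. \<Sum>b\<in>?ky. \<Sum>\<theta>\<in>Q \<rightarrow>\<^sub>E carrier H. ?lx a * ?ly b * (of_nat (class_mark a Q \<theta> \<phi>) * of_nat (class_mark b Q \<chi> \<theta>)))"
    by (intro sum.cong refl) (simp add: cm sum_distrib_left)
  also have "\<dots> = (\<Sum>a\<in>?kx. \<Sum>\<theta>\<in>Q \<rightarrow>\<^sub>E carrier H. \<Sum>b\<in>?ky. ?lx a * ?ly b * (of_nat (class_mark a Q \<theta> \<phi>) * of_nat (class_mark b Q \<chi> \<theta>)))"
    by (intro sum.cong refl sum.swap)
  also have "\<dots> = (\<Sum>\<theta>\<in>Q \<rightarrow>\<^sub>E carrier H. \<Sum>a\<in>?kx. \<Sum>b\<in>?ky. ?lx a * ?ly b * (of_nat (class_mark a Q \<theta> \<phi>) * of_nat (class_mark b Q \<chi> \<theta>)))"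
    by (rule sum.swap)
  also have "\<dots> = (\<Sum>\<theta>\<in>Q \<rightarrow>\<^sub>E carrier H. fmark x Q \<theta> \<phi> * fmark y Q \<chi> \<theta>)"
    unfolding fmark_def by (intro sum.cong refl) (simp add: sum_product mult.assoc mult.left_commute)
  finally show ?thesis .
qed

text \<open>Composition is well defined on cosets, again by marks: replacing x and y by congruent
  combinations changes none of their marks, hence none of the marks of the composite.\<close>

lemma burnside_comp_class:
  assumes x: "x \<in> carrier HK.FC" and y: "y \<in> carrier GH.FC"
  shows "burnside_comp p G H K (burnside_class p H K x) (burnside_class p G H y) = burnside_class p G K (formal_comp G H K x y)"
proof -
  have eq: "burnside_class p G K (formal_comp G H K x' y') = burnside_class p G K (formal_comp G H K x y)"
    if x': "x' \<in> burnside_class p H K x" and y': "y' \<in> burnside_class p G H y" for x' y'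
  proof (rule GK.burnside_class_eqI, rule GK.mem_R_of_fmark)
    have "x' - x \<in> carrier HK.FC" "y' - y \<in> carrier GH.FC"
      using x' y' HK.burnside_class_mem_iff GH.burnside_class_mem_iff HK.R_FC GH.R_FC by auto
    then have c': "x' \<in> carrier HK.FC" "y' \<in> carrier GH.FC"
      using HK.FC_add[of "x' - x" x] GH.FC_add[of "y' - y" y] x y by auto
    show "formal_comp G H K x' y' - formal_comp G H K x y \<in> carrier GK.FC"
      using GK.FC_add[OF formal_comp_closed[OF c'] GK.FC_uminus[OF formal_comp_closed[OF x y]]] by simp
    fix Q \<psi> assume Q: "subgroup Q G" and \<psi>: "\<psi> \<in> Q \<rightarrow>\<^sub>E carrier K"
    have c: "finite Q" "(\<lambda>q. q) \<in> Q \<rightarrow> carrier G" "\<psi> \<in> Q \<rightarrow> carrier K"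
      using subgroup.subset[OF Q] \<psi> GH.finite_G finite_subset by auto
    have "(\<Sum>\<theta>\<in>Q \<rightarrow>\<^sub>E carrier H. fmark x' Q \<theta> \<psi> * fmark y' Q (\<lambda>q. q) \<theta>) = (\<Sum>\<theta>\<in>Q \<rightarrow>\<^sub>E carrier H. fmark x Q \<theta> \<psi> * fmark y Q (\<lambda>q. q) \<theta>)"
    proof (rule sum.cong[OF refl])
      fix \<theta> assume "\<theta> \<in> Q \<rightarrow>\<^sub>E carrier H"
      then have "\<theta> \<in> Q \<rightarrow> carrier H" by auto
      then show "fmark x' Q \<theta> \<psi> * fmark y' Q (\<lambda>q. q) \<theta> = fmark x Q \<theta> \<psi> * fmark y Q (\<lambda>q. q) \<theta>"
        using HK.fmark_cong_class[OF x' _ c(3)] GH.fmark_cong_class[OF y' c(2)] by simp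
    qed
    then have "of_nat (card (carrier H)) * fmark (formal_comp G H K x' y') Q (\<lambda>q. q) \<psi> = of_nat (card (carrier H)) * fmark (formal_comp G H K x y) Q (\<lambda>q. q) \<psi>"
      using fmark_formal_comp[OF c' c] fmark_formal_comp[OF x y c] by simp
    moreover have "card (carrier H) > 0" using GH.finite_H GH.H.one_closed by (auto simp: card_gt_0_iff)
    ultimately show "fmark (formal_comp G H K x' y' - formal_comp G H K x y) Q (\<lambda>q. q) \<psi> = 0" by (simp add: fmark_diff)
  qed
  have "x \<in> burnside_class p H K x" "y \<in> burnside_class p G H y"
    by (simp_all add: HK.burnside_class_mem_iff GH.burnside_class_mem_iff HK.R_zero GH.R_zero)
  then show ?thesis unfolding burnside_comp_def using eq by blast
qed

lemma burnside_comp_closed: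
  assumes "A \<in> carrier (burnside p H K)" "B \<in> carrier (burnside p G H)"
  shows "burnside_comp p G H K A B \<in> carrier (burnside p G K)"
  using assms burnside_comp_class formal_comp_closed
  unfolding HK.burnside_carrier GH.burnside_carrier GK.burnside_carrier by auto

lemma elem_mark_comp:
  assumes "A \<in> carrier (burnside p H K)" "B \<in> carrier (burnside p G H)"
    and Q: "finite Q" "\<chi> \<in> Q \<rightarrow> carrier G" "\<phi> \<in> Q \<rightarrow> carrier K"
  shows "of_nat (card (carrier H)) * elem_mark (burnside_comp p G H K A B) Q \<chi> \<phi> =
    (\<Sum>\<theta>\<in>Q \<rightarrow>\<^sub>E carrier H. elem_mark A Q \<theta> \<phi> * elem_mark B Q \<chi> \<theta>)"
proof -
  obtain x y where xy: "x \<in> carrier HK.FC" "A = burnside_class p H K x" "y \<in> carrier GH.FC" "B = burnside_class p G H y"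
    using assms HK.burnside_carrier GH.burnside_carrier by auto
  have "elem_mark A Q \<theta> \<phi> * elem_mark B Q \<chi> \<theta> = fmark x Q \<theta> \<phi> * fmark y Q \<chi> \<theta>" if "\<theta> \<in> Q \<rightarrow>\<^sub>E carrier H" for \<theta>
  proof -
    have "\<theta> \<in> Q \<rightarrow> carrier H" using that by auto
    then show ?thesis using xy Q by (simp add: HK.elem_mark_burnside_class GH.elem_mark_burnside_class)
  qed
  then show ?thesis
    using fmark_formal_comp[OF xy(1,3) Q] xy Q
    by (simp add: burnside_comp_class GK.elem_mark_burnside_class)
qed

end

text \<open>This turns a mark at (\<theta>, \<psi>) with \<theta> injective into a mark on
  \<theta>(Q) with the inclusion as first map, where the formula for characteristic idempotents
  applies.\<close>

lemma elem_mark_reindex: "elem_mark A (f ` Q) \<chi> \<phi> = elem_mark A Q (\<chi> \<circ> f) (\<phi> \<circ> f)"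
  unfolding elem_mark_def fmark_def class_mark_def by (simp add: mark_reindex)

lemma elem_mark_cong:
  fixes A :: "('g, 'h) burnside_elem"
  assumes "\<And>q. q \<in> Q \<Longrightarrow> \<chi> q = \<chi>' q" "\<And>q. q \<in> Q \<Longrightarrow> \<phi> q = \<phi>' q"
  shows "elem_mark A Q \<chi> \<phi> = elem_mark A Q \<chi>' \<phi>'"
proof -
  have "mark X Q \<chi> \<phi> = mark X Q \<chi>' \<phi>'" for X :: "('g, 'h, nat) biset"
    by (rule mark_cong) (use assms in auto)
  then show ?thesis unfolding elem_mark_def fmark_def class_mark_def by simp
qed

text \<open>Double counting: each h contributes to exactly one \<eta>, the restriction of
  \<open>c h\<close> to Q.\<close>

lemma sum_PiE_card_eq:
  fixes f :: "_ \<Rightarrow> rat"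
  assumes "finite Q" "finite B" "finite A" and c: "\<And>h q. h \<in> A \<Longrightarrow> q \<in> Q \<Longrightarrow> c h q \<in> B"
  shows "(\<Sum>\<eta>\<in>Q \<rightarrow>\<^sub>E B. f \<eta> * of_nat (card {h \<in> A. \<forall>q\<in>Q. \<eta> q = c h q})) = (\<Sum>h\<in>A. f (restrict (c h) Q))"
proof -
  have fin: "finite (Q \<rightarrow>\<^sub>E B)" using assms by (simp add: finite_PiE)
  have "(\<Sum>\<eta>\<in>Q \<rightarrow>\<^sub>E B. f \<eta> * of_nat (card {h \<in> A. \<forall>q\<in>Q. \<eta> q = c h q})) =
    (\<Sum>\<eta>\<in>Q \<rightarrow>\<^sub>E B. \<Sum>h\<in>A. if \<forall>q\<in>Q. \<eta> q = c h q then f \<eta> else 0)"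
  proof (rule sum.cong[OF refl])
    fix \<eta>
    have "(\<Sum>h\<in>A. if \<forall>q\<in>Q. \<eta> q = c h q then f \<eta> else 0) = (\<Sum>h\<in>{h \<in> A. \<forall>q\<in>Q. \<eta> q = c h q}. f \<eta>)"
      using assms(3) by (simp add: sum.If_cases Int_def)
    then show "f \<eta> * of_nat (card {h \<in> A. \<forall>q\<in>Q. \<eta> q = c h q}) = (\<Sum>h\<in>A. if \<forall>q\<in>Q. \<eta> q = c h q then f \<eta> else 0)"
      by simp
  qed
  also have "\<dots> = (\<Sum>h\<in>A. \<Sum>\<eta>\<in>Q \<rightarrow>\<^sub>E B. if \<forall>q\<in>Q. \<eta> q = c h q then f \<eta> else 0)" by (rule sum.swap)
  also have "\<dots> = (\<Sum>h\<in>A. f (restrict (c h) Q))"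
  proof (rule sum.cong[OF refl])
    fix h assume h: "h \<in> A"
    have r: "restrict (c h) Q \<in> Q \<rightarrow>\<^sub>E B" using c h by auto
    have "(\<forall>q\<in>Q. \<eta> q = c h q) \<longleftrightarrow> \<eta> = restrict (c h) Q" if "\<eta> \<in> Q \<rightarrow>\<^sub>E B" for \<eta>
      using that r by (auto intro!: PiE_ext[OF that r])
    then have "(\<Sum>\<eta>\<in>Q \<rightarrow>\<^sub>E B. if \<forall>q\<in>Q. \<eta> q = c h q then f \<eta> else 0) =
      (\<Sum>\<eta>\<in>Q \<rightarrow>\<^sub>E B. if \<eta> = restrict (c h) Q then f \<eta> else 0)"
      by (intro sum.cong) auto
    then show "(\<Sum>\<eta>\<in>Q \<rightarrow>\<^sub>E B. if \<forall>q\<in>Q. \<eta> q = c h q then f \<eta> else 0) = f (restrict (c h) Q)"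
      using fin r by simp
  qed
  finally show ?thesis .
qed

context burnside_module
begin

lemma elem_mark_conj:
  assumes A: "A \<in> carrier (burnside p G H)"
    and st: "s \<in> carrier G" "t \<in> carrier H" and c: "\<chi> \<in> Q \<rightarrow> carrier G" "\<phi> \<in> Q \<rightarrow> carrier H"
  shows "elem_mark A Q (\<lambda>q. s \<otimes>\<^bsub>G\<^esub> \<chi> q \<otimes>\<^bsub>G\<^esub> inv\<^bsub>G\<^esub> s) (\<lambda>q. t \<otimes>\<^bsub>H\<^esub> \<phi> q \<otimes>\<^bsub>H\<^esub> inv\<^bsub>H\<^esub> t) = elem_mark A Q \<chi> \<phi>"
proof -
  let ?\<chi> = "\<lambda>q. s \<otimes>\<^bsub>G\<^esub> \<chi> q \<otimes>\<^bsub>G\<^esub> inv\<^bsub>G\<^esub> s" and ?\<phi> = "\<lambda>q. t \<otimes>\<^bsub>H\<^esub> \<phi> q \<otimes>\<^bsub>H\<^esub> inv\<^bsub>H\<^esub> t"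
  obtain x where x: "x \<in> carrier FC" "A = burnside_class p G H x" using A burnside_carrier by auto
  have c': "?\<chi> \<in> Q \<rightarrow> carrier G" "?\<phi> \<in> Q \<rightarrow> carrier H" using c st by auto
  have "class_mark a Q ?\<chi> ?\<phi> = class_mark a Q \<chi> \<phi>" if "a \<in> iso_classes G H" for a
  proof -
    obtain X :: "('g, 'h, nat) biset" where X: "left_free_biset G H X" "a = iso_class G H X"
      using \<open>a \<in> iso_classes G H\<close> unfolding iso_classes_def by blast
    show ?thesis unfolding X(2) class_mark_iso_class[OF X(1) c] class_mark_iso_class[OF X(1) c']
      by (rule left_free_biset.mark_conj[OF X(1) st c])
  qed
  then have "fmark x Q ?\<chi> ?\<phi> = fmark x Q \<chi> \<phi>"
    unfolding fmark_def using x(1) by (intro sum.cong refl) (auto simp: mem_FC)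
  then show ?thesis unfolding x(2) elem_mark_burnside_class[OF c] elem_mark_burnside_class[OF c'] .
qed

lemma basis_pair: "\<lbrakk>subgroup K G; \<phi> \<in> hom (G\<lparr>carrier := K\<rparr>) H\<rbrakk> \<Longrightarrow> basis_pair G H K \<phi>"
  by (simp add: basis_pair_def basis_pair_axioms_def finite_G finite_H G.is_group H.is_group)

lemma basis_elem_closed:
  assumes "subgroup K G" "\<phi> \<in> hom (G\<lparr>carrier := K\<rparr>) H"
  shows "basis_elem p G H K \<phi> \<in> carrier (burnside p G H)"
  unfolding basis_elem_def burnside_carrier
  using basis_pair.left_free_basis_biset[OF basis_pair[OF assms]]
  by (intro imageI FC_single iso_class_mem_iso_classes Z_loc_1 prime_p)

lemma elem_mark_basis_elem:
  assumes "subgroup K G" "\<phi> \<in> hom (G\<lparr>carrier := K\<rparr>) H" "\<chi> \<in> Q \<rightarrow> carrier G" "\<psi> \<in> Q \<rightarrow> carrier H"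
  shows "elem_mark (basis_elem p G H K \<phi>) Q \<chi> \<psi> = of_nat (mark (basis_biset G H K \<phi>) Q \<chi> \<psi>)"
  unfolding basis_elem_def elem_mark_burnside_class[OF assms(3,4)] fmark_single
  using class_mark_iso_class[OF basis_pair.left_free_basis_biset[OF basis_pair[OF assms(1,2)]] assms(3,4)] by simp

lemma elem_mark_basis_comb:
  assumes "is_basis_comb p G H I c X" "\<chi> \<in> Q \<rightarrow> carrier G" "\<psi> \<in> Q \<rightarrow> carrier H"
  shows "elem_mark X Q \<chi> \<psi> = (\<Sum>(P, \<phi>)\<in>I. c (P, \<phi>) * of_nat (mark (basis_biset G H P \<phi>) Q \<chi> \<psi>))"
proof -
  have X: "X = burnside_class p G H
       (\<Sum>(P, \<phi>)\<in>I. Poly_Mapping.single (iso_class G H (basis_biset G H P \<phi>)) (c (P, \<phi>)))"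
    using assms(1) by (simp add: is_basis_comb_def)
  have "class_mark (iso_class G H (basis_biset G H P \<phi>)) Q \<chi> \<psi> = mark (basis_biset G H P \<phi>) Q \<chi> \<psi>" if "(P, \<phi>) \<in> I" for P \<phi>
    using that assms basis_pair.left_free_basis_biset[OF basis_pair, of P \<phi>]
    by (intro class_mark_iso_class) (auto simp: is_basis_comb_def)
  then show ?thesis
    unfolding X elem_mark_burnside_class[OF assms(2,3)] fmark_sum
    by (intro sum.cong refl) (auto simp: fmark_single)
qed

text \<open>When \<open>\<theta>\<close> is defined on all of \<open>G\<close>, the biset is \<open>H\<close> with \<open>G\<close> acting through \<open>\<theta>\<close>.\<close>

lemma mark_basis_biset_total:
  assumes \<theta>: "\<theta> \<in> hom G H" and Q: "finite Q" "\<chi> \<in> Q \<rightarrow> carrier G" "\<psi> \<in> Q \<rightarrow> carrier H"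
  shows "mark (basis_biset G H (carrier G) \<theta>) Q \<chi> \<psi> =
    card {h \<in> carrier H. \<forall>q\<in>Q. \<psi> q = h \<otimes>\<^bsub>H\<^esub> \<theta> (\<chi> q) \<otimes>\<^bsub>H\<^esub> inv\<^bsub>H\<^esub> h}" (is "_ = card ?B")
proof -
  interpret \<theta>: group_hom G H \<theta> by unfold_locales (rule \<theta>)
  interpret basis_pair G H "carrier G" \<theta> by (rule basis_pair) (simp_all add: G.subgroup_self \<theta>)
  let ?A = "{(h, g) \<in> carrier H \<times> carrier G. \<forall>q\<in>Q. g \<otimes>\<^bsub>G\<^esub> \<chi> q \<otimes>\<^bsub>G\<^esub> inv\<^bsub>G\<^esub> g \<in> carrier G \<and>
      \<psi> q = h \<otimes>\<^bsub>H\<^esub> \<theta> (g \<otimes>\<^bsub>G\<^esub> \<chi> q \<otimes>\<^bsub>G\<^esub> inv\<^bsub>G\<^esub> g) \<otimes>\<^bsub>H\<^esub> inv\<^bsub>H\<^esub> h}"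
  have c: "\<chi> q \<in> carrier G" if "q \<in> Q" for q using Q that by auto
  have eq: "h \<otimes>\<^bsub>H\<^esub> \<theta> (g \<otimes>\<^bsub>G\<^esub> \<chi> q \<otimes>\<^bsub>G\<^esub> inv\<^bsub>G\<^esub> g) \<otimes>\<^bsub>H\<^esub> inv\<^bsub>H\<^esub> h =
      (h \<otimes>\<^bsub>H\<^esub> \<theta> g) \<otimes>\<^bsub>H\<^esub> \<theta> (\<chi> q) \<otimes>\<^bsub>H\<^esub> inv\<^bsub>H\<^esub> (h \<otimes>\<^bsub>H\<^esub> \<theta> g)"
    if "h \<in> carrier H" "g \<in> carrier G" "q \<in> Q" for h g q
    using that c by (simp add: H.m_assoc H.inv_mult_group)
  \<comment> \<open>The condition on (h, g) depends only on the product h \<theta>(g). Shearing the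
    pairs makes g a free parameter, whose |G| choices cancel against the order of the subgroup, here
    G itself.\<close>
  have A: "?A = {(h, g) \<in> carrier H \<times> carrier G. h \<otimes>\<^bsub>H\<^esub> \<theta> g \<in> ?B}"
    by (rule Collect_cong) (use c eq in auto)
  have "bij_betw (\<lambda>(h, g). (h \<otimes>\<^bsub>H\<^esub> \<theta> g, g)) {(h, g) \<in> carrier H \<times> carrier G. h \<otimes>\<^bsub>H\<^esub> \<theta> g \<in> B} (B \<times> carrier G)"
    if "B \<subseteq> carrier H" for B
    by (rule bij_betw_byWitness[where f' = "\<lambda>(h, g). (h \<otimes>\<^bsub>H\<^esub> inv\<^bsub>H\<^esub> \<theta> g, g)"])
      (use that in \<open>auto simp: H.m_assoc subset_iff\<close>)
  from this[of ?B] have "bij_betw (\<lambda>(h, g). (h \<otimes>\<^bsub>H\<^esub> \<theta> g, g)) ?A (?B \<times> carrier G)"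
    unfolding A by blast
  then have "card ?A = card ?B * card (carrier G)"
    using bij_betw_same_card[of _ ?A "?B \<times> carrier G"] by (simp only: card_cartesian_product)
  then have "card (carrier G) * mark (basis_biset G H (carrier G) \<theta>) Q \<chi> \<psi> = card (carrier G) * card ?B"
    using mark_basis_biset[OF Q] by (simp only: mult.commute)
  moreover have "card (carrier G) > 0" using finite_G G.one_closed by (auto simp: card_gt_0_iff)
  ultimately show ?thesis by simp
qed

text \<open>When \<open>\<phi>\<close> is bijective with inverse \<open>\<theta>\<close>, the biset is \<open>G\<close> with \<open>H\<close> acting through \<open>\<theta>\<close>.\<close>

lemma mark_basis_biset_bij:
  assumes K: "subgroup K G" and \<phi>: "\<phi> \<in> hom (G\<lparr>carrier := K\<rparr>) H"
    and \<theta>: "\<theta> \<in> hom H G" "\<And>h. h \<in> carrier H \<Longrightarrow> \<theta> h \<in> K \<and> \<phi> (\<theta> h) = h" "\<And>k. k \<in> K \<Longrightarrow> \<theta> (\<phi> k) = k"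
    and Q: "finite Q" "\<chi> \<in> Q \<rightarrow> carrier G" "\<psi> \<in> Q \<rightarrow> carrier H"
  shows "mark (basis_biset G H K \<phi>) Q \<chi> \<psi> =
    card {g \<in> carrier G. \<forall>q\<in>Q. \<chi> q = g \<otimes>\<^bsub>G\<^esub> \<theta> (\<psi> q) \<otimes>\<^bsub>G\<^esub> inv\<^bsub>G\<^esub> g}" (is "_ = card ?B")
proof -
  interpret \<theta>: group_hom H G \<theta> by unfold_locales (rule \<theta>)
  interpret K: subgroup K G by (rule K)
  interpret basis_pair G H K \<phi> by (rule basis_pair[OF K \<phi>])
  let ?A = "{(h, g) \<in> carrier H \<times> carrier G. \<forall>q\<in>Q. g \<otimes>\<^bsub>G\<^esub> \<chi> q \<otimes>\<^bsub>G\<^esub> inv\<^bsub>G\<^esub> g \<in> K \<and>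
      \<psi> q = h \<otimes>\<^bsub>H\<^esub> \<phi> (g \<otimes>\<^bsub>G\<^esub> \<chi> q \<otimes>\<^bsub>G\<^esub> inv\<^bsub>G\<^esub> g) \<otimes>\<^bsub>H\<^esub> inv\<^bsub>H\<^esub> h}"
  \<comment> \<open>Solving for \<chi>(q) shows that (h, g) enters only through g^-1 \<theta>(h)^-1.
    The |H| choices of h are then free and cancel against |K| = |H|.\<close>
  have ab: "(g \<otimes>\<^bsub>G\<^esub> a \<otimes>\<^bsub>G\<^esub> inv\<^bsub>G\<^esub> g \<in> K \<and> b = h \<otimes>\<^bsub>H\<^esub> \<phi> (g \<otimes>\<^bsub>G\<^esub> a \<otimes>\<^bsub>G\<^esub> inv\<^bsub>G\<^esub> g) \<otimes>\<^bsub>H\<^esub> inv\<^bsub>H\<^esub> h) \<longleftrightarrow>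
      a = (inv\<^bsub>G\<^esub> g \<otimes>\<^bsub>G\<^esub> inv\<^bsub>G\<^esub> \<theta> h) \<otimes>\<^bsub>G\<^esub> \<theta> b \<otimes>\<^bsub>G\<^esub> inv\<^bsub>G\<^esub> (inv\<^bsub>G\<^esub> g \<otimes>\<^bsub>G\<^esub> inv\<^bsub>G\<^esub> \<theta> h)"
    if m: "h \<in> carrier H" "g \<in> carrier G" "a \<in> carrier G" "b \<in> carrier H" for h g a b
  proof -
    have "(g \<otimes>\<^bsub>G\<^esub> a \<otimes>\<^bsub>G\<^esub> inv\<^bsub>G\<^esub> g \<in> K \<and> b = h \<otimes>\<^bsub>H\<^esub> \<phi> (g \<otimes>\<^bsub>G\<^esub> a \<otimes>\<^bsub>G\<^esub> inv\<^bsub>G\<^esub> g) \<otimes>\<^bsub>H\<^esub> inv\<^bsub>H\<^esub> h) \<longleftrightarrow>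
      (g \<otimes>\<^bsub>G\<^esub> a \<otimes>\<^bsub>G\<^esub> inv\<^bsub>G\<^esub> g \<in> K \<and> inv\<^bsub>H\<^esub> h \<otimes>\<^bsub>H\<^esub> b \<otimes>\<^bsub>H\<^esub> h = \<phi> (g \<otimes>\<^bsub>G\<^esub> a \<otimes>\<^bsub>G\<^esub> inv\<^bsub>G\<^esub> g))"
    proof -
      have "b = h \<otimes>\<^bsub>H\<^esub> y \<otimes>\<^bsub>H\<^esub> inv\<^bsub>H\<^esub> h \<longleftrightarrow> inv\<^bsub>H\<^esub> h \<otimes>\<^bsub>H\<^esub> b \<otimes>\<^bsub>H\<^esub> h = y" if "y \<in> carrier H" for y
        using m that by (metis H.inv_closed H.inv_solve_left H.inv_solve_right H.m_assoc H.m_closed H.inv_inv)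
      then show ?thesis using hom_in_carrier by blast
    qed
    also have "\<dots> \<longleftrightarrow> g \<otimes>\<^bsub>G\<^esub> a \<otimes>\<^bsub>G\<^esub> inv\<^bsub>G\<^esub> g = \<theta> (inv\<^bsub>H\<^esub> h \<otimes>\<^bsub>H\<^esub> b \<otimes>\<^bsub>H\<^esub> h)"
      using \<theta>(2,3) m by (metis H.inv_closed H.m_closed)
    also have "\<theta> (inv\<^bsub>H\<^esub> h \<otimes>\<^bsub>H\<^esub> b \<otimes>\<^bsub>H\<^esub> h) = inv\<^bsub>G\<^esub> \<theta> h \<otimes>\<^bsub>G\<^esub> \<theta> b \<otimes>\<^bsub>G\<^esub> \<theta> h"
      using m by simp
    also have "g \<otimes>\<^bsub>G\<^esub> a \<otimes>\<^bsub>G\<^esub> inv\<^bsub>G\<^esub> g = inv\<^bsub>G\<^esub> \<theta> h \<otimes>\<^bsub>G\<^esub> \<theta> b \<otimes>\<^bsub>G\<^esub> \<theta> h \<longleftrightarrow>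
       a = inv\<^bsub>G\<^esub> g \<otimes>\<^bsub>G\<^esub> (inv\<^bsub>G\<^esub> \<theta> h \<otimes>\<^bsub>G\<^esub> \<theta> b \<otimes>\<^bsub>G\<^esub> \<theta> h) \<otimes>\<^bsub>G\<^esub> g"
    proof -
      have y: "inv\<^bsub>G\<^esub> \<theta> h \<otimes>\<^bsub>G\<^esub> \<theta> b \<otimes>\<^bsub>G\<^esub> \<theta> h \<in> carrier G" using m by simp
      have "g \<otimes>\<^bsub>G\<^esub> a \<otimes>\<^bsub>G\<^esub> inv\<^bsub>G\<^esub> g = y \<longleftrightarrow> a = inv\<^bsub>G\<^esub> g \<otimes>\<^bsub>G\<^esub> y \<otimes>\<^bsub>G\<^esub> g" if "y \<in> carrier G" for y
        using m that by (metis G.inv_closed G.inv_solve_left G.inv_solve_right G.m_assoc G.m_closed G.inv_inv)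
      then show ?thesis using y by blast
    qed
    also have "inv\<^bsub>G\<^esub> g \<otimes>\<^bsub>G\<^esub> (inv\<^bsub>G\<^esub> \<theta> h \<otimes>\<^bsub>G\<^esub> \<theta> b \<otimes>\<^bsub>G\<^esub> \<theta> h) \<otimes>\<^bsub>G\<^esub> g =
       (inv\<^bsub>G\<^esub> g \<otimes>\<^bsub>G\<^esub> inv\<^bsub>G\<^esub> \<theta> h) \<otimes>\<^bsub>G\<^esub> \<theta> b \<otimes>\<^bsub>G\<^esub> inv\<^bsub>G\<^esub> (inv\<^bsub>G\<^esub> g \<otimes>\<^bsub>G\<^esub> inv\<^bsub>G\<^esub> \<theta> h)"
      using m by (simp add: G.m_assoc G.inv_mult_group)
    finally show ?thesis .
  qed
  have c: "\<chi> q \<in> carrier G" "\<psi> q \<in> carrier H" if "q \<in> Q" for q using Q that by auto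
  have A: "?A = {(h, g) \<in> carrier H \<times> carrier G. inv\<^bsub>G\<^esub> g \<otimes>\<^bsub>G\<^esub> inv\<^bsub>G\<^esub> \<theta> h \<in> ?B}"
  proof (rule Collect_cong, clarify)
    fix h g
    show "((h, g) \<in> carrier H \<times> carrier G \<and> (\<forall>q\<in>Q. g \<otimes>\<^bsub>G\<^esub> \<chi> q \<otimes>\<^bsub>G\<^esub> inv\<^bsub>G\<^esub> g \<in> K \<and>
      \<psi> q = h \<otimes>\<^bsub>H\<^esub> \<phi> (g \<otimes>\<^bsub>G\<^esub> \<chi> q \<otimes>\<^bsub>G\<^esub> inv\<^bsub>G\<^esub> g) \<otimes>\<^bsub>H\<^esub> inv\<^bsub>H\<^esub> h)) =
      ((h, g) \<in> carrier H \<times> carrier G \<and> inv\<^bsub>G\<^esub> g \<otimes>\<^bsub>G\<^esub> inv\<^bsub>G\<^esub> \<theta> h \<in> ?B)"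
    proof (rule conj_cong[OF refl])
      assume "(h, g) \<in> carrier H \<times> carrier G"
      then have hg: "h \<in> carrier H" "g \<in> carrier G" by auto
      have "(\<forall>q\<in>Q. g \<otimes>\<^bsub>G\<^esub> \<chi> q \<otimes>\<^bsub>G\<^esub> inv\<^bsub>G\<^esub> g \<in> K \<and>
        \<psi> q = h \<otimes>\<^bsub>H\<^esub> \<phi> (g \<otimes>\<^bsub>G\<^esub> \<chi> q \<otimes>\<^bsub>G\<^esub> inv\<^bsub>G\<^esub> g) \<otimes>\<^bsub>H\<^esub> inv\<^bsub>H\<^esub> h) \<longleftrightarrow>
        (\<forall>q\<in>Q. \<chi> q = (inv\<^bsub>G\<^esub> g \<otimes>\<^bsub>G\<^esub> inv\<^bsub>G\<^esub> \<theta> h) \<otimes>\<^bsub>G\<^esub> \<theta> (\<psi> q) \<otimes>\<^bsub>G\<^esub> inv\<^bsub>G\<^esub> (inv\<^bsub>G\<^esub> g \<otimes>\<^bsub>G\<^esub> inv\<^bsub>G\<^esub> \<theta> h))"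
        by (rule ball_cong[OF refl]) (rule ab[OF hg c])
      then show "(\<forall>q\<in>Q. g \<otimes>\<^bsub>G\<^esub> \<chi> q \<otimes>\<^bsub>G\<^esub> inv\<^bsub>G\<^esub> g \<in> K \<and>
        \<psi> q = h \<otimes>\<^bsub>H\<^esub> \<phi> (g \<otimes>\<^bsub>G\<^esub> \<chi> q \<otimes>\<^bsub>G\<^esub> inv\<^bsub>G\<^esub> g) \<otimes>\<^bsub>H\<^esub> inv\<^bsub>H\<^esub> h) \<longleftrightarrow>
        inv\<^bsub>G\<^esub> g \<otimes>\<^bsub>G\<^esub> inv\<^bsub>G\<^esub> \<theta> h \<in> ?B" using hg by simp
    qed
  qed
  have "bij_betw (\<lambda>(h, g). (h, inv\<^bsub>G\<^esub> g \<otimes>\<^bsub>G\<^esub> inv\<^bsub>G\<^esub> \<theta> h))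
      {(h, g) \<in> carrier H \<times> carrier G. inv\<^bsub>G\<^esub> g \<otimes>\<^bsub>G\<^esub> inv\<^bsub>G\<^esub> \<theta> h \<in> B} (carrier H \<times> B)"
    if "B \<subseteq> carrier G" for B
    by (rule bij_betw_byWitness[where f' = "\<lambda>(h, g). (h, inv\<^bsub>G\<^esub> \<theta> h \<otimes>\<^bsub>G\<^esub> inv\<^bsub>G\<^esub> g)"])
      (use that in \<open>auto simp: G.inv_mult_group G.inv_solve_left' G.inv_solve_left G.m_assoc subset_iff\<close>)
  from this[of ?B] have "bij_betw (\<lambda>(h, g). (h, inv\<^bsub>G\<^esub> g \<otimes>\<^bsub>G\<^esub> inv\<^bsub>G\<^esub> \<theta> h)) ?A (carrier H \<times> ?B)"
    unfolding A by blast
  then have "card ?A = card (carrier H) * card ?B"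
    using bij_betw_same_card[of _ ?A "carrier H \<times> ?B"] by (simp only: card_cartesian_product)
  moreover have "card K = card (carrier H)"
    by (rule bij_betw_same_card[of \<phi>], rule bij_betw_byWitness[where f' = \<theta>]) (use \<theta> hom_in_carrier in auto)
  ultimately have "card (carrier H) * mark (basis_biset G H K \<phi>) Q \<chi> \<psi> = card (carrier H) * card ?B"
    using mark_basis_biset[OF Q] by (simp only: mult.commute)
  moreover have "card (carrier H) > 0" using finite_H H.one_closed by (auto simp: card_gt_0_iff)
  ultimately show ?thesis by simp
qed

end

section \<open>Composition with basis elements as restriction of an action\<close>

context burnside_composition
begin

text \<open>The mark of [G, \<theta>] at (\<chi>, \<eta>) counts the h that conjugate \<theta>
  \<circ> \<chi> to \<eta>. Summing over \<eta> gives one term for each h in H, and conjugation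
  invariance makes these |H| terms equal.\<close>

lemma elem_mark_comp_basis_total:
  assumes X: "X \<in> carrier (burnside p H K)" and \<theta>: "\<theta> \<in> hom G H"
    and Q: "finite Q" "\<chi> \<in> Q \<rightarrow> carrier G" "\<psi> \<in> Q \<rightarrow> carrier K"
  shows "elem_mark (burnside_comp p G H K X (basis_elem p G H (carrier G) \<theta>)) Q \<chi> \<psi> = elem_mark X Q (\<theta> \<circ> \<chi>) \<psi>"
proof -
  interpret \<theta>: group_hom G H \<theta> by unfold_locales (rule \<theta>)
  have sub: "subgroup (carrier G) G" "\<theta> \<in> hom (G\<lparr>carrier := carrier G\<rparr>) H" using \<theta> GH.G.subgroup_self by auto
  have c: "\<chi> q \<in> carrier G" if "q \<in> Q" for q using that Q by auto
  have "of_nat (card (carrier H)) * elem_mark (burnside_comp p G H K X (basis_elem p G H (carrier G) \<theta>)) Q \<chi> \<psi> =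
    (\<Sum>\<eta>\<in>Q \<rightarrow>\<^sub>E carrier H. elem_mark X Q \<eta> \<psi> * elem_mark (basis_elem p G H (carrier G) \<theta>) Q \<chi> \<eta>)"
    by (rule elem_mark_comp[OF X GH.basis_elem_closed[OF sub] Q])
  also have "\<dots> = (\<Sum>\<eta>\<in>Q \<rightarrow>\<^sub>E carrier H. elem_mark X Q \<eta> \<psi> *
      of_nat (card {h \<in> carrier H. \<forall>q\<in>Q. \<eta> q = h \<otimes>\<^bsub>H\<^esub> \<theta> (\<chi> q) \<otimes>\<^bsub>H\<^esub> inv\<^bsub>H\<^esub> h}))"
  proof (rule sum.cong[OF refl])
    fix \<eta> assume "\<eta> \<in> Q \<rightarrow>\<^sub>E carrier H"
    then have "\<eta> \<in> Q \<rightarrow> carrier H" by auto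
    then show "elem_mark X Q \<eta> \<psi> * elem_mark (basis_elem p G H (carrier G) \<theta>) Q \<chi> \<eta> = elem_mark X Q \<eta> \<psi> *
      of_nat (card {h \<in> carrier H. \<forall>q\<in>Q. \<eta> q = h \<otimes>\<^bsub>H\<^esub> \<theta> (\<chi> q) \<otimes>\<^bsub>H\<^esub> inv\<^bsub>H\<^esub> h})"
      by (simp only: GH.elem_mark_basis_elem[OF sub Q(2)] GH.mark_basis_biset_total[OF \<theta> Q(1,2)])
  qed
  also have "\<dots> = (\<Sum>h\<in>carrier H. elem_mark X Q (\<lambda>q\<in>Q. h \<otimes>\<^bsub>H\<^esub> \<theta> (\<chi> q) \<otimes>\<^bsub>H\<^esub> inv\<^bsub>H\<^esub> h) \<psi>)"
    by (rule sum_PiE_card_eq) (use Q GH.finite_H c in auto)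
  also have "\<dots> = (\<Sum>h\<in>carrier H. elem_mark X Q (\<theta> \<circ> \<chi>) \<psi>)"
  proof (rule sum.cong[OF refl])
    fix h assume h: "h \<in> carrier H"
    have "elem_mark X Q (\<lambda>q\<in>Q. h \<otimes>\<^bsub>H\<^esub> \<theta> (\<chi> q) \<otimes>\<^bsub>H\<^esub> inv\<^bsub>H\<^esub> h) \<psi> =
      elem_mark X Q (\<lambda>q. h \<otimes>\<^bsub>H\<^esub> (\<theta> \<circ> \<chi>) q \<otimes>\<^bsub>H\<^esub> inv\<^bsub>H\<^esub> h) (\<lambda>q. \<one>\<^bsub>K\<^esub> \<otimes>\<^bsub>K\<^esub> \<psi> q \<otimes>\<^bsub>K\<^esub> inv\<^bsub>K\<^esub> \<one>\<^bsub>K\<^esub>)"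
      by (rule elem_mark_cong) (use Q in \<open>auto simp: Pi_iff\<close>)
    also have "\<dots> = elem_mark X Q (\<theta> \<circ> \<chi>) \<psi>"
      by (rule HK.elem_mark_conj[OF X h]) (use Q c in auto)
    finally show "elem_mark X Q (\<lambda>q\<in>Q. h \<otimes>\<^bsub>H\<^esub> \<theta> (\<chi> q) \<otimes>\<^bsub>H\<^esub> inv\<^bsub>H\<^esub> h) \<psi> = elem_mark X Q (\<theta> \<circ> \<chi>) \<psi>" .
  qed
  finally have "of_nat (card (carrier H)) * elem_mark (burnside_comp p G H K X (basis_elem p G H (carrier G) \<theta>)) Q \<chi> \<psi> =
     of_nat (card (carrier H)) * elem_mark X Q (\<theta> \<circ> \<chi>) \<psi>" by simp
  moreover have "card (carrier H) > 0" using GH.finite_H GH.H.one_closed by (auto simp: card_gt_0_iff)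
  ultimately show ?thesis by simp
qed

text \<open>Dual to composition with [G, \<theta>] on the right: here \<phi> is an isomorphism from
  a subgroup L of H to K, and composing with [L, \<phi>] restricts the left action along its inverse
  \<theta>. Left stability is phrased with such elements.\<close>

lemma elem_mark_basis_bij_comp:
  assumes X: "X \<in> carrier (burnside p G H)" and L: "subgroup L H" and \<phi>: "\<phi> \<in> hom (H\<lparr>carrier := L\<rparr>) K"
    and \<theta>: "\<theta> \<in> hom K H" "\<And>k. k \<in> carrier K \<Longrightarrow> \<theta> k \<in> L \<and> \<phi> (\<theta> k) = k" "\<And>l. l \<in> L \<Longrightarrow> \<theta> (\<phi> l) = l"
    and Q: "finite Q" "\<chi> \<in> Q \<rightarrow> carrier G" "\<psi> \<in> Q \<rightarrow> carrier K"
  shows "elem_mark (burnside_comp p G H K (basis_elem p H K L \<phi>) X) Q \<chi> \<psi> = elem_mark X Q \<chi> (\<theta> \<circ> \<psi>)"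
proof -
  interpret \<theta>: group_hom K H \<theta> by unfold_locales (rule \<theta>)
  have c: "\<psi> q \<in> carrier K" if "q \<in> Q" for q using that Q by auto
  have "of_nat (card (carrier H)) * elem_mark (burnside_comp p G H K (basis_elem p H K L \<phi>) X) Q \<chi> \<psi> =
    (\<Sum>\<eta>\<in>Q \<rightarrow>\<^sub>E carrier H. elem_mark (basis_elem p H K L \<phi>) Q \<eta> \<psi> * elem_mark X Q \<chi> \<eta>)"
    by (rule elem_mark_comp[OF HK.basis_elem_closed[OF L \<phi>] X Q])
  also have "\<dots> = (\<Sum>\<eta>\<in>Q \<rightarrow>\<^sub>E carrier H. elem_mark X Q \<chi> \<eta> *
      of_nat (card {h \<in> carrier H. \<forall>q\<in>Q. \<eta> q = h \<otimes>\<^bsub>H\<^esub> \<theta> (\<psi> q) \<otimes>\<^bsub>H\<^esub> inv\<^bsub>H\<^esub> h}))"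
  proof (rule sum.cong[OF refl])
    fix \<eta> assume "\<eta> \<in> Q \<rightarrow>\<^sub>E carrier H"
    then have "\<eta> \<in> Q \<rightarrow> carrier H" by auto
    then show "elem_mark (basis_elem p H K L \<phi>) Q \<eta> \<psi> * elem_mark X Q \<chi> \<eta> = elem_mark X Q \<chi> \<eta> *
      of_nat (card {h \<in> carrier H. \<forall>q\<in>Q. \<eta> q = h \<otimes>\<^bsub>H\<^esub> \<theta> (\<psi> q) \<otimes>\<^bsub>H\<^esub> inv\<^bsub>H\<^esub> h})"
      using HK.elem_mark_basis_elem[OF L \<phi> _ Q(3)] HK.mark_basis_biset_bij[OF L \<phi> \<theta> Q(1) _ Q(3)] by simp
  qed
  also have "\<dots> = (\<Sum>h\<in>carrier H. elem_mark X Q \<chi> (\<lambda>q\<in>Q. h \<otimes>\<^bsub>H\<^esub> \<theta> (\<psi> q) \<otimes>\<^bsub>H\<^esub> inv\<^bsub>H\<^esub> h))"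
    by (rule sum_PiE_card_eq) (use Q GH.finite_H c in auto)
  also have "\<dots> = (\<Sum>h\<in>carrier H. elem_mark X Q \<chi> (\<theta> \<circ> \<psi>))"
  proof (rule sum.cong[OF refl])
    fix h assume h: "h \<in> carrier H"
    have "elem_mark X Q \<chi> (\<lambda>q\<in>Q. h \<otimes>\<^bsub>H\<^esub> \<theta> (\<psi> q) \<otimes>\<^bsub>H\<^esub> inv\<^bsub>H\<^esub> h) =
      elem_mark X Q (\<lambda>q. \<one>\<^bsub>G\<^esub> \<otimes>\<^bsub>G\<^esub> \<chi> q \<otimes>\<^bsub>G\<^esub> inv\<^bsub>G\<^esub> \<one>\<^bsub>G\<^esub>) (\<lambda>q. h \<otimes>\<^bsub>H\<^esub> (\<theta> \<circ> \<psi>) q \<otimes>\<^bsub>H\<^esub> inv\<^bsub>H\<^esub> h)"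
      by (rule elem_mark_cong) (use Q in \<open>auto simp: Pi_iff\<close>)
    also have "\<dots> = elem_mark X Q \<chi> (\<theta> \<circ> \<psi>)"
      by (rule GH.elem_mark_conj[OF X _ h]) (use Q c in auto)
    finally show "elem_mark X Q \<chi> (\<lambda>q\<in>Q. h \<otimes>\<^bsub>H\<^esub> \<theta> (\<psi> q) \<otimes>\<^bsub>H\<^esub> inv\<^bsub>H\<^esub> h) = elem_mark X Q \<chi> (\<theta> \<circ> \<psi>)" .
  qed
  finally have "of_nat (card (carrier H)) * elem_mark (burnside_comp p G H K (basis_elem p H K L \<phi>) X) Q \<chi> \<psi> =
     of_nat (card (carrier H)) * elem_mark X Q \<chi> (\<theta> \<circ> \<psi>)" by simp
  moreover have "card (carrier H) > 0" using GH.finite_H GH.H.one_closed by (auto simp: card_gt_0_iff)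
  ultimately show ?thesis by simp
qed

end

section \<open>Morphisms of fusion systems\<close>

context fusion_system
begin

lemma mor_hom:
  assumes "subgroup P S" "subgroup Q S" "\<phi> \<in> F P Q"
  shows "\<phi> \<in> hom (S\<lparr>carrier := P\<rparr>) (S\<lparr>carrier := Q\<rparr>)" "\<phi> \<in> hom (S\<lparr>carrier := P\<rparr>) S"
    "inj_on \<phi> P" "\<phi> ` P \<subseteq> Q" "\<phi> \<in> extensional P" "\<phi> \<in> P \<rightarrow>\<^sub>E Q" "\<And>x. x \<in> P \<Longrightarrow> \<phi> x \<in> Q"
    "\<And>x y. x \<in> P \<Longrightarrow> y \<in> P \<Longrightarrow> \<phi> (x \<otimes> y) = \<phi> x \<otimes> \<phi> y"
proof -
  have "\<phi> \<in> P \<rightarrow> Q"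
    and h: "\<forall>x\<in>P. \<forall>y\<in>P. \<phi> (x \<otimes> y) = \<phi> x \<otimes> \<phi> y" "inj_on \<phi> P" "\<phi> \<in> extensional P"
    using injective_hom[OF assms(1,2)] assms(3) by (auto simp: mon_def hom_def)
  then have "\<phi> x \<in> Q" "\<phi> x \<in> carrier S" if "x \<in> P" for x
    using that subgroup.mem_carrier[OF assms(2)] by auto
  then show "\<phi> \<in> hom (S\<lparr>carrier := P\<rparr>) (S\<lparr>carrier := Q\<rparr>)" "\<phi> \<in> hom (S\<lparr>carrier := P\<rparr>) S"
    "inj_on \<phi> P" "\<phi> ` P \<subseteq> Q" "\<phi> \<in> extensional P" "\<phi> \<in> P \<rightarrow>\<^sub>E Q" "\<And>x. x \<in> P \<Longrightarrow> \<phi> x \<in> Q"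
    "\<And>x y. x \<in> P \<Longrightarrow> y \<in> P \<Longrightarrow> \<phi> (x \<otimes> y) = \<phi> x \<otimes> \<phi> y"
    using h by (auto simp: hom_def PiE_def)
qed

lemma mor_group_hom:
  assumes "subgroup P S" "subgroup Q S" "\<phi> \<in> F P Q"
  shows "group_hom (S\<lparr>carrier := P\<rparr>) S \<phi>"
  using mor_hom(2)[OF assms] subgroup_imp_group[OF assms(1)] is_group
  by (simp add: group_hom_def group_hom_axioms_def)

lemma mor_inv:
  assumes "subgroup P S" "subgroup Q S" "\<phi> \<in> F P Q" "x \<in> P"
  shows "\<phi> (inv x) = inv (\<phi> x)"
  using group_hom.hom_inv[OF mor_group_hom[OF assms(1-3)], of x] assms(4) m_inv_consistent[OF assms(1)] by simp

lemma mor_image_subgroup: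
  assumes "subgroup P S" "subgroup Q S" "\<phi> \<in> F P Q"
  shows "subgroup (\<phi> ` P) S"
  using group_hom.img_is_subgroup[OF mor_group_hom[OF assms]] by simp

lemma mor_image_sub:
  assumes "subgroup P S" "subgroup Q S" "\<phi> \<in> F P Q" "subgroup R S" "R \<subseteq> P"
  shows "subgroup (\<phi> ` R) S"
proof -
  have "subgroup R (S\<lparr>carrier := P\<rparr>)" using assms by (simp add: subgroup_incl)
  then show ?thesis using group_hom.subgroup_img_is_subgroup[OF mor_group_hom[OF assms(1-3)]] by blast
qed

lemma conj_mor:
  assumes "subgroup P S" "subgroup Q S" "g \<in> carrier S" "\<And>x. x \<in> P \<Longrightarrow> g \<otimes> x \<otimes> inv g \<in> Q"
  shows "(\<lambda>x\<in>P. g \<otimes> x \<otimes> inv g) \<in> F P Q"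
  using conj_hom_subset[OF assms(1,2)] assms unfolding conj_hom_def by blast

lemma incl_mor:
  assumes P: "subgroup P S" and "subgroup Q S" "P \<subseteq> Q"
  shows "(\<lambda>x\<in>P. x) \<in> F P Q"
proof -
  have "(\<lambda>x\<in>P. \<one> \<otimes> x \<otimes> inv \<one>) \<in> F P Q"
    by (rule conj_mor) (use assms subgroup.mem_carrier[OF P] in auto)
  moreover have "(\<lambda>x\<in>P. \<one> \<otimes> x \<otimes> inv \<one>) = (\<lambda>x\<in>P. x)"
    using subgroup.mem_carrier[OF P] by (intro restrict_ext) auto
  ultimately show ?thesis by simp
qed

text \<open>Each morphism is an isomorphism onto its image followed by an inclusion, so the codomain
  may be exchanged for any subgroup that contains the image.\<close>

lemma mor_codomain:
  assumes "subgroup P S" "subgroup Q S" "subgroup R S" "\<phi> \<in> F P Q" "\<phi> ` P \<subseteq> R"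
  shows "\<phi> \<in> F P R"
proof -
  have img: "subgroup (\<phi> ` P) S" by (rule mor_image_subgroup[OF assms(1,2,4)])
  have "compose P (\<lambda>x\<in>\<phi> ` P. x) \<phi> \<in> F P R"
    using comp_closed[OF assms(1) img assms(3)] iso_factor[OF assms(1,2,4)] incl_mor[OF img assms(3,5)] by blast
  moreover have "compose P (\<lambda>x\<in>\<phi> ` P. x) \<phi> = \<phi>"
    using mor_hom(5)[OF assms(1,2,4)] by (auto simp: compose_def fun_eq_iff extensional_def)
  ultimately show ?thesis by simp
qed

lemma mor_to_S: "\<lbrakk>subgroup P S; subgroup Q S; \<phi> \<in> F P Q\<rbrakk> \<Longrightarrow> \<phi> \<in> F P (carrier S)"
  using mor_codomain[of P Q "carrier S" \<phi>] mor_hom(4) subgroup.subset subgroup_self by blast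

lemma mor_restrict:
  assumes "subgroup P S" "subgroup Q S" "subgroup R S" "\<phi> \<in> F P Q" "R \<subseteq> P"
  shows "restrict \<phi> R \<in> F R Q"
proof -
  have "compose R \<phi> (\<lambda>x\<in>R. x) \<in> F R Q"
    by (rule comp_closed[OF assms(3,1,2) incl_mor[OF assms(3,1,5)] assms(4)])
  moreover have "compose R \<phi> (\<lambda>x\<in>R. x) = restrict \<phi> R" by (auto simp: compose_def)
  ultimately show ?thesis by simp
qed

lemma mor_comp:
  assumes "subgroup P S" "subgroup Q S" "\<phi> \<in> F P Q" "subgroup R S" "subgroup R' S" "\<psi> \<in> F R R'" "\<phi> ` P \<subseteq> R"
  shows "compose P \<psi> \<phi> \<in> F P R'"
  using comp_closed[OF assms(1,4,5) mor_codomain[OF assms(1,2,4,3,7)] assms(6)] .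

lemma mor_inverse:
  assumes "subgroup P S" "subgroup Q S" "\<phi> \<in> F P Q"
  shows "restrict (inv_into P \<phi>) (\<phi> ` P) \<in> F (\<phi> ` P) P"
  using iso_factor[OF assms] by blast

lemma finite_sub: "subgroup P S \<Longrightarrow> finite P"
  using finite_carrier subgroup.subset finite_subset by blast

lemma finite_mor:
  assumes "subgroup P S" "subgroup Q S"
  shows "finite (F P Q)"
  by (rule finite_subset[of _ "P \<rightarrow>\<^sub>E Q"]) (use mor_hom(6)[OF assms] finite_sub assms in \<open>auto intro: finite_PiE\<close>)

lemma card_mor_pos: "subgroup P S \<Longrightarrow> card (F P (carrier S)) > 0"
  using incl_mor[of P "carrier S"] finite_mor[of P "carrier S"] subgroup_self subgroup.subset
  by (auto simp: card_gt_0_iff)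

lemma mor_eqI:
  "\<lbrakk>\<phi> \<in> extensional P; \<psi> \<in> extensional P; \<And>x. x \<in> P \<Longrightarrow> \<phi> x = \<psi> x\<rbrakk> \<Longrightarrow> \<phi> = \<psi>"
  by (rule extensionalityI)

lemma subgroup_card_prime_power: "subgroup P S \<Longrightarrow> \<exists>k. card P = p ^ k"
  using lagrange[of P] order_p_power prime_p by (metis divides_primepow_nat dvd_triv_right)

end

section \<open>Marks of characteristic idempotents\<close>

context fusion_system
begin

lemma burnside_composition_sub:
  "\<lbrakk>subgroup P S; subgroup Q S\<rbrakk> \<Longrightarrow> burnside_composition (S\<lparr>carrier := P\<rparr>) (S\<lparr>carrier := Q\<rparr>) S p"
  by (simp add: burnside_composition_def burnside_module_def burnside_module_axioms_def
      subgroup_imp_group finite_sub finite_carrier prime_p is_group)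

lemma burnside_composition_sub':
  "subgroup P S \<Longrightarrow> burnside_composition (S\<lparr>carrier := P\<rparr>) S S p"
  "subgroup P S \<Longrightarrow> burnside_composition S S (S\<lparr>carrier := P\<rparr>) p"
  by (simp_all add: burnside_composition_def burnside_module_def burnside_module_axioms_def
      subgroup_imp_group finite_sub finite_carrier prime_p is_group)

interpretation SS: burnside_composition S S S p
  by (simp add: burnside_composition_def burnside_module_def burnside_module_axioms_def finite_carrier prime_p is_group)

text \<open>Composition with [P, \<theta>] restricts the right action along \<theta>. Reading off
  the marks of both sides of the stability equation therefore replaces \<theta> by the
  inclusion.\<close>

lemma right_stable_elem_mark:
  assumes X: "X \<in> carrier (burnside p S S)" and "right_stable S p F S X"
    and P: "subgroup P S" and \<theta>: "\<theta> \<in> F P (carrier S)" and \<psi>: "\<psi> \<in> P \<rightarrow> carrier S"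
  shows "elem_mark X P \<theta> \<psi> = elem_mark X P (\<lambda>x. x) \<psi>"
proof -
  let ?P = "S\<lparr>carrier := P\<rparr>"
  interpret C: burnside_composition ?P S S p by (rule burnside_composition_sub'(1)[OF P])
  have eq: "burnside_comp p ?P S S X (basis_elem p ?P S P \<theta>) = burnside_comp p ?P S S X (basis_elem p ?P S P (\<lambda>x\<in>P. x))"
    using assms(2) P \<theta> by (auto simp: right_stable_def Let_def)
  have *: "elem_mark (burnside_comp p ?P S S X (basis_elem p ?P S P \<eta>)) P (\<lambda>x. x) \<psi> = elem_mark X P \<eta> \<psi>"
    if "\<eta> \<in> F P (carrier S)" for \<eta>
    using C.elem_mark_comp_basis_total[OF X mor_hom(2)[OF P subgroup_self that] finite_sub[OF P], of "\<lambda>x. x" \<psi>] \<psi>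
    by (simp add: comp_def)
  have "elem_mark X P \<theta> \<psi> = elem_mark X P (\<lambda>x\<in>P. x) \<psi>"
    using *[OF \<theta>] *[OF incl_mor[OF P subgroup_self subgroup.subset[OF P]]] eq by simp
  also have "\<dots> = elem_mark X P (\<lambda>x. x) \<psi>" by (rule elem_mark_cong) auto
  finally show ?thesis .
qed

lemma left_stable_elem_mark:
  assumes X: "X \<in> carrier (burnside p S S)" and "left_stable S p F S X"
    and P: "subgroup P S" and \<theta>: "\<theta> \<in> F P (carrier S)" and \<chi>: "\<chi> \<in> P \<rightarrow> carrier S"
  shows "elem_mark X P \<chi> \<theta> = elem_mark X P \<chi> (\<lambda>x. x)"
proof -
  let ?P = "S\<lparr>carrier := P\<rparr>"
  interpret C: burnside_composition S S ?P p by (rule burnside_composition_sub'(2)[OF P])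
  let ?b = "\<lambda>\<eta>. basis_elem p S ?P (\<eta> ` P) (restrict (inv_into P \<eta>) (\<eta> ` P))"
  have "burnside_comp p S S ?P (?b \<theta>) X = burnside_comp p S S ?P (basis_elem p S ?P P (\<lambda>x\<in>P. x)) X"
    using assms(2) P \<theta> unfolding left_stable_def Let_def by blast
  \<comment> \<open>The right-hand side of left stability is its left-hand side for the inclusion,
    so one computation of marks serves both sides.\<close>
  moreover have "?b (\<lambda>x\<in>P. x) = basis_elem p S ?P P (\<lambda>x\<in>P. x)"
  proof -
    have "restrict (inv_into P (\<lambda>x\<in>P. x)) P = (\<lambda>x\<in>P. x)"
      by (rule restrict_ext) (metis inv_into_f_f inj_on_restrict_eq inj_on_id2 restrict_apply')
    then show ?thesis by (simp add: image_restrict_eq)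
  qed
  ultimately have eq: "burnside_comp p S S ?P (?b \<theta>) X = burnside_comp p S S ?P (?b (\<lambda>x\<in>P. x)) X" by simp
  have *: "elem_mark (burnside_comp p S S ?P (?b \<eta>) X) P \<chi> (\<lambda>x. x) = elem_mark X P \<chi> \<eta>"
    if \<eta>: "\<eta> \<in> F P (carrier S)" for \<eta>
  proof -
    note h = mor_hom[OF P subgroup_self \<eta>]
    have "elem_mark (burnside_comp p S S ?P (?b \<eta>) X) P \<chi> (\<lambda>x. x) = elem_mark X P \<chi> (\<eta> \<circ> (\<lambda>x. x))"
    proof (rule C.elem_mark_basis_bij_comp[OF X])
      show "subgroup (\<eta> ` P) S" by (rule mor_image_subgroup[OF P subgroup_self \<eta>])
      show "restrict (inv_into P \<eta>) (\<eta> ` P) \<in> hom (S\<lparr>carrier := \<eta> ` P\<rparr>) ?P"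
        by (rule mor_hom(1)[OF mor_image_subgroup[OF P subgroup_self \<eta>] P mor_inverse[OF P subgroup_self \<eta>]])
      show "\<eta> \<in> hom ?P S" by (rule h(2))
    qed (use h finite_sub[OF P] \<chi> in auto)
    then show ?thesis by (simp add: comp_def)
  qed
  have "elem_mark X P \<chi> \<theta> = elem_mark X P \<chi> (\<lambda>x\<in>P. x)"
    using *[OF \<theta>] *[OF incl_mor[OF P subgroup_self subgroup.subset[OF P]]] eq by simp
  also have "\<dots> = elem_mark X P \<chi> (\<lambda>x. x)" by (rule elem_mark_cong) auto
  finally show ?thesis .
qed

text \<open>A pair (h, g) counted by the mark writes \<theta> as c_h \<phi> c_g, a composite of
  morphisms of F. A map outside F admits no such pair.\<close>

lemma mark_basis_biset_eq_0:
  assumes R: "subgroup R S" and \<phi>: "\<phi> \<in> F R (carrier S)"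
    and P: "subgroup P S" and \<theta>: "\<theta> \<in> P \<rightarrow>\<^sub>E carrier S" and not: "\<theta> \<notin> F P (carrier S)"
  shows "mark (basis_biset S S R \<phi>) P (\<lambda>x. x) \<theta> = 0"
proof -
  interpret B: basis_pair S S R \<phi> by (rule SS.GH.basis_pair[OF R mor_hom(2)[OF R subgroup_self \<phi>]])
  let ?A = "{(h, g) \<in> carrier S \<times> carrier S. \<forall>q\<in>P. g \<otimes> q \<otimes> inv g \<in> R \<and> \<theta> q = h \<otimes> \<phi> (g \<otimes> q \<otimes> inv g) \<otimes> inv h}"
  have "?A = {}"
  proof (rule ccontr)
    assume "?A \<noteq> {}"
    then obtain h g where hg: "h \<in> carrier S" "g \<in> carrier S" "\<And>q. q \<in> P \<Longrightarrow> g \<otimes> q \<otimes> inv g \<in> R"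
      "\<And>q. q \<in> P \<Longrightarrow> \<theta> q = h \<otimes> \<phi> (g \<otimes> q \<otimes> inv g) \<otimes> inv h" by auto
    have 1: "(\<lambda>x\<in>P. g \<otimes> x \<otimes> inv g) \<in> F P R" by (rule conj_mor[OF P R hg(2,3)])
    have 2: "(\<lambda>x\<in>carrier S. h \<otimes> x \<otimes> inv h) \<in> F (carrier S) (carrier S)"
      by (rule conj_mor[OF subgroup_self subgroup_self hg(1)]) (use hg in auto)
    have "compose P (\<lambda>x\<in>carrier S. h \<otimes> x \<otimes> inv h) (compose P \<phi> (\<lambda>x\<in>P. g \<otimes> x \<otimes> inv g)) \<in> F P (carrier S)"
      by (rule comp_closed[OF P subgroup_self subgroup_self comp_closed[OF P R subgroup_self 1 \<phi>] 2])
    moreover have "compose P (\<lambda>x\<in>carrier S. h \<otimes> x \<otimes> inv h) (compose P \<phi> (\<lambda>x\<in>P. g \<otimes> x \<otimes> inv g)) = \<theta>"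
      by (rule mor_eqI[of _ P]) (use \<theta> hg mor_hom(7)[OF R subgroup_self \<phi>] in \<open>auto simp: compose_def PiE_iff\<close>)
    ultimately show False using not by simp
  qed
  moreover have "(\<lambda>x. x) \<in> P \<rightarrow> carrier S" "\<theta> \<in> P \<rightarrow> carrier S" using \<theta> subgroup.subset[OF P] by auto
  ultimately have "card R * mark (basis_biset S S R \<phi>) P (\<lambda>x. x) \<theta> = 0"
    using B.mark_basis_biset[OF finite_sub[OF P], of "\<lambda>x. x" \<theta>] by (simp only: card.empty)
  moreover have "card R \<noteq> 0" using finite_sub[OF R] subgroup.one_closed[OF R] by auto
  ultimately show ?thesis by simp
qed

lemma generated_elem_mark_eq_0:
  assumes "F_generated S p F X" and P: "subgroup P S" and \<theta>: "\<theta> \<in> P \<rightarrow>\<^sub>E carrier S" and not: "\<theta> \<notin> F P (carrier S)"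
  shows "elem_mark X P (\<lambda>x. x) \<theta> = 0"
proof -
  obtain I c where I: "is_basis_comb p S S I c X" "\<forall>(P, \<phi>)\<in>I. \<phi> \<in> F P (carrier S)"
    using assms(1) unfolding F_generated_def by blast
  have "(\<lambda>x. x) \<in> P \<rightarrow> carrier S" "\<theta> \<in> P \<rightarrow> carrier S" using subgroup.subset[OF P] \<theta> by auto
  then have "elem_mark X P (\<lambda>x. x) \<theta> = (\<Sum>(R, \<phi>)\<in>I. c (R, \<phi>) * of_nat (mark (basis_biset S S R \<phi>) P (\<lambda>x. x) \<theta>))"
    by (rule SS.GH.elem_mark_basis_comb[OF I(1)])
  also have "\<dots> = 0"
  proof (rule sum.neutral, clarify)
    fix R \<phi> assume "(R, \<phi>) \<in> I"
    then have "subgroup R S" "\<phi> \<in> F R (carrier S)" using I by (auto simp: is_basis_comb_def)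
    then show "c (R, \<phi>) * of_nat (mark (basis_biset S S R \<phi>) P (\<lambda>x. x) \<theta>) = 0"
      using mark_basis_biset_eq_0[OF _ _ P \<theta> not] by simp
  qed
  finally show ?thesis .
qed

text \<open>At the empty set the mark counts all points. It is |S| times the contribution of
  [R, \<phi>] to the augmentation, which makes the augmentation a function of the element
  alone.\<close>

lemma mark_basis_biset_empty:
  assumes R: "subgroup R S" and \<phi>: "\<phi> \<in> hom (S\<lparr>carrier := R\<rparr>) S"
  shows "mark (basis_biset S S R \<phi>) ({} :: 'a set) (\<lambda>x. x) (\<lambda>x. x) = order S * card (rcosets R)"
proof -
  interpret B: basis_pair S S R \<phi> by (rule SS.GH.basis_pair[OF R \<phi>])
  have "card R * mark (basis_biset S S R \<phi>) ({} :: 'a set) (\<lambda>x. x) (\<lambda>x. x) = card (carrier S \<times> carrier S)"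
    using B.mark_basis_biset[of "{} :: 'a set" "\<lambda>x. x" "\<lambda>x. x"] by (simp add: Sigma_def)
  also have "\<dots> = card R * (order S * card (rcosets R))"
    using lagrange[OF R] by (simp add: card_cartesian_product order_def mult.commute mult.left_commute)
  finally show ?thesis using finite_sub[OF R] subgroup.one_closed[OF R] by auto
qed

lemma basis_comb_augmentation:
  assumes "is_basis_comb p S S I c X"
  shows "(\<Sum>(P, \<phi>)\<in>I. c (P, \<phi>) * of_nat (card (rcosets P))) =
    elem_mark X ({} :: 'a set) (\<lambda>x. x) (\<lambda>x. x) / of_nat (order S)"
proof -
  have "elem_mark X ({} :: 'a set) (\<lambda>x. x) (\<lambda>x. x) =
    (\<Sum>(P, \<phi>)\<in>I. c (P, \<phi>) * of_nat (mark (basis_biset S S P \<phi>) ({} :: 'a set) (\<lambda>x. x) (\<lambda>x. x)))"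
    by (rule SS.GH.elem_mark_basis_comb[OF assms]) auto
  also have "\<dots> = (\<Sum>(P, \<phi>)\<in>I. of_nat (order S) * (c (P, \<phi>) * of_nat (card (rcosets P))))"
    by (rule sum.cong[OF refl]) (use assms mark_basis_biset_empty in \<open>auto simp: is_basis_comb_def\<close>)
  also have "\<dots> = of_nat (order S) * (\<Sum>(P, \<phi>)\<in>I. c (P, \<phi>) * of_nat (card (rcosets P)))"
    by (simp add: sum_distrib_left case_prod_beta)
  finally show ?thesis using finite_carrier order_gt_0_iff_finite by simp
qed

text \<open>The definite description is justified because each basis combination of X yields the
  same value, the mark at the empty set divided by |S|.\<close>

lemma augmentation_eq:
  assumes "is_basis_comb p S S I c X"
  shows "augmentation S p X = (\<Sum>(P, \<phi>)\<in>I. c (P, \<phi>) * of_nat (card (rcosets P)))"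
  unfolding augmentation_def
proof (rule the_equality)
  fix r assume "\<exists>I c. is_basis_comb p S S I c X \<and> r = (\<Sum>(P, \<phi>)\<in>I. c (P, \<phi>) * of_nat (card (rcosets P)))"
  then show "r = (\<Sum>(P, \<phi>)\<in>I. c (P, \<phi>) * of_nat (card (rcosets P)))"
    using basis_comb_augmentation[OF assms] basis_comb_augmentation[of _ _ X] by auto
qed (use assms in blast)

text \<open>Summing over \<theta> counts each pair (h, g) with g P g^-1 inside R once and divides by
  |R|. The number of admissible g is |R| f by \<open>card_conjugators_into_subgroup\<close>, and h
  is free.\<close>

lemma sum_mark_basis_biset:
  assumes R: "subgroup R S" and \<phi>: "\<phi> \<in> hom (S\<lparr>carrier := R\<rparr>) S" and P: "subgroup P S"
  obtains f where "(\<Sum>\<theta>\<in>P \<rightarrow>\<^sub>E carrier S. mark (basis_biset S S R \<phi>) P (\<lambda>x. x) \<theta>) = order S * f"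
    "f mod p = card (rcosets R) mod p"
proof -
  interpret B: basis_pair S S R \<phi> by (rule SS.GH.basis_pair[OF R \<phi>])
  obtain k where k: "card P = p ^ k" using subgroup_card_prime_power[OF P] by blast
  obtain f where f: "card {g \<in> carrier S. \<forall>d\<in>P. g \<otimes> d \<otimes> inv g \<in> R} = card R * f" "f mod p = card (rcosets R) mod p"
    using card_conjugators_into_subgroup[OF finite_carrier R P prime_p k] by blast
  let ?A = "{(h, g) \<in> carrier S \<times> carrier S. \<forall>q\<in>P. g \<otimes> q \<otimes> inv g \<in> R}"
  let ?c = "\<lambda>(h, g) q. h \<otimes> \<phi> (g \<otimes> q \<otimes> inv g) \<otimes> inv h"
  have A: "?A = carrier S \<times> {g \<in> carrier S. \<forall>d\<in>P. g \<otimes> d \<otimes> inv g \<in> R}" by auto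
  have "card R * (\<Sum>\<theta>\<in>P \<rightarrow>\<^sub>E carrier S. mark (basis_biset S S R \<phi>) P (\<lambda>x. x) \<theta>) =
    (\<Sum>\<theta>\<in>P \<rightarrow>\<^sub>E carrier S. card {a \<in> ?A. \<forall>q\<in>P. \<theta> q = ?c a q})"
    unfolding sum_distrib_left
  proof (rule sum.cong[OF refl])
    fix \<theta> assume "\<theta> \<in> P \<rightarrow>\<^sub>E carrier S"
    then have "\<theta> \<in> P \<rightarrow> carrier S" by auto
    then have "card R * mark (basis_biset S S R \<phi>) P (\<lambda>x. x) \<theta> = card {(h, g) \<in> carrier S \<times> carrier S. \<forall>q\<in>P. g \<otimes> q \<otimes> inv g \<in> R \<and> \<theta> q = h \<otimes> \<phi> (g \<otimes> q \<otimes> inv g) \<otimes> inv h}"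
      using finite_sub[OF P] subgroup.subset[OF P] by (intro B.mark_basis_biset) auto
    also have "\<dots> = card {a \<in> ?A. \<forall>q\<in>P. \<theta> q = ?c a q}" by (rule arg_cong[where f = card]) auto
    finally show "card R * mark (basis_biset S S R \<phi>) P (\<lambda>x. x) \<theta> = card {a \<in> ?A. \<forall>q\<in>P. \<theta> q = ?c a q}" .
  qed
  also have "\<dots> = card ?A"
  proof -
    \<comment> \<open>The constant weight 1 turns the double counting of
      \<open>sum_PiE_card_eq\<close> into a count of \<open>?A\<close>.\<close>
    have "(\<Sum>\<theta>\<in>P \<rightarrow>\<^sub>E carrier S. (1::rat) * of_nat (card {a \<in> ?A. \<forall>q\<in>P. \<theta> q = ?c a q})) = (\<Sum>a\<in>?A. 1)"
      by (rule sum_PiE_card_eq[OF finite_sub[OF P] finite_carrier])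
        (use finite_carrier B.hom_in_carrier in \<open>auto simp: A\<close>)
    then have "(of_nat (\<Sum>\<theta>\<in>P \<rightarrow>\<^sub>E carrier S. card {a \<in> ?A. \<forall>q\<in>P. \<theta> q = ?c a q}) :: rat) = of_nat (card ?A)"
      by simp
    then show ?thesis by (simp only: of_nat_eq_iff)
  qed
  also have "\<dots> = card R * (order S * f)" unfolding A card_cartesian_product f(1) by (simp add: order_def)
  finally have "(\<Sum>\<theta>\<in>P \<rightarrow>\<^sub>E carrier S. mark (basis_biset S S R \<phi>) P (\<lambda>x. x) \<theta>) = order S * f"
    using finite_sub[OF R] subgroup.one_closed[OF R] by auto
  then show ?thesis using f(2) that by blast
qed

text \<open>The marks at P sum to |S| times the sum of the c_i f_i, with f_i congruent modulo p to
  the index of the i-th subgroup P_i. If all marks vanish, subtracting this zero sum writes the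
  augmentation as the sum of the c_i (|S : P_i| - f_i), a multiple of p in the p-local
  integers.\<close>

lemma char_idempotent_elem_mark_nonzero:
  assumes \<omega>: "characteristic_idempotent S p F \<omega>" and P: "subgroup P S"
  shows "\<exists>\<theta>\<in>P \<rightarrow>\<^sub>E carrier S. elem_mark \<omega> P (\<lambda>x. x) \<theta> \<noteq> 0"
proof (rule ccontr)
  assume "\<not> ?thesis"
  then have 0: "(\<Sum>\<theta>\<in>P \<rightarrow>\<^sub>E carrier S. elem_mark \<omega> P (\<lambda>x. x) \<theta>) = 0" by simp
  obtain I c where I: "is_basis_comb p S S I c \<omega>"
    using \<omega> unfolding characteristic_idempotent_def F_generated_def by blast
  have Ih: "subgroup (fst i) S" "snd i \<in> hom (S\<lparr>carrier := fst i\<rparr>) S" "c i \<in> Z_loc p" if "i \<in> I" for i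
    using that I by (auto simp: is_basis_comb_def)
  have "\<forall>i\<in>I. \<exists>f. (\<Sum>\<theta>\<in>P \<rightarrow>\<^sub>E carrier S. mark (basis_biset S S (fst i) (snd i)) P (\<lambda>x. x) \<theta>) = order S * f \<and>
    f mod p = card (rcosets (fst i)) mod p"
    using sum_mark_basis_biset[OF Ih(1,2) P] by metis
  then obtain f where f: "\<And>i. i \<in> I \<Longrightarrow> (\<Sum>\<theta>\<in>P \<rightarrow>\<^sub>E carrier S. mark (basis_biset S S (fst i) (snd i)) P (\<lambda>x. x) \<theta>) = order S * f i"
    "\<And>i. i \<in> I \<Longrightarrow> f i mod p = card (rcosets (fst i)) mod p" by metis
  have "(\<Sum>\<theta>\<in>P \<rightarrow>\<^sub>E carrier S. elem_mark \<omega> P (\<lambda>x. x) \<theta>) =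
    (\<Sum>\<theta>\<in>P \<rightarrow>\<^sub>E carrier S. \<Sum>i\<in>I. c i * of_nat (mark (basis_biset S S (fst i) (snd i)) P (\<lambda>x. x) \<theta>))"
  proof (rule sum.cong[OF refl])
    fix \<theta> assume "\<theta> \<in> P \<rightarrow>\<^sub>E carrier S"
    then have "\<theta> \<in> P \<rightarrow> carrier S" "(\<lambda>x. x) \<in> P \<rightarrow> carrier S" using subgroup.subset[OF P] by auto
    then show "elem_mark \<omega> P (\<lambda>x. x) \<theta> = (\<Sum>i\<in>I. c i * of_nat (mark (basis_biset S S (fst i) (snd i)) P (\<lambda>x. x) \<theta>))"
      using SS.GH.elem_mark_basis_comb[OF I, of "\<lambda>x. x" P \<theta>] by (simp add: case_prod_beta)
  qed
  also have "\<dots> = (\<Sum>i\<in>I. c i * of_nat (\<Sum>\<theta>\<in>P \<rightarrow>\<^sub>E carrier S. mark (basis_biset S S (fst i) (snd i)) P (\<lambda>x. x) \<theta>))"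
    by (subst sum.swap) (simp add: sum_distrib_left)
  also have "\<dots> = (\<Sum>i\<in>I. of_nat (order S) * (c i * of_nat (f i)))"
    by (rule sum.cong[OF refl]) (simp add: f)
  also have "\<dots> = of_nat (order S) * (\<Sum>i\<in>I. c i * of_nat (f i))" by (simp only: sum_distrib_left)
  finally have fsum: "(\<Sum>i\<in>I. c i * of_nat (f i)) = 0"
    using 0 finite_carrier order_gt_0_iff_finite by simp
  have "augmentation S p \<omega> = (\<Sum>i\<in>I. c i * of_nat (card (rcosets (fst i))))"
    using augmentation_eq[OF I] by (simp add: case_prod_beta)
  also have "\<dots> = (\<Sum>i\<in>I. c i * of_nat (card (rcosets (fst i)))) - (\<Sum>i\<in>I. c i * of_nat (f i))" using fsum by simp
  also have "\<dots> = (\<Sum>i\<in>I. c i * of_int (int (card (rcosets (fst i))) - int (f i)))"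
    by (simp add: sum_subtractf right_diff_distrib)
  \<comment> \<open>By the congruence each integer factor is divisible by p, so the integer division
    here is exact.\<close>
  also have "\<dots> = (\<Sum>i\<in>I. of_nat p * (c i * of_int ((int (card (rcosets (fst i))) - int (f i)) div int p)))"
  proof (rule sum.cong[OF refl])
    fix i assume "i \<in> I"
    then have "int (f i) mod int p = int (card (rcosets (fst i))) mod int p" using f(2) by (metis of_nat_mod)
    then have "int p dvd int (card (rcosets (fst i))) - int (f i)" by (metis mod_eq_dvd_iff)
    then have "int (card (rcosets (fst i))) - int (f i) = int p * ((int (card (rcosets (fst i))) - int (f i)) div int p)" by simp
    then have "(of_int (int (card (rcosets (fst i))) - int (f i)) :: rat) = of_nat p * of_int ((int (card (rcosets (fst i))) - int (f i)) div int p)"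
      by (metis of_int_mult of_int_of_nat_eq)
    then show "c i * of_int (int (card (rcosets (fst i))) - int (f i)) = of_nat p * (c i * of_int ((int (card (rcosets (fst i))) - int (f i)) div int p))"
      by (simp only: mult.left_commute)
  qed
  also have "\<dots> = of_nat p * (\<Sum>i\<in>I. c i * of_int ((int (card (rcosets (fst i))) - int (f i)) div int p))" by (simp only: sum_distrib_left)
  finally have aug: "augmentation S p \<omega> = of_nat p * (\<Sum>i\<in>I. c i * of_int ((int (card (rcosets (fst i))) - int (f i)) div int p))" .
  have "finite I" using I by (simp add: is_basis_comb_def)
  then have "(\<Sum>i\<in>I. c i * of_int (g i)) \<in> Z_loc p" for g
    using Ih(3) by (induction I rule: finite_induct)
      (auto intro!: Z_loc_add[OF prime_p] Z_loc_mult[OF prime_p] Z_loc_0[OF prime_p] Z_loc_of_int prime_gt_1_nat[OF prime_p])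
  from this[of "\<lambda>i. (int (card (rcosets (fst i))) - int (f i)) div int p"] aug
  show False using \<omega> unfolding characteristic_idempotent_def by blast
qed

text \<open>Left stability and generation leave one unknown m, the mark at the inclusion. In the
  mark of the square each morphism in F(P,S) contributes m^2, so idempotence reads |S| m = |F(P,S)|
  m^2, and m is nonzero.\<close>

theorem char_idempotent_elem_mark:
  assumes \<omega>: "characteristic_idempotent S p F \<omega>" and P: "subgroup P S" and \<phi>: "\<phi> \<in> P \<rightarrow>\<^sub>E carrier S"
  shows "elem_mark \<omega> P (\<lambda>x. x) \<phi> =
    (if \<phi> \<in> F P (carrier S) then of_nat (card (carrier S)) / of_nat (card (F P (carrier S))) else 0)"
proof (cases "\<phi> \<in> F P (carrier S)")
  case False
  then show ?thesis using generated_elem_mark_eq_0[OF _ P \<phi> False] \<omega> unfolding characteristic_idempotent_def by simp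
next
  case True
  have X: "\<omega> \<in> carrier (burnside p S S)" and idem: "burnside_comp p S S S \<omega> \<omega> = \<omega>" and gen: "F_generated S p F \<omega>"
    and ls: "left_stable S p F S \<omega>" and rs: "right_stable S p F S \<omega>"
    using \<omega> by (auto simp: characteristic_idempotent_def)
  let ?m = "elem_mark \<omega> P (\<lambda>x. x) (\<lambda>x. x)"
  have idP: "(\<lambda>x. x) \<in> P \<rightarrow> carrier S" using subgroup.subset[OF P] by auto
  have val: "elem_mark \<omega> P (\<lambda>x. x) \<theta> = (if \<theta> \<in> F P (carrier S) then ?m else 0)" if "\<theta> \<in> P \<rightarrow>\<^sub>E carrier S" for \<theta>
    using left_stable_elem_mark[OF X ls P _ idP] generated_elem_mark_eq_0[OF gen P that] by auto
  have nz: "?m \<noteq> 0" using char_idempotent_elem_mark_nonzero[OF \<omega> P] val by metis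
  have fin: "finite (P \<rightarrow>\<^sub>E carrier S)" using finite_sub[OF P] finite_carrier by (simp add: finite_PiE)
  have "of_nat (card (carrier S)) * ?m = (\<Sum>\<theta>\<in>P \<rightarrow>\<^sub>E carrier S. elem_mark \<omega> P \<theta> (\<lambda>x. x) * elem_mark \<omega> P (\<lambda>x. x) \<theta>)"
    using SS.elem_mark_comp[OF X X finite_sub[OF P] idP idP] idem by simp
  \<comment> \<open>Outside F the second factor vanishes; inside, right stability replaces the first
    map \<theta> by the inclusion.\<close>
  also have "\<dots> = (\<Sum>\<theta>\<in>P \<rightarrow>\<^sub>E carrier S. if \<theta> \<in> F P (carrier S) then ?m * ?m else 0)"
    by (rule sum.cong[OF refl]) (auto simp: val right_stable_elem_mark[OF X rs P _ idP])
  also have "\<dots> = (\<Sum>\<theta>\<in>F P (carrier S). ?m * ?m)"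
  proof -
    have "(P \<rightarrow>\<^sub>E carrier S) \<inter> F P (carrier S) = F P (carrier S)" using mor_hom(6)[OF P subgroup_self] by blast
    then show ?thesis using fin by (simp add: sum.If_cases Int_def)
  qed
  also have "\<dots> = of_nat (card (F P (carrier S))) * ?m * ?m" by simp
  finally have "of_nat (card (carrier S)) = of_nat (card (F P (carrier S))) * ?m" using nz by simp
  then have "?m = of_nat (card (carrier S)) / of_nat (card (F P (carrier S)))"
    using card_mor_pos[OF P] by (simp add: field_simps)
  then show ?thesis using val[OF \<phi>] True by simp
qed

end

section \<open>Residual subgroups\<close>

text \<open>The target is cut down to the image because the isomorphism theorem for factor groups
  asks for a surjective map.\<close>

lemma (in group_hom) card_rcosets_kernel: "card (rcosets\<^bsub>G\<^esub> (kernel G H h)) = card (h ` carrier G)"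
proof -
  let ?I = "H\<lparr>carrier := h ` carrier G\<rparr>"
  interpret im: group_hom G ?I h
    using H.subgroup_imp_group[OF img_is_subgroup] homh G.is_group
    by (auto simp: group_hom_def group_hom_axioms_def hom_def)
  have "(\<lambda>X. the_elem (h ` X)) \<in> iso (G Mod kernel G ?I h) ?I" by (rule im.FactGroup_iso_set) simp
  then have "bij_betw (\<lambda>X. the_elem (h ` X)) (carrier (G Mod kernel G ?I h)) (carrier ?I)" by (simp add: iso_def)
  then have "card (carrier (G Mod kernel G ?I h)) = card (carrier ?I)" by (rule bij_betw_same_card)
  then show ?thesis by (simp add: FactGroup_def kernel_def)
qed

lemma (in group_hom) card_image_dvd_order: "card (h ` carrier G) dvd order G"
  using G.lagrange[OF subgroup_kernel] card_rcosets_kernel by (metis dvd_triv_left)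

lemma (in group_hom) card_rcosets_kernel_dvd: "card (rcosets\<^bsub>G\<^esub> (kernel G H h)) dvd order H"
  unfolding card_rcosets_kernel using H.lagrange[OF img_is_subgroup] by (metis dvd_triv_right)

lemma (in group) rcosets_hom: "N \<lhd> G \<Longrightarrow> group_hom G (G Mod N) (\<lambda>g. N #> g)"
  by (simp add: group_hom_def group_hom_axioms_def normal.factorgroup_is_group normal.r_coset_hom_Mod is_group)

lemma (in group) kernel_rcosets_hom:
  assumes "N \<lhd> G"
  shows "kernel G (G Mod N) (\<lambda>g. N #> g) = N"
proof -
  interpret N: normal N G by fact
  have "N #> g = N \<longleftrightarrow> g \<in> N" if "g \<in> carrier G" for g
  proof
    assume "N #> g = N" then show "g \<in> N" by (rule coset_join1[OF _ that N.is_subgroup])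
  next
    assume "g \<in> N" then show "N #> g = N" by (rule coset_join2[OF that N.is_subgroup])
  qed
  then show ?thesis using N.subset by (auto simp: kernel_def)
qed

text \<open>The condition \<open>C\<close> on the index covers both cases: p-power index gives O^p,
  and index prime to p gives O^{p'}.\<close>

definition index_residual :: "(nat \<Rightarrow> bool) \<Rightarrow> ('a, 'm) monoid_scheme \<Rightarrow> 'a set" where
  "index_residual C G = (LEAST N. N \<lhd> G \<and> C (card (rcosets\<^bsub>G\<^esub> N)))"

text \<open>Closure under divisors of products is what intersections require, because |G : N
  \<inter> M| divides |G : N| |G : M|.\<close>

locale index_class =
  fixes C :: "nat \<Rightarrow> bool"
  assumes C_one: "C 1" and C_mult_dvd: "\<lbrakk>C a; C b; d dvd a * b\<rbrakk> \<Longrightarrow> C d"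
begin

text \<open>N \<inter> M is the kernel of the map from G to G/N \<times> G/M, so its index divides
  the order of this product.\<close>

lemma normal_inter:
  assumes G: "group G" and N: "N \<lhd> G" "C (card (rcosets\<^bsub>G\<^esub> N))" and M: "M \<lhd> G" "C (card (rcosets\<^bsub>G\<^esub> M))"
  shows "N \<inter> M \<lhd> G \<and> C (card (rcosets\<^bsub>G\<^esub> (N \<inter> M)))"
proof -
  interpret G: group G by fact
  let ?h = "\<lambda>g. (N #>\<^bsub>G\<^esub> g, M #>\<^bsub>G\<^esub> g)"
  let ?H = "(G Mod N) \<times>\<times> (G Mod M)"
  interpret gN: group_hom G "G Mod N" "\<lambda>g. N #>\<^bsub>G\<^esub> g" using G.rcosets_hom[OF N(1)] .
  interpret gM: group_hom G "G Mod M" "\<lambda>g. M #>\<^bsub>G\<^esub> g" using G.rcosets_hom[OF M(1)] .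
  interpret h: group_hom G ?H ?h
  proof -
    have "?h \<in> hom G ?H"
      by (rule homI) (simp_all del: mult_FactGroup)
    then show "group_hom G ?H ?h"
      using DirProd_group[OF gN.H.is_group gM.H.is_group] G by (simp add: group_hom_def group_hom_axioms_def)
  qed
  have "kernel G ?H ?h = kernel G (G Mod N) (\<lambda>g. N #>\<^bsub>G\<^esub> g) \<inter> kernel G (G Mod M) (\<lambda>g. M #>\<^bsub>G\<^esub> g)"
    by (auto simp: kernel_def DirProd_def)
  then have k: "kernel G ?H ?h = N \<inter> M"
    using G.kernel_rcosets_hom[OF N(1)] G.kernel_rcosets_hom[OF M(1)] by simp
  have "card (rcosets\<^bsub>G\<^esub> (N \<inter> M)) dvd card (rcosets\<^bsub>G\<^esub> N) * card (rcosets\<^bsub>G\<^esub> M)"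
    using h.card_rcosets_kernel_dvd unfolding k by (simp add: order_def DirProd_def FactGroup_def card_cartesian_product)
  then show ?thesis using C_mult_dvd[OF N(2) M(2)] h.normal_kernel k by simp
qed

text \<open>A member of least cardinality lies inside every other member, since intersecting it with
  another member cannot make it smaller. Thus a least element under inclusion exists, as
  \<open>LEAST\<close> presupposes.\<close>

lemma index_residual:
  assumes G: "group G" and fin: "finite (carrier G)"
  shows "index_residual C G \<lhd> G" "C (card (rcosets\<^bsub>G\<^esub> (index_residual C G)))"
    "\<And>M. \<lbrakk>M \<lhd> G; C (card (rcosets\<^bsub>G\<^esub> M))\<rbrakk> \<Longrightarrow> index_residual C G \<subseteq> M"
proof -
  interpret G: group G by fact
  let ?P = "\<lambda>N. N \<lhd> G \<and> C (card (rcosets\<^bsub>G\<^esub> N))"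
  have "card (rcosets\<^bsub>G\<^esub> (carrier G)) * card (carrier G) = order G" by (rule G.lagrange[OF G.subgroup_self])
  moreover have "order G > 0" using fin by (simp add: G.order_gt_0_iff_finite)
  ultimately have "card (rcosets\<^bsub>G\<^esub> (carrier G)) = 1" by (simp add: order_def)
  then have "?P (carrier G)" using C_one G.normal_self by simp
  then obtain N where N: "?P N" and min: "\<And>M. ?P M \<Longrightarrow> card N \<le> card M"
    using ex_has_least_nat[of ?P "carrier G" card] by blast
  have finN: "finite N" using fin N by (meson normal_imp_subgroup finite_subset subgroup.subset)
  have least: "N \<subseteq> M" if M: "?P M" for M
  proof -
    have "?P (N \<inter> M)" using normal_inter[OF G] N M by blast
    then have "card N \<le> card (N \<inter> M)" by (rule min)
    then have "N \<inter> M = N" using finN by (intro card_seteq) auto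
    then show ?thesis by blast
  qed
  have "index_residual C G = N" unfolding index_residual_def
    by (rule Least_equality) (use N least in auto)
  then show "index_residual C G \<lhd> G" "C (card (rcosets\<^bsub>G\<^esub> (index_residual C G)))"
    "\<And>M. \<lbrakk>M \<lhd> G; C (card (rcosets\<^bsub>G\<^esub> M))\<rbrakk> \<Longrightarrow> index_residual C G \<subseteq> M"
    using N least by auto
qed

text \<open>The preimage of the residual of H is the kernel of the map from G to the quotient of H
  by its residual. Its index is therefore admissible, and it contains the residual of G.\<close>

lemma index_residual_hom:
  assumes "group_hom G H h" and fin: "finite (carrier G)" "finite (carrier H)" and x: "x \<in> index_residual C G"
  shows "h x \<in> index_residual C H"
proof -
  interpret h: group_hom G H h by fact
  let ?N = "index_residual C H"
  note N = index_residual[OF h.H.is_group fin(2)]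
  interpret q: group_hom H "H Mod ?N" "\<lambda>g. ?N #>\<^bsub>H\<^esub> g" using h.H.rcosets_hom[OF N(1)] .
  interpret c: group_hom G "H Mod ?N" "\<lambda>g. ?N #>\<^bsub>H\<^esub> h g"
    by unfold_locales (auto intro!: homI)
  have k: "kernel G (H Mod ?N) (\<lambda>g. ?N #>\<^bsub>H\<^esub> h g) = {g \<in> carrier G. h g \<in> ?N}"
  proof -
    have "?N #>\<^bsub>H\<^esub> h g = ?N \<longleftrightarrow> h g \<in> ?N" if "g \<in> carrier G" for g
    proof -
      have "h g \<in> kernel H (H Mod ?N) (\<lambda>g. ?N #>\<^bsub>H\<^esub> g) \<longleftrightarrow> ?N #>\<^bsub>H\<^esub> h g = ?N"
        using h.hom_closed[OF that] by (simp add: kernel_def)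
      then show ?thesis unfolding h.H.kernel_rcosets_hom[OF N(1)] by blast
    qed
    then show ?thesis by (auto simp: kernel_def)
  qed
  \<comment> \<open>The index on the right is squared only to match the form of
    \<open>C_mult_dvd\<close>.\<close>
  have "card (rcosets\<^bsub>G\<^esub> {g \<in> carrier G. h g \<in> ?N}) dvd card (rcosets\<^bsub>H\<^esub> ?N) * card (rcosets\<^bsub>H\<^esub> ?N)"
    using c.card_rcosets_kernel_dvd unfolding k by (simp add: order_def FactGroup_def)
  then have "C (card (rcosets\<^bsub>G\<^esub> {g \<in> carrier G. h g \<in> ?N}))" using C_mult_dvd[OF N(2) N(2)] by blast
  then have "index_residual C G \<subseteq> {g \<in> carrier G. h g \<in> ?N}"
    using index_residual(3)[OF h.G.is_group fin(1)] c.normal_kernel k by simp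
  then show ?thesis using x by blast
qed

end

lemma index_class_p_power:
  assumes "prime p"
  shows "index_class (\<lambda>n. \<exists>k. n = p ^ k)"
proof
  show "\<exists>k. 1 = p ^ k" by (rule exI[of _ 0]) simp
  fix a b d assume "\<exists>k. a = p ^ k" "\<exists>k. b = p ^ k" "d dvd a * b"
  then obtain i j where "d dvd p ^ (i + j)" by (auto simp: power_add)
  then show "\<exists>k. d = p ^ k" using assms by (metis divides_primepow_nat)
qed

lemma index_class_coprime: "index_class (\<lambda>n. coprime p n)"
proof
  fix a b d :: nat assume "coprime p a" "coprime p b" "d dvd a * b"
  then show "coprime p d" by (meson coprime_divisors coprime_mult_right_iff dvd_refl)
qed simp

lemma O_p_residual_eq: "O_p_residual p G = index_residual (\<lambda>n. \<exists>k. n = p ^ k) G"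
  by (simp add: O_p_residual_def index_residual_def)

lemma O_p'_residual_eq: "O_p'_residual p G = index_residual (\<lambda>n. coprime p n) G"
  by (simp add: O_p'_residual_def index_residual_def)

lemma sylow_index_coprime:
  assumes "group G" "finite (carrier G)" "prime p" "sylow_subgroup p G Q"
  shows "coprime p (card (rcosets\<^bsub>G\<^esub> Q))"
proof -
  interpret G: group G by fact
  have Q: "subgroup Q G" "card Q = p ^ multiplicity p (order G)" using assms(4) by (auto simp: sylow_subgroup_def)
  have eq: "card (rcosets\<^bsub>G\<^esub> Q) * p ^ multiplicity p (order G) = order G" using G.lagrange[OF Q(1)] Q(2) by simp
  have "order G \<noteq> 0" using assms(2) G.order_gt_0_iff_finite by simp
  have "\<not> p dvd card (rcosets\<^bsub>G\<^esub> Q)"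
  proof
    assume "p dvd card (rcosets\<^bsub>G\<^esub> Q)"
    then obtain m where "card (rcosets\<^bsub>G\<^esub> Q) = p * m" by (rule dvdE)
    then have "order G = p ^ Suc (multiplicity p (order G)) * m" using eq by (simp add: mult.commute mult.left_commute)
    then have "p ^ Suc (multiplicity p (order G)) dvd order G" by (rule dvdI)
    moreover have "\<not> is_unit p" using assms(3) not_prime_unit by blast
    ultimately have "Suc (multiplicity p (order G)) \<le> multiplicity p (order G)"
      using \<open>order G \<noteq> 0\<close> by (intro multiplicity_geI) auto
    then show False by simp
  qed
  then show ?thesis using assms(3) by (simp add: prime_imp_coprime)
qed

text \<open>The index of the product N Q divides |G : N|, a power of p, as well as |G : Q|, which is
  prime to p. So it is 1.\<close>

lemma O_p_residual_mult_sylow: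
  assumes "group G" "finite (carrier G)" "prime p" "sylow_subgroup p G Q" "g \<in> carrier G"
  obtains n q where "n \<in> O_p_residual p G" "q \<in> Q" "g = n \<otimes>\<^bsub>G\<^esub> q"
proof -
  interpret G: group G by fact
  interpret C: index_class "\<lambda>n. \<exists>k. n = p ^ k" by (rule index_class_p_power[OF assms(3)])
  let ?N = "O_p_residual p G"
  note N = C.index_residual(1,2)[OF assms(1,2), folded O_p_residual_eq]
  have Q: "subgroup Q G" using assms(4) by (auto simp: sylow_subgroup_def)
  have Nsub: "subgroup ?N G" using N(1) normal_imp_subgroup by blast
  interpret Q: subgroup Q G by (rule Q)
  interpret N: subgroup ?N G by (rule Nsub)
  let ?NQ = "?N <#>\<^bsub>G\<^esub> Q"
  have NQ: "subgroup ?NQ G" using G.mult_norm_subgroup[OF N(1) Q] .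
  have fin: "finite ?NQ" using subgroup.subset[OF NQ] assms(2) finite_subset by blast
  have sub: "?N \<subseteq> ?NQ" "Q \<subseteq> ?NQ"
  proof -
    show "?N \<subseteq> ?NQ"
    proof
      fix n assume "n \<in> ?N"
      then have "n \<otimes>\<^bsub>G\<^esub> \<one>\<^bsub>G\<^esub> \<in> ?NQ" unfolding set_mult_def using Q.one_closed by blast
      then show "n \<in> ?NQ" using \<open>n \<in> ?N\<close> N.mem_carrier by simp
    qed
    show "Q \<subseteq> ?NQ"
    proof
      fix q assume "q \<in> Q"
      then have "\<one>\<^bsub>G\<^esub> \<otimes>\<^bsub>G\<^esub> q \<in> ?NQ" unfolding set_mult_def using N.one_closed by blast
      then show "q \<in> ?NQ" using \<open>q \<in> Q\<close> Q.mem_carrier by simp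
    qed
  qed
  have dvd: "card H dvd card ?NQ" if "subgroup H G" "H \<subseteq> ?NQ" for H
  proof -
    have "subgroup H (G\<lparr>carrier := ?NQ\<rparr>)" using that NQ by (simp add: G.subgroup_incl)
    then have "card (rcosets\<^bsub>G\<lparr>carrier := ?NQ\<rparr>\<^esub> H) * card H = card ?NQ"
      using group.lagrange[OF G.subgroup_imp_group[OF NQ]] by (simp add: order_def)
    then show ?thesis by (metis dvd_triv_right)
  qed
  have idx: "card (rcosets\<^bsub>G\<^esub> ?NQ) * card ?NQ = order G" by (rule G.lagrange[OF NQ])
  have pos: "card ?N > 0" "card Q > 0" "order G > 0"
    using assms(2) N.one_closed Q.one_closed finite_subset[OF N.subset] finite_subset[OF Q.subset]
    unfolding card_gt_0_iff G.order_gt_0_iff_finite by blast+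
  obtain k where k: "card (rcosets\<^bsub>G\<^esub> ?N) = p ^ k" using N(2) by blast
  obtain m where m: "card ?NQ = card ?N * m" using dvd[OF Nsub sub(1)] by (auto elim: dvdE)
  have "card (rcosets\<^bsub>G\<^esub> ?NQ) * m * card ?N = p ^ k * card ?N"
    using idx m G.lagrange[OF Nsub] k by (simp add: mult.commute mult.left_commute)
  then have "card (rcosets\<^bsub>G\<^esub> ?NQ) dvd p ^ k" using pos(1) by (metis dvd_triv_left mult_cancel2 not_gr_zero)
  then obtain j where j: "card (rcosets\<^bsub>G\<^esub> ?NQ) = p ^ j" using assms(3) by (metis divides_primepow_nat)
  obtain l where l: "card ?NQ = card Q * l" using dvd[OF Q sub(2)] by (auto elim: dvdE)
  have "card (rcosets\<^bsub>G\<^esub> ?NQ) * l * card Q = card (rcosets\<^bsub>G\<^esub> Q) * card Q"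
    using idx l G.lagrange[OF Q] by (simp add: mult.commute mult.left_commute)
  then have "card (rcosets\<^bsub>G\<^esub> ?NQ) dvd card (rcosets\<^bsub>G\<^esub> Q)" using pos(2) by (metis dvd_triv_left mult_cancel2 not_gr_zero)
  then have "coprime p (p ^ j)"
    using sylow_index_coprime[OF assms(1-4)] j by (metis coprime_divisors dvd_refl)
  then have "j = 0" using assms(3) by (metis coprime_power_right_iff coprime_self not_prime_unit neq0_conv)
  then have "card ?NQ = card (carrier G)" using idx j by (simp add: order_def)
  then have "?NQ = carrier G" using subgroup.subset[OF NQ] assms(2) by (metis card_subset_eq)
  then have "g \<in> ?NQ" using assms(5) by simp
  then show ?thesis using that unfolding set_mult_def by blast
qed

section \<open>Automizers\<close>

context fusion_system
begin

lemma conj_mem_normalizer: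
  assumes "subgroup P S" "g \<in> normalizer S P" "x \<in> P"
  shows "g \<otimes> x \<otimes> inv g \<in> P"
proof -
  have "(\<lambda>x. g \<otimes> x \<otimes> inv g) ` P = P"
    using assms(2) by (simp add: mem_normalizer_iff[OF is_group subgroup.subset[OF assms(1)]])
  then show ?thesis using assms(3) by blast
qed

lemma normalizerI:
  assumes "subgroup P S" "g \<in> carrier S" "\<And>x. x \<in> P \<Longrightarrow> g \<otimes> x \<otimes> inv g \<in> P"
  shows "g \<in> normalizer S P"
  using conj_image_eq_of_subset[OF finite_sub[OF assms(1)] subgroup.subset[OF assms(1)] assms(2,3)] assms(2)
  by (simp add: mem_normalizer_iff[OF is_group subgroup.subset[OF assms(1)]])

lemma normalizer_carrier: "subgroup P S \<Longrightarrow> g \<in> normalizer S P \<Longrightarrow> g \<in> carrier S"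
  by (simp add: mem_normalizer_iff[OF is_group subgroup.subset])

lemma conj_hom_self: "subgroup P S \<Longrightarrow> conj_hom S P P = (\<lambda>g. \<lambda>x\<in>P. g \<otimes> x \<otimes> inv g) ` normalizer S P"
proof (intro subset_antisym subsetI)
  assume P: "subgroup P S"
  fix c assume "c \<in> conj_hom S P P"
  then obtain g where "g \<in> carrier S" "\<forall>x\<in>P. g \<otimes> x \<otimes> inv g \<in> P" "c = (\<lambda>x\<in>P. g \<otimes> x \<otimes> inv g)"
    by (auto simp: conj_hom_def)
  then show "c \<in> (\<lambda>g. \<lambda>x\<in>P. g \<otimes> x \<otimes> inv g) ` normalizer S P" using normalizerI[OF P] by blast
next
  assume P: "subgroup P S"
  fix c assume "c \<in> (\<lambda>g. \<lambda>x\<in>P. g \<otimes> x \<otimes> inv g) ` normalizer S P"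
  then obtain g where "g \<in> normalizer S P" "c = (\<lambda>x\<in>P. g \<otimes> x \<otimes> inv g)" by blast
  then show "c \<in> conj_hom S P P"
    using normalizer_carrier[OF P] conj_mem_normalizer[OF P] by (auto simp: conj_hom_def intro!: exI[of _ g])
qed

lemma subgroup_normalizer: "subgroup P S \<Longrightarrow> subgroup (normalizer S P) S"
  by (rule normalizer_imp_subgroup) (rule subgroup.subset)

lemma aut_image: "\<lbrakk>subgroup P S; \<alpha> \<in> F P P\<rbrakk> \<Longrightarrow> \<alpha> ` P = P"
  by (rule endo_inj_surj[OF finite_sub mor_hom(4) mor_hom(3)])

lemma aut_Bij: "\<lbrakk>subgroup P S; \<alpha> \<in> F P P\<rbrakk> \<Longrightarrow> \<alpha> \<in> Bij P"
  using mor_hom(3,5)[of P P \<alpha>] aut_image[of P \<alpha>] by (simp add: Bij_def bij_betw_def)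

lemma aut_subgroup_BijGroup:
  assumes P: "subgroup P S"
  shows "subgroup (F P P) (BijGroup P)"
proof (rule group.subgroupI[OF group_BijGroup])
  show "F P P \<subseteq> carrier (BijGroup P)" using aut_Bij[OF P] by (auto simp: BijGroup_def)
  show "F P P \<noteq> {}" using incl_mor[OF P P] by blast
next
  fix \<alpha> assume \<alpha>: "\<alpha> \<in> F P P"
  then show "inv\<^bsub>BijGroup P\<^esub> \<alpha> \<in> F P P"
    unfolding inv_BijGroup[OF aut_Bij[OF P \<alpha>]] using mor_inverse[OF P P \<alpha>] aut_image[OF P \<alpha>] by simp
next
  fix \<alpha> \<beta> assume "\<alpha> \<in> F P P" "\<beta> \<in> F P P"
  then show "\<alpha> \<otimes>\<^bsub>BijGroup P\<^esub> \<beta> \<in> F P P"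
    using aut_Bij[OF P] comp_closed[OF P P P] by (simp add: BijGroup_def)
qed

lemma group_aut_group: "subgroup P S \<Longrightarrow> group (aut_group F P)"
  unfolding aut_group_def using group.subgroup_imp_group[OF group_BijGroup aut_subgroup_BijGroup] .

lemma carrier_aut_group [simp]: "carrier (aut_group F P) = F P P"
  by (simp add: aut_group_def)

lemma mult_aut_group: "\<lbrakk>subgroup P S; \<alpha> \<in> F P P; \<beta> \<in> F P P\<rbrakk> \<Longrightarrow> \<alpha> \<otimes>\<^bsub>aut_group F P\<^esub> \<beta> = compose P \<alpha> \<beta>"
  using aut_Bij by (simp add: aut_group_def BijGroup_def)

lemma one_aut_group: "\<one>\<^bsub>aut_group F P\<^esub> = (\<lambda>x\<in>P. x)"
  by (simp add: aut_group_def BijGroup_def)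

lemma inv_aut_group:
  assumes "subgroup P S" "\<alpha> \<in> F P P"
  shows "inv\<^bsub>aut_group F P\<^esub> \<alpha> = restrict (inv_into P \<alpha>) P"
  using group.m_inv_consistent[OF group_BijGroup aut_subgroup_BijGroup[OF assms(1)] assms(2)]
    inv_BijGroup[OF aut_Bij[OF assms]] by (simp add: aut_group_def)

lemma finite_aut_group: "subgroup P S \<Longrightarrow> finite (carrier (aut_group F P))"
  by (simp add: finite_mor)

text \<open>Conjugation by N_S(P), carried over to Q by \<phi>. The extender of \<phi> is the
  preimage of Aut_S(Q) under this homomorphism.\<close>

lemma transported_conj_hom:
  assumes P: "subgroup P S" and Q: "subgroup Q S" and \<phi>: "\<phi> \<in> F P Q" and img: "\<phi> ` P = Q"
  shows "group_hom (S\<lparr>carrier := normalizer S P\<rparr>) (aut_group F Q)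
    (\<lambda>g. \<lambda>y\<in>Q. \<phi> (g \<otimes> inv_into P \<phi> y \<otimes> inv g))" (is "group_hom _ _ ?h")
proof -
  let ?i = "inv_into P \<phi>"
  have i: "?i y \<in> P" "\<phi> (?i y) = y" if "y \<in> Q" for y
    using that img by (auto intro: inv_into_into f_inv_into_f)
  have ii: "?i (\<phi> x) = x" if "x \<in> P" for x using that mor_hom(3)[OF P Q \<phi>] by simp
  have \<phi>i: "restrict ?i Q \<in> F Q P" using mor_inverse[OF P Q \<phi>] img by simp
  have cl: "?h g \<in> F Q Q" if g: "g \<in> normalizer S P" for g
  proof -
    have c: "(\<lambda>x\<in>P. g \<otimes> x \<otimes> inv g) \<in> F P P"
      by (rule conj_mor[OF P P normalizer_carrier[OF P g] conj_mem_normalizer[OF P g]])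
    have "compose Q \<phi> (compose Q (\<lambda>x\<in>P. g \<otimes> x \<otimes> inv g) (restrict ?i Q)) \<in> F Q Q"
      by (rule comp_closed[OF Q P Q comp_closed[OF Q P P \<phi>i c] \<phi>])
    moreover have "compose Q \<phi> (compose Q (\<lambda>x\<in>P. g \<otimes> x \<otimes> inv g) (restrict ?i Q)) = ?h g"
      using i by (auto simp: compose_def fun_eq_iff)
    ultimately show ?thesis by simp
  qed
  have "?h \<in> hom (S\<lparr>carrier := normalizer S P\<rparr>) (aut_group F Q)"
  proof (rule homI)
    fix g assume "g \<in> carrier (S\<lparr>carrier := normalizer S P\<rparr>)"
    then show "?h g \<in> carrier (aut_group F Q)" using cl by simp
  next
    fix g k assume "g \<in> carrier (S\<lparr>carrier := normalizer S P\<rparr>)" "k \<in> carrier (S\<lparr>carrier := normalizer S P\<rparr>)"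
    then have gk: "g \<in> normalizer S P" "k \<in> normalizer S P" by auto
    note gkc = gk[THEN normalizer_carrier[OF P]]
    have "?h (g \<otimes> k) = compose Q (?h g) (?h k)"
    proof (rule mor_eqI[of _ Q])
      fix y assume y: "y \<in> Q"
      have x: "?i y \<in> P" "?i y \<in> carrier S" using i[OF y] subgroup.mem_carrier[OF P] by auto
      have kx: "k \<otimes> ?i y \<otimes> inv k \<in> P" by (rule conj_mem_normalizer[OF P gk(2) x(1)])
      have "g \<otimes> k \<otimes> ?i y \<otimes> inv (g \<otimes> k) = g \<otimes> (k \<otimes> ?i y \<otimes> inv k) \<otimes> inv g"
        using gkc x by (simp add: inv_mult_group m_assoc)
      moreover have "\<phi> (k \<otimes> ?i y \<otimes> inv k) \<in> Q" using kx img by blast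
      ultimately show "?h (g \<otimes> k) y = compose Q (?h g) (?h k) y"
        using y ii[OF kx] by (simp add: compose_def)
    qed auto
    then show "?h (g \<otimes>\<^bsub>S\<lparr>carrier := normalizer S P\<rparr>\<^esub> k) = ?h g \<otimes>\<^bsub>aut_group F Q\<^esub> ?h k"
      using mult_aut_group[OF Q cl cl] gk by simp
  qed
  then show ?thesis
    using subgroup_imp_group[OF subgroup_normalizer[OF P]] group_aut_group[OF Q]
    by (simp add: group_hom_def group_hom_axioms_def)
qed

text \<open>The automorphisms induced by S are the image of the normalizer under the transported
  conjugation for \<phi> the identity.\<close>

lemma subgroup_conj_hom:
  assumes P: "subgroup P S"
  shows "subgroup (conj_hom S P P) (aut_group F P)"
proof -
  have id: "(\<lambda>x\<in>P. x) \<in> F P P" "(\<lambda>x\<in>P. x) ` P = P" using incl_mor[OF P P] by auto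
  have "restrict (\<lambda>x. (\<lambda>x\<in>P. x) (g \<otimes> inv_into P (\<lambda>x\<in>P. x) x \<otimes> inv g)) P = (\<lambda>x\<in>P. g \<otimes> x \<otimes> inv g)"
    if "g \<in> normalizer S P" for g
  proof (rule restrict_ext)
    fix x assume x: "x \<in> P"
    have "inv_into P (\<lambda>x\<in>P. x) x = x" using inv_into_f_f[of "\<lambda>x\<in>P. x" P x] x by (simp add: inj_on_def)
    then show "(\<lambda>x\<in>P. x) (g \<otimes> inv_into P (\<lambda>x\<in>P. x) x \<otimes> inv g) = g \<otimes> x \<otimes> inv g"
      using conj_mem_normalizer[OF P that x] by simp
  qed
  then have "(\<lambda>g. \<lambda>x\<in>P. (\<lambda>x\<in>P. x) (g \<otimes> inv_into P (\<lambda>x\<in>P. x) x \<otimes> inv g)) ` normalizer S P = conj_hom S P P"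
    unfolding conj_hom_self[OF P] by (intro image_cong) auto
  then show ?thesis using group_hom.img_is_subgroup[OF transported_conj_hom[OF P P id]] by simp
qed

lemma F_conjugate_trans: "\<lbrakk>F_conjugate S F P Q; F_conjugate S F Q R\<rbrakk> \<Longrightarrow> F_conjugate S F P R"
proof -
  assume "F_conjugate S F P Q" "F_conjugate S F Q R"
  then obtain \<phi> \<psi> where s: "subgroup P S" "subgroup Q S" "subgroup R S" "\<phi> \<in> F P Q" "\<phi> ` P = Q" "\<psi> \<in> F Q R" "\<psi> ` Q = R"
    by (auto simp: F_conjugate_def)
  have "compose P \<psi> \<phi> \<in> F P R" by (rule comp_closed[OF s(1-4,6)])
  moreover have "compose P \<psi> \<phi> ` P = R" using s by (auto simp: compose_def image_image)
  ultimately show ?thesis using s by (auto simp: F_conjugate_def)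
qed

lemma F_conjugate_refl: "subgroup P S \<Longrightarrow> F_conjugate S F P P"
  using incl_mor[of P P] by (auto simp: F_conjugate_def intro!: bexI[of _ "\<lambda>x\<in>P. x"])

lemma F_conjugate_image: "\<lbrakk>subgroup P S; \<phi> \<in> F P (carrier S)\<rbrakk> \<Longrightarrow> F_conjugate S F (\<phi> ` P) P"
proof -
  assume P: "subgroup P S" and \<phi>: "\<phi> \<in> F P (carrier S)"
  have "restrict (inv_into P \<phi>) (\<phi> ` P) ` \<phi> ` P = P"
    using mor_hom(3)[OF P subgroup_self \<phi>] by (simp add: image_image)
  then show ?thesis
    unfolding F_conjugate_def using mor_inverse[OF P subgroup_self \<phi>] P mor_image_subgroup[OF P subgroup_self \<phi>] by blast
qed

lemma ex_fully_normalized: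
  assumes P: "subgroup P S"
  obtains Q where "F_conjugate S F P Q" "fully_normalized S F Q"
proof -
  have bound: "card (normalizer S Q) \<le> card (carrier S)" if "F_conjugate S F P Q" for Q
    by (rule card_mono[OF finite_carrier]) (use that subgroup_normalizer subgroup.subset in \<open>auto simp: F_conjugate_def\<close>)
  obtain Q where Q: "F_conjugate S F P Q" "\<And>R. F_conjugate S F P R \<Longrightarrow> card (normalizer S R) \<le> card (normalizer S Q)"
    using ex_has_greatest_nat[of "F_conjugate S F P" P "\<lambda>Q. card (normalizer S Q)" "Suc (card (carrier S))"]
      F_conjugate_refl[OF P] bound le_imp_less_Suc by metis
  have "fully_normalized S F Q" unfolding fully_normalized_def using Q F_conjugate_trans by blast
  then show ?thesis using Q that by blast
qed

end

section \<open>Alperin's fusion theorem as an induction principle\<close>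

context saturated_fusion_system
begin

text \<open>The hypothesis on \<beta> says that the extender of \<beta> \<phi> is all of N_S(P), so
  the extension axiom reaches the whole normalizer. The choice of \<beta> is left open: Sylow's
  theorem supplies it for Alperin's theorem, Frattini's argument for the subsystem of index prime to
  p.\<close>

lemma extend_compose:
  assumes P: "subgroup P S" and Qs: "subgroup Q S" and \<phi>: "\<phi> \<in> F P Q" "\<phi> ` P = Q"
    and Q: "fully_normalized S F Q" and \<beta>: "\<beta> \<in> F Q Q"
    and conj: "\<And>g. g \<in> normalizer S P \<Longrightarrow>
      \<beta> \<otimes>\<^bsub>aut_group F Q\<^esub> (\<lambda>y\<in>Q. \<phi> (g \<otimes> inv_into P \<phi> y \<otimes> inv g)) \<otimes>\<^bsub>aut_group F Q\<^esub> inv\<^bsub>aut_group F Q\<^esub> \<beta> \<in> conj_hom S Q Q"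
  obtains \<psi> where "\<psi> \<in> F (normalizer S P) (carrier S)" "restrict \<psi> P = compose P \<beta> \<phi>"
proof -
  let ?h = "\<lambda>g. \<lambda>y\<in>Q. \<phi> (g \<otimes> inv_into P \<phi> y \<otimes> inv g)"
  let ?A = "aut_group F Q"
  interpret h: group_hom "S\<lparr>carrier := normalizer S P\<rparr>" ?A ?h by (rule transported_conj_hom[OF P Qs \<phi>])
  note s = P Qs \<phi>
  have fc: "fully_centralized S F Q" using sylow_axiom[OF Qs Q] by blast
  define \<xi> where "\<xi> = compose P \<beta> \<phi>"
  have \<xi>: "\<xi> \<in> F P Q" unfolding \<xi>_def by (rule comp_closed[OF s(1,2,2,3) \<beta>])
  have \<xi>img: "\<xi> ` P = Q" using s(4) aut_image[OF s(2) \<beta>] by (simp add: \<xi>_def compose_def image_image[symmetric])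
  have inv\<beta>: "inv\<^bsub>?A\<^esub> \<beta> = restrict (inv_into Q \<beta>) Q" by (rule inv_aut_group[OF s(2) \<beta>])
  have i: "inv_into P \<xi> y = inv_into P \<phi> (inv_into Q \<beta> y)" if "y \<in> Q" for y
  proof -
    have a: "inv_into Q \<beta> y \<in> Q" "\<beta> (inv_into Q \<beta> y) = y"
      using that aut_image[OF s(2) \<beta>] by (auto intro: inv_into_into f_inv_into_f)
    have b: "inv_into P \<phi> (inv_into Q \<beta> y) \<in> P" "\<phi> (inv_into P \<phi> (inv_into Q \<beta> y)) = inv_into Q \<beta> y"
      using a s(4) by (auto intro: inv_into_into f_inv_into_f)
    have "\<xi> (inv_into P \<phi> (inv_into Q \<beta> y)) = y" using a b by (simp add: \<xi>_def compose_def)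
    then show ?thesis using inv_into_f_f[OF mor_hom(3)[OF s(1,2) \<xi>] b(1)] by simp
  qed
  \<comment> \<open>For g in N_S(P), \<xi> c_g \<xi>^-1 equals \<beta> (\<phi> c_g \<phi>^-1)
    \<beta>^-1, which lies in Aut_S(Q) by assumption.\<close>
  have "extender S P \<xi> = normalizer S P"
  proof -
    have "(\<lambda>y\<in>\<xi> ` P. \<xi> (g \<otimes> inv_into P \<xi> y \<otimes> inv g)) \<in> conj_hom S (\<xi> ` P) (\<xi> ` P)" if g: "g \<in> normalizer S P" for g
    proof -
      have hg: "?h g \<in> F Q Q" using h.hom_closed g by simp
      have i\<beta>: "inv\<^bsub>?A\<^esub> \<beta> \<in> F Q Q" using h.H.inv_closed[of \<beta>] \<beta> by simp
      have "\<beta> \<otimes>\<^bsub>?A\<^esub> ?h g \<otimes>\<^bsub>?A\<^esub> inv\<^bsub>?A\<^esub> \<beta> = compose Q (compose Q \<beta> (?h g)) (inv\<^bsub>?A\<^esub> \<beta>)"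
        using mult_aut_group[OF s(2)] \<beta> hg i\<beta> comp_closed[OF s(2,2,2) hg \<beta>] by simp
      also have "\<dots> = (\<lambda>y\<in>Q. \<xi> (g \<otimes> inv_into P \<xi> y \<otimes> inv g))"
      proof (rule mor_eqI[of _ Q])
        fix y assume y: "y \<in> Q"
        have a: "inv_into Q \<beta> y \<in> Q" using y aut_image[OF s(2) \<beta>] by (auto intro: inv_into_into)
        have b: "inv_into P \<phi> (inv_into Q \<beta> y) \<in> P" using a s(4) by (auto intro: inv_into_into)
        show "compose Q (compose Q \<beta> (?h g)) (inv\<^bsub>?A\<^esub> \<beta>) y = (\<lambda>y\<in>Q. \<xi> (g \<otimes> inv_into P \<xi> y \<otimes> inv g)) y"
          using y a i[OF y] conj_mem_normalizer[OF s(1) g b] by (simp add: compose_def inv\<beta> \<xi>_def)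
      qed auto
      finally show ?thesis using conj[OF g] \<xi>img by simp
    qed
    then show ?thesis unfolding extender_def by blast
  qed
  moreover have "\<xi> \<in> F P (carrier S)" by (rule mor_to_S[OF s(1,2) \<xi>])
  ultimately obtain \<psi> where \<psi>: "\<psi> \<in> F (normalizer S P) (carrier S)" "restrict \<psi> P = \<xi>"
    using extension_axiom[OF s(1), of \<xi>] fc \<xi>img by auto
  then show ?thesis using that by (simp add: \<xi>_def)
qed

text \<open>As Q is fully normalized, Aut_S(Q) is a Sylow subgroup of Aut_F(Q). The p-group \<phi>
  Aut_S(P) \<phi>^-1 can be conjugated into it by some \<beta>, and then \<beta> \<phi>
  extends.\<close>

lemma extend_to_normalizer:
  assumes Q: "fully_normalized S F Q" and PQ: "F_conjugate S F P Q"
  obtains \<chi> where "\<chi> \<in> F (normalizer S P) (carrier S)" "\<chi> ` P = Q"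
proof -
  obtain \<phi> where s: "subgroup P S" "subgroup Q S" "\<phi> \<in> F P Q" "\<phi> ` P = Q" using PQ by (auto simp: F_conjugate_def)
  let ?h = "\<lambda>g. \<lambda>y\<in>Q. \<phi> (g \<otimes> inv_into P \<phi> y \<otimes> inv g)"
  let ?A = "aut_group F Q"
  interpret h: group_hom "S\<lparr>carrier := normalizer S P\<rparr>" ?A ?h by (rule transported_conj_hom[OF s])
  have N: "subgroup (normalizer S P) S" by (rule subgroup_normalizer[OF s(1)])
  have syl: "sylow_subgroup p ?A (conj_hom S Q Q)"
    using sylow_axiom[OF s(2) Q] by blast
  have D: "subgroup (?h ` normalizer S P) ?A" using h.img_is_subgroup by simp
  obtain k where "card (normalizer S P) = p ^ k" using subgroup_card_prime_power[OF N] by blast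
  then obtain j where j: "card (?h ` normalizer S P) = p ^ j"
    using h.card_image_dvd_order prime_p by (auto simp: order_def divides_primepow_nat)
  obtain \<beta> where \<beta>: "\<beta> \<in> F Q Q" and conj: "\<And>d. d \<in> ?h ` normalizer S P \<Longrightarrow> \<beta> \<otimes>\<^bsub>?A\<^esub> d \<otimes>\<^bsub>?A\<^esub> inv\<^bsub>?A\<^esub> \<beta> \<in> conj_hom S Q Q"
    using h.H.p_subgroup_conjugate_into[OF finite_aut_group[OF s(2)] _ D prime_p j
        sylow_index_coprime[OF group_aut_group[OF s(2)] finite_aut_group[OF s(2)] prime_p syl]]
      syl by (auto simp: sylow_subgroup_def)
  obtain \<psi> where \<psi>: "\<psi> \<in> F (normalizer S P) (carrier S)" "restrict \<psi> P = compose P \<beta> \<phi>"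
    by (rule extend_compose[OF s Q \<beta> conj[OF imageI]])
  have "compose P \<beta> \<phi> ` P = Q" using s(4) aut_image[OF s(2) \<beta>] by (simp add: compose_def image_image[symmetric])
  then have "\<psi> ` P = Q" using \<psi>(2) by (metis image_restrict_eq)
  then show ?thesis using \<psi>(1) that by blast
qed

text \<open>By its order, S is its own only conjugate.\<close>

lemma fully_normalized_carrier: "fully_normalized S F (carrier S)"
  unfolding fully_normalized_def
proof (intro allI impI)
  fix Q assume "F_conjugate S F (carrier S) Q"
  then obtain \<phi> where \<phi>: "subgroup Q S" "\<phi> \<in> F (carrier S) Q" "\<phi> ` carrier S = Q" by (auto simp: F_conjugate_def)
  then have "card Q = card (carrier S)" using mor_hom(3)[OF subgroup_self] card_image by metis
  then have "Q = carrier S" using \<phi>(1) finite_carrier subgroup.subset by (metis card_subset_eq)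
  then show "card (normalizer S Q) \<le> card (normalizer S (carrier S))" by simp
qed

text \<open>For P < S choose a fully normalized conjugate Q of P. There are morphisms c from P and
  c' from \<phi>(P) onto Q that extend to the normalizers, which are strictly larger, so they are
  good by induction; and \<phi> = c'^-1 \<alpha> c for an automorphism \<alpha> of Q. An induction
  rule, instead of a decomposition into a chain of morphisms, lets \<open>base\<close> use the
  property on all larger subgroups.\<close>

theorem alperin_induct:
  fixes Good :: "'a set \<Rightarrow> ('a \<Rightarrow> 'a) \<Rightarrow> bool"
  assumes restr: "\<And>P R \<phi>. \<lbrakk>subgroup P S; subgroup R S; R \<subseteq> P; \<phi> \<in> F P (carrier S); Good P \<phi>\<rbrakk> \<Longrightarrow> Good R (restrict \<phi> R)"
    and comp: "\<And>P \<phi> \<psi>. \<lbrakk>subgroup P S; \<phi> \<in> F P (carrier S); Good P \<phi>; \<psi> \<in> F (\<phi> ` P) (carrier S); Good (\<phi> ` P) \<psi>\<rbrakk>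
      \<Longrightarrow> Good P (compose P \<psi> \<phi>)"
    and inv: "\<And>P \<phi>. \<lbrakk>subgroup P S; \<phi> \<in> F P (carrier S); Good P \<phi>\<rbrakk> \<Longrightarrow> Good (\<phi> ` P) (restrict (inv_into P \<phi>) (\<phi> ` P))"
    and base: "\<And>P \<alpha>. \<lbrakk>subgroup P S; fully_normalized S F P; \<alpha> \<in> F P P;
      \<And>R \<phi>. \<lbrakk>subgroup R S; card P < card R; \<phi> \<in> F R (carrier S)\<rbrakk> \<Longrightarrow> Good R \<phi>\<rbrakk> \<Longrightarrow> Good P \<alpha>"
    and P: "subgroup P S" and \<phi>: "\<phi> \<in> F P (carrier S)"
  shows "Good P \<phi>"
  using P \<phi>
proof (induction "card (carrier S) - card P" arbitrary: P \<phi> rule: less_induct)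
  case (less P \<phi>)
  note P = less.prems(1) and \<phi> = less.prems(2)
  have IH: "Good R \<psi>" if "subgroup R S" "card P < card R" "\<psi> \<in> F R (carrier S)" for R \<psi>
  proof -
    have "card R \<le> card (carrier S)" using that(1) finite_carrier by (simp add: card_mono subgroup.subset)
    then show ?thesis using less.hyps[of R \<psi>] that by linarith
  qed
  show ?case
  proof (cases "P = carrier S")
    case True
    then show ?thesis using base[OF P _ _ IH] fully_normalized_carrier \<phi> by auto
  next
    case False
    \<comment> \<open>Conjugates of P have the order of P, and their normalizers are strictly
      larger; this is what brings the induction hypothesis into play.\<close>
    have grow: "card P < card (normalizer S R)" "R \<subseteq> normalizer S R" if R: "F_conjugate S F P R" for R
    proof -
      obtain \<psi> where \<psi>: "subgroup R S" "\<psi> \<in> F P R" "\<psi> ` P = R" using R by (auto simp: F_conjugate_def)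
      have cR: "card R = card P" using mor_hom(3)[OF P \<psi>(1,2)] \<psi>(3) card_image by metis
      then have "R \<noteq> carrier S" using False P finite_carrier subgroup.subset by (metis card_subset_eq)
      then have "R \<subset> normalizer S R"
        using p_group_normalizer_grows[OF finite_carrier \<psi>(1) prime_p] order_p_power by blast
      then show "card P < card (normalizer S R)" "R \<subseteq> normalizer S R"
        using psubset_card_mono[OF finite_sub[OF subgroup_normalizer[OF \<psi>(1)]], of R] cR by auto
    qed
    obtain Q where PQ: "F_conjugate S F P Q" and Q: "fully_normalized S F Q" using ex_fully_normalized[OF P] by blast
    have Qs: "subgroup Q S" using PQ by (simp add: F_conjugate_def)
    let ?P' = "\<phi> ` P"
    have P': "subgroup ?P' S" by (rule mor_image_subgroup[OF P subgroup_self \<phi>])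
    have P'P: "F_conjugate S F ?P' P" by (rule F_conjugate_image[OF P \<phi>])
    have PP': "F_conjugate S F P ?P'" using P P' iso_factor[OF P subgroup_self \<phi>] by (auto simp: F_conjugate_def)
    have P'Q: "F_conjugate S F ?P' Q" by (rule F_conjugate_trans[OF P'P PQ])
    have step: "\<exists>c. c \<in> F R (carrier S) \<and> Good R c \<and> c ` R = Q" if R: "subgroup R S" "F_conjugate S F P R" "F_conjugate S F R Q" for R
    proof -
      obtain \<chi> where \<chi>: "\<chi> \<in> F (normalizer S R) (carrier S)" "\<chi> ` R = Q" using extend_to_normalizer[OF Q R(3)] by blast
      have N: "subgroup (normalizer S R) S" by (rule subgroup_normalizer[OF R(1)])
      have "Good (normalizer S R) \<chi>" by (rule IH[OF N grow(1)[OF R(2)] \<chi>(1)])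
      then have "Good R (restrict \<chi> R)" by (rule restr[OF N R(1) grow(2)[OF R(2)] \<chi>(1)])
      moreover have "restrict \<chi> R \<in> F R (carrier S)" by (rule mor_restrict[OF N subgroup_self R(1) \<chi>(1) grow(2)[OF R(2)]])
      ultimately show ?thesis using \<chi>(2) by (intro exI[of _ "restrict \<chi> R"]) auto
    qed
    obtain c where c: "c \<in> F P (carrier S)" "Good P c" "c ` P = Q" using step[OF P F_conjugate_refl[OF P] PQ] by blast
    obtain c' where c': "c' \<in> F ?P' (carrier S)" "Good ?P' c'" "c' ` ?P' = Q" using step[OF P' PP' P'Q] by blast
    have injc: "inj_on c P" and injc': "inj_on c' ?P'" using mor_hom(3)[OF P subgroup_self c(1)] mor_hom(3)[OF P' subgroup_self c'(1)] .
    have ci: "restrict (inv_into P c) Q \<in> F Q P" using mor_inverse[OF P subgroup_self c(1)] c(3) by simp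
    have c'Q: "c' \<in> F ?P' Q" by (rule mor_codomain[OF P' subgroup_self Qs c'(1)]) (simp add: c'(3))
    have cQ: "c \<in> F P Q" by (rule mor_codomain[OF P subgroup_self Qs c(1)]) (simp add: c(3))
    have \<phi>': "\<phi> \<in> F P ?P'" using iso_factor[OF P subgroup_self \<phi>] by blast
    \<comment> \<open>The two maps c and c' \<phi> from P onto Q differ by this automorphism of
      Q.\<close>
    define \<alpha> where "\<alpha> = compose Q c' (compose Q \<phi> (restrict (inv_into P c) Q))"
    have \<alpha>: "\<alpha> \<in> F Q Q" unfolding \<alpha>_def by (rule comp_closed[OF Qs P' Qs comp_closed[OF Qs P P' ci \<phi>'] c'Q])
    have "card Q = card P" using c(3) injc card_image by metis
    then have "Good Q \<alpha>" using base[OF Qs Q \<alpha>] IH by simp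
    moreover have "\<alpha> \<in> F (c ` P) (carrier S)" using mor_to_S[OF Qs Qs \<alpha>] c(3) by simp
    ultimately have g1: "Good P (compose P \<alpha> c)" using comp[OF P c(1,2)] c(3) by simp
    have \<alpha>c: "compose P \<alpha> c \<in> F P Q" by (rule comp_closed[OF P Qs Qs cQ \<alpha>])
    have \<alpha>cv: "compose P \<alpha> c x = c' (\<phi> x)" if "x \<in> P" for x
    proof -
      have "c x \<in> Q" using that c(3) by blast
      then show ?thesis using that injc by (simp add: \<alpha>_def compose_def)
    qed
    have img: "compose P \<alpha> c ` P = Q" using \<alpha>cv c'(3) by (simp add: image_image)
    have g2: "Good Q (restrict (inv_into ?P' c') Q)" using inv[OF P' c'(1,2)] c'(3) by simp
    have "restrict (inv_into ?P' c') Q \<in> F Q ?P'" using mor_inverse[OF P' subgroup_self c'(1)] c'(3) by simp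
    then have m2: "restrict (inv_into ?P' c') Q \<in> F Q (carrier S)" by (rule mor_to_S[OF Qs P'])
    have "Good P (compose P (restrict (inv_into ?P' c') Q) (compose P \<alpha> c))"
      using comp[OF P mor_to_S[OF P Qs \<alpha>c] g1] m2 g2 img by simp
    moreover have "compose P (restrict (inv_into ?P' c') Q) (compose P \<alpha> c) = \<phi>"
    proof (rule mor_eqI[of _ P])
      fix x assume x: "x \<in> P"
      have "c' (\<phi> x) \<in> Q" using x c'(3) by blast
      then show "compose P (restrict (inv_into ?P' c') Q) (compose P \<alpha> c) x = \<phi> x"
        using x injc' \<alpha>cv[OF x] by (simp add: compose_eq)
    qed (use mor_hom(5)[OF P subgroup_self \<phi>] in auto)
    ultimately show ?thesis by simp
  qed
qed

lemma aut_fully_normalized_factor: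
  assumes P: "subgroup P S" "fully_normalized S F P" and \<alpha>: "\<alpha> \<in> F P P"
  obtains \<beta> g where "\<beta> \<in> O_p_residual p (aut_group F P)" "\<beta> \<in> F P P" "g \<in> normalizer S P"
    "\<alpha> = compose P \<beta> (\<lambda>x\<in>P. g \<otimes> x \<otimes> inv g)"
proof -
  have syl: "sylow_subgroup p (aut_group F P) (conj_hom S P P)" using sylow_axiom[OF P] by blast
  obtain \<beta> q where \<beta>q: "\<beta> \<in> O_p_residual p (aut_group F P)" "q \<in> conj_hom S P P" "\<alpha> = \<beta> \<otimes>\<^bsub>aut_group F P\<^esub> q"
    using O_p_residual_mult_sylow[OF group_aut_group[OF P(1)] finite_aut_group[OF P(1)] prime_p syl] \<alpha> by auto
  interpret C: index_class "\<lambda>n. \<exists>k. n = p ^ k" by (rule index_class_p_power[OF prime_p])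
  have "O_p_residual p (aut_group F P) \<lhd> aut_group F P"
    using C.index_residual(1)[OF group_aut_group[OF P(1)] finite_aut_group[OF P(1)]] by (simp add: O_p_residual_eq)
  then have \<beta>: "\<beta> \<in> F P P" using \<beta>q(1) normal_imp_subgroup subgroup.mem_carrier carrier_aut_group by metis
  obtain g where g: "g \<in> normalizer S P" "q = (\<lambda>x\<in>P. g \<otimes> x \<otimes> inv g)" using \<beta>q(2) conj_hom_self[OF P(1)] by auto
  have "q \<in> F P P" using \<beta>q(2) conj_hom_subset[OF P(1,1)] by blast
  then have "\<alpha> = compose P \<beta> q" using \<beta>q(3) mult_aut_group[OF P(1) \<beta>] by simp
  then show ?thesis using that \<beta>q(1) \<beta> g by blast
qed

end

section \<open>Subsystems invariant under a group of automorphisms\<close>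

lemma (in group) subgroup_of_subgroup_iff:
  assumes "subgroup T G"
  shows "subgroup P (G\<lparr>carrier := T\<rparr>) \<longleftrightarrow> subgroup P G \<and> P \<subseteq> T"
proof
  assume P: "subgroup P (G\<lparr>carrier := T\<rparr>)"
  show "subgroup P G \<and> P \<subseteq> T" using incl_subgroup[OF assms P] subgroup.subset[OF P] by simp
qed (simp add: subgroup_incl assms)

text \<open>A acts through \<open>c\<close>, which may have a kernel, so that both S acting by
  conjugation and Aut_F(S) acting by evaluation are instances. The subsystem lives on T, which is
  the hyperfocal subgroup in the first case and S in the second.\<close>

locale invariant_subsystem = saturated_fusion_system S p F + A: group A
  for S (structure) and p F and A :: "('i, 'n) monoid_scheme" +
  fixes c :: "'i \<Rightarrow> 'a \<Rightarrow> 'a" and T E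
  assumes T_subgroup: "subgroup T S"
    and E_fusion: "fusion_system (S\<lparr>carrier := T\<rparr>) p E"
    and E_subset: "\<And>P Q. \<lbrakk>subgroup P (S\<lparr>carrier := T\<rparr>); subgroup Q (S\<lparr>carrier := T\<rparr>)\<rbrakk> \<Longrightarrow> E P Q \<subseteq> F P Q"
    and finite_A: "finite (carrier A)"
    and c_mor: "\<And>a. a \<in> carrier A \<Longrightarrow> c a \<in> F (carrier S) (carrier S)"
    and c_mult: "\<And>a b x. \<lbrakk>a \<in> carrier A; b \<in> carrier A; x \<in> carrier S\<rbrakk> \<Longrightarrow> c (a \<otimes>\<^bsub>A\<^esub> b) x = c a (c b x)"
    and c_one: "\<And>x. x \<in> carrier S \<Longrightarrow> c \<one>\<^bsub>A\<^esub> x = x"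
    and c_T: "\<And>a x. \<lbrakk>a \<in> carrier A; x \<in> T\<rbrakk> \<Longrightarrow> c a x \<in> T"
    and c_invariant: "\<And>a P \<theta>. \<lbrakk>a \<in> carrier A; subgroup P (S\<lparr>carrier := T\<rparr>); \<theta> \<in> E P T\<rbrakk> \<Longrightarrow>
      (\<lambda>x\<in>c a ` P. c a (\<theta> (c (inv\<^bsub>A\<^esub> a) x))) \<in> E (c a ` P) T"
begin

abbreviation "subT P \<equiv> subgroup P (S\<lparr>carrier := T\<rparr>)"

sublocale E: fusion_system "S\<lparr>carrier := T\<rparr>" p E by (rule E_fusion)

lemma subT_iff: "subT P \<longleftrightarrow> subgroup P S \<and> P \<subseteq> T"
  by (rule subgroup_of_subgroup_iff[OF T_subgroup])

lemma subT_T: "subT T"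
  using T_subgroup by (simp add: subT_iff)

lemma subT_inter: "subgroup P S \<Longrightarrow> subT (P \<inter> T)"
  unfolding subT_iff using subgroups_Inter_pair[OF _ T_subgroup] by blast

lemma c_closed: "\<lbrakk>a \<in> carrier A; x \<in> carrier S\<rbrakk> \<Longrightarrow> c a x \<in> carrier S"
  using mor_hom(7)[OF subgroup_self subgroup_self c_mor] .

lemma c_inv: "\<lbrakk>a \<in> carrier A; x \<in> carrier S\<rbrakk> \<Longrightarrow> c (inv\<^bsub>A\<^esub> a) (c a x) = x"
  "\<lbrakk>a \<in> carrier A; x \<in> carrier S\<rbrakk> \<Longrightarrow> c a (c (inv\<^bsub>A\<^esub> a) x) = x"
  using c_mult[of "inv\<^bsub>A\<^esub> a" a x] c_mult[of a "inv\<^bsub>A\<^esub> a" x] c_one by simp_all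

lemma T_carrier: "x \<in> T \<Longrightarrow> x \<in> carrier S"
  using subgroup.mem_carrier[OF T_subgroup] .

lemma subT_c:
  assumes "a \<in> carrier A" "subT P"
  shows "subT (c a ` P)"
proof -
  have "subgroup (c a ` P) S"
    by (rule mor_image_sub[OF subgroup_self subgroup_self c_mor[OF assms(1)]])
      (use assms(2) subgroup.subset[of P S] in \<open>auto simp: subT_iff\<close>)
  then show ?thesis using assms c_T by (auto simp: subT_iff)
qed

text \<open>P ranges over all subgroups of S because Alperin's induction does, but only P \<inter> T
  can be compared with E. The equation for images makes \<phi> match the parts inside T, which is
  what allows factorizations to be composed and inverted.\<close>

definition factors :: "'a set \<Rightarrow> ('a \<Rightarrow> 'a) \<Rightarrow> bool" where
  "factors P \<phi> \<longleftrightarrow> \<phi> ` (P \<inter> T) = \<phi> ` P \<inter> T \<and>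
     (\<exists>a\<in>carrier A. \<exists>\<theta>\<in>E (P \<inter> T) T. \<forall>x\<in>P \<inter> T. \<phi> x = c a (\<theta> x))"

text \<open>Injectivity of \<phi> on P cuts the equation for images down to R.\<close>

lemma factors_restrict:
  assumes P: "subgroup P S" and R: "subgroup R S" "R \<subseteq> P" and \<phi>: "\<phi> \<in> F P (carrier S)" "factors P \<phi>"
  shows "factors R (restrict \<phi> R)"
proof -
  obtain a \<theta> where a: "\<phi> ` (P \<inter> T) = \<phi> ` P \<inter> T" "a \<in> carrier A" "\<theta> \<in> E (P \<inter> T) T" "\<And>x. x \<in> P \<inter> T \<Longrightarrow> \<phi> x = c a (\<theta> x)"
    using \<phi>(2) by (auto simp: factors_def)
  have "\<phi> ` (R \<inter> T) = \<phi> ` R \<inter> T"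
  proof (intro subset_antisym subsetI)
    fix y assume "y \<in> \<phi> ` R \<inter> T"
    then obtain x where x: "x \<in> R" "y = \<phi> x" "\<phi> x \<in> T" by auto
    then have "\<phi> x \<in> \<phi> ` (P \<inter> T)" using a(1) R(2) by auto
    then obtain x' where "x' \<in> P \<inter> T" "\<phi> x = \<phi> x'" by auto
    then have "x = x'" using mor_hom(3)[OF P subgroup_self \<phi>(1)] x R(2) by (auto dest: inj_onD)
    then show "y \<in> \<phi> ` (R \<inter> T)" using x \<open>x' \<in> P \<inter> T\<close> by auto
  qed (use a(1) R(2) in auto)
  moreover have "restrict \<theta> (R \<inter> T) \<in> E (R \<inter> T) T"
    by (rule E.mor_restrict[OF subT_inter[OF P] subT_T subT_inter[OF R(1)] a(3)]) (use R in auto)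
  moreover have "\<forall>x\<in>R \<inter> T. restrict \<phi> R x = c a (restrict \<theta> (R \<inter> T) x)" using a(4) R(2) by auto
  moreover have "restrict \<phi> R ` (R \<inter> T) = \<phi> ` (R \<inter> T)" "restrict \<phi> R ` R = \<phi> ` R" by auto
  ultimately show ?thesis unfolding factors_def using a(2) by metis
qed

text \<open>c_b \<eta> c_a \<theta> = c_{ba} (c_a^-1 \<eta> c_a) \<theta>, and the bracket lies in E
  by invariance.\<close>

lemma factors_compose:
  assumes P: "subgroup P S" and \<phi>: "\<phi> \<in> F P (carrier S)" "factors P \<phi>"
    and \<psi>: "\<psi> \<in> F (\<phi> ` P) (carrier S)" "factors (\<phi> ` P) \<psi>"
  shows "factors P (compose P \<psi> \<phi>)"
proof -
  obtain a \<theta> where a: "\<phi> ` (P \<inter> T) = \<phi> ` P \<inter> T" "a \<in> carrier A" "\<theta> \<in> E (P \<inter> T) T" "\<And>x. x \<in> P \<inter> T \<Longrightarrow> \<phi> x = c a (\<theta> x)"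
    using \<phi>(2) by (auto simp: factors_def)
  obtain b \<eta> where b: "\<psi> ` (\<phi> ` P \<inter> T) = \<psi> ` \<phi> ` P \<inter> T" "b \<in> carrier A" "\<eta> \<in> E (\<phi> ` P \<inter> T) T" "\<And>x. x \<in> \<phi> ` P \<inter> T \<Longrightarrow> \<psi> x = c b (\<eta> x)"
    using \<psi>(2) by (auto simp: factors_def)
  let ?i = "inv\<^bsub>A\<^esub> a"
  have i: "?i \<in> carrier A" "inv\<^bsub>A\<^esub> ?i = a" using a(2) by simp_all
  have \<phi>P: "subgroup (\<phi> ` P) S" by (rule mor_image_subgroup[OF P subgroup_self \<phi>(1)])
  note sP = subT_inter[OF P] and s\<phi>P = subT_inter[OF \<phi>P]
  let ?\<eta> = "\<lambda>x\<in>c ?i ` (\<phi> ` P \<inter> T). c ?i (\<eta> (c a x))"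
  have \<eta>': "?\<eta> \<in> E (c ?i ` (\<phi> ` P \<inter> T)) T" using c_invariant[OF i(1) s\<phi>P b(3)] i(2) by simp
  have \<theta>v: "\<theta> x = c ?i (\<phi> x)" "c ?i (\<phi> x) \<in> c ?i ` (\<phi> ` P \<inter> T)" "c a (\<theta> x) = \<phi> x" "\<phi> x \<in> \<phi> ` P \<inter> T" if x: "x \<in> P \<inter> T" for x
  proof -
    have "\<theta> x \<in> carrier S" using E.mor_hom(7)[OF sP subT_T a(3) x] T_carrier by blast
    then show "\<theta> x = c ?i (\<phi> x)" "c a (\<theta> x) = \<phi> x" using a(2,4) x c_inv(1) by simp_all
    show "\<phi> x \<in> \<phi> ` P \<inter> T" using a(1) x by blast
    then show "c ?i (\<phi> x) \<in> c ?i ` (\<phi> ` P \<inter> T)" by blast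
  qed
  have "compose (P \<inter> T) ?\<eta> \<theta> \<in> E (P \<inter> T) T"
    by (rule E.mor_comp[OF sP subT_T a(3) subT_c[OF i(1) s\<phi>P] subT_T \<eta>']) (use \<theta>v in auto)
  moreover have "compose P \<psi> \<phi> x = c (b \<otimes>\<^bsub>A\<^esub> a) (compose (P \<inter> T) ?\<eta> \<theta> x)" if x: "x \<in> P \<inter> T" for x
  proof -
    have \<eta>T: "\<eta> (\<phi> x) \<in> carrier S" using E.mor_hom(7)[OF s\<phi>P subT_T b(3) \<theta>v(4)[OF x]] T_carrier by blast
    have "compose (P \<inter> T) ?\<eta> \<theta> x = c ?i (\<eta> (\<phi> x))"
      using x \<theta>v[OF x] by (simp add: compose_def)
    then have "c (b \<otimes>\<^bsub>A\<^esub> a) (compose (P \<inter> T) ?\<eta> \<theta> x) = c b (\<eta> (\<phi> x))"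
      using \<eta>T a(2) b(2) i(1) by (simp add: c_mult c_closed c_inv)
    then show ?thesis using x b(4)[OF \<theta>v(4)[OF x]] by (simp add: compose_def)
  qed
  moreover have "compose P \<psi> \<phi> ` (P \<inter> T) = compose P \<psi> \<phi> ` P \<inter> T"
  proof -
    have "compose P \<psi> \<phi> ` (P \<inter> T) = \<psi> ` \<phi> ` (P \<inter> T)" "compose P \<psi> \<phi> ` P = \<psi> ` \<phi> ` P"
      by (auto simp: compose_def image_image)
    then show ?thesis using a(1) b(1) by simp
  qed
  ultimately show ?thesis unfolding factors_def using a(2) b(2) by (meson A.m_closed)
qed

text \<open>The inverse of c_a \<theta> is \<theta>^-1 c_a^-1 = c_a^-1 (c_a \<theta>^-1 c_a^-1), and
  the bracket lies in E by invariance.\<close>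

lemma factors_inverse:
  assumes P: "subgroup P S" and \<phi>: "\<phi> \<in> F P (carrier S)" "factors P \<phi>"
  shows "factors (\<phi> ` P) (restrict (inv_into P \<phi>) (\<phi> ` P))"
proof -
  obtain a \<theta> where a: "\<phi> ` (P \<inter> T) = \<phi> ` P \<inter> T" "a \<in> carrier A" "\<theta> \<in> E (P \<inter> T) T" "\<And>x. x \<in> P \<inter> T \<Longrightarrow> \<phi> x = c a (\<theta> x)"
    using \<phi>(2) by (auto simp: factors_def)
  let ?i = "inv\<^bsub>A\<^esub> a"
  note sP = subT_inter[OF P]
  have inj: "inj_on \<phi> P" by (rule mor_hom(3)[OF P subgroup_self \<phi>(1)])
  have inj\<theta>: "inj_on \<theta> (P \<inter> T)" by (rule E.mor_hom(3)[OF sP subT_T a(3)])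
  have s\<theta>: "subT (\<theta> ` (P \<inter> T))" by (rule E.mor_image_subgroup[OF sP subT_T a(3)])
  let ?z = "restrict (inv_into (P \<inter> T) \<theta>) (\<theta> ` (P \<inter> T))"
  have z: "?z \<in> E (\<theta> ` (P \<inter> T)) T"
    by (rule E.mor_codomain[OF s\<theta> sP subT_T E.mor_inverse[OF sP subT_T a(3)]]) (use inj\<theta> in auto)
  have img: "c a ` \<theta> ` (P \<inter> T) = \<phi> ` P \<inter> T" unfolding a(1)[symmetric] image_image by (rule image_cong) (auto simp: a(4))
  have z': "(\<lambda>x\<in>\<phi> ` P \<inter> T. c a (?z (c ?i x))) \<in> E (\<phi> ` P \<inter> T) T"
    using c_invariant[OF a(2) s\<theta> z] img by simp
  have "restrict (inv_into P \<phi>) (\<phi> ` P) y = c ?i ((\<lambda>x\<in>\<phi> ` P \<inter> T. c a (?z (c ?i x))) y)" if y: "y \<in> \<phi> ` P \<inter> T" for y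
  proof -
    obtain x where x: "x \<in> P \<inter> T" "y = \<phi> x" using y a(1) by (metis imageE)
    have "\<theta> x \<in> carrier S" using E.mor_hom(7)[OF sP subT_T a(3) x(1)] T_carrier by blast
    then have "c ?i y = \<theta> x" using a(2,4) x c_inv(1) by simp
    then have "?z (c ?i y) = x" using x(1) inj\<theta> by simp
    moreover have "inv_into P \<phi> y = x" using x inj by auto
    moreover have "x \<in> carrier S" using x T_carrier by auto
    ultimately show ?thesis using y a(2) c_inv(1) by simp
  qed
  moreover have "restrict (inv_into P \<phi>) (\<phi> ` P) ` (\<phi> ` P \<inter> T) = restrict (inv_into P \<phi>) (\<phi> ` P) ` (\<phi> ` P) \<inter> T"
  proof -
    have "restrict (inv_into P \<phi>) (\<phi> ` P) ` (\<phi> ` P) = P" using inj by (simp add: image_image)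
    moreover have "restrict (inv_into P \<phi>) (\<phi> ` P) ` \<phi> ` (P \<inter> T) = inv_into P \<phi> ` \<phi> ` (P \<inter> T)"
      by (rule image_cong) auto
    moreover have "inv_into P \<phi> ` \<phi> ` (P \<inter> T) = P \<inter> T" by (rule inv_into_image_cancel[OF inj]) auto
    ultimately show ?thesis using a(1) by simp
  qed
  ultimately show ?thesis unfolding factors_def using z' a(2) by (meson A.inv_closed)
qed

theorem factors_all:
  assumes base: "\<And>P \<alpha>. \<lbrakk>subgroup P S; fully_normalized S F P; \<alpha> \<in> F P P;
      \<And>R \<phi>. \<lbrakk>subgroup R S; card P < card R; \<phi> \<in> F R (carrier S)\<rbrakk> \<Longrightarrow> factors R \<phi>\<rbrakk> \<Longrightarrow> factors P \<alpha>"
    and P: "subgroup P S" and \<phi>: "\<phi> \<in> F P (carrier S)"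
  shows "factors P \<phi>"
  by (rule alperin_induct[where Good = factors, OF factors_restrict factors_compose factors_inverse base P \<phi>])

text \<open>On P, c_t \<psi> = (c_t \<psi> c_t^-1) c_t, and the bracket is a morphism of E by
  invariance, hence invertible on its image. Whether c_t \<psi> lies in E is thus independent of
  \<psi>.\<close>

lemma c_restrict_mor_iff:
  assumes t: "t \<in> carrier A" and P: "subT P" and \<psi>: "\<psi> \<in> E P T"
  shows "(\<lambda>x\<in>P. c t (\<psi> x)) \<in> E P T \<longleftrightarrow> (\<lambda>x\<in>P. c t x) \<in> E P T"
proof -
  let ?k = "\<lambda>x\<in>P. c t x" and ?m = "\<lambda>x\<in>P. c t (\<psi> x)"
  let ?\<psi> = "\<lambda>x\<in>c t ` P. c t (\<psi> (c (inv\<^bsub>A\<^esub> t) x))"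
  have tP: "subT (c t ` P)" by (rule subT_c[OF t P])
  have \<psi>': "?\<psi> \<in> E (c t ` P) T" by (rule c_invariant[OF t P \<psi>])
  have PS: "x \<in> carrier S" if "x \<in> P" for x using that P T_carrier by (auto simp: subT_iff)
  have v: "?\<psi> (c t x) = c t (\<psi> x)" if "x \<in> P" for x using that t PS c_inv(1) by simp
  have inj: "inj_on ?\<psi> (c t ` P)" by (rule E.mor_hom(3)[OF tP subT_T \<psi>'])
  show ?thesis
  proof
    assume k: "?k \<in> E P T"
    have "compose P ?\<psi> ?k \<in> E P T"
      by (rule E.mor_comp[OF P subT_T k tP subT_T \<psi>']) auto
    moreover have "compose P ?\<psi> ?k = ?m"
      by (rule mor_eqI[of _ P]) (use v in \<open>auto simp: compose_eq\<close>)
    ultimately show "?m \<in> E P T" by simp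
  next
    assume m: "?m \<in> E P T"
    have img: "?m ` P = ?\<psi> ` c t ` P" using v by (auto simp: image_image)
    let ?z = "restrict (inv_into (c t ` P) ?\<psi>) (?\<psi> ` c t ` P)"
    have z: "?z \<in> E (?\<psi> ` c t ` P) (c t ` P)" by (rule E.mor_inverse[OF tP subT_T \<psi>'])
    have sz: "subT (?\<psi> ` c t ` P)" by (rule E.mor_image_subgroup[OF tP subT_T \<psi>'])
    have "compose P ?z ?m \<in> E P (c t ` P)"
      by (rule E.mor_comp[OF P subT_T m sz tP z]) (simp only: img order_refl)
    moreover have "compose P ?z ?m = ?k"
    proof (rule mor_eqI[of _ P])
      fix x assume x: "x \<in> P"
      have "inv_into (c t ` P) ?\<psi> (?\<psi> (c t x)) = c t x" by (rule inv_into_f_f[OF inj]) (use x in blast)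
      moreover have "?\<psi> (c t x) \<in> ?\<psi> ` c t ` P" using x by blast
      ultimately have "?z (?\<psi> (c t x)) = c t x" by (simp only: restrict_apply')
      then show "compose P ?z ?m x = ?k x" unfolding compose_eq[OF x] restrict_apply'[OF x] v[OF x] .
    qed auto
    ultimately have "?k \<in> E P (c t ` P)" by simp
    then show "?k \<in> E P T"
      by (rule E.mor_codomain[OF P tP subT_T]) (use c_T[OF t] P in \<open>auto simp: subT_iff\<close>)
  qed
qed

text \<open>Starting from one factorization \<phi> = c_r \<psi>, all of them correspond to the t =
  a^-1 r with c_t \<psi> in E, that is, with c_t in E on P. Their number does not depend on \<phi>.
  As each pair (a, \<theta>) factors exactly one morphism, summing over \<phi> counts all of A
  \<times> E(P,T).\<close>

theorem card_factorizations:
  assumes all: "\<And>P \<phi>. \<lbrakk>subgroup P S; \<phi> \<in> F P (carrier S)\<rbrakk> \<Longrightarrow> factors P \<phi>"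
    and P: "subT P" and \<phi>: "\<phi> \<in> F P (carrier S)"
  shows "card {(a, \<theta>) \<in> carrier A \<times> E P T. \<forall>x\<in>P. \<phi> x = c a (\<theta> x)} * card (F P (carrier S)) =
    card (carrier A) * card (E P T)"
proof -
  have Ps: "subgroup P S" "P \<subseteq> T" using P by (auto simp: subT_iff)
  have PT: "P \<inter> T = P" using Ps by auto
  have finE: "finite (E P T)" by (rule E.finite_mor[OF P subT_T])
  let ?N = "\<lambda>\<phi>. {(a, \<theta>) \<in> carrier A \<times> E P T. \<forall>x\<in>P. \<phi> x = c a (\<theta> x)}"
  let ?K = "{t \<in> carrier A. (\<lambda>x\<in>P. c t x) \<in> E P T}"
  have N: "card (?N \<phi>) = card ?K" if \<phi>: "\<phi> \<in> F P (carrier S)" for \<phi>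
  proof -
    obtain r \<psi> where r: "r \<in> carrier A" "\<psi> \<in> E P T" "\<And>x. x \<in> P \<Longrightarrow> \<phi> x = c r (\<psi> x)"
      using all[OF Ps(1) \<phi>] PT by (auto simp: factors_def)
    have \<psi>S: "\<psi> x \<in> carrier S" if "x \<in> P" for x using E.mor_hom(7)[OF P subT_T r(2) that] T_carrier by blast
    have "bij_betw (\<lambda>(a, \<theta>). inv\<^bsub>A\<^esub> a \<otimes>\<^bsub>A\<^esub> r) (?N \<phi>) ?K"
    proof (rule bij_betw_byWitness[where f' = "\<lambda>t. (r \<otimes>\<^bsub>A\<^esub> inv\<^bsub>A\<^esub> t, \<lambda>x\<in>P. c t (\<psi> x))"])
      \<comment> \<open>The second component is recovered from a: it must be c_{a^-1} \<phi>, and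
        \<phi> is c_r \<psi>.\<close>
      have key: "\<theta> = (\<lambda>x\<in>P. c (inv\<^bsub>A\<^esub> a \<otimes>\<^bsub>A\<^esub> r) (\<psi> x))"
        if a: "a \<in> carrier A" "\<theta> \<in> E P T" "\<forall>x\<in>P. \<phi> x = c a (\<theta> x)" for a \<theta>
      proof (rule mor_eqI[of _ P])
        fix x assume x: "x \<in> P"
        have "\<theta> x \<in> carrier S" using E.mor_hom(7)[OF P subT_T a(2) x] T_carrier by blast
        then have "\<theta> x = c (inv\<^bsub>A\<^esub> a) (\<phi> x)" using a x c_inv(1) by simp
        then show "\<theta> x = (\<lambda>x\<in>P. c (inv\<^bsub>A\<^esub> a \<otimes>\<^bsub>A\<^esub> r) (\<psi> x)) x"
          using x r a \<psi>S by (simp add: c_mult)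
      qed (use E.mor_hom(5)[OF P subT_T a(2)] in auto)
      show "\<forall>z\<in>?N \<phi>. (\<lambda>t. (r \<otimes>\<^bsub>A\<^esub> inv\<^bsub>A\<^esub> t, \<lambda>x\<in>P. c t (\<psi> x))) ((\<lambda>(a, \<theta>). inv\<^bsub>A\<^esub> a \<otimes>\<^bsub>A\<^esub> r) z) = z"
      proof
        fix z assume "z \<in> ?N \<phi>"
        then obtain a \<theta> where z: "z = (a, \<theta>)" and a: "a \<in> carrier A" "\<theta> \<in> E P T" "\<forall>x\<in>P. \<phi> x = c a (\<theta> x)" by auto
        have "r \<otimes>\<^bsub>A\<^esub> inv\<^bsub>A\<^esub> (inv\<^bsub>A\<^esub> a \<otimes>\<^bsub>A\<^esub> r) = a"
          using a(1) r(1) by (simp add: A.inv_mult_group A.m_assoc[symmetric])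
        then show "(\<lambda>t. (r \<otimes>\<^bsub>A\<^esub> inv\<^bsub>A\<^esub> t, \<lambda>x\<in>P. c t (\<psi> x))) ((\<lambda>(a, \<theta>). inv\<^bsub>A\<^esub> a \<otimes>\<^bsub>A\<^esub> r) z) = z"
          using key[OF a] by (simp add: z)
      qed
      show "\<forall>t\<in>?K. (\<lambda>(a, \<theta>). inv\<^bsub>A\<^esub> a \<otimes>\<^bsub>A\<^esub> r) ((\<lambda>t. (r \<otimes>\<^bsub>A\<^esub> inv\<^bsub>A\<^esub> t, \<lambda>x\<in>P. c t (\<psi> x))) t) = t"
        using r(1) by (auto simp: A.inv_mult_group A.m_assoc)
      show "(\<lambda>(a, \<theta>). inv\<^bsub>A\<^esub> a \<otimes>\<^bsub>A\<^esub> r) ` ?N \<phi> \<subseteq> ?K"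
      proof (rule image_subsetI)
        fix z assume "z \<in> ?N \<phi>"
        then obtain a \<theta> where z: "z = (a, \<theta>)" and a: "a \<in> carrier A" "\<theta> \<in> E P T" "\<forall>x\<in>P. \<phi> x = c a (\<theta> x)" by auto
        have t: "inv\<^bsub>A\<^esub> a \<otimes>\<^bsub>A\<^esub> r \<in> carrier A" using a r by simp
        then show "(\<lambda>(a, \<theta>). inv\<^bsub>A\<^esub> a \<otimes>\<^bsub>A\<^esub> r) z \<in> ?K"
          using c_restrict_mor_iff[OF t P r(2)] key[OF a] a(2) by (simp add: z)
      qed
      show "(\<lambda>t. (r \<otimes>\<^bsub>A\<^esub> inv\<^bsub>A\<^esub> t, \<lambda>x\<in>P. c t (\<psi> x))) ` ?K \<subseteq> ?N \<phi>"
      proof (rule image_subsetI)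
        fix t assume "t \<in> ?K"
        then have t: "t \<in> carrier A" "(\<lambda>x\<in>P. c t x) \<in> E P T" by auto
        have "\<phi> x = c (r \<otimes>\<^bsub>A\<^esub> inv\<^bsub>A\<^esub> t) ((\<lambda>x\<in>P. c t (\<psi> x)) x)" if "x \<in> P" for x
          using that t(1) r \<psi>S by (simp add: c_mult c_closed c_inv)
        then show "(r \<otimes>\<^bsub>A\<^esub> inv\<^bsub>A\<^esub> t, \<lambda>x\<in>P. c t (\<psi> x)) \<in> ?N \<phi>"
          using c_restrict_mor_iff[OF t(1) P r(2)] t r(1) by simp
      qed
    qed
    then show ?thesis by (rule bij_betw_same_card)
  qed
  have "carrier A \<times> E P T = (\<Union>\<phi>\<in>F P (carrier S). ?N \<phi>)"
  proof (intro subset_antisym subsetI)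
    fix z assume "z \<in> carrier A \<times> E P T"
    then obtain a \<theta> where z: "z = (a, \<theta>)" "a \<in> carrier A" "\<theta> \<in> E P T" by auto
    have "\<theta> \<in> F P T" using E_subset[OF P subT_T] z by blast
    then have "compose P (c a) \<theta> \<in> F P (carrier S)"
      by (rule mor_comp[OF Ps(1) T_subgroup _ subgroup_self subgroup_self c_mor[OF z(2)]])
        (use E.mor_hom(7)[OF P subT_T z(3)] T_carrier in auto)
    moreover have "z \<in> ?N (compose P (c a) \<theta>)" using z by (auto simp: compose_eq)
    ultimately show "z \<in> (\<Union>\<phi>\<in>F P (carrier S). ?N \<phi>)" by blast
  qed auto
  then have "card (carrier A \<times> E P T) = card (\<Union>\<phi>\<in>F P (carrier S). ?N \<phi>)" by (rule arg_cong[where f = card])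
  also have "\<dots> = (\<Sum>\<phi>\<in>F P (carrier S). card (?N \<phi>))"
  proof (rule card_UN_disjoint)
    show "finite (F P (carrier S))" by (rule finite_mor[OF Ps(1) subgroup_self])
    show "\<forall>\<phi>\<in>F P (carrier S). finite (?N \<phi>)"
      by (intro ballI, rule finite_subset[of _ "carrier A \<times> E P T"]) (use finite_A finE in blast)+
    show "\<forall>\<phi>\<in>F P (carrier S). \<forall>\<psi>\<in>F P (carrier S). \<phi> \<noteq> \<psi> \<longrightarrow> ?N \<phi> \<inter> ?N \<psi> = {}"
    proof (intro ballI impI)
      fix \<phi> \<psi> assume p: "\<phi> \<in> F P (carrier S)" "\<psi> \<in> F P (carrier S)" "\<phi> \<noteq> \<psi>"
      then obtain x where "x \<in> P" "\<phi> x \<noteq> \<psi> x"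
        using mor_eqI[OF mor_hom(5)[OF Ps(1) subgroup_self p(1)] mor_hom(5)[OF Ps(1) subgroup_self p(2)]] by blast
      then show "?N \<phi> \<inter> ?N \<psi> = {}" by fastforce
    qed
  qed
  also have "\<dots> = card (F P (carrier S)) * card ?K" using N by simp
  finally show ?thesis using N[OF \<phi>] by (simp add: card_cartesian_product mult.commute)
qed

end

lemma (in group) inv_mult_cancel: "\<lbrakk>s \<in> carrier G; y \<in> carrier G\<rbrakk> \<Longrightarrow> inv s \<otimes> (s \<otimes> y) = y"
  by (simp add: m_assoc[symmetric])

section \<open>Transport of morphisms along a bijection\<close>

locale carrier_bij =
  fixes X :: "'a set" and f g :: "'a \<Rightarrow> 'a"
  assumes f_closed: "x \<in> X \<Longrightarrow> f x \<in> X" and g_closed: "x \<in> X \<Longrightarrow> g x \<in> X"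
    and gf: "x \<in> X \<Longrightarrow> g (f x) = x" and fg: "x \<in> X \<Longrightarrow> f (g x) = x"
begin

text \<open>The map f \<phi> f^-1 on f(P). The inverse g of f is a parameter of its own, so that
  transports are computed without \<open>inv_into\<close>.\<close>

definition transport :: "'a set \<Rightarrow> ('a \<Rightarrow> 'a) \<Rightarrow> 'a \<Rightarrow> 'a" where
  "transport P \<phi> = (\<lambda>x\<in>f ` P. f (\<phi> (g x)))"

lemma transport_apply: "\<lbrakk>P \<subseteq> X; x \<in> P\<rbrakk> \<Longrightarrow> transport P \<phi> (f x) = f (\<phi> x)"
  using gf by (auto simp: transport_def)

lemma transport_extensional: "transport P \<phi> \<in> extensional (f ` P)"
  by (simp add: transport_def)

lemma transport_eqI:
  assumes "P \<subseteq> X" "\<eta> \<in> extensional (f ` P)" "\<And>x. x \<in> P \<Longrightarrow> \<eta> (f x) = f (\<phi> x)"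
  shows "\<eta> = transport P \<phi>"
  by (rule extensionalityI[OF assms(2) transport_extensional]) (use assms transport_apply in auto)

lemma transport_image: "P \<subseteq> X \<Longrightarrow> transport P \<phi> ` f ` P = f ` \<phi> ` P"
  using transport_apply[of P] by (auto simp: image_image cong: image_cong_simp)

lemma transport_restrict: "\<lbrakk>P \<subseteq> X; R \<subseteq> P\<rbrakk> \<Longrightarrow> restrict (transport P \<phi>) (f ` R) = transport R (restrict \<phi> R)"
  by (rule transport_eqI) (use transport_apply in auto)

lemma transport_compose:
  assumes "P \<subseteq> X" "R \<subseteq> X" "\<phi> ` P \<subseteq> R"
  shows "compose (f ` P) (transport R \<psi>) (transport P \<phi>) = transport P (compose P \<psi> \<phi>)"
proof (rule transport_eqI[OF assms(1)])
  fix x assume x: "x \<in> P"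
  have "\<phi> x \<in> R" using x assms(3) by blast
  then show "compose (f ` P) (transport R \<psi>) (transport P \<phi>) (f x) = f (compose P \<psi> \<phi> x)"
    using x assms transport_apply by (simp add: compose_def)
qed simp

lemma inj_f: "P \<subseteq> X \<Longrightarrow> inj_on f P"
  by (rule inj_onI) (metis gf subsetD)

lemma transport_inj:
  assumes "P \<subseteq> X" "\<phi> ` P \<subseteq> X" "inj_on \<phi> P"
  shows "inj_on (transport P \<phi>) (f ` P)"
proof (rule inj_onI, clarify)
  fix x y assume xy: "x \<in> P" "y \<in> P" "transport P \<phi> (f x) = transport P \<phi> (f y)"
  then have "f (\<phi> x) = f (\<phi> y)" using transport_apply assms(1) by simp
  then have "\<phi> x = \<phi> y" using inj_f[OF assms(2)] xy by (auto dest: inj_onD)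
  then show "f x = f y" using assms(3) xy by (auto dest: inj_onD)
qed

lemma transport_inverse:
  assumes "P \<subseteq> X" "\<phi> ` P \<subseteq> X" "inj_on \<phi> P"
  shows "restrict (inv_into (f ` P) (transport P \<phi>)) (f ` \<phi> ` P) = transport (\<phi> ` P) (restrict (inv_into P \<phi>) (\<phi> ` P))"
proof (rule transport_eqI[OF assms(2)])
  fix y assume "y \<in> \<phi> ` P"
  then obtain x where x: "x \<in> P" "y = \<phi> x" by auto
  have "inv_into (f ` P) (transport P \<phi>) (transport P \<phi> (f x)) = f x"
    by (rule inv_into_f_f[OF transport_inj[OF assms]]) (use x in blast)
  then show "restrict (inv_into (f ` P) (transport P \<phi>)) (f ` \<phi> ` P) (f y) = f (restrict (inv_into P \<phi>) (\<phi> ` P) y)"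
    using x assms(1,3) by (simp add: transport_apply)
qed simp

end

text \<open>Conjugation of automorphisms by an isomorphism \<phi>. Combined with the functoriality
  of residuals it carries O^p(Aut_F(P)) and O^{p'}(Aut_F(P)) into the residuals of Aut_F(Q).\<close>

lemma (in fusion_system) aut_transport_hom:
  assumes P: "subgroup P S" and Q: "subgroup Q S" and \<phi>: "\<phi> \<in> F P Q" and img: "\<phi> ` P = Q"
  shows "group_hom (aut_group F P) (aut_group F Q) (\<lambda>\<alpha>. \<lambda>y\<in>Q. \<phi> (\<alpha> (inv_into P \<phi> y)))" (is "group_hom _ _ ?h")
proof -
  let ?i = "inv_into P \<phi>"
  have i: "?i y \<in> P" "\<phi> (?i y) = y" if "y \<in> Q" for y
    using that img by (auto intro: inv_into_into f_inv_into_f)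
  have ii: "?i (\<phi> x) = x" if "x \<in> P" for x using that mor_hom(3)[OF P Q \<phi>] by simp
  have \<phi>i: "restrict ?i Q \<in> F Q P" using mor_inverse[OF P Q \<phi>] img by simp
  have cl: "?h \<alpha> \<in> F Q Q" if \<alpha>: "\<alpha> \<in> F P P" for \<alpha>
  proof -
    have "compose Q \<phi> (compose Q \<alpha> (restrict ?i Q)) \<in> F Q Q"
      by (rule comp_closed[OF Q P Q comp_closed[OF Q P P \<phi>i \<alpha>] \<phi>])
    moreover have "compose Q \<phi> (compose Q \<alpha> (restrict ?i Q)) = ?h \<alpha>"
      by (auto simp: compose_def fun_eq_iff)
    ultimately show ?thesis by simp
  qed
  have "?h \<in> hom (aut_group F P) (aut_group F Q)"
  proof (rule homI)
    fix \<alpha> \<beta> assume "\<alpha> \<in> carrier (aut_group F P)" "\<beta> \<in> carrier (aut_group F P)"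
    then have a: "\<alpha> \<in> F P P" "\<beta> \<in> F P P" by auto
    have "?h (compose P \<alpha> \<beta>) = compose Q (?h \<alpha>) (?h \<beta>)"
    proof (rule mor_eqI[of _ Q])
      fix y assume y: "y \<in> Q"
      have b: "\<beta> (?i y) \<in> P" using mor_hom(7)[OF P P a(2)] i[OF y] by blast
      moreover have "\<phi> (\<beta> (?i y)) \<in> Q" using b img by blast
      ultimately show "?h (compose P \<alpha> \<beta>) y = compose Q (?h \<alpha>) (?h \<beta>) y"
        using y i[OF y] ii by (simp add: compose_def)
    qed auto
    then show "?h (\<alpha> \<otimes>\<^bsub>aut_group F P\<^esub> \<beta>) = ?h \<alpha> \<otimes>\<^bsub>aut_group F Q\<^esub> ?h \<beta>"
      using mult_aut_group[OF P a] mult_aut_group[OF Q cl cl] a by simp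
  qed (use cl in simp)
  then show ?thesis using group_aut_group[OF P] group_aut_group[OF Q] by (simp add: group_hom_def group_hom_axioms_def)
qed

lemma (in fusion_system) O_p_residual_aut: "subgroup P S \<Longrightarrow> O_p_residual p (aut_group F P) \<subseteq> F P P"
proof -
  assume P: "subgroup P S"
  interpret C: index_class "\<lambda>n. \<exists>k. n = p ^ k" by (rule index_class_p_power[OF prime_p])
  have "O_p_residual p (aut_group F P) \<lhd> aut_group F P"
    using C.index_residual(1)[OF group_aut_group[OF P] finite_aut_group[OF P]] by (simp add: O_p_residual_eq)
  then have "subgroup (O_p_residual p (aut_group F P)) (aut_group F P)" by (rule normal_imp_subgroup)
  then show ?thesis using subgroup.subset by fastforce
qed

lemma (in fusion_system) O_p_residual_hom:
  assumes "group_hom (aut_group F P) H h" "subgroup P S" "finite (carrier H)" "\<alpha> \<in> O_p_residual p (aut_group F P)"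
  shows "h \<alpha> \<in> O_p_residual p H"
proof -
  interpret C: index_class "\<lambda>n. \<exists>k. n = p ^ k" by (rule index_class_p_power[OF prime_p])
  show ?thesis
    using C.index_residual_hom[OF assms(1) finite_aut_group[OF assms(2)] assms(3)] assms(4) by (simp add: O_p_residual_eq)
qed

lemma (in fusion_system) conj_bij:
  assumes "s \<in> carrier S"
  shows "carrier_bij (carrier S) (\<lambda>x\<in>carrier S. s \<otimes> x \<otimes> inv s) (\<lambda>x\<in>carrier S. inv s \<otimes> x \<otimes> inv (inv s))"
  by unfold_locales (use assms in \<open>auto simp: m_assoc[symmetric]\<close>, auto simp: m_assoc)

section \<open>The hyperfocal subgroup\<close>

context fusion_system
begin

abbreviation "T \<equiv> hyperfocal S p F"

lemma hyperfocal_generator: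
  assumes "subgroup P S" "x \<in> P" "\<alpha> \<in> O_p_residual p (aut_group F P)"
  shows "inv x \<otimes> \<alpha> x \<in> T"
  unfolding hyperfocal_def by (rule generate.incl) (use assms in blast)

lemma hyperfocal_generators_carrier:
  "{inv g \<otimes> \<alpha> g | g \<alpha> P. subgroup P S \<and> g \<in> P \<and> \<alpha> \<in> O_p_residual p (aut_group F P)} \<subseteq> carrier S"
proof clarify
  fix g \<alpha> P assume a: "subgroup P S" "g \<in> P" "\<alpha> \<in> O_p_residual p (aut_group F P)"
  then have "\<alpha> \<in> F P P" using O_p_residual_aut by blast
  then have "\<alpha> g \<in> P" using mor_hom(7)[OF a(1,1)] a(2) by blast
  then show "inv g \<otimes> \<alpha> g \<in> carrier S" using a subgroup.mem_carrier[OF a(1)] by simp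
qed

lemma subgroup_hyperfocal: "subgroup T S"
  unfolding hyperfocal_def by (rule generate_is_subgroup[OF hyperfocal_generators_carrier])

text \<open>Conjugation by s takes the generator g^-1 \<alpha>(g) to the one formed from s g s^-1
  and c_s \<alpha> c_s^-1, and the latter lies in O^p of the automizer of s P s^-1.\<close>

lemma hyperfocal_conj:
  assumes s: "s \<in> carrier S" and x: "x \<in> T"
  shows "s \<otimes> x \<otimes> inv s \<in> T"
  using x unfolding hyperfocal_def
proof (induction rule: generate.induct)
  let ?G = "{inv g \<otimes> \<alpha> g | g \<alpha> P. subgroup P S \<and> g \<in> P \<and> \<alpha> \<in> O_p_residual p (aut_group F P)}"
  have gen: "s \<otimes> h \<otimes> inv s \<in> T" if h: "h \<in> ?G" for h
  proof -
    obtain g \<alpha> P where a: "h = inv g \<otimes> \<alpha> g" "subgroup P S" "g \<in> P" "\<alpha> \<in> O_p_residual p (aut_group F P)" using h by blast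
    have \<alpha>: "\<alpha> \<in> F P P" using O_p_residual_aut a by blast
    let ?c = "\<lambda>x\<in>P. s \<otimes> x \<otimes> inv s"
    have c: "?c \<in> F P (carrier S)"
      by (rule conj_mor[OF a(2) subgroup_self s]) (use s subgroup.mem_carrier[OF a(2)] in auto)
    have cP: "subgroup (?c ` P) S" by (rule mor_image_subgroup[OF a(2) subgroup_self c])
    have c': "?c \<in> F P (?c ` P)" using iso_factor[OF a(2) subgroup_self c] by blast
    let ?\<alpha> = "\<lambda>y\<in>?c ` P. ?c (\<alpha> (inv_into P ?c y))"
    have "?\<alpha> \<in> O_p_residual p (aut_group F (?c ` P))"
      by (rule O_p_residual_hom[OF aut_transport_hom[OF a(2) cP c' refl] a(2) finite_aut_group[OF cP] a(4)])
    moreover have "?c g \<in> ?c ` P" using a(3) by blast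
    ultimately have "inv (?c g) \<otimes> ?\<alpha> (?c g) \<in> T" using hyperfocal_generator[OF cP] by blast
    moreover have "?\<alpha> (?c g) = s \<otimes> \<alpha> g \<otimes> inv s"
    proof -
      have "inv_into P ?c (?c g) = g" by (rule inv_into_f_f[OF mor_hom(3)[OF a(2) subgroup_self c] a(3)])
      moreover have "\<alpha> g \<in> P" using mor_hom(7)[OF a(2,2) \<alpha> a(3)] .
      ultimately show ?thesis using \<open>?c g \<in> ?c ` P\<close> by (simp only: restrict_apply' if_True)
    qed
    moreover have "g \<in> carrier S" "\<alpha> g \<in> carrier S"
      using a(3) mor_hom(7)[OF a(2,2) \<alpha> a(3)] subgroup.mem_carrier[OF a(2)] by auto
    then have "s \<otimes> h \<otimes> inv s = inv (s \<otimes> g \<otimes> inv s) \<otimes> (s \<otimes> \<alpha> g \<otimes> inv s)"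
      using s unfolding a(1) by (simp add: inv_mult_group m_assoc inv_mult_cancel)
    ultimately show ?thesis using a(3) by simp
  qed
  note car = hyperfocal_generators_carrier
  {
    case one
    have "\<one> \<in> T" by (rule subgroup.one_closed[OF subgroup_hyperfocal])
    then show ?case using s unfolding hyperfocal_def by simp
  next
    case (incl h) then show ?case using gen unfolding hyperfocal_def by blast
  next
    case (inv h)
    then have "h \<in> carrier S" using car by blast
    then have "s \<otimes> inv h \<otimes> inv s = inv (s \<otimes> h \<otimes> inv s)" using s by (simp add: inv_mult_group m_assoc)
    then show ?case using subgroup.m_inv_closed[OF subgroup_hyperfocal gen[OF inv]] unfolding hyperfocal_def by simp
  next
    case (eng h1 h2)
    then have "h1 \<in> carrier S" "h2 \<in> carrier S" using generate_in_carrier[OF car] by auto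
    then have "s \<otimes> (h1 \<otimes> h2) \<otimes> inv s = (s \<otimes> h1 \<otimes> inv s) \<otimes> (s \<otimes> h2 \<otimes> inv s)"
      using s by (simp add: m_assoc inv_mult_cancel)
    then show ?case using subgroup.m_closed[OF subgroup_hyperfocal[unfolded hyperfocal_def] eng.IH] by simp
  }
qed

end

section \<open>Subsystems of \<open>p\<close>-power index\<close>

locale O_p_subsystem = saturated_fusion_system +
  fixes E
  assumes is_O_p: "is_O_p_subsystem S p F E"
begin

lemma sub: "fusion_subsystem S p F T E" and E_saturated: "saturated_fusion_system (S\<lparr>carrier := T\<rparr>) p E"
  and O_p_subset: "subgroup P (S\<lparr>carrier := T\<rparr>) \<Longrightarrow> O_p_residual p (aut_group F P) \<subseteq> E P P"
  using is_O_p by (auto simp: is_O_p_subsystem_def Let_def)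

lemma E_subset: "\<lbrakk>subgroup P (S\<lparr>carrier := T\<rparr>); subgroup Q (S\<lparr>carrier := T\<rparr>)\<rbrakk> \<Longrightarrow> E P Q \<subseteq> F P Q"
  using sub by (auto simp: fusion_subsystem_def)

sublocale E: saturated_fusion_system "S\<lparr>carrier := T\<rparr>" p E by (rule E_saturated)

abbreviation "subT P \<equiv> subgroup P (S\<lparr>carrier := T\<rparr>)"

lemma subT_iff: "subT P \<longleftrightarrow> subgroup P S \<and> P \<subseteq> T"
  by (rule subgroup_of_subgroup_iff[OF subgroup_hyperfocal])

lemma T_carrier: "x \<in> T \<Longrightarrow> x \<in> carrier S"
  using subgroup.mem_carrier[OF subgroup_hyperfocal] .

lemma subT_T: "subT T"
  using subgroup_hyperfocal by (simp add: subT_iff)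

lemma inv_T: "x \<in> T \<Longrightarrow> inv\<^bsub>S\<lparr>carrier := T\<rparr>\<^esub> x = inv x"
  by (rule m_inv_consistent[OF subgroup_hyperfocal])

abbreviation conj_map :: "'a \<Rightarrow> 'a \<Rightarrow> 'a" where
  "conj_map s \<equiv> (\<lambda>x\<in>carrier S. s \<otimes> x \<otimes> inv s)"

lemma subT_conj:
  assumes s: "s \<in> carrier S" and P: "subT P"
  shows "subT (conj_map s ` P)"
proof -
  have c: "conj_map s \<in> F (carrier S) (carrier S)" by (rule conj_mor[OF subgroup_self subgroup_self s]) (use s in auto)
  have Ps: "subgroup P S" "P \<subseteq> T" using P by (auto simp: subT_iff)
  have "subgroup (conj_map s ` P) S"
    by (rule mor_image_sub[OF subgroup_self subgroup_self c Ps(1) subgroup.subset[OF Ps(1)]])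
  moreover have "conj_map s ` P \<subseteq> T" using Ps hyperfocal_conj[OF s] T_carrier by auto
  ultimately show ?thesis by (simp add: subT_iff)
qed

text \<open>c_s is an isomorphism of F from P to s P s^-1, so it carries O^p(Aut_F(P)) into
  O^p(Aut_F(s P s^-1)), which E contains by definition.\<close>

lemma transport_conj_O_p:
  assumes s: "s \<in> carrier S" and P: "subT P" and \<beta>: "\<beta> \<in> O_p_residual p (aut_group F P)"
  shows "carrier_bij.transport (conj_map s) (conj_map (inv s)) P \<beta> \<in> E (conj_map s ` P) (conj_map s ` P)"
proof -
  interpret B: carrier_bij "carrier S" "conj_map s" "conj_map (inv s)" by (rule conj_bij[OF s])
  have Ps: "subgroup P S" "P \<subseteq> T" using P by (auto simp: subT_iff)
  have PS: "P \<subseteq> carrier S" by (rule subgroup.subset[OF Ps(1)])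
  have sP: "subT (conj_map s ` P)" by (rule subT_conj[OF s P])
  then have sPs: "subgroup (conj_map s ` P) S" by (simp add: subT_iff)
  let ?c = "\<lambda>x\<in>P. s \<otimes> x \<otimes> inv s"
  have cv: "?c x = conj_map s x" if "x \<in> P" for x using that PS by auto
  have img: "?c ` P = conj_map s ` P" using cv by (rule image_cong[OF refl])
  have c: "?c \<in> F P (conj_map s ` P)"
    by (rule conj_mor[OF Ps(1) sPs s]) (use PS in \<open>auto intro!: rev_image_eqI\<close>)
  have \<beta>F: "\<beta> \<in> F P P" using O_p_residual_aut[OF Ps(1)] \<beta> by blast
  have "(\<lambda>y\<in>conj_map s ` P. ?c (\<beta> (inv_into P ?c y))) \<in> O_p_residual p (aut_group F (conj_map s ` P))"
    by (rule O_p_residual_hom[OF aut_transport_hom[OF Ps(1) sPs c img] Ps(1) finite_aut_group[OF sPs] \<beta>])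
  moreover have "(\<lambda>y\<in>conj_map s ` P. ?c (\<beta> (inv_into P ?c y))) = B.transport P \<beta>"
  proof (rule B.transport_eqI[OF PS])
    fix x assume x: "x \<in> P"
    have "inv_into P ?c (conj_map s x) = x"
      using inv_into_f_f[OF mor_hom(3)[OF Ps(1) sPs c] x] cv[OF x] by simp
    moreover have "\<beta> x \<in> P" by (rule mor_hom(7)[OF Ps(1,1) \<beta>F x])
    ultimately show "(\<lambda>y\<in>conj_map s ` P. ?c (\<beta> (inv_into P ?c y))) (conj_map s x) = conj_map s (\<beta> x)"
      using x cv[of "\<beta> x"] by (simp only: restrict_apply' imageI)
  qed simp
  ultimately show ?thesis using O_p_subset[OF sP] by auto
qed

text \<open>Since \<open>E\<close> is saturated, Alperin's theorem says that it is generated by \<open>T\<close> and the groups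
  \<open>O\<^sup>p(Aut\<^sub>F(P))\<close>, a description that is visibly invariant under \<open>S\<close>.\<close>

lemma E_invariant:
  assumes s: "s \<in> carrier S" and P: "subT P" and \<theta>: "\<theta> \<in> E P T"
  shows "carrier_bij.transport (conj_map s) (conj_map (inv s)) P \<theta> \<in> E (conj_map s ` P) T"
proof -
  interpret B: carrier_bij "carrier S" "conj_map s" "conj_map (inv s)" by (rule conj_bij[OF s])
  have TS: "T \<subseteq> carrier S" by (rule subgroup.subset[OF subgroup_hyperfocal])
  have sT: "conj_map s ` T \<subseteq> T" using hyperfocal_conj[OF s] T_carrier by auto
  have PS: "Q \<subseteq> carrier S" if "subT Q" for Q using that TS by (auto simp: subT_iff)
  note sub = subT_conj[OF s]
  let ?Good = "\<lambda>P \<phi>. B.transport P \<phi> \<in> E (conj_map s ` P) T"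
  have T: "carrier (S\<lparr>carrier := T\<rparr>) = T" by simp
  show ?thesis
  proof (rule E.alperin_induct[of ?Good P \<theta>, unfolded T])
    fix P R \<phi> assume a: "subT P" "subT R" "R \<subseteq> P" "\<phi> \<in> E P T" "?Good P \<phi>"
    have "restrict (B.transport P \<phi>) (conj_map s ` R) \<in> E (conj_map s ` R) T"
      by (rule E.mor_restrict[OF sub[OF a(1)] subT_T sub[OF a(2)] a(5) image_mono[OF a(3)]])
    then show "?Good R (restrict \<phi> R)" using B.transport_restrict[OF PS[OF a(1)] a(3)] by simp
  next
    fix P \<phi> \<psi> assume a: "subT P" "\<phi> \<in> E P T" "?Good P \<phi>" "\<psi> \<in> E (\<phi> ` P) T" "?Good (\<phi> ` P) \<psi>"
    have \<phi>P: "subT (\<phi> ` P)" by (rule E.mor_image_subgroup[OF a(1) subT_T a(2)])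
    have "compose (conj_map s ` P) (B.transport (\<phi> ` P) \<psi>) (B.transport P \<phi>) \<in> E (conj_map s ` P) T"
      by (rule E.mor_comp[OF sub[OF a(1)] subT_T a(3) sub[OF \<phi>P] subT_T a(5)]) (simp only: B.transport_image[OF PS[OF a(1)]] order_refl)
    then show "?Good P (compose P \<psi> \<phi>)" using B.transport_compose[OF PS[OF a(1)] PS[OF \<phi>P]] by simp
  next
    fix P \<phi> assume a: "subT P" "\<phi> \<in> E P T" "?Good P \<phi>"
    have \<phi>P: "subT (\<phi> ` P)" by (rule E.mor_image_subgroup[OF a(1) subT_T a(2)])
    have img: "B.transport P \<phi> ` conj_map s ` P = conj_map s ` \<phi> ` P" by (rule B.transport_image[OF PS[OF a(1)]])
    have inv: "restrict (inv_into (conj_map s ` P) (B.transport P \<phi>)) (conj_map s ` \<phi> ` P) =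
        B.transport (\<phi> ` P) (restrict (inv_into P \<phi>) (\<phi> ` P))"
      by (rule B.transport_inverse[OF PS[OF a(1)] PS[OF \<phi>P] E.mor_hom(3)[OF a(1) subT_T a(2)]])
    have "restrict (inv_into (conj_map s ` P) (B.transport P \<phi>)) (conj_map s ` \<phi> ` P) \<in> E (conj_map s ` \<phi> ` P) (conj_map s ` P)"
      using E.mor_inverse[OF sub[OF a(1)] subT_T a(3)] unfolding img .
    then show "?Good (\<phi> ` P) (restrict (inv_into P \<phi>) (\<phi> ` P))"
      unfolding inv using E.mor_to_S[OF sub[OF \<phi>P] sub[OF a(1)]] by simp
  next
    fix P \<alpha> assume a: "subT P" "fully_normalized (S\<lparr>carrier := T\<rparr>) E P" "\<alpha> \<in> E P P"
    obtain \<beta> g where \<beta>: "\<beta> \<in> O_p_residual p (aut_group E P)" "\<beta> \<in> E P P" and g: "g \<in> normalizer (S\<lparr>carrier := T\<rparr>) P"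
      and \<alpha>: "\<alpha> = compose P \<beta> (\<lambda>x\<in>P. g \<otimes>\<^bsub>S\<lparr>carrier := T\<rparr>\<^esub> x \<otimes>\<^bsub>S\<lparr>carrier := T\<rparr>\<^esub> inv\<^bsub>S\<lparr>carrier := T\<rparr>\<^esub> g)"
      using E.aut_fully_normalized_factor[OF a] by blast
    have gT: "g \<in> T" using E.normalizer_carrier[OF a(1) g] by simp
    have gS: "g \<in> carrier S" using gT T_carrier by blast
    have Ps: "subgroup P S" using a(1) by (simp add: subT_iff)
    let ?c = "\<lambda>x\<in>P. g \<otimes> x \<otimes> inv g"
    have \<alpha>: "\<alpha> = compose P \<beta> ?c" using \<alpha> inv_T[OF gT] by simp
    have cP: "g \<otimes> x \<otimes> inv g \<in> P" if "x \<in> P" for x using E.conj_mem_normalizer[OF a(1) g that] inv_T[OF gT] by simp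
    \<comment> \<open>The inclusion of Aut_E(P) in Aut_F(P) carries O^p into O^p. This leads from
      the residual taken in E, about whose conjugates nothing is known yet, to the one taken in
      F.\<close>
    have "group_hom (aut_group E P) (aut_group F P) (\<lambda>x. x)"
    proof -
      have "(\<lambda>x. x) \<in> hom (aut_group E P) (aut_group F P)"
        using E_subset[OF a(1,1)] by (auto simp: hom_def aut_group_def)
      then show ?thesis using E.group_aut_group[OF a(1)] group_aut_group[OF Ps] by (simp add: group_hom_def group_hom_axioms_def)
    qed
    then have "\<beta> \<in> O_p_residual p (aut_group F P)"
      using E.O_p_residual_hom[OF _ a(1) finite_aut_group[OF Ps] \<beta>(1)] by blast
    then have t\<beta>: "B.transport P \<beta> \<in> E (conj_map s ` P) (conj_map s ` P)" by (rule transport_conj_O_p[OF s a(1)])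
    \<comment> \<open>The other factor of \<alpha> is conjugation by g in T. Conjugated by s it
      becomes conjugation by s g s^-1, again an element of T by normality.\<close>
    have tT: "s \<otimes> g \<otimes> inv s \<in> T" by (rule hyperfocal_conj[OF s gT])
    have tS: "s \<otimes> g \<otimes> inv s \<in> carrier S" using tT T_carrier by blast
    have xS: "x \<in> carrier S" if "x \<in> P" for x using that PS[OF a(1)] by blast
    have tv: "(s \<otimes> g \<otimes> inv s) \<otimes> (s \<otimes> x \<otimes> inv s) \<otimes> inv (s \<otimes> g \<otimes> inv s) = s \<otimes> (g \<otimes> x \<otimes> inv g) \<otimes> inv s" if "x \<in> carrier S" for x
      using s gS that by (simp add: inv_mult_group m_assoc inv_mult_cancel)
    have "(\<lambda>y\<in>conj_map s ` P. (s \<otimes> g \<otimes> inv s) \<otimes>\<^bsub>S\<lparr>carrier := T\<rparr>\<^esub> y \<otimes>\<^bsub>S\<lparr>carrier := T\<rparr>\<^esub> inv\<^bsub>S\<lparr>carrier := T\<rparr>\<^esub> (s \<otimes> g \<otimes> inv s)) \<in> E (conj_map s ` P) (conj_map s ` P)"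
    proof (rule E.conj_mor[OF sub[OF a(1)] sub[OF a(1)]])
      fix y assume "y \<in> conj_map s ` P"
      then obtain x where x: "x \<in> P" "y = s \<otimes> x \<otimes> inv s" using xS by auto
      have "s \<otimes> (g \<otimes> x \<otimes> inv g) \<otimes> inv s \<in> conj_map s ` P"
        by (rule rev_image_eqI[OF cP[OF x(1)]]) (use xS[OF cP[OF x(1)]] in simp)
      then show "(s \<otimes> g \<otimes> inv s) \<otimes>\<^bsub>S\<lparr>carrier := T\<rparr>\<^esub> y \<otimes>\<^bsub>S\<lparr>carrier := T\<rparr>\<^esub> inv\<^bsub>S\<lparr>carrier := T\<rparr>\<^esub> (s \<otimes> g \<otimes> inv s) \<in> conj_map s ` P"
        using tv[OF xS[OF x(1)]] inv_T[OF tT] x(2) by simp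
    qed (use tT in simp)
    moreover have "(\<lambda>y\<in>conj_map s ` P. (s \<otimes> g \<otimes> inv s) \<otimes>\<^bsub>S\<lparr>carrier := T\<rparr>\<^esub> y \<otimes>\<^bsub>S\<lparr>carrier := T\<rparr>\<^esub> inv\<^bsub>S\<lparr>carrier := T\<rparr>\<^esub> (s \<otimes> g \<otimes> inv s)) = B.transport P ?c"
    proof (rule B.transport_eqI[OF PS[OF a(1)]])
      fix x assume x: "x \<in> P"
      then have "conj_map s x \<in> conj_map s ` P" by blast
      then show "(\<lambda>y\<in>conj_map s ` P. (s \<otimes> g \<otimes> inv s) \<otimes>\<^bsub>S\<lparr>carrier := T\<rparr>\<^esub> y \<otimes>\<^bsub>S\<lparr>carrier := T\<rparr>\<^esub> inv\<^bsub>S\<lparr>carrier := T\<rparr>\<^esub> (s \<otimes> g \<otimes> inv s)) (conj_map s x) = conj_map s (?c x)"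
        using tv[OF xS[OF x]] inv_T[OF tT] x xS[OF x] xS[OF cP[OF x]] by simp
    qed simp
    ultimately have tc: "B.transport P ?c \<in> E (conj_map s ` P) (conj_map s ` P)" by simp
    have "compose (conj_map s ` P) (B.transport P \<beta>) (B.transport P ?c) \<in> E (conj_map s ` P) (conj_map s ` P)"
      by (rule E.comp_closed[OF sub[OF a(1)] sub[OF a(1)] sub[OF a(1)] tc t\<beta>])
    moreover have "compose (conj_map s ` P) (B.transport P \<beta>) (B.transport P ?c) = B.transport P \<alpha>"
      unfolding \<alpha> by (rule B.transport_compose[OF PS[OF a(1)] PS[OF a(1)]]) (use cP in auto)
    ultimately show "?Good P \<alpha>" using E.mor_to_S[OF sub[OF a(1)] sub[OF a(1)]] by simp
  qed (use P \<theta> in auto)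
qed

sublocale I: invariant_subsystem S p F S "\<lambda>s. conj_map s" T E
proof unfold_locales
  fix P Q assume "subT P" "subT Q"
  then show "E P Q \<subseteq> F P Q" by (rule E_subset)
next
  fix a assume "a \<in> carrier S"
  then show "conj_map a \<in> F (carrier S) (carrier S)" by (intro conj_mor[OF subgroup_self subgroup_self]) auto
next
  fix a b x assume "a \<in> carrier S" "b \<in> carrier S" "x \<in> carrier S"
  then show "conj_map (a \<otimes> b) x = conj_map a (conj_map b x)" by (simp add: inv_mult_group m_assoc)
next
  fix a x assume "a \<in> carrier S" "x \<in> T"
  then show "conj_map a x \<in> T" using hyperfocal_conj T_carrier by simp
next
  fix a P \<theta> assume a: "a \<in> carrier S" "subT P" "\<theta> \<in> E P T"
  interpret B: carrier_bij "carrier S" "conj_map a" "conj_map (inv a)" by (rule conj_bij[OF a(1)])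
  show "(\<lambda>x\<in>conj_map a ` P. conj_map a (\<theta> (conj_map (inv a) x))) \<in> E (conj_map a ` P) T"
    using E_invariant[OF a] unfolding B.transport_def .
qed (simp_all add: finite_carrier subgroup.subset[OF subgroup_hyperfocal] subgroup.m_closed[OF subgroup_hyperfocal]
    subgroup.one_closed[OF subgroup_hyperfocal] subgroup.m_inv_closed[OF subgroup_hyperfocal])

text \<open>The element g itself serves as a, with \<theta> the inclusion of P \<inter> T; normality
  of T gives the equation for images.\<close>

lemma factors_conj:
  assumes P: "subgroup P S" and g: "g \<in> normalizer S P"
  shows "I.factors P (\<lambda>x\<in>P. g \<otimes> x \<otimes> inv g)"
proof -
  have gS: "g \<in> carrier S" by (rule normalizer_carrier[OF P g])
  have PS: "x \<in> carrier S" if "x \<in> P" for x using that subgroup.mem_carrier[OF P] by blast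
  have sPT: "subT (P \<inter> T)" by (rule I.subT_inter[OF P])
  have back_T: "x \<in> T" if "x \<in> carrier S" "g \<otimes> x \<otimes> inv g \<in> T" for x
    using hyperfocal_conj[OF inv_closed[OF gS] that(2)] that(1) gS by (simp add: m_assoc inv_mult_cancel)
  have "(\<lambda>x\<in>P. g \<otimes> x \<otimes> inv g) ` (P \<inter> T) = (\<lambda>x\<in>P. g \<otimes> x \<otimes> inv g) ` P \<inter> T"
    using back_T PS hyperfocal_conj[OF gS] by auto
  moreover have "(\<lambda>x\<in>P \<inter> T. x) \<in> E (P \<inter> T) T" by (rule E.incl_mor[OF sPT subT_T]) auto
  moreover have "\<forall>x\<in>P \<inter> T. (\<lambda>x\<in>P. g \<otimes> x \<otimes> inv g) x = conj_map g ((\<lambda>x\<in>P \<inter> T. x) x)" using PS by auto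
  ultimately show ?thesis unfolding I.factors_def using gS by blast
qed

text \<open>By definition of the hyperfocal subgroup, x^-1 \<beta>(x) lies in T.\<close>

lemma residual_preserves_T:
  assumes P: "subgroup P S" and \<beta>: "\<beta> \<in> O_p_residual p (aut_group F P)" and x: "x \<in> P"
  shows "\<beta> x \<in> T \<longleftrightarrow> x \<in> T"
proof -
  have "\<beta> x \<in> P" using mor_hom(7)[OF P P _ x] O_p_residual_aut[OF P] \<beta> by blast
  then have c: "x \<in> carrier S" "\<beta> x \<in> carrier S" using x subgroup.mem_carrier[OF P] by auto
  have t: "inv x \<otimes> \<beta> x \<in> T" by (rule hyperfocal_generator[OF P x \<beta>])
  have "\<beta> x = x \<otimes> (inv x \<otimes> \<beta> x)" "x = \<beta> x \<otimes> inv (inv x \<otimes> \<beta> x)"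
    using c inv_mult_cancel[of "inv x" "\<beta> x"] inv_mult_cancel[of "inv (\<beta> x)" x] by (simp_all add: inv_mult_group)
  then show ?thesis
    using t subgroup.m_closed[OF subgroup_hyperfocal] subgroup.m_inv_closed[OF subgroup_hyperfocal t] by metis
qed

text \<open>Automorphisms of P preserve P \<inter> T, so restriction is a homomorphism from Aut_F(P)
  to Aut_F(P \<inter> T). It carries \<beta> into O^p(Aut_F(P \<inter> T)), which E contains, and a
  = 1 completes the factorization.\<close>

lemma factors_residual:
  assumes P: "subgroup P S" "fully_normalized S F P" and \<beta>: "\<beta> \<in> O_p_residual p (aut_group F P)"
  shows "I.factors P \<beta>"
proof -
  have \<beta>F: "\<beta> \<in> F P P" using O_p_residual_aut[OF P(1)] \<beta> by blast
  have sPT: "subT (P \<inter> T)" by (rule I.subT_inter[OF P(1)])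
  then have PT: "subgroup (P \<inter> T) S" by (simp add: subT_iff)
  \<comment> \<open>Full normalization enters here: \<alpha> is conjugation by an element of S
    followed by an element of O^p(Aut_F(P)), and both preserve T.\<close>
  have pres: "\<alpha> x \<in> P \<inter> T" if \<alpha>: "\<alpha> \<in> F P P" and x: "x \<in> P \<inter> T" for \<alpha> x
  proof -
    obtain \<gamma> g where \<gamma>: "\<gamma> \<in> O_p_residual p (aut_group F P)" "\<gamma> \<in> F P P" "g \<in> normalizer S P"
      "\<alpha> = compose P \<gamma> (\<lambda>x\<in>P. g \<otimes> x \<otimes> inv g)" using aut_fully_normalized_factor[OF P \<alpha>] by blast
    have gx: "g \<otimes> x \<otimes> inv g \<in> P" using conj_mem_normalizer[OF P(1) \<gamma>(3)] x by blast
    have "g \<otimes> x \<otimes> inv g \<in> T" using hyperfocal_conj[OF normalizer_carrier[OF P(1) \<gamma>(3)]] x by blast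
    then have "\<gamma> (g \<otimes> x \<otimes> inv g) \<in> T" using residual_preserves_T[OF P(1) \<gamma>(1) gx] by blast
    moreover have "\<alpha> x \<in> P" using mor_hom(7)[OF P(1,1) \<alpha>] x by blast
    ultimately show ?thesis using x \<gamma>(4) by (simp add: compose_def)
  qed
  let ?r = "\<lambda>\<alpha>. restrict \<alpha> (P \<inter> T)"
  have r: "?r \<alpha> \<in> F (P \<inter> T) (P \<inter> T)" if "\<alpha> \<in> F P P" for \<alpha>
    using mor_codomain[OF PT P(1) PT mor_restrict[OF P(1,1) PT that]] pres[OF that] by auto
  have "group_hom (aut_group F P) (aut_group F (P \<inter> T)) ?r"
  proof -
    have "?r (compose P \<alpha> \<gamma>) = compose (P \<inter> T) (?r \<alpha>) (?r \<gamma>)" if "\<alpha> \<in> F P P" "\<gamma> \<in> F P P" for \<alpha> \<gamma>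
      using pres[OF that(2)] by (auto simp: compose_def fun_eq_iff)
    then have "?r \<in> hom (aut_group F P) (aut_group F (P \<inter> T))"
      using r by (auto intro!: homI simp: mult_aut_group[OF P(1)] mult_aut_group[OF PT])
    then show ?thesis using group_aut_group[OF P(1)] group_aut_group[OF PT] by (simp add: group_hom_def group_hom_axioms_def)
  qed
  then have "?r \<beta> \<in> O_p_residual p (aut_group F (P \<inter> T))"
    by (rule O_p_residual_hom[OF _ P(1) finite_aut_group[OF PT] \<beta>])
  then have "?r \<beta> \<in> E (P \<inter> T) (P \<inter> T)" using O_p_subset[OF sPT] by blast
  then have "?r \<beta> \<in> E (P \<inter> T) T" using E.mor_to_S[OF sPT sPT] by simp
  moreover have "\<beta> ` (P \<inter> T) = \<beta> ` P \<inter> T" using residual_preserves_T[OF P(1) \<beta>] by auto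
  moreover have "\<forall>x\<in>P \<inter> T. \<beta> x = conj_map \<one> (?r \<beta> x)"
  proof
    fix x assume x: "x \<in> P \<inter> T"
    then have "\<beta> x \<in> carrier S" using pres[OF \<beta>F x] T_carrier by blast
    then show "\<beta> x = conj_map \<one> (?r \<beta> x)" using x by simp
  qed
  ultimately show ?thesis unfolding I.factors_def by (meson one_closed)
qed

text \<open>An automorphism of a fully normalized subgroup is conjugation by an element of S
  followed by an element of O^p(Aut_F(P)). Both factor, hence so does the composite.\<close>

lemma factors:
  assumes "subgroup P S" "\<phi> \<in> F P (carrier S)"
  shows "I.factors P \<phi>"
proof (rule I.factors_all[OF _ assms])
  fix P \<alpha> assume P: "subgroup P S" "fully_normalized S F P" and \<alpha>: "\<alpha> \<in> F P P"
  obtain \<beta> g where \<beta>: "\<beta> \<in> O_p_residual p (aut_group F P)" "\<beta> \<in> F P P" "g \<in> normalizer S P"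
    "\<alpha> = compose P \<beta> (\<lambda>x\<in>P. g \<otimes> x \<otimes> inv g)" using aut_fully_normalized_factor[OF P \<alpha>] by blast
  let ?c = "\<lambda>x\<in>P. g \<otimes> x \<otimes> inv g"
  have c: "?c \<in> F P P"
    by (rule conj_mor[OF P(1,1) normalizer_carrier[OF P(1) \<beta>(3)] conj_mem_normalizer[OF P(1) \<beta>(3)]])
  have "?c ` P = P" by (rule aut_image[OF P(1) c])
  then show "I.factors P \<alpha>"
    unfolding \<beta>(4) using I.factors_compose[OF P(1) mor_to_S[OF P(1,1) c] factors_conj[OF P(1) \<beta>(3)]]
      mor_to_S[OF P(1,1) \<beta>(2)] factors_residual[OF P \<beta>(1)] by simp
qed

text \<open>At (Q, \<psi>) the left side has the mark of \<omega>. On the right, the mark of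
  [T, incl] at (\<theta>, \<psi>) counts the s in S with \<psi> = c_s \<theta>, so the sum over
  \<theta> in E(Q,T) counts factorizations, each weighted with |T| / |E(Q,T)|; this |T| cancels
  against the factor in the product formula. For \<psi> in F, \<open>card_factorizations\<close>
  turns the rest into |S| / |F(Q,S)|.\<close>

theorem O_p_idempotent_reciprocity:
  assumes \<omega>: "characteristic_idempotent S p F \<omega>"
    and \<omega>E: "characteristic_idempotent (S\<lparr>carrier := T\<rparr>) p E \<omega>\<^sub>E"
  shows "burnside_comp p (S\<lparr>carrier := T\<rparr>) S S \<omega> (basis_elem p (S\<lparr>carrier := T\<rparr>) S T (\<lambda>x\<in>T. x)) =
    burnside_comp p (S\<lparr>carrier := T\<rparr>) (S\<lparr>carrier := T\<rparr>) S (basis_elem p (S\<lparr>carrier := T\<rparr>) S T (\<lambda>x\<in>T. x)) \<omega>\<^sub>E"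
proof -
  let ?T = "S\<lparr>carrier := T\<rparr>"
  let ?b = "basis_elem p ?T S T (\<lambda>x\<in>T. x)"
  interpret TSS: burnside_composition ?T S S p by (rule burnside_composition_sub'(1)[OF subgroup_hyperfocal])
  interpret TTS: burnside_composition ?T ?T S p by (rule burnside_composition_sub[OF subgroup_hyperfocal subgroup_hyperfocal])
  have X: "\<omega> \<in> carrier (burnside p S S)" "\<omega>\<^sub>E \<in> carrier (burnside p ?T ?T)"
    using \<omega> \<omega>E by (auto simp: characteristic_idempotent_def)
  have incl: "(\<lambda>x\<in>T. x) \<in> hom ?T S" using T_carrier subgroup.m_closed[OF subgroup_hyperfocal] by (auto simp: hom_def)
  have sT: "subgroup T ?T" "(\<lambda>x\<in>T. x) \<in> hom (?T\<lparr>carrier := T\<rparr>) S" using subT_T incl by simp_all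
  have b: "?b \<in> carrier (burnside p ?T S)" by (rule TSS.GH.basis_elem_closed[OF sT])
  show ?thesis
  proof (rule TSS.GH.burnside_elem_eqI[OF TSS.burnside_comp_closed[OF X(1) b] TTS.burnside_comp_closed[OF b X(2)]])
    fix Q \<psi> assume Q: "subT Q" and \<psi>: "\<psi> \<in> Q \<rightarrow>\<^sub>E carrier S"
    have Qs: "subgroup Q S" "Q \<subseteq> T" using Q by (auto simp: subT_iff)
    have q: "finite Q" "(\<lambda>q. q) \<in> Q \<rightarrow> carrier ?T" "\<psi> \<in> Q \<rightarrow> carrier S" using finite_sub[OF Qs(1)] Qs(2) \<psi> by auto
    let ?nF = "of_nat (card (F Q (carrier S))) :: rat" and ?nE = "of_nat (card (E Q T)) :: rat" and ?nS = "of_nat (card (carrier S)) :: rat"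
    have "elem_mark (burnside_comp p ?T S S \<omega> ?b) Q (\<lambda>q. q) \<psi> = elem_mark \<omega> Q ((\<lambda>x\<in>T. x) \<circ> (\<lambda>q. q)) \<psi>"
      using TSS.elem_mark_comp_basis_total[OF X(1) incl q] by simp
    also have "\<dots> = elem_mark \<omega> Q (\<lambda>q. q) \<psi>" by (rule elem_mark_cong) (use Qs in auto)
    finally have lhs: "elem_mark (burnside_comp p ?T S S \<omega> ?b) Q (\<lambda>q. q) \<psi> =
      (if \<psi> \<in> F Q (carrier S) then ?nS / ?nF else 0)"
      using char_idempotent_elem_mark[OF \<omega> Qs(1) \<psi>] by simp
    let ?N = "{(a, \<theta>) \<in> carrier S \<times> E Q T. \<forall>x\<in>Q. \<psi> x = conj_map a (\<theta> x)}"
    have fE: "finite (E Q T)" using E.finite_mor[OF Q subT_T] .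
    have pE: "card (E Q T) > 0" using E.card_mor_pos[OF Q] by simp
    have "of_nat (card T) * elem_mark (burnside_comp p ?T ?T S ?b \<omega>\<^sub>E) Q (\<lambda>q. q) \<psi> =
      (\<Sum>\<theta>\<in>Q \<rightarrow>\<^sub>E T. elem_mark ?b Q \<theta> \<psi> * elem_mark \<omega>\<^sub>E Q (\<lambda>q. q) \<theta>)"
      using TTS.elem_mark_comp[OF b X(2) q] by simp
    also have "\<dots> = (\<Sum>\<theta>\<in>Q \<rightarrow>\<^sub>E T. if \<theta> \<in> E Q T then
      of_nat (card {a \<in> carrier S. \<forall>x\<in>Q. \<psi> x = conj_map a (\<theta> x)}) * (of_nat (card T) / ?nE) else 0)"
    proof (rule sum.cong[OF refl])
      fix \<theta> assume \<theta>: "\<theta> \<in> Q \<rightarrow>\<^sub>E T"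
      have \<theta>T: "\<theta> x \<in> T" if "x \<in> Q" for x using \<theta> that by auto
      have "elem_mark ?b Q \<theta> \<psi> = of_nat (card {h \<in> carrier S. \<forall>q\<in>Q. \<psi> q = h \<otimes> (\<lambda>x\<in>T. x) (\<theta> q) \<otimes> inv h})"
        using TSS.GH.elem_mark_basis_elem[OF sT _ q(3), of \<theta>] TSS.GH.mark_basis_biset_total[OF incl q(1) _ q(3), of \<theta>] \<theta>T by auto
      also have "{h \<in> carrier S. \<forall>q\<in>Q. \<psi> q = h \<otimes> (\<lambda>x\<in>T. x) (\<theta> q) \<otimes> inv h} = {a \<in> carrier S. \<forall>x\<in>Q. \<psi> x = conj_map a (\<theta> x)}"
        using \<theta>T T_carrier by auto
      finally have e0: "elem_mark ?b Q \<theta> \<psi> = of_nat (card {a \<in> carrier S. \<forall>x\<in>Q. \<psi> x = conj_map a (\<theta> x)})" .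
      have e1: "elem_mark \<omega>\<^sub>E Q (\<lambda>q. q) \<theta> = (if \<theta> \<in> E Q T then of_nat (card T) / ?nE else 0)"
        using E.char_idempotent_elem_mark[OF \<omega>E Q, of \<theta>] \<theta> by simp
      show "elem_mark ?b Q \<theta> \<psi> * elem_mark \<omega>\<^sub>E Q (\<lambda>q. q) \<theta> = (if \<theta> \<in> E Q T then
        of_nat (card {a \<in> carrier S. \<forall>x\<in>Q. \<psi> x = conj_map a (\<theta> x)}) * (of_nat (card T) / ?nE) else 0)"
        unfolding e0 e1 by (cases "\<theta> \<in> E Q T") (simp_all only: if_True if_False mult_zero_right)
    qed
    also have "\<dots> = (\<Sum>\<theta>\<in>E Q T. of_nat (card {a \<in> carrier S. \<forall>x\<in>Q. \<psi> x = conj_map a (\<theta> x)}) * (of_nat (card T) / ?nE))"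
    proof -
      have "(Q \<rightarrow>\<^sub>E T) \<inter> E Q T = E Q T" using E.mor_hom(6)[OF Q subT_T] by blast
      moreover have "finite (Q \<rightarrow>\<^sub>E T)" using q(1) finite_sub[OF subgroup_hyperfocal] by (simp add: finite_PiE)
      ultimately show ?thesis by (simp add: sum.If_cases Int_def)
    qed
    also have "\<dots> = of_nat (\<Sum>\<theta>\<in>E Q T. card {a \<in> carrier S. \<forall>x\<in>Q. \<psi> x = conj_map a (\<theta> x)}) * (of_nat (card T) / ?nE)"
      unfolding of_nat_sum sum_distrib_right ..
    also have "(\<Sum>\<theta>\<in>E Q T. card {a \<in> carrier S. \<forall>x\<in>Q. \<psi> x = conj_map a (\<theta> x)}) = card ?N"
    proof -
      have "card (SIGMA \<theta>:E Q T. {a \<in> carrier S. \<forall>x\<in>Q. \<psi> x = conj_map a (\<theta> x)}) =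
        (\<Sum>\<theta>\<in>E Q T. card {a \<in> carrier S. \<forall>x\<in>Q. \<psi> x = conj_map a (\<theta> x)})"
        using fE finite_carrier by (intro card_SigmaI) auto
      moreover have "?N = prod.swap ` (SIGMA \<theta>:E Q T. {a \<in> carrier S. \<forall>x\<in>Q. \<psi> x = conj_map a (\<theta> x)})"
      proof (intro subset_antisym subsetI)
        fix z assume "z \<in> ?N"
        then obtain a \<theta> where z: "z = (a, \<theta>)" "a \<in> carrier S" "\<theta> \<in> E Q T" "\<forall>x\<in>Q. \<psi> x = conj_map a (\<theta> x)" by blast
        then have "(\<theta>, a) \<in> (SIGMA \<theta>:E Q T. {a \<in> carrier S. \<forall>x\<in>Q. \<psi> x = conj_map a (\<theta> x)})" by blast
        then show "z \<in> prod.swap ` (SIGMA \<theta>:E Q T. {a \<in> carrier S. \<forall>x\<in>Q. \<psi> x = conj_map a (\<theta> x)})"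
          by (rule rev_image_eqI) (simp only: z(1) swap_simp)
      qed auto
      ultimately show ?thesis by (simp only: card_image[OF inj_swap])
    qed
    finally have "of_nat (card T) * elem_mark (burnside_comp p ?T ?T S ?b \<omega>\<^sub>E) Q (\<lambda>q. q) \<psi> =
      of_nat (card ?N) * (of_nat (card T) / ?nE)" .
    moreover have "(of_nat (card T) :: rat) \<noteq> 0"
      using finite_sub[OF subgroup_hyperfocal] subgroup.one_closed[OF subgroup_hyperfocal] by auto
    moreover have "x = y / z" if "t * x = y * (t / z)" "t \<noteq> 0" for t x y z :: rat
      using that by (metis mult.commute mult_cancel_left times_divide_eq_left times_divide_eq_right)
    ultimately have rhs: "elem_mark (burnside_comp p ?T ?T S ?b \<omega>\<^sub>E) Q (\<lambda>q. q) \<psi> = of_nat (card ?N) / ?nE" by blast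
    have "of_nat (card ?N) / ?nE = (if \<psi> \<in> F Q (carrier S) then ?nS / ?nF else 0)"
    proof (cases "\<psi> \<in> F Q (carrier S)")
      case True
      have "card ?N * card (F Q (carrier S)) = card (carrier S) * card (E Q T)"
        by (rule I.card_factorizations[OF factors Q True])
      then have "of_nat (card ?N) * ?nF = ?nS * ?nE" unfolding of_nat_mult[symmetric] by (rule arg_cong)
      moreover have "?nE \<noteq> 0" "?nF \<noteq> 0" using pE card_mor_pos[OF Qs(1)] by simp_all
      ultimately have "of_nat (card ?N) / ?nE = ?nS / ?nF" by (intro frac_eq_eq[THEN iffD2])
      then show ?thesis by (simp only: True if_True)
    next
      case False
      \<comment> \<open>A factorization would make \<psi> a composite of morphisms of F.\<close>
      have "?N = {}"
      proof (rule ccontr)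
        assume "?N \<noteq> {}"
        then obtain a \<theta> where a: "a \<in> carrier S" "\<theta> \<in> E Q T" "\<forall>x\<in>Q. \<psi> x = conj_map a (\<theta> x)" by auto
        have \<theta>: "\<theta> \<in> F Q T" using E_subset[OF Q subT_T] a(2) by blast
        have "compose Q (conj_map a) \<theta> \<in> F Q (carrier S)"
          by (rule mor_comp[OF Qs(1) subgroup_hyperfocal \<theta> subgroup_self subgroup_self I.c_mor[OF a(1)]])
            (use mor_hom(4)[OF Qs(1) subgroup_hyperfocal \<theta>] T_carrier in blast)
        moreover have "compose Q (conj_map a) \<theta> = \<psi>"
          by (rule mor_eqI[of _ Q]) (use a(3) \<psi> in \<open>auto simp: compose_eq PiE_iff\<close>)
        ultimately show False using False by simp
      qed
      then have "card ?N = 0" by (simp only: card.empty)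
      then show ?thesis by (simp only: False if_False of_nat_0 div_0)
    qed
    then show "elem_mark (burnside_comp p ?T S S \<omega> ?b) Q (\<lambda>q. q) \<psi> = elem_mark (burnside_comp p ?T ?T S ?b \<omega>\<^sub>E) Q (\<lambda>q. q) \<psi>"
      by (simp only: lhs rhs)
  qed
qed

end

section \<open>Saturation is preserved by automorphisms of the group\<close>

text \<open>The extender is the preimage of the subgroup Aut_S(\<phi>(P)) under the transported
  conjugation.\<close>

lemma (in fusion_system) subgroup_extender:
  assumes P: "subgroup P S" and \<phi>: "\<phi> \<in> F P (carrier S)"
  shows "subgroup (extender S P \<phi>) S"
proof -
  have \<phi>P: "subgroup (\<phi> ` P) S" by (rule mor_image_subgroup[OF P subgroup_self \<phi>])
  have \<phi>': "\<phi> \<in> F P (\<phi> ` P)" using iso_factor[OF P subgroup_self \<phi>] by blast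
  let ?N = "S\<lparr>carrier := normalizer S P\<rparr>"
  let ?h = "\<lambda>g. \<lambda>y\<in>\<phi> ` P. \<phi> (g \<otimes> inv_into P \<phi> y \<otimes> inv g)"
  interpret h: group_hom ?N "aut_group F (\<phi> ` P)" ?h by (rule transported_conj_hom[OF P \<phi>P \<phi>' refl])
  interpret C: subgroup "conj_hom S (\<phi> ` P) (\<phi> ` P)" "aut_group F (\<phi> ` P)" by (rule subgroup_conj_hom[OF \<phi>P])
  have X: "extender S P \<phi> = {g \<in> carrier ?N. ?h g \<in> conj_hom S (\<phi> ` P) (\<phi> ` P)}" by (simp add: extender_def)
  have "subgroup (extender S P \<phi>) ?N"
    unfolding X
  proof (rule h.G.subgroupI)
    have "\<one>\<^bsub>?N\<^esub> \<in> {g \<in> carrier ?N. ?h g \<in> conj_hom S (\<phi> ` P) (\<phi> ` P)}"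
      unfolding mem_Collect_eq h.hom_one using h.G.one_closed C.one_closed by blast
    then show "{g \<in> carrier ?N. ?h g \<in> conj_hom S (\<phi> ` P) (\<phi> ` P)} \<noteq> {}" by blast
  next
    fix a assume "a \<in> {g \<in> carrier ?N. ?h g \<in> conj_hom S (\<phi> ` P) (\<phi> ` P)}"
    then have a: "a \<in> carrier ?N" "?h a \<in> conj_hom S (\<phi> ` P) (\<phi> ` P)" by auto
    show "inv\<^bsub>?N\<^esub> a \<in> {g \<in> carrier ?N. ?h g \<in> conj_hom S (\<phi> ` P) (\<phi> ` P)}"
      unfolding mem_Collect_eq h.hom_inv[OF a(1)] using h.G.inv_closed[OF a(1)] C.m_inv_closed[OF a(2)] by blast
  next
    fix a b assume "a \<in> {g \<in> carrier ?N. ?h g \<in> conj_hom S (\<phi> ` P) (\<phi> ` P)}" "b \<in> {g \<in> carrier ?N. ?h g \<in> conj_hom S (\<phi> ` P) (\<phi> ` P)}"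
    then have a: "a \<in> carrier ?N" "?h a \<in> conj_hom S (\<phi> ` P) (\<phi> ` P)" and b: "b \<in> carrier ?N" "?h b \<in> conj_hom S (\<phi> ` P) (\<phi> ` P)" by auto
    show "a \<otimes>\<^bsub>?N\<^esub> b \<in> {g \<in> carrier ?N. ?h g \<in> conj_hom S (\<phi> ` P) (\<phi> ` P)}"
      unfolding mem_Collect_eq h.hom_mult[OF a(1) b(1)] using h.G.m_closed[OF a(1) b(1)] C.m_closed[OF a(2) b(2)] by blast
  qed auto
  then show ?thesis using subgroup_of_subgroup_iff[OF subgroup_normalizer[OF P]] by blast
qed

text \<open>It is applied with the subsystem of index prime to p in the place of F and with f an
  automorphism of S from the ambient system, which is not known in advance to preserve the
  subsystem.\<close>

locale transported_system = saturated_fusion_system S p F + carrier_bij "carrier S" f g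
  for S (structure) and p F f g +
  assumes f_hom: "f \<in> hom S S"
begin

text \<open>The conjugate f^-1 F f, defined by pulling back, so that its morphisms are recognized by
  their transports in F.\<close>

definition F' :: "'a set \<Rightarrow> 'a set \<Rightarrow> ('a \<Rightarrow> 'a) set" where
  "F' P Q = {\<phi> \<in> P \<rightarrow>\<^sub>E Q. transport P \<phi> \<in> F (f ` P) (f ` Q)}"

lemma f_mult: "\<lbrakk>x \<in> carrier S; y \<in> carrier S\<rbrakk> \<Longrightarrow> f (x \<otimes> y) = f x \<otimes> f y"
  using f_hom by (simp add: hom_def)

lemma f_group_hom: "group_hom S S f"
  using f_hom is_group by (simp add: group_hom_def group_hom_axioms_def)

lemma f_inv: "x \<in> carrier S \<Longrightarrow> f (inv x) = inv (f x)"
  by (rule group_hom.hom_inv[OF f_group_hom])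

lemma g_hom: "g \<in> hom S S"
proof (rule homI)
  fix x y assume xy: "x \<in> carrier S" "y \<in> carrier S"
  have "f (g x \<otimes> g y) = x \<otimes> y" using xy by (simp add: f_mult g_closed fg)
  then show "g (x \<otimes> y) = g x \<otimes> g y" using xy gf[of "g x \<otimes> g y"] by (simp add: g_closed)
qed (rule g_closed)

lemma g_group_hom: "group_hom S S g"
  using g_hom is_group by (simp add: group_hom_def group_hom_axioms_def)

lemma subgroup_f: "subgroup P S \<Longrightarrow> subgroup (f ` P) S"
  by (rule group_hom.subgroup_img_is_subgroup[OF f_group_hom])

lemma subgroup_g: "subgroup P S \<Longrightarrow> subgroup (g ` P) S"
  by (rule group_hom.subgroup_img_is_subgroup[OF g_group_hom])

lemma f_g_image: "P \<subseteq> carrier S \<Longrightarrow> f ` g ` P = P"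
  using fg by (force simp: image_image)

lemma f_carrier: "f ` carrier S = carrier S"
proof (intro subset_antisym subsetI)
  fix x assume "x \<in> carrier S"
  then show "x \<in> f ` carrier S" using g_closed fg by (metis imageI)
qed (use f_closed in blast)

lemma f_eq_iff: "\<lbrakk>x \<in> carrier S; y \<in> carrier S\<rbrakk> \<Longrightarrow> f x = f y \<longleftrightarrow> x = y"
  using gf by metis

lemma sub_carrier: "subgroup P S \<Longrightarrow> P \<subseteq> carrier S"
  by (rule subgroup.subset)

lemma f_mem_image_iff: "\<lbrakk>subgroup P S; x \<in> carrier S\<rbrakk> \<Longrightarrow> f x \<in> f ` P \<longleftrightarrow> x \<in> P"
  using f_eq_iff subgroup.mem_carrier by fastforce

lemma f_conj: "\<lbrakk>x \<in> carrier S; y \<in> carrier S\<rbrakk> \<Longrightarrow> f (x \<otimes> y \<otimes> inv x) = f x \<otimes> f y \<otimes> inv (f x)"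
  by (simp add: f_mult f_inv)

lemma transport_conj:
  assumes "subgroup P S" "s \<in> carrier S"
  shows "transport P (\<lambda>x\<in>P. s \<otimes> x \<otimes> inv s) = (\<lambda>y\<in>f ` P. f s \<otimes> y \<otimes> inv (f s))"
proof (rule transport_eqI[OF sub_carrier[OF assms(1)], symmetric])
  fix x assume x: "x \<in> P"
  then have "x \<in> carrier S" using subgroup.mem_carrier[OF assms(1)] by blast
  then show "(\<lambda>y\<in>f ` P. f s \<otimes> y \<otimes> inv (f s)) (f x) = f ((\<lambda>x\<in>P. s \<otimes> x \<otimes> inv s) x)"
    using x f_conj[OF assms(2)] by simp
qed simp

lemma transport_inj_eq:
  assumes "subgroup P S" "\<phi> \<in> P \<rightarrow>\<^sub>E carrier S" "\<psi> \<in> P \<rightarrow>\<^sub>E carrier S" "transport P \<phi> = transport P \<psi>"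
  shows "\<phi> = \<psi>"
proof (rule PiE_ext[OF assms(2,3)])
  fix x assume x: "x \<in> P"
  have "f (\<phi> x) = f (\<psi> x)" using assms(4) transport_apply[OF sub_carrier[OF assms(1)] x] by metis
  moreover have "\<phi> x \<in> carrier S" "\<psi> x \<in> carrier S" using assms(2,3) x by auto
  ultimately show "\<phi> x = \<psi> x" using f_eq_iff by blast
qed

lemma PiE_sub_carrier: "\<lbrakk>subgroup Q S; \<phi> \<in> P \<rightarrow>\<^sub>E Q\<rbrakk> \<Longrightarrow> \<phi> \<in> P \<rightarrow>\<^sub>E carrier S"
  using subgroup.subset by (fastforce simp: PiE_iff)

text \<open>Conjugation by the inverse g shows that transport is onto the morphisms of F between
  f(P) and f(Q).\<close>

lemma pull_back:
  assumes P: "subgroup P S" and Q: "subgroup Q S" and \<eta>: "\<eta> \<in> F (f ` P) (f ` Q)"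
  obtains \<phi> where "\<phi> \<in> F' P Q" "transport P \<phi> = \<eta>"
proof -
  let ?\<phi> = "\<lambda>x\<in>P. g (\<eta> (f x))"
  have \<eta>v: "\<eta> (f x) \<in> f ` Q" if "x \<in> P" for x
    using mor_hom(7)[OF subgroup_f[OF P] subgroup_f[OF Q] \<eta>] that by blast
  have fQ: "y \<in> carrier S" if "y \<in> f ` Q" for y using that subgroup.mem_carrier[OF subgroup_f[OF Q]] by blast
  have "transport P ?\<phi> = \<eta>"
    by (rule transport_eqI[OF sub_carrier[OF P] mor_hom(5)[OF subgroup_f[OF P] subgroup_f[OF Q] \<eta>], symmetric])
      (use \<eta>v fQ fg in simp)
  moreover have "?\<phi> \<in> P \<rightarrow>\<^sub>E Q"
  proof (rule PiE_I)
    fix x assume x: "x \<in> P"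
    then obtain q where q: "q \<in> Q" "\<eta> (f x) = f q" using \<eta>v by blast
    then show "?\<phi> x \<in> Q" using x gf[of q] subgroup.mem_carrier[OF Q] by simp
  qed simp
  ultimately show ?thesis using that[of ?\<phi>] \<eta> by (simp add: F'_def)
qed

lemma F'_image:
  assumes "subgroup P S"
  shows "transport P \<phi> ` f ` P = f ` \<phi> ` P"
  by (rule transport_image[OF sub_carrier[OF assms]])

text \<open>Multiplicativity and injectivity are checked after applying the injective homomorphism
  f.\<close>

lemma F'_mor:
  assumes P: "subgroup P S" and Q: "subgroup Q S" and \<phi>: "\<phi> \<in> F' P Q"
  shows "\<phi> \<in> hom (S\<lparr>carrier := P\<rparr>) (S\<lparr>carrier := Q\<rparr>)" "inj_on \<phi> P" "\<phi> \<in> extensional P" "\<phi> ` P \<subseteq> Q"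
    "transport P \<phi> \<in> F (f ` P) (f ` Q)" "subgroup (\<phi> ` P) S" "\<And>x. x \<in> P \<Longrightarrow> \<phi> x \<in> Q"
proof -
  have \<phi>E: "\<phi> \<in> P \<rightarrow>\<^sub>E Q" and t: "transport P \<phi> \<in> F (f ` P) (f ` Q)" using \<phi> by (auto simp: F'_def)
  note h = mor_hom[OF subgroup_f[OF P] subgroup_f[OF Q] t]
  have v: "\<phi> x \<in> Q" "\<phi> x \<in> carrier S" "transport P \<phi> (f x) = f (\<phi> x)" "x \<in> carrier S" if "x \<in> P" for x
    using that \<phi>E subgroup.mem_carrier[OF Q] subgroup.mem_carrier[OF P] transport_apply[OF sub_carrier[OF P] that] by auto
  have m: "\<phi> (x \<otimes> y) = \<phi> x \<otimes> \<phi> y" if xy: "x \<in> P" "y \<in> P" for x y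
  proof -
    have xyP: "x \<otimes> y \<in> P" using xy subgroup.m_closed[OF P] by blast
    have "f (\<phi> (x \<otimes> y)) = transport P \<phi> (f x \<otimes> f y)"
      using v(3)[OF xyP] f_mult[OF v(4)[OF xy(1)] v(4)[OF xy(2)]] by simp
    also have "\<dots> = f (\<phi> x) \<otimes> f (\<phi> y)" using h(8)[of "f x" "f y"] xy v(3) by simp
    also have "\<dots> = f (\<phi> x \<otimes> \<phi> y)" using f_mult v(2) xy by simp
    finally show ?thesis using f_eq_iff[OF v(2)[OF xyP]] v(2) xy by simp
  qed
  show hom: "\<phi> \<in> hom (S\<lparr>carrier := P\<rparr>) (S\<lparr>carrier := Q\<rparr>)" using m v(1) by (auto simp: hom_def)
  show "inj_on \<phi> P"
  proof (rule inj_onI)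
    fix x y assume xy: "x \<in> P" "y \<in> P" "\<phi> x = \<phi> y"
    then have "transport P \<phi> (f x) = transport P \<phi> (f y)" using v(3) by simp
    then have "f x = f y" using inj_onD[OF h(3)] xy by blast
    then show "x = y" using f_eq_iff v(4) xy by simp
  qed
  show "\<phi> \<in> extensional P" "\<phi> ` P \<subseteq> Q" "transport P \<phi> \<in> F (f ` P) (f ` Q)" "\<And>x. x \<in> P \<Longrightarrow> \<phi> x \<in> Q"
    using \<phi>E t by (auto simp: PiE_iff)
  have "\<phi> \<in> hom (S\<lparr>carrier := P\<rparr>) S" using m v(2) by (auto simp: hom_def)
  then have "group_hom (S\<lparr>carrier := P\<rparr>) S \<phi>"
    using subgroup_imp_group[OF P] is_group by (simp add: group_hom_def group_hom_axioms_def)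
  then show "subgroup (\<phi> ` P) S" using group_hom.img_is_subgroup by fastforce
qed

lemma fusion_system_F': "fusion_system S p F'"
proof (intro fusion_system.intro fusion_system_axioms.intro)
  show "finite_p_group S p" by (rule finite_p_group_axioms)
next
  fix P Q assume P: "subgroup P S" and Q: "subgroup Q S"
  show "conj_hom S P Q \<subseteq> F' P Q"
  proof
    fix \<phi> assume "\<phi> \<in> conj_hom S P Q"
    then obtain s where s: "s \<in> carrier S" "\<And>x. x \<in> P \<Longrightarrow> s \<otimes> x \<otimes> inv s \<in> Q" "\<phi> = (\<lambda>x\<in>P. s \<otimes> x \<otimes> inv s)"
      by (auto simp: conj_hom_def)
    have "(\<lambda>y\<in>f ` P. f s \<otimes> y \<otimes> inv (f s)) \<in> F (f ` P) (f ` Q)"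
    proof (rule conj_mor[OF subgroup_f[OF P] subgroup_f[OF Q] f_closed[OF s(1)]])
      fix y assume "y \<in> f ` P"
      then obtain x where x: "x \<in> P" "y = f x" by blast
      then have "f s \<otimes> y \<otimes> inv (f s) = f (s \<otimes> x \<otimes> inv s)" using f_conj[OF s(1)] subgroup.mem_carrier[OF P] by simp
      then show "f s \<otimes> y \<otimes> inv (f s) \<in> f ` Q" using s(2)[OF x(1)] by blast
    qed
    then show "\<phi> \<in> F' P Q" using s(2) transport_conj[OF P s(1)] by (auto simp: F'_def s(3))
  qed
next
  fix P Q assume PQ: "subgroup P S" "subgroup Q S"
  show "F' P Q \<subseteq> mon (S\<lparr>carrier := P\<rparr>) (S\<lparr>carrier := Q\<rparr>) \<inter> extensional P"
    using F'_mor(1-3)[OF PQ] by (auto simp: mon_def)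
next
  fix P Q R \<phi> \<psi> assume s: "subgroup P S" "subgroup Q S" "subgroup R S" and \<phi>: "\<phi> \<in> F' P Q" and \<psi>: "\<psi> \<in> F' Q R"
  have "compose (f ` P) (transport Q \<psi>) (transport P \<phi>) \<in> F (f ` P) (f ` R)"
    by (rule comp_closed[OF subgroup_f[OF s(1)] subgroup_f[OF s(2)] subgroup_f[OF s(3)] F'_mor(5)[OF s(1,2) \<phi>] F'_mor(5)[OF s(2,3) \<psi>]])
  moreover have "compose (f ` P) (transport Q \<psi>) (transport P \<phi>) = transport P (compose P \<psi> \<phi>)"
    by (rule transport_compose[OF sub_carrier[OF s(1)] sub_carrier[OF s(2)] F'_mor(4)[OF s(1,2) \<phi>]])
  moreover have "compose P \<psi> \<phi> \<in> P \<rightarrow>\<^sub>E R"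
    using F'_mor(7)[OF s(1,2) \<phi>] F'_mor(7)[OF s(2,3) \<psi>] by (auto simp: compose_def)
  ultimately show "compose P \<psi> \<phi> \<in> F' P R" by (simp add: F'_def)
next
  fix P Q \<phi> assume s: "subgroup P S" "subgroup Q S" and \<phi>: "\<phi> \<in> F' P Q"
  note m = F'_mor[OF s \<phi>]
  have i: "transport P \<phi> \<in> F (f ` P) (f ` \<phi> ` P)"
    "restrict (inv_into (f ` P) (transport P \<phi>)) (f ` \<phi> ` P) \<in> F (f ` \<phi> ` P) (f ` P)"
    using iso_factor[OF subgroup_f[OF s(1)] subgroup_f[OF s(2)] m(5)] unfolding F'_image[OF s(1)] by auto
  have "transport (\<phi> ` P) (restrict (inv_into P \<phi>) (\<phi> ` P)) \<in> F (f ` \<phi> ` P) (f ` P)"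
    using i(2) transport_inverse[OF sub_carrier[OF s(1)] sub_carrier[OF m(6)] m(2)] by simp
  moreover have "restrict (inv_into P \<phi>) (\<phi> ` P) \<in> \<phi> ` P \<rightarrow>\<^sub>E P" using m(2) by auto
  moreover have "\<phi> \<in> P \<rightarrow>\<^sub>E \<phi> ` P" using m(3) by (auto simp: PiE_iff)
  ultimately show "\<phi> \<in> F' P (\<phi> ` P) \<and> restrict (inv_into P \<phi>) (\<phi> ` P) \<in> F' (\<phi> ` P) P"
    using i(1) by (simp add: F'_def)
qed

sublocale F': fusion_system S p F' by (rule fusion_system_F')

section \<open>Transport of conjugacy, normalizers, centralizers, automizers and extenders\<close>

lemma F_conjugate_iff:
  assumes P: "subgroup P S" and Q: "subgroup Q S"
  shows "F_conjugate S F' P Q \<longleftrightarrow> F_conjugate S F (f ` P) (f ` Q)"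
proof
  assume "F_conjugate S F' P Q"
  then obtain \<phi> where \<phi>: "\<phi> \<in> F' P Q" "\<phi> ` P = Q" by (auto simp: F_conjugate_def)
  then have "transport P \<phi> \<in> F (f ` P) (f ` Q)" "transport P \<phi> ` f ` P = f ` Q"
    using F'_mor(5)[OF P Q] F'_image[OF P] by auto
  then show "F_conjugate S F (f ` P) (f ` Q)" unfolding F_conjugate_def using subgroup_f P Q by blast
next
  assume "F_conjugate S F (f ` P) (f ` Q)"
  then obtain \<eta> where \<eta>: "\<eta> \<in> F (f ` P) (f ` Q)" "\<eta> ` f ` P = f ` Q" by (auto simp: F_conjugate_def)
  obtain \<phi> where \<phi>: "\<phi> \<in> F' P Q" "transport P \<phi> = \<eta>" using pull_back[OF P Q \<eta>(1)] by blast
  have "f ` \<phi> ` P = f ` Q" using F'_image[OF P, of \<phi>] \<phi>(2) \<eta>(2) by simp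
  then have "\<phi> ` P = Q"
    unfolding inj_on_image_eq_iff[OF inj_f[OF order_refl] sub_carrier[OF F'_mor(6)[OF P Q \<phi>(1)]] sub_carrier[OF Q]] .
  then show "F_conjugate S F' P Q" unfolding F_conjugate_def using \<phi>(1) P Q by blast
qed

lemma normalizer_f:
  assumes P: "subgroup P S"
  shows "normalizer S (f ` P) = f ` normalizer S P"
proof -
  have iff: "f s \<in> normalizer S (f ` P) \<longleftrightarrow> s \<in> normalizer S P" if s: "s \<in> carrier S" for s
  proof -
    have "(\<forall>y\<in>f ` P. f s \<otimes> y \<otimes> inv (f s) \<in> f ` P) \<longleftrightarrow> (\<forall>x\<in>P. s \<otimes> x \<otimes> inv s \<in> P)"
      using f_conj[OF s] f_mem_image_iff[OF P] subgroup.mem_carrier[OF P] s by (simp add: Ball_image_comp) (metis inv_closed m_closed)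
    then show ?thesis
      using normalizerI[OF P s] conj_mem_normalizer[OF P, of s]
        normalizerI[OF subgroup_f[OF P] f_closed[OF s]] conj_mem_normalizer[OF subgroup_f[OF P], of "f s"] by blast
  qed
  show ?thesis
  proof (intro subset_antisym subsetI)
    fix y assume y: "y \<in> normalizer S (f ` P)"
    then have yS: "y \<in> carrier S" using normalizer_carrier[OF subgroup_f[OF P]] by blast
    then have "g y \<in> normalizer S P" using iff[OF g_closed[OF yS]] y fg by simp
    then show "y \<in> f ` normalizer S P" using fg[OF yS] by (metis imageI)
  next
    fix y assume "y \<in> f ` normalizer S P"
    then show "y \<in> normalizer S (f ` P)" using iff normalizer_carrier[OF P] by blast
  qed
qed

lemma centralizer_f:
  assumes P: "subgroup P S"
  shows "group_centralizer S (f ` P) = f ` group_centralizer S P"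
proof -
  have iff: "f s \<in> group_centralizer S (f ` P) \<longleftrightarrow> s \<in> group_centralizer S P" if s: "s \<in> carrier S" for s
  proof -
    have "f s \<otimes> f x = f x \<otimes> f s \<longleftrightarrow> s \<otimes> x = x \<otimes> s" if "x \<in> P" for x
      using s subgroup.mem_carrier[OF P that] f_eq_iff[of "s \<otimes> x" "x \<otimes> s"] by (simp add: f_mult)
    then show ?thesis using s f_closed by (simp add: group_centralizer_def)
  qed
  have "group_centralizer S (f ` P) \<subseteq> carrier S" "group_centralizer S P \<subseteq> carrier S" by (auto simp: group_centralizer_def)
  then show ?thesis
  proof (intro subset_antisym subsetI)
    fix y assume y: "y \<in> group_centralizer S (f ` P)"
    then have yS: "y \<in> carrier S" by (simp add: group_centralizer_def)
    then have "g y \<in> group_centralizer S P" using iff[OF g_closed[OF yS]] y fg by simp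
    then show "y \<in> f ` group_centralizer S P" using fg[OF yS] by (metis imageI)
  next
    fix y assume "y \<in> f ` group_centralizer S P"
    then show "y \<in> group_centralizer S (f ` P)" using iff by (auto simp: group_centralizer_def)
  qed
qed

lemma card_f: "A \<subseteq> carrier S \<Longrightarrow> card (f ` A) = card A"
  by (rule card_image[OF inj_f])

lemma card_normalizer_f: "subgroup P S \<Longrightarrow> card (normalizer S (f ` P)) = card (normalizer S P)"
  unfolding normalizer_f using card_f normalizer_carrier by blast

lemma card_centralizer_f: "subgroup P S \<Longrightarrow> card (group_centralizer S (f ` P)) = card (group_centralizer S P)"
  unfolding centralizer_f by (rule card_f) (auto simp: group_centralizer_def)

lemma F_conjugate_f_obtain:
  assumes P: "subgroup P S" and "F_conjugate S F (f ` P) R"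
  obtains Q where "subgroup Q S" "R = f ` Q" "F_conjugate S F' P Q"
proof -
  have R: "subgroup R S" using assms(2) by (simp add: F_conjugate_def)
  have "R = f ` g ` R" using f_g_image[OF sub_carrier[OF R]] by simp
  then show ?thesis using that[OF subgroup_g[OF R]] F_conjugate_iff[OF P subgroup_g[OF R]] assms(2) by simp
qed

lemma fully_normalized_f:
  assumes P: "subgroup P S" and "fully_normalized S F' P"
  shows "fully_normalized S F (f ` P)"
  unfolding fully_normalized_def
proof (intro allI impI)
  fix R assume "F_conjugate S F (f ` P) R"
  then obtain Q where "subgroup Q S" "R = f ` Q" "F_conjugate S F' P Q" by (rule F_conjugate_f_obtain[OF P])
  then show "card (normalizer S R) \<le> card (normalizer S (f ` P))"
    using assms(2) card_normalizer_f P by (simp add: fully_normalized_def)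
qed

lemma fully_centralized_f_iff:
  assumes P: "subgroup P S"
  shows "fully_centralized S F (f ` P) \<longleftrightarrow> fully_centralized S F' P"
proof
  assume c: "fully_centralized S F (f ` P)"
  show "fully_centralized S F' P" unfolding fully_centralized_def
  proof (intro allI impI)
    fix Q assume Q: "F_conjugate S F' P Q"
    then have Qs: "subgroup Q S" by (simp add: F_conjugate_def)
    then have "card (group_centralizer S (f ` Q)) \<le> card (group_centralizer S (f ` P))"
      using c F_conjugate_iff[OF P Qs] Q by (simp add: fully_centralized_def)
    then show "card (group_centralizer S Q) \<le> card (group_centralizer S P)"
      using card_centralizer_f P Qs by simp
  qed
next
  assume c: "fully_centralized S F' P"
  show "fully_centralized S F (f ` P)" unfolding fully_centralized_def
  proof (intro allI impI)
    fix R assume "F_conjugate S F (f ` P) R"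
    then obtain Q where "subgroup Q S" "R = f ` Q" "F_conjugate S F' P Q" by (rule F_conjugate_f_obtain[OF P])
    then show "card (group_centralizer S R) \<le> card (group_centralizer S (f ` P))"
      using c card_centralizer_f P by (simp add: fully_centralized_def)
  qed
qed

lemma transport_conj_hom:
  assumes P: "subgroup P S"
  shows "transport P ` conj_hom S P P = conj_hom S (f ` P) (f ` P)"
proof -
  have "transport P ` conj_hom S P P = (\<lambda>s. \<lambda>y\<in>f ` P. f s \<otimes> y \<otimes> inv (f s)) ` normalizer S P"
    unfolding conj_hom_self[OF P] image_image
    by (rule image_cong[OF refl]) (rule transport_conj[OF P normalizer_carrier[OF P]])
  also have "\<dots> = (\<lambda>s. \<lambda>y\<in>f ` P. s \<otimes> y \<otimes> inv s) ` normalizer S (f ` P)"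
    unfolding normalizer_f[OF P] image_image ..
  also have "\<dots> = conj_hom S (f ` P) (f ` P)" by (rule conj_hom_self[OF subgroup_f[OF P], symmetric])
  finally show ?thesis .
qed

lemma transport_inj_on_F':
  assumes P: "subgroup P S"
  shows "inj_on (transport P) (F' P P)"
proof (rule inj_onI)
  fix \<phi> \<psi> assume \<phi>: "\<phi> \<in> F' P P" and \<psi>: "\<psi> \<in> F' P P" and eq: "transport P \<phi> = transport P \<psi>"
  have "\<phi> \<in> P \<rightarrow>\<^sub>E P" "\<psi> \<in> P \<rightarrow>\<^sub>E P" using \<phi> \<psi> by (simp_all add: F'_def)
  then show "\<phi> = \<psi>" by (intro transport_inj_eq[OF P _ _ eq] PiE_sub_carrier[OF P])
qed

lemma transport_bij_F': "subgroup P S \<Longrightarrow> transport P ` F' P P = F (f ` P) (f ` P)"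
  using pull_back[of P P] by (auto simp: F'_def)

text \<open>Transport is a bijection from the automizer of P to that of f(P) and matches the
  subgroups induced by S. Beyond being a subgroup, the Sylow property only compares orders.\<close>

lemma sylow_F':
  assumes P: "subgroup P S" and "sylow_subgroup p (aut_group F (f ` P)) (conj_hom S (f ` P) (f ` P))"
  shows "sylow_subgroup p (aut_group F' P) (conj_hom S P P)"
proof -
  have sub: "conj_hom S P P \<subseteq> F' P P" by (rule F'.conj_hom_subset[OF P P])
  have "card (conj_hom S (f ` P) (f ` P)) = card (conj_hom S P P)"
    unfolding transport_conj_hom[OF P, symmetric] by (rule card_image[OF inj_on_subset[OF transport_inj_on_F'[OF P] sub]])
  moreover have "order (aut_group F (f ` P)) = order (aut_group F' P)"
    unfolding order_def F'.carrier_aut_group carrier_aut_group transport_bij_F'[OF P, symmetric]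
    by (rule card_image[OF transport_inj_on_F'[OF P]])
  ultimately show ?thesis using assms(2) F'.subgroup_conj_hom[OF P] by (simp add: sylow_subgroup_def)
qed

text \<open>Conjugation by f(s) is the transport of c_s, so the condition that puts f(s) into the
  extender of the transported map is the transport of the condition for s.\<close>

lemma extender_f:
  assumes P: "subgroup P S" and \<phi>: "\<phi> \<in> F' P (carrier S)"
  shows "extender S (f ` P) (transport P \<phi>) = f ` extender S P \<phi>"
proof -
  note m = F'_mor[OF P subgroup_self \<phi>]
  have \<phi>P: "subgroup (\<phi> ` P) S" by (rule m(6))
  have imgs: "transport P \<phi> ` f ` P = f ` \<phi> ` P" by (rule F'_image[OF P])
  have PS: "P \<subseteq> carrier S" by (rule sub_carrier[OF P])
  have key: "(\<lambda>y\<in>f ` \<phi> ` P. transport P \<phi> (f s \<otimes> inv_into (f ` P) (transport P \<phi>) y \<otimes> inv (f s))) =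
      transport (\<phi> ` P) (\<lambda>y\<in>\<phi> ` P. \<phi> (s \<otimes> inv_into P \<phi> y \<otimes> inv s))"
    and into: "(\<lambda>y\<in>\<phi> ` P. \<phi> (s \<otimes> inv_into P \<phi> y \<otimes> inv s)) \<in> \<phi> ` P \<rightarrow>\<^sub>E carrier S"
    if s: "s \<in> normalizer S P" for s
  proof -
    have sS: "s \<in> carrier S" by (rule normalizer_carrier[OF P s])
    have inj: "inj_on (transport P \<phi>) (f ` P)" by (rule transport_inj[OF PS m(4) m(2)])
    show "(\<lambda>y\<in>f ` \<phi> ` P. transport P \<phi> (f s \<otimes> inv_into (f ` P) (transport P \<phi>) y \<otimes> inv (f s))) =
      transport (\<phi> ` P) (\<lambda>y\<in>\<phi> ` P. \<phi> (s \<otimes> inv_into P \<phi> y \<otimes> inv s))"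
    proof (rule transport_eqI[OF sub_carrier[OF \<phi>P]])
      fix y assume "y \<in> \<phi> ` P"
      then obtain x where x: "x \<in> P" "y = \<phi> x" by blast
      have fx: "f y = transport P \<phi> (f x)" using transport_apply[OF PS x(1)] x(2) by simp
      have i: "inv_into (f ` P) (transport P \<phi>) (f y) = f x"
        unfolding fx by (rule inv_into_f_f[OF inj]) (use x(1) in blast)
      have c: "s \<otimes> x \<otimes> inv s \<in> P" by (rule conj_mem_normalizer[OF P s x(1)])
      have "f s \<otimes> f x \<otimes> inv (f s) = f (s \<otimes> x \<otimes> inv s)" using f_conj[OF sS] x(1) PS by auto
      then have "transport P \<phi> (f s \<otimes> f x \<otimes> inv (f s)) = f (\<phi> (s \<otimes> x \<otimes> inv s))"
        using transport_apply[OF PS c] by simp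
      moreover have "f y \<in> f ` \<phi> ` P" using x by blast
      ultimately show "(\<lambda>y\<in>f ` \<phi> ` P. transport P \<phi> (f s \<otimes> inv_into (f ` P) (transport P \<phi>) y \<otimes> inv (f s))) (f y) =
         f ((\<lambda>y\<in>\<phi> ` P. \<phi> (s \<otimes> inv_into P \<phi> y \<otimes> inv s)) y)"
        using i x inv_into_f_f[OF m(2) x(1)] by simp
    qed simp
    show "(\<lambda>y\<in>\<phi> ` P. \<phi> (s \<otimes> inv_into P \<phi> y \<otimes> inv s)) \<in> \<phi> ` P \<rightarrow>\<^sub>E carrier S"
      using conj_mem_normalizer[OF P s] m(2,7) by auto
  qed
  have conj_iff: "transport (\<phi> ` P) \<eta> \<in> conj_hom S (f ` \<phi> ` P) (f ` \<phi> ` P) \<longleftrightarrow> \<eta> \<in> conj_hom S (\<phi> ` P) (\<phi> ` P)"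
    if \<eta>: "\<eta> \<in> \<phi> ` P \<rightarrow>\<^sub>E carrier S" for \<eta>
  proof
    assume "transport (\<phi> ` P) \<eta> \<in> conj_hom S (f ` \<phi> ` P) (f ` \<phi> ` P)"
    then obtain \<eta>' where \<eta>': "\<eta>' \<in> conj_hom S (\<phi> ` P) (\<phi> ` P)" "transport (\<phi> ` P) \<eta> = transport (\<phi> ` P) \<eta>'"
      unfolding transport_conj_hom[OF \<phi>P, symmetric] by blast
    have "\<eta>' \<in> \<phi> ` P \<rightarrow>\<^sub>E carrier S"
      using \<eta>'(1) sub_carrier[OF \<phi>P] by (auto simp: conj_hom_def)
    then show "\<eta> \<in> conj_hom S (\<phi> ` P) (\<phi> ` P)" using transport_inj_eq[OF \<phi>P \<eta>] \<eta>' by simp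
  qed (use transport_conj_hom[OF \<phi>P] in blast)
  have "f s \<in> extender S (f ` P) (transport P \<phi>) \<longleftrightarrow> s \<in> extender S P \<phi>" if "s \<in> normalizer S P" for s
  proof -
    have "f s \<in> normalizer S (f ` P)" using that normalizer_f[OF P] by blast
    then show ?thesis unfolding extender_def imgs using that key[OF that] conj_iff[OF into[OF that]] by simp
  qed
  moreover have "extender S (f ` P) (transport P \<phi>) \<subseteq> f ` normalizer S P"
    unfolding extender_def normalizer_f[OF P] by blast
  moreover have "extender S P \<phi> \<subseteq> normalizer S P" unfolding extender_def by blast
  ultimately show ?thesis by blast
qed

text \<open>For s in P the map \<phi> c_s \<phi>^-1 is conjugation by \<phi>(s). The inclusion
  allows an extension to be restricted back to P.\<close>

lemma subset_extender:
  assumes P: "subgroup P S" and \<phi>: "\<phi> \<in> F' P (carrier S)"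
  shows "P \<subseteq> extender S P \<phi>"
proof
  fix s assume s: "s \<in> P"
  note h = F'.mor_hom[OF P subgroup_self \<phi>]
  have PS: "P \<subseteq> carrier S" by (rule sub_carrier[OF P])
  have "s \<in> normalizer S P" using subgroup_subset_normalizer[OF finite_carrier P] s by blast
  moreover have "(\<lambda>y\<in>\<phi> ` P. \<phi> (s \<otimes> inv_into P \<phi> y \<otimes> inv s)) = (\<lambda>y\<in>\<phi> ` P. \<phi> s \<otimes> y \<otimes> inv (\<phi> s))"
  proof (rule restrict_ext)
    fix y assume "y \<in> \<phi> ` P"
    then obtain x where x: "x \<in> P" "y = \<phi> x" by blast
    have "s \<otimes> x \<in> P" "inv s \<in> P" using s x subgroup.m_closed[OF P] subgroup.m_inv_closed[OF P] by auto
    then show "\<phi> (s \<otimes> inv_into P \<phi> y \<otimes> inv s) = \<phi> s \<otimes> y \<otimes> inv (\<phi> s)"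
      using x s h(8) F'.mor_inv[OF P subgroup_self \<phi> s] inv_into_f_f[OF h(3) x(1)] by simp
  qed
  moreover have "(\<lambda>y\<in>\<phi> ` P. \<phi> s \<otimes> y \<otimes> inv (\<phi> s)) \<in> conj_hom S (\<phi> ` P) (\<phi> ` P)"
  proof -
    have \<phi>P: "subgroup (\<phi> ` P) S" by (rule F'.mor_image_subgroup[OF P subgroup_self \<phi>])
    have "\<phi> s \<in> normalizer S (\<phi> ` P)" using subgroup_subset_normalizer[OF finite_carrier \<phi>P] s by blast
    then show ?thesis unfolding conj_hom_self[OF \<phi>P] by blast
  qed
  ultimately show "s \<in> extender S P \<phi>" unfolding extender_def by simp
qed

text \<open>Each notion in the axioms corresponds under f to the same notion for F, so the axioms
  for \<open>F'\<close> at P are those for F at f(P), pulled back.\<close>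

lemma saturated_F': "saturated_fusion_system S p F'"
proof (intro saturated_fusion_system.intro saturated_fusion_system_axioms.intro)
  show "fusion_system S p F'" by (rule fusion_system_F')
next
  fix P assume P: "subgroup P S" "fully_normalized S F' P"
  show "fully_centralized S F' P \<and> sylow_subgroup p (aut_group F' P) (conj_hom S P P)"
    using sylow_axiom[OF subgroup_f[OF P(1)] fully_normalized_f[OF P]] sylow_F'[OF P(1)] fully_centralized_f_iff[OF P(1)] by blast
next
  fix P \<phi> assume P: "subgroup P S" and \<phi>: "\<phi> \<in> F' P (carrier S)" and c: "fully_centralized S F' (\<phi> ` P)"
  note m = F'_mor[OF P subgroup_self \<phi>]
  have t: "transport P \<phi> \<in> F (f ` P) (carrier S)" using m(5) f_carrier by simp
  have "fully_centralized S F (transport P \<phi> ` f ` P)"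
    unfolding F'_image[OF P] using c fully_centralized_f_iff[OF m(6)] by blast
  then obtain \<psi> where \<psi>: "\<psi> \<in> F (f ` extender S P \<phi>) (carrier S)" "restrict \<psi> (f ` P) = transport P \<phi>"
    using extension_axiom[OF subgroup_f[OF P] t] extender_f[OF P \<phi>] by auto
  let ?X = "extender S P \<phi>"
  have X: "subgroup ?X S" by (rule F'.subgroup_extender[OF P \<phi>])
  obtain \<eta> where \<eta>: "\<eta> \<in> F' ?X (carrier S)" "transport ?X \<eta> = \<psi>"
    using pull_back[OF X subgroup_self, of \<psi>] \<psi>(1) f_carrier by auto
  have PX: "P \<subseteq> ?X" by (rule subset_extender[OF P \<phi>])
  have "transport P (restrict \<eta> P) = transport P \<phi>"
    using transport_restrict[OF sub_carrier[OF X] PX, of \<eta>] \<eta>(2) \<psi>(2) by simp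
  moreover have "restrict \<eta> P \<in> P \<rightarrow>\<^sub>E carrier S" using F'.mor_hom(7)[OF X subgroup_self \<eta>(1)] PX by auto
  ultimately have "restrict \<eta> P = \<phi>"
    using transport_inj_eq[OF P _ F'.mor_hom(6)[OF P subgroup_self \<phi>]] by blast
  then show "\<exists>\<psi>\<in>F' (extender S P \<phi>) (carrier S). restrict \<psi> P = \<phi>" using \<eta>(1) by blast
qed

end

section \<open>Subsystems of index prime to \<open>p\<close>\<close>

lemma (in fusion_system) O_p'_residual_hom:
  assumes "group_hom (aut_group F P) H h" "subgroup P S" "finite (carrier H)" "\<alpha> \<in> O_p'_residual p (aut_group F P)"
  shows "h \<alpha> \<in> O_p'_residual p H"
proof -
  interpret C: index_class "\<lambda>n. coprime p n" by (rule index_class_coprime)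
  show ?thesis
    using C.index_residual_hom[OF assms(1) finite_aut_group[OF assms(2)] assms(3)] assms(4) by (simp add: O_p'_residual_eq)
qed

lemma (in fusion_system) O_p'_residual_normal:
  assumes "subgroup P S"
  shows "O_p'_residual p (aut_group F P) \<lhd> aut_group F P"
    "coprime p (card (rcosets\<^bsub>aut_group F P\<^esub> (O_p'_residual p (aut_group F P))))"
    "O_p'_residual p (aut_group F P) \<subseteq> F P P"
proof -
  interpret C: index_class "\<lambda>n. coprime p n" by (rule index_class_coprime)
  note r = C.index_residual(1,2)[OF group_aut_group[OF assms] finite_aut_group[OF assms], folded O_p'_residual_eq]
  show "O_p'_residual p (aut_group F P) \<lhd> aut_group F P"
    "coprime p (card (rcosets\<^bsub>aut_group F P\<^esub> (O_p'_residual p (aut_group F P))))" by (fact r)+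
  show "O_p'_residual p (aut_group F P) \<subseteq> F P P"
    using subgroup.subset[OF normal_imp_subgroup[OF r(1)]] by simp
qed

text \<open>N contains every p-subgroup of G: some conjugate lies in N because the index is prime to
  p, and N is normal. So Q and D lie in N, where Q still has index prime to p, and Sylow conjugation
  inside N yields a conjugating element of N itself.\<close>

lemma (in group) frattini:
  assumes fin: "finite (carrier G)" and p: "prime p"
    and N: "N \<lhd> G" "coprime p (card (rcosets N))" and Q: "sylow_subgroup p G Q"
    and D: "subgroup D G" "card D = p ^ k"
  obtains n where "n \<in> N" "\<And>d. d \<in> D \<Longrightarrow> n \<otimes> d \<otimes> inv n \<in> Q"
proof -
  have Ns: "subgroup N G" by (rule normal_imp_subgroup[OF N(1)])
  have Qs: "subgroup Q G" using Q by (simp add: sylow_subgroup_def)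
  have p_sub: "D' \<subseteq> N" if D': "subgroup D' G" "card D' = p ^ j" for D' j
  proof
    fix d assume d: "d \<in> D'"
    obtain g where g: "g \<in> carrier G" "\<And>d. d \<in> D' \<Longrightarrow> g \<otimes> d \<otimes> inv g \<in> N"
      using p_subgroup_conjugate_into[OF fin Ns D'(1) p D'(2) N(2)] by blast
    have "inv g \<otimes> (g \<otimes> d \<otimes> inv g) \<otimes> g \<in> N" by (rule normal.inv_op_closed1[OF N(1) g(1) g(2)[OF d]])
    moreover have "d \<in> carrier G" using d subgroup.mem_carrier[OF D'(1)] by blast
    then have "inv g \<otimes> (g \<otimes> d \<otimes> inv g) \<otimes> g = d" using g(1) by (simp add: m_assoc[symmetric]) (simp add: m_assoc)
    ultimately show "d \<in> N" by simp
  qed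
  let ?N = "G\<lparr>carrier := N\<rparr>"
  interpret M: group ?N by (rule subgroup_imp_group[OF Ns])
  have cQ: "card Q = p ^ multiplicity p (order G)" using Q by (simp add: sylow_subgroup_def)
  have Qn: "subgroup Q ?N" using Qs p_sub[OF Qs cQ] subgroup_incl[OF Qs Ns] by blast
  have Dn: "subgroup D ?N" using D p_sub[OF D] subgroup_incl[OF D(1) Ns] by blast
  \<comment> \<open>Multiplicativity of the index: |G : N| |N : Q| = |G : Q|.\<close>
  have "card (rcosets\<^bsub>?N\<^esub> Q) * card Q = card N" using M.lagrange[OF Qn] by (simp add: order_def)
  moreover have "card (rcosets N) * card N = order G" "card (rcosets Q) * card Q = order G" by (rule lagrange[OF Ns], rule lagrange[OF Qs])
  ultimately have "card (rcosets N) * card (rcosets\<^bsub>?N\<^esub> Q) * card Q = card (rcosets Q) * card Q" by (metis mult.assoc)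
  moreover have "card Q > 0" using finite_subset[OF subgroup.subset[OF Qs] fin] subgroup.one_closed[OF Qs] by (auto simp: card_gt_0_iff)
  ultimately have "card (rcosets N) * card (rcosets\<^bsub>?N\<^esub> Q) = card (rcosets Q)" by simp
  then have "card (rcosets\<^bsub>?N\<^esub> Q) dvd card (rcosets Q)" by (metis dvd_triv_right)
  then have cop: "coprime p (card (rcosets\<^bsub>?N\<^esub> Q))"
    using sylow_index_coprime[OF is_group fin p Q] by (meson coprime_divisors dvd_refl)
  have "finite (carrier ?N)" using finite_subset[OF subgroup.subset[OF Ns] fin] by simp
  then obtain n where "n \<in> carrier ?N" "\<And>d. d \<in> D \<Longrightarrow> n \<otimes>\<^bsub>?N\<^esub> d \<otimes>\<^bsub>?N\<^esub> inv\<^bsub>?N\<^esub> n \<in> Q"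
    using M.p_subgroup_conjugate_into[OF _ Qn Dn p D(2) cop] by blast
  then show ?thesis using that[of n] m_inv_consistent[OF Ns, of n] by simp
qed

locale O_p'_subsystem = saturated_fusion_system +
  fixes E
  assumes is_O_p': "is_O_p'_subsystem S p F E"
begin

lemma E_saturated: "saturated_fusion_system S p E"
  and E_subset: "\<lbrakk>subgroup P S; subgroup Q S\<rbrakk> \<Longrightarrow> E P Q \<subseteq> F P Q"
  and O_p'_subset: "subgroup P S \<Longrightarrow> O_p'_residual p (aut_group F P) \<subseteq> E P P"
  and E_minimal: "\<lbrakk>saturated_of_index_prime_to_p S p F E'; subgroup P S; subgroup Q S\<rbrakk> \<Longrightarrow> E P Q \<subseteq> E' P Q"
  using is_O_p' by (auto simp: is_O_p'_subsystem_def saturated_of_index_prime_to_p_def fusion_subsystem_def)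

sublocale E: saturated_fusion_system S p E by (rule E_saturated)

abbreviation "A \<equiv> aut_group F (carrier S)"

lemma A_inv:
  assumes "a \<in> F (carrier S) (carrier S)"
  shows "inv\<^bsub>A\<^esub> a \<in> F (carrier S) (carrier S)" "x \<in> carrier S \<Longrightarrow> (inv\<^bsub>A\<^esub> a) (a x) = x"
    "x \<in> carrier S \<Longrightarrow> a ((inv\<^bsub>A\<^esub> a) x) = x"
proof -
  have b: "inv\<^bsub>A\<^esub> a = restrict (inv_into (carrier S) a) (carrier S)" by (rule inv_aut_group[OF subgroup_self assms])
  note h = mor_hom[OF subgroup_self subgroup_self assms]
  have img: "a ` carrier S = carrier S" by (rule aut_image[OF subgroup_self assms])
  show "inv\<^bsub>A\<^esub> a \<in> F (carrier S) (carrier S)"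
    unfolding b using mor_inverse[OF subgroup_self subgroup_self assms] img by simp
  show "(inv\<^bsub>A\<^esub> a) (a x) = x" if "x \<in> carrier S" unfolding b using that h(3,7) by simp
  show "a ((inv\<^bsub>A\<^esub> a) x) = x" if "x \<in> carrier S" unfolding b using that img by (simp add: f_inv_into_f)
qed

lemma A_bij:
  assumes "a \<in> F (carrier S) (carrier S)"
  shows "carrier_bij (carrier S) a (inv\<^bsub>A\<^esub> a)"
  using A_inv[OF assms] mor_hom(7)[OF subgroup_self subgroup_self] assms by unfold_locales auto

text \<open>The conjugate a^-1 E a becomes a competitor in the minimality of E. Its morphisms are
  composites a^-1 \<eta> a of morphisms of F, and it contains the residuals because a carries those
  of P into those of a(P). Its saturation is \<open>saturated_F'\<close>.\<close>

lemma transported_index_prime_to_p: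
  assumes a: "a \<in> F (carrier S) (carrier S)"
  shows "saturated_of_index_prime_to_p S p F (transported_system.F' E a (inv\<^bsub>A\<^esub> a))"
proof -
  let ?b = "inv\<^bsub>A\<^esub> a"
  interpret W: transported_system S p E a ?b
    by (intro transported_system.intro E_saturated A_bij[OF a] transported_system_axioms.intro)
      (use mor_hom(2)[OF subgroup_self subgroup_self a] in simp)
  have ra: "restrict a P \<in> F P (a ` P)" if P: "subgroup P S" for P
    using iso_factor[OF P subgroup_self mor_restrict[OF subgroup_self subgroup_self P a subgroup.subset[OF P]]]
    by (simp add: image_restrict_eq)
  show ?thesis unfolding saturated_of_index_prime_to_p_def fusion_subsystem_def
  proof (intro conjI allI impI)
    show "subgroup (carrier S) S" by (rule subgroup_self)
    show "fusion_system (S\<lparr>carrier := carrier S\<rparr>) p W.F'" using W.fusion_system_F' by simp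
    show "saturated_fusion_system S p W.F'" by (rule W.saturated_F')
  next
    fix P Q assume "subgroup P (S\<lparr>carrier := carrier S\<rparr>) \<and> subgroup Q (S\<lparr>carrier := carrier S\<rparr>)"
    then have P: "subgroup P S" and Q: "subgroup Q S" by simp_all
    show "W.F' P Q \<subseteq> F P Q"
    proof
      fix \<phi> assume \<phi>: "\<phi> \<in> W.F' P Q"
      note m = W.F'_mor[OF P Q \<phi>]
      have aP: "subgroup (a ` P) S" and aQ: "subgroup (a ` Q) S" using W.subgroup_f P Q by auto
      have t: "W.transport P \<phi> \<in> F (a ` P) (a ` Q)" using E_subset[OF aP aQ] m(5) by blast
      have bQ: "?b ` a ` Q = Q" using A_inv(2)[OF a] subgroup.mem_carrier[OF Q] by (force simp: image_image)
      have "restrict ?b (a ` Q) \<in> F (a ` Q) (carrier S)"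
        by (rule mor_restrict[OF subgroup_self subgroup_self aQ A_inv(1)[OF a] subgroup.subset[OF aQ]])
      then have b: "restrict ?b (a ` Q) \<in> F (a ` Q) Q"
        by (rule mor_codomain[OF aQ subgroup_self Q]) (simp add: bQ)
      have "compose P (restrict ?b (a ` Q)) (compose P (W.transport P \<phi>) (restrict a P)) \<in> F P Q"
        by (rule comp_closed[OF P aQ Q comp_closed[OF P aP aQ ra[OF P] t] b])
      moreover have "compose P (restrict ?b (a ` Q)) (compose P (W.transport P \<phi>) (restrict a P)) = \<phi>"
        by (rule mor_eqI[of _ P])
          (use m(3,7) W.transport_apply[OF subgroup.subset[OF P]] A_inv(2)[OF a] subgroup.mem_carrier[OF Q] in \<open>auto simp: compose_eq\<close>)
      ultimately show "\<phi> \<in> F P Q" by simp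
    qed
  next
    fix P assume P: "subgroup P S"
    have aP: "subgroup (a ` P) S" by (rule W.subgroup_f[OF P])
    show "O_p'_residual p (aut_group F P) \<subseteq> W.F' P P"
    proof
      fix \<alpha> assume \<alpha>: "\<alpha> \<in> O_p'_residual p (aut_group F P)"
      then have \<alpha>F: "\<alpha> \<in> F P P" using O_p'_residual_normal(3)[OF P] by blast
      note m = mor_hom[OF P P \<alpha>F]
      have img: "restrict a P ` P = a ` P" by (simp add: image_restrict_eq)
      have "(\<lambda>y\<in>a ` P. (restrict a P) (\<alpha> (inv_into P (restrict a P) y))) \<in> O_p'_residual p (aut_group F (a ` P))"
        by (rule O_p'_residual_hom[OF aut_transport_hom[OF P aP ra[OF P] img] P finite_aut_group[OF aP] \<alpha>])
      moreover have "(\<lambda>y\<in>a ` P. (restrict a P) (\<alpha> (inv_into P (restrict a P) y))) = W.transport P \<alpha>"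
      proof (rule W.transport_eqI[OF subgroup.subset[OF P]])
        fix x assume x: "x \<in> P"
        have "inv_into P (restrict a P) (restrict a P x) = x"
          by (rule inv_into_f_f[OF mor_hom(3)[OF P aP ra[OF P]] x])
        then show "(\<lambda>y\<in>a ` P. (restrict a P) (\<alpha> (inv_into P (restrict a P) y))) (a x) = a (\<alpha> x)"
          using x m(7)[OF x] by simp
      qed simp
      ultimately have "W.transport P \<alpha> \<in> E (a ` P) (a ` P)" using O_p'_subset[OF aP] by auto
      then show "\<alpha> \<in> W.F' P P" using m(6) by (simp add: W.F'_def)
    qed
  qed
qed

sublocale I: invariant_subsystem S p F A "\<lambda>a. a" "carrier S" E
proof (intro invariant_subsystem.intro invariant_subsystem_axioms.intro)
  show "saturated_fusion_system S p F" by unfold_locales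
  show "group A" by (rule group_aut_group[OF subgroup_self])
  show "subgroup (carrier S) S" by (rule subgroup_self)
  show "fusion_system (S\<lparr>carrier := carrier S\<rparr>) p E" using E.fusion_system_axioms by simp
  show "finite (carrier A)" by (rule finite_aut_group[OF subgroup_self])
next
  fix P Q assume "subgroup P (S\<lparr>carrier := carrier S\<rparr>)" "subgroup Q (S\<lparr>carrier := carrier S\<rparr>)"
  then show "E P Q \<subseteq> F P Q" using E_subset by simp
next
  fix a assume "a \<in> carrier A" then show "a \<in> F (carrier S) (carrier S)" by simp
next
  fix a b x assume "a \<in> carrier A" "b \<in> carrier A" "x \<in> carrier S"
  then show "(a \<otimes>\<^bsub>A\<^esub> b) x = a (b x)" by (simp add: mult_aut_group[OF subgroup_self] compose_eq)
next
  fix x assume "x \<in> carrier S" then show "\<one>\<^bsub>A\<^esub> x = x" by (simp add: one_aut_group)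
next
  fix a x assume "a \<in> carrier A" "x \<in> carrier S"
  then show "a x \<in> carrier S" using mor_hom(7)[OF subgroup_self subgroup_self] by simp
next
  fix a P \<theta> assume "a \<in> carrier A" "subgroup P (S\<lparr>carrier := carrier S\<rparr>)" and \<theta>: "\<theta> \<in> E P (carrier S)"
  then have a: "a \<in> F (carrier S) (carrier S)" and P: "subgroup P S" by simp_all
  interpret W: transported_system S p E a "inv\<^bsub>A\<^esub> a"
    by (intro transported_system.intro E_saturated A_bij[OF a] transported_system_axioms.intro)
      (use mor_hom(2)[OF subgroup_self subgroup_self a] in simp)
  \<comment> \<open>Minimality puts E inside the conjugate system, which says that a \<theta> a^-1
    lies in E.\<close>
  have "\<theta> \<in> W.F' P (carrier S)" using E_minimal[OF transported_index_prime_to_p[OF a] P subgroup_self] \<theta> by blast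
  then have "W.transport P \<theta> \<in> E (a ` P) (carrier S)" using W.f_carrier by (simp add: W.F'_def)
  then show "(\<lambda>x\<in>a ` P. a (\<theta> ((inv\<^bsub>A\<^esub> a) x))) \<in> E (a ` P) (carrier S)" by (simp only: W.transport_def)
qed

lemma factors_iff:
  assumes "subgroup P S" "\<phi> \<in> F P (carrier S)"
  shows "I.factors P \<phi> \<longleftrightarrow> (\<exists>a\<in>F (carrier S) (carrier S). \<exists>\<theta>\<in>E P (carrier S). \<forall>x\<in>P. \<phi> x = a (\<theta> x))"
proof -
  have "P \<inter> carrier S = P" "\<phi> ` P \<inter> carrier S = \<phi> ` P"
    using subgroup.subset[OF assms(1)] mor_hom(4)[OF assms(1) subgroup_self assms(2)] by auto
  then show ?thesis by (simp add: I.factors_def)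
qed

lemma factors_E:
  assumes "subgroup P S" "\<theta> \<in> E P (carrier S)"
  shows "I.factors P \<theta>"
proof -
  have \<theta>: "\<theta> \<in> F P (carrier S)" using E_subset[OF assms(1) subgroup_self] assms(2) by blast
  have one: "(\<lambda>x\<in>carrier S. x) \<in> F (carrier S) (carrier S)" by (rule incl_mor[OF subgroup_self subgroup_self order_refl])
  have "\<forall>x\<in>P. \<theta> x = (\<lambda>x\<in>carrier S. x) (\<theta> x)" using mor_hom(7)[OF assms(1) subgroup_self \<theta>] by simp
  then show ?thesis unfolding factors_iff[OF assms(1) \<theta>] using one assms(2) by blast
qed

text \<open>For P = S, \<alpha> itself belongs to A. Otherwise some n in O^{p'}(Aut_F(P)), hence in
  E, makes n \<alpha> extend to N_S(P). The extension factors by induction, so its restriction n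
  \<alpha> does, and composing with n^-1 in E recovers \<alpha>.\<close>

lemma factors:
  assumes "subgroup P S" "\<phi> \<in> F P (carrier S)"
  shows "I.factors P \<phi>"
proof (rule I.factors_all[OF _ assms])
  fix P \<alpha> assume P: "subgroup P S" and fn: "fully_normalized S F P" and \<alpha>: "\<alpha> \<in> F P P"
    and IH: "\<And>R \<phi>. \<lbrakk>subgroup R S; card P < card R; \<phi> \<in> F R (carrier S)\<rbrakk> \<Longrightarrow> I.factors R \<phi>"
  have \<alpha>S: "\<alpha> \<in> F P (carrier S)" by (rule mor_to_S[OF P P \<alpha>])
  show "I.factors P \<alpha>"
  proof (cases "P = carrier S")
    case True
    have "(\<lambda>x\<in>carrier S. x) \<in> E (carrier S) (carrier S)" by (rule E.incl_mor[OF subgroup_self subgroup_self order_refl])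
    moreover have "\<forall>x\<in>P. \<alpha> x = \<alpha> ((\<lambda>x\<in>carrier S. x) x)" using True by simp
    ultimately show ?thesis unfolding factors_iff[OF P \<alpha>S] using \<alpha> True by blast
  next
    case False
    let ?G = "aut_group F P" and ?N = "O_p'_residual p (aut_group F P)"
    let ?h = "\<lambda>g. \<lambda>y\<in>P. \<alpha> (g \<otimes> inv_into P \<alpha> y \<otimes> inv g)"
    have img: "\<alpha> ` P = P" by (rule aut_image[OF P \<alpha>])
    interpret h: group_hom "S\<lparr>carrier := normalizer S P\<rparr>" ?G ?h by (rule transported_conj_hom[OF P P \<alpha> img])
    have NP: "subgroup (normalizer S P) S" by (rule subgroup_normalizer[OF P])
    have syl: "sylow_subgroup p ?G (conj_hom S P P)" using sylow_axiom[OF P fn] by blast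
    have D: "subgroup (?h ` normalizer S P) ?G" using h.img_is_subgroup by simp
    obtain k where "card (normalizer S P) = p ^ k" using subgroup_card_prime_power[OF NP] by blast
    then obtain j where j: "card (?h ` normalizer S P) = p ^ j"
      using h.card_image_dvd_order prime_p by (auto simp: order_def divides_primepow_nat)
    \<comment> \<open>The p-group \<alpha> Aut_S(P) \<alpha>^-1 is brought back into Aut_S(P). Sylow
      conjugation in Aut_F(P) alone would give an element that may lie outside E; Frattini's
      argument finds one in the residual.\<close>
    obtain n where n: "n \<in> ?N" "\<And>d. d \<in> ?h ` normalizer S P \<Longrightarrow> n \<otimes>\<^bsub>?G\<^esub> d \<otimes>\<^bsub>?G\<^esub> inv\<^bsub>?G\<^esub> n \<in> conj_hom S P P"
      using h.H.frattini[OF finite_aut_group[OF P] prime_p O_p'_residual_normal(1,2)[OF P] syl D j] by blast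
    have nF: "n \<in> F P P" using n(1) O_p'_residual_normal(3)[OF P] by blast
    have "inv\<^bsub>?G\<^esub> n \<in> ?N"
      by (rule subgroup.m_inv_closed[OF normal_imp_subgroup[OF O_p'_residual_normal(1)[OF P]] n(1)])
    then have ninv: "inv\<^bsub>?G\<^esub> n \<in> E P P" using O_p'_subset[OF P] by blast
    then have ninvE: "inv\<^bsub>?G\<^esub> n \<in> E P (carrier S)" by (rule E.mor_to_S[OF P P])
    have ninvF: "inv\<^bsub>?G\<^esub> n \<in> F P (carrier S)" using E_subset[OF P subgroup_self] ninvE by blast
    obtain \<psi> where \<psi>: "\<psi> \<in> F (normalizer S P) (carrier S)" "restrict \<psi> P = compose P n \<alpha>"
      by (rule extend_compose[OF P P \<alpha> img fn nF n(2)[OF imageI]])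
    have grow: "P \<subset> normalizer S P"
      using p_group_normalizer_grows[OF finite_carrier P prime_p _ False] order_p_power by blast
    have "I.factors (normalizer S P) \<psi>"
      by (rule IH[OF NP psubset_card_mono[OF finite_sub[OF NP] grow] \<psi>(1)])
    then have "I.factors P (restrict \<psi> P)" by (rule I.factors_restrict[OF NP P psubset_imp_subset[OF grow] \<psi>(1)])
    then have f1: "I.factors P (compose P n \<alpha>)" using \<psi>(2) by simp
    have n\<alpha>: "compose P n \<alpha> \<in> F P P" by (rule comp_closed[OF P P P \<alpha> nF])
    have img2: "compose P n \<alpha> ` P = P" by (rule aut_image[OF P n\<alpha>])
    have "I.factors P (compose P (inv\<^bsub>?G\<^esub> n) (compose P n \<alpha>))"
      using I.factors_compose[OF P mor_to_S[OF P P n\<alpha>] f1] ninvF factors_E[OF P ninvE] img2 by simp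
    moreover have "compose P (inv\<^bsub>?G\<^esub> n) (compose P n \<alpha>) = \<alpha>"
    proof (rule mor_eqI[of _ P])
      fix x assume x: "x \<in> P"
      have "\<alpha> x \<in> P" "n (\<alpha> x) \<in> P" using mor_hom(7)[OF P P] \<alpha> nF x by blast+
      then show "compose P (inv\<^bsub>?G\<^esub> n) (compose P n \<alpha>) x = \<alpha> x"
        using x inv_aut_group[OF P nF] inv_into_f_f[OF mor_hom(3)[OF P P nF]] by (simp add: compose_eq)
    qed (use mor_hom(5)[OF P P \<alpha>] in auto)
    ultimately show ?thesis by simp
  qed
qed

end

section \<open>The normalizer of the Sylow subgroup\<close>

context fusion_system
begin

lemma normalizer_system_eq:
  assumes "subgroup P S"
  shows "normalizer_system S F P (carrier S) = (\<lambda>a. restrict a P) ` F (carrier S) (carrier S)"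
  using mor_restrict[OF subgroup_self subgroup_self assms _ subgroup.subset[OF assms]]
  by (auto simp: normalizer_system_def)

text \<open>Composites and inverses of restricted automorphisms of S are the restrictions of the
  composites and inverses of these automorphisms.\<close>

lemma fusion_system_normalizer_system: "fusion_system S p (normalizer_system S F)"
proof (intro fusion_system.intro fusion_system_axioms.intro)
  show "finite_p_group S p" by (rule finite_p_group_axioms)
next
  fix P Q assume PQ: "subgroup P S" "subgroup Q S"
  show "conj_hom S P Q \<subseteq> normalizer_system S F P Q"
  proof
    fix \<phi> assume \<phi>: "\<phi> \<in> conj_hom S P Q"
    then obtain s where s: "s \<in> carrier S" "\<phi> = (\<lambda>x\<in>P. s \<otimes> x \<otimes> inv s)" by (auto simp: conj_hom_def)
    have "(\<lambda>x\<in>carrier S. s \<otimes> x \<otimes> inv s) \<in> F (carrier S) (carrier S)"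
      by (rule conj_mor[OF subgroup_self subgroup_self s(1)]) (use s in auto)
    moreover have "restrict (\<lambda>x\<in>carrier S. s \<otimes> x \<otimes> inv s) P = \<phi>"
      using s(2) subgroup.subset[OF PQ(1)] by (auto simp: fun_eq_iff)
    moreover have "\<phi> \<in> F P Q" using conj_hom_subset[OF PQ] \<phi> by blast
    ultimately show "\<phi> \<in> normalizer_system S F P Q" unfolding normalizer_system_def by blast
  qed
  show "normalizer_system S F P Q \<subseteq> mon (S\<lparr>carrier := P\<rparr>) (S\<lparr>carrier := Q\<rparr>) \<inter> extensional P"
    using injective_hom[OF PQ] by (auto simp: normalizer_system_def)
next
  fix P Q R \<phi> \<psi> assume s: "subgroup P S" "subgroup Q S" "subgroup R S"
    and \<phi>: "\<phi> \<in> normalizer_system S F P Q" and \<psi>: "\<psi> \<in> normalizer_system S F Q R"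
  obtain a where a: "a \<in> F (carrier S) (carrier S)" "restrict a P = \<phi>" and \<phi>F: "\<phi> \<in> F P Q"
    using \<phi> by (auto simp: normalizer_system_def)
  obtain b where b: "b \<in> F (carrier S) (carrier S)" "restrict b Q = \<psi>" and \<psi>F: "\<psi> \<in> F Q R"
    using \<psi> by (auto simp: normalizer_system_def)
  have "compose (carrier S) b a \<in> F (carrier S) (carrier S)"
    by (rule comp_closed[OF subgroup_self subgroup_self subgroup_self a(1) b(1)])
  moreover have "restrict (compose (carrier S) b a) P = compose P \<psi> \<phi>"
  proof (rule mor_eqI[of _ P])
    fix x assume x: "x \<in> P"
    have "\<phi> x = a x" "\<phi> x \<in> Q" using x a(2) mor_hom(7)[OF s(1,2) \<phi>F] by auto
    moreover have "\<psi> (\<phi> x) = b (\<phi> x)" using b(2) \<open>\<phi> x \<in> Q\<close> by auto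
    ultimately show "restrict (compose (carrier S) b a) P x = compose P \<psi> \<phi> x"
      using x subgroup.mem_carrier[OF s(1) x] by (simp add: compose_eq)
  qed auto
  ultimately show "compose P \<psi> \<phi> \<in> normalizer_system S F P R"
    using comp_closed[OF s \<phi>F \<psi>F] by (auto simp: normalizer_system_def)
next
  fix P Q \<phi> assume s: "subgroup P S" "subgroup Q S" and \<phi>: "\<phi> \<in> normalizer_system S F P Q"
  obtain a where a: "a \<in> F (carrier S) (carrier S)" "restrict a P = \<phi>" and \<phi>F: "\<phi> \<in> F P Q"
    using \<phi> by (auto simp: normalizer_system_def)
  let ?b = "restrict (inv_into (carrier S) a) (carrier S)"
  have b: "?b \<in> F (carrier S) (carrier S)"
    using mor_inverse[OF subgroup_self subgroup_self a(1)] aut_image[OF subgroup_self a(1)] by simp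
  have "restrict ?b (\<phi> ` P) = restrict (inv_into P \<phi>) (\<phi> ` P)"
  proof (rule restrict_ext)
    fix y assume "y \<in> \<phi> ` P"
    then obtain x where x: "x \<in> P" "y = \<phi> x" by blast
    have xS: "x \<in> carrier S" by (rule subgroup.mem_carrier[OF s(1) x(1)])
    have ax: "\<phi> x = a x" using a(2) x(1) by auto
    have "inv_into (carrier S) a (a x) = x" by (rule inv_into_f_f[OF mor_hom(3)[OF subgroup_self subgroup_self a(1)] xS])
    moreover have "a x \<in> carrier S" using mor_hom(7)[OF subgroup_self subgroup_self a(1) xS] .
    moreover have "inv_into P \<phi> (\<phi> x) = x" by (rule inv_into_f_f[OF mor_hom(3)[OF s \<phi>F] x(1)])
    ultimately show "?b y = inv_into P \<phi> y" using x(2) ax by simp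
  qed
  then show "\<phi> \<in> normalizer_system S F P (\<phi> ` P) \<and> restrict (inv_into P \<phi>) (\<phi> ` P) \<in> normalizer_system S F (\<phi> ` P) P"
    unfolding normalizer_system_def using iso_factor[OF s \<phi>F] a b by blast
qed

text \<open>Restriction from Aut_F(S) onto the morphisms P \<rightarrow> S of N_F(S) has fibres of
  equal size: composing with one extension a of \<eta> maps the automorphisms that fix P pointwise
  bijectively to the fibre of \<eta>. A map outside N_F(S) has empty fibre.\<close>

lemma card_extending_automorphisms:
  assumes P: "subgroup P S" and \<eta>: "\<eta> \<in> P \<rightarrow>\<^sub>E carrier S"
  shows "card {a \<in> F (carrier S) (carrier S). \<forall>x\<in>P. \<eta> x = a x} * card (normalizer_system S F P (carrier S)) =
    (if \<eta> \<in> normalizer_system S F P (carrier S) then card (F (carrier S) (carrier S)) else 0)"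
proof -
  let ?A = "F (carrier S) (carrier S)" and ?N = "normalizer_system S F P (carrier S)"
  let ?fib = "\<lambda>\<eta>. {a \<in> ?A. \<forall>x\<in>P. \<eta> x = a x}"
  note S = subgroup_self
  have N: "?N = (\<lambda>a. restrict a P) ` ?A" by (rule normalizer_system_eq[OF P])
  have PS: "x \<in> carrier S" if "x \<in> P" for x using that subgroup.mem_carrier[OF P] by blast
  have fin: "finite ?A" by (rule finite_mor[OF S S])
  have fib: "card (?fib \<eta>) = card (?fib (\<lambda>x. x))" if "\<eta> \<in> ?N" for \<eta>
  proof -
    obtain a where a: "a \<in> ?A" "\<eta> = restrict a P" using \<open>\<eta> \<in> ?N\<close> unfolding N by (rule imageE)
    let ?b = "restrict (inv_into (carrier S) a) (carrier S)"
    have img: "a ` carrier S = carrier S" by (rule aut_image[OF S a(1)])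
    have b: "?b \<in> ?A" using mor_inverse[OF S S a(1)] img by simp
    have ba: "?b (a x) = x" if "x \<in> carrier S" for x
      using that mor_hom(3,7)[OF S S a(1)] by simp
    have ab: "a (?b x) = x" if "x \<in> carrier S" for x using that img by (simp add: f_inv_into_f)
    have bcl: "?b x \<in> carrier S" if "x \<in> carrier S" for x using mor_hom(7)[OF S S b that] .
    have "bij_betw (\<lambda>t. compose (carrier S) a t) (?fib (\<lambda>x. x)) (?fib \<eta>)"
    proof (rule bij_betw_byWitness[where f' = "\<lambda>t. compose (carrier S) ?b t"])
      show "\<forall>t\<in>?fib (\<lambda>x. x). compose (carrier S) ?b (compose (carrier S) a t) = t"
      proof
        fix t assume "t \<in> ?fib (\<lambda>x. x)"
        then have t: "t \<in> ?A" by simp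
        show "compose (carrier S) ?b (compose (carrier S) a t) = t"
          by (rule mor_eqI[of _ "carrier S"]) (use mor_hom(5,7)[OF S S t] ba in \<open>auto simp: compose_eq\<close>)
      qed
      show "\<forall>t\<in>?fib \<eta>. compose (carrier S) a (compose (carrier S) ?b t) = t"
      proof
        fix t assume "t \<in> ?fib \<eta>"
        then have t: "t \<in> ?A" by simp
        show "compose (carrier S) a (compose (carrier S) ?b t) = t"
        proof (rule mor_eqI[of _ "carrier S"])
          fix x assume x: "x \<in> carrier S"
          have "a (?b (t x)) = t x" by (rule ab[OF mor_hom(7)[OF S S t x]])
          then show "compose (carrier S) a (compose (carrier S) ?b t) x = t x" by (simp only: compose_eq[OF x])
        qed (use mor_hom(5)[OF S S t] in auto)
      qed
      show "(\<lambda>t. compose (carrier S) a t) ` ?fib (\<lambda>x. x) \<subseteq> ?fib \<eta>"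
      proof (rule image_subsetI)
        fix t assume t: "t \<in> ?fib (\<lambda>x. x)"
        have "compose (carrier S) a t \<in> ?A" using comp_closed[OF S S S _ a(1)] t by blast
        moreover have "\<eta> x = compose (carrier S) a t x" if x: "x \<in> P" for x
        proof -
          have "t x = x" using t x by force
          then show ?thesis using x PS[OF x] a(2) by (simp add: compose_eq)
        qed
        ultimately show "compose (carrier S) a t \<in> ?fib \<eta>" by blast
      qed
      show "(\<lambda>t. compose (carrier S) ?b t) ` ?fib \<eta> \<subseteq> ?fib (\<lambda>x. x)"
      proof (rule image_subsetI)
        fix t assume t: "t \<in> ?fib \<eta>"
        have "compose (carrier S) ?b t \<in> ?A" using comp_closed[OF S S S _ b] t by blast
        moreover have "x = compose (carrier S) ?b t x" if x: "x \<in> P" for x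
        proof -
          have "t x = a x" using t x a(2) by force
          then show ?thesis using ba[OF PS[OF x]] by (simp only: compose_eq[OF PS[OF x]])
        qed
        ultimately show "compose (carrier S) ?b t \<in> ?fib (\<lambda>x. x)" by blast
      qed
    qed
    then show ?thesis by (rule bij_betw_same_card[symmetric])
  qed
  have "?A = (\<Union>\<eta>\<in>?N. ?fib \<eta>)" unfolding N by auto
  then have "card ?A = card (\<Union>\<eta>\<in>?N. ?fib \<eta>)" by (rule arg_cong[where f = card])
  also have "\<dots> = (\<Sum>\<eta>\<in>?N. card (?fib \<eta>))"
  proof (rule card_UN_disjoint)
    show "finite ?N" unfolding N using fin by simp
    show "\<forall>\<eta>\<in>?N. finite (?fib \<eta>)" using fin by simp
    show "\<forall>\<eta>\<in>?N. \<forall>\<eta>'\<in>?N. \<eta> \<noteq> \<eta>' \<longrightarrow> ?fib \<eta> \<inter> ?fib \<eta>' = {}"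
    proof (intro ballI impI)
      fix \<eta> \<eta>' assume e: "\<eta> \<in> ?N" "\<eta>' \<in> ?N" "\<eta> \<noteq> \<eta>'"
      then have "\<eta> \<in> extensional P" "\<eta>' \<in> extensional P" unfolding N by auto
      then obtain x where "x \<in> P" "\<eta> x \<noteq> \<eta>' x" using mor_eqI e(3) by blast
      then show "?fib \<eta> \<inter> ?fib \<eta>' = {}" by force
    qed
  qed
  also have "\<dots> = card ?N * card (?fib (\<lambda>x. x))" using fib by simp
  finally have A: "card ?A = card ?N * card (?fib (\<lambda>x. x))" .
  show ?thesis
  proof (cases "\<eta> \<in> ?N")
    case True
    then show ?thesis using A fib[OF True] by (simp only: if_True mult.commute)
  next
    case False
    have "?fib \<eta> = {}"
    proof (rule ccontr)
      assume "?fib \<eta> \<noteq> {}"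
      then obtain a where a: "a \<in> ?A" "\<forall>x\<in>P. \<eta> x = a x" by blast
      have "\<eta> = restrict a P" by (rule mor_eqI[of _ P]) (use \<eta> a(2) in \<open>auto simp: PiE_iff\<close>)
      then show False using False a(1) N by blast
    qed
    then have "card (?fib \<eta>) = 0" by (simp only: card.empty)
    then show ?thesis by (simp only: False if_False mult_zero_left)
  qed
qed

end

context O_p'_subsystem
begin

text \<open>The mark of \<open>\<omega>\<^sub>N\<close> at (\<theta>, \<psi>) is |S| / |A| times the
  number of a in A = Aut_F(S) with \<psi> = a \<theta>. Summing over \<theta> in E(Q,S) gives n
  |S|^2 / (|A| |E(Q,S)|) with n the number of factorizations; the product formula removes one |S|,
  and for \<psi> in F \<open>card_factorizations\<close> turns the rest into |S| / |F(Q,S)|.\<close>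

theorem O_p'_idempotent_factorization:
  assumes \<omega>: "characteristic_idempotent S p F \<omega>" and \<omega>E: "characteristic_idempotent S p E \<omega>\<^sub>E"
    and \<omega>N: "characteristic_idempotent S p (normalizer_system S F) \<omega>\<^sub>N"
  shows "\<omega> = burnside_comp p S S S \<omega>\<^sub>N \<omega>\<^sub>E"
proof -
  interpret N: fusion_system S p "normalizer_system S F" by (rule fusion_system_normalizer_system)
  interpret SSS: burnside_composition S S S p
    by (simp add: burnside_composition_def burnside_module_def burnside_module_axioms_def finite_carrier prime_p is_group)
  have X: "\<omega> \<in> carrier (burnside p S S)" "\<omega>\<^sub>E \<in> carrier (burnside p S S)" "\<omega>\<^sub>N \<in> carrier (burnside p S S)"
    using \<omega> \<omega>E \<omega>N by (auto simp: characteristic_idempotent_def)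
  show ?thesis
  proof (rule SSS.GH.burnside_elem_eqI[OF X(1) SSS.burnside_comp_closed[OF X(3,2)]])
    fix Q \<psi> assume Q: "subgroup Q S" and \<psi>: "\<psi> \<in> Q \<rightarrow>\<^sub>E carrier S"
    have q: "finite Q" "(\<lambda>q. q) \<in> Q \<rightarrow> carrier S" "\<psi> \<in> Q \<rightarrow> carrier S" using finite_sub[OF Q] subgroup.subset[OF Q] \<psi> by auto
    let ?A = "F (carrier S) (carrier S)"
    let ?nF = "of_nat (card (F Q (carrier S))) :: rat" and ?nE = "of_nat (card (E Q (carrier S))) :: rat"
      and ?nS = "of_nat (card (carrier S)) :: rat" and ?nA = "of_nat (card ?A) :: rat"
    have pos: "?nS \<noteq> 0" "?nA \<noteq> 0" "?nE \<noteq> 0" "?nF \<noteq> 0"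
      using card_mor_pos[OF subgroup_self] E.card_mor_pos[OF Q] card_mor_pos[OF Q] finite_carrier one_closed by auto
    let ?fib = "\<lambda>\<theta>. {a \<in> ?A. \<forall>x\<in>Q. \<psi> x = a (\<theta> x)}"
    have mN: "elem_mark \<omega>\<^sub>N Q \<theta> \<psi> = of_nat (card (?fib \<theta>)) * ?nS / ?nA" if \<theta>E: "\<theta> \<in> E Q (carrier S)" for \<theta>
    proof -
      have \<theta>: "\<theta> \<in> F Q (carrier S)" using E_subset[OF Q subgroup_self] \<theta>E by blast
      have \<theta>Q: "subgroup (\<theta> ` Q) S" by (rule mor_image_subgroup[OF Q subgroup_self \<theta>])
      have inj: "inj_on \<theta> Q" by (rule mor_hom(3)[OF Q subgroup_self \<theta>])
      \<comment> \<open>The first map is absorbed into the domain: \<psi> \<theta>^-1 on \<theta>(Q)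
        has the inclusion as first map, and its extensions to S are exactly the a with \<psi> = a
        \<theta>.\<close>
      let ?\<eta> = "\<lambda>y\<in>\<theta> ` Q. \<psi> (inv_into Q \<theta> y)"
      have \<eta>v: "?\<eta> (\<theta> x) = \<psi> x" if "x \<in> Q" for x using that inj by simp
      have \<eta>: "?\<eta> \<in> \<theta> ` Q \<rightarrow>\<^sub>E carrier S" using inj q(3) by auto
      let ?nN = "of_nat (card (normalizer_system S F (\<theta> ` Q) (carrier S))) :: rat"
      have "elem_mark \<omega>\<^sub>N Q \<theta> \<psi> = elem_mark \<omega>\<^sub>N Q ((\<lambda>x. x) \<circ> \<theta>) (?\<eta> \<circ> \<theta>)"
        by (rule elem_mark_cong) (simp_all only: \<eta>v comp_apply)
      also have "\<dots> = elem_mark \<omega>\<^sub>N (\<theta> ` Q) (\<lambda>x. x) ?\<eta>" by (rule elem_mark_reindex[symmetric])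
      also have "\<dots> = (if ?\<eta> \<in> normalizer_system S F (\<theta> ` Q) (carrier S) then ?nS / ?nN else 0)"
        by (rule N.char_idempotent_elem_mark[OF \<omega>N \<theta>Q \<eta>])
      also have "\<dots> = of_nat (card {a \<in> ?A. \<forall>y\<in>\<theta> ` Q. ?\<eta> y = a y}) * ?nS / ?nA"
      proof -
        have "of_nat (card {a \<in> ?A. \<forall>y\<in>\<theta> ` Q. ?\<eta> y = a y}) * ?nN =
          (if ?\<eta> \<in> normalizer_system S F (\<theta> ` Q) (carrier S) then ?nA else 0)"
          using arg_cong[OF card_extending_automorphisms[OF \<theta>Q \<eta>], of "of_nat :: nat \<Rightarrow> rat"] by (simp only: of_nat_mult of_nat_0 if_distrib[of of_nat])
        moreover have "?nN \<noteq> 0" using N.card_mor_pos[OF \<theta>Q] by simp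
        moreover have "(if c then s / n else 0) = k * s / a" if "k * n = (if c then a else 0)" "n \<noteq> 0" "a \<noteq> 0" for c and s n k a :: rat
          using that by (auto simp: field_simps split: if_splits)
        ultimately show ?thesis using pos(2) by blast
      qed
      also have "{a \<in> ?A. \<forall>y\<in>\<theta> ` Q. ?\<eta> y = a y} = ?fib \<theta>" using \<eta>v by auto
      finally show ?thesis .
    qed
    let ?N = "{(a, \<theta>) \<in> ?A \<times> E Q (carrier S). \<forall>x\<in>Q. \<psi> x = a (\<theta> x)}"
    have fE: "finite (E Q (carrier S))" by (rule E.finite_mor[OF Q subgroup_self])
    have "?nS * elem_mark (burnside_comp p S S S \<omega>\<^sub>N \<omega>\<^sub>E) Q (\<lambda>q. q) \<psi> =
      (\<Sum>\<theta>\<in>Q \<rightarrow>\<^sub>E carrier S. elem_mark \<omega>\<^sub>N Q \<theta> \<psi> * elem_mark \<omega>\<^sub>E Q (\<lambda>q. q) \<theta>)"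
      by (rule SSS.elem_mark_comp[OF X(3,2) q])
    also have "\<dots> = (\<Sum>\<theta>\<in>Q \<rightarrow>\<^sub>E carrier S. if \<theta> \<in> E Q (carrier S) then of_nat (card (?fib \<theta>)) * (?nS / ?nA * (?nS / ?nE)) else 0)"
      by (rule sum.cong[OF refl]) (simp add: E.char_idempotent_elem_mark[OF \<omega>E Q] mN)
    also have "\<dots> = (\<Sum>\<theta>\<in>E Q (carrier S). of_nat (card (?fib \<theta>)) * (?nS / ?nA * (?nS / ?nE)))"
    proof -
      have "(Q \<rightarrow>\<^sub>E carrier S) \<inter> E Q (carrier S) = E Q (carrier S)" using E.mor_hom(6)[OF Q subgroup_self] by blast
      moreover have "finite (Q \<rightarrow>\<^sub>E carrier S)" using q(1) finite_carrier by (simp add: finite_PiE)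
      ultimately show ?thesis by (simp add: sum.If_cases Int_def)
    qed
    also have "\<dots> = of_nat (\<Sum>\<theta>\<in>E Q (carrier S). card (?fib \<theta>)) * (?nS / ?nA * (?nS / ?nE))"
      unfolding of_nat_sum sum_distrib_right ..
    also have "(\<Sum>\<theta>\<in>E Q (carrier S). card (?fib \<theta>)) = card ?N"
    proof -
      have "card (SIGMA \<theta>:E Q (carrier S). ?fib \<theta>) = (\<Sum>\<theta>\<in>E Q (carrier S). card (?fib \<theta>))"
        using fE finite_mor[OF subgroup_self subgroup_self] by (intro card_SigmaI) auto
      moreover have "?N = prod.swap ` (SIGMA \<theta>:E Q (carrier S). ?fib \<theta>)"
      proof (intro subset_antisym subsetI)
        fix z assume "z \<in> ?N"
        then obtain a \<theta> where z: "z = (a, \<theta>)" "a \<in> ?A" "\<theta> \<in> E Q (carrier S)" "\<forall>x\<in>Q. \<psi> x = a (\<theta> x)" by blast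
        then have "(\<theta>, a) \<in> (SIGMA \<theta>:E Q (carrier S). ?fib \<theta>)" by blast
        then show "z \<in> prod.swap ` (SIGMA \<theta>:E Q (carrier S). ?fib \<theta>)"
          by (rule rev_image_eqI) (simp only: z(1) swap_simp)
      qed auto
      ultimately show ?thesis by (simp only: card_image[OF inj_swap])
    qed
    finally have sum: "?nS * elem_mark (burnside_comp p S S S \<omega>\<^sub>N \<omega>\<^sub>E) Q (\<lambda>q. q) \<psi> = of_nat (card ?N) * (?nS / ?nA * (?nS / ?nE))" .
    have cancel: "x = n * s / (a * e)" if "s * x = n * (s / a * (s / e))" "s \<noteq> 0" for s x n a e :: rat
    proof -
      have "s * x = s * (n * s / (a * e))" using that(1) by (simp only: times_divide_eq_right times_divide_eq_left divide_divide_eq_left mult.commute mult.left_commute)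
      then show ?thesis using that(2) by (simp only: mult_cancel_left) simp
    qed
    have rhs: "elem_mark (burnside_comp p S S S \<omega>\<^sub>N \<omega>\<^sub>E) Q (\<lambda>q. q) \<psi> = of_nat (card ?N) * ?nS / (?nA * ?nE)"
      by (rule cancel[OF sum pos(1)])
    have "of_nat (card ?N) * ?nS / (?nA * ?nE) = (if \<psi> \<in> F Q (carrier S) then ?nS / ?nF else 0)"
    proof (cases "\<psi> \<in> F Q (carrier S)")
      case True
      have Q': "subgroup Q (S\<lparr>carrier := carrier S\<rparr>)" using Q by simp
      have "card ?N * card (F Q (carrier S)) = card ?A * card (E Q (carrier S))"
        using I.card_factorizations[OF factors Q' True] by (simp only: carrier_aut_group)
      then have "of_nat (card ?N) * ?nF = ?nA * ?nE" unfolding of_nat_mult[symmetric] by (rule arg_cong)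
      moreover have "n * s / (a * e) = s / f" if "n * f = a * e" "a * e \<noteq> 0" "f \<noteq> 0" for n s a e f :: rat
        using that by (simp add: frac_eq_eq)
      ultimately have "of_nat (card ?N) * ?nS / (?nA * ?nE) = ?nS / ?nF" using pos by simp
      then show ?thesis by (simp only: True if_True)
    next
      case False
      have "?N = {}"
      proof (rule ccontr)
        assume "?N \<noteq> {}"
        then obtain a \<theta> where a: "a \<in> ?A" "\<theta> \<in> E Q (carrier S)" "\<forall>x\<in>Q. \<psi> x = a (\<theta> x)" by auto
        have \<theta>: "\<theta> \<in> F Q (carrier S)" using E_subset[OF Q subgroup_self] a(2) by blast
        have "compose Q a \<theta> \<in> F Q (carrier S)" by (rule comp_closed[OF Q subgroup_self subgroup_self \<theta> a(1)])
        moreover have "compose Q a \<theta> = \<psi>"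
          by (rule mor_eqI[of _ Q]) (use a(3) \<psi> in \<open>auto simp: compose_eq PiE_iff\<close>)
        ultimately show False using False by simp
      qed
      then have "card ?N = 0" by (simp only: card.empty)
      then show ?thesis by (simp only: False if_False of_nat_0 div_0 mult_zero_left)
    qed
    then show "elem_mark \<omega> Q (\<lambda>q. q) \<psi> = elem_mark (burnside_comp p S S S \<omega>\<^sub>N \<omega>\<^sub>E) Q (\<lambda>q. q) \<psi>"
      by (simp only: rhs char_idempotent_elem_mark[OF \<omega> Q \<psi>])
  qed
qed

end

theorem corollary1p4:
  fixes S :: "('a, 'm) monoid_scheme"
    and p :: nat
    and F :: "'a set \<Rightarrow> 'a set \<Rightarrow> ('a \<Rightarrow> 'a) set"
    and T :: "'a set"
    and S_T :: "('a, 'm) monoid_scheme"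
    and \<omega> :: "('a, 'a) burnside_elem"
  assumes "saturated_fusion_system S p F"
    and "characteristic_idempotent S p F \<omega>"
    and "T = hyperfocal S p F"
    and "S_T = S\<lparr>carrier := T\<rparr>"
  shows "(\<forall>E \<omega>\<^sub>E. is_O_p_subsystem S p F E \<and> characteristic_idempotent S_T p E \<omega>\<^sub>E \<longrightarrow>
            burnside_comp p S_T S S \<omega> (basis_elem p S_T S T (\<lambda>x\<in>T. x)) =
            burnside_comp p S_T S_T S (basis_elem p S_T S T (\<lambda>x\<in>T. x)) \<omega>\<^sub>E) \<and>
         (\<forall>E \<omega>\<^sub>E \<omega>\<^sub>N. is_O_p'_subsystem S p F E \<and> characteristic_idempotent S p E \<omega>\<^sub>E \<and>
            characteristic_idempotent S p (normalizer_system S F) \<omega>\<^sub>N \<longrightarrow>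
            \<omega> = burnside_comp p S S S \<omega>\<^sub>N \<omega>\<^sub>E)"
proof (intro conjI allI impI)
  fix E \<omega>\<^sub>E assume a: "is_O_p_subsystem S p F E \<and> characteristic_idempotent S_T p E \<omega>\<^sub>E"
  interpret O_p_subsystem S p F E
    using assms(1) a by (simp add: O_p_subsystem_def O_p_subsystem_axioms_def)
  show "burnside_comp p S_T S S \<omega> (basis_elem p S_T S T (\<lambda>x\<in>T. x)) =
      burnside_comp p S_T S_T S (basis_elem p S_T S T (\<lambda>x\<in>T. x)) \<omega>\<^sub>E"
    using O_p_idempotent_reciprocity[OF assms(2)] a unfolding assms(3,4) by blast
next
  fix E \<omega>\<^sub>E \<omega>\<^sub>N assume a: "is_O_p'_subsystem S p F E \<and> characteristic_idempotent S p E \<omega>\<^sub>E \<and>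
            characteristic_idempotent S p (normalizer_system S F) \<omega>\<^sub>N"
  interpret O_p'_subsystem S p F E
    using assms(1) a by (simp add: O_p'_subsystem_def O_p'_subsystem_axioms_def)
  show "\<omega> = burnside_comp p S S S \<omega>\<^sub>N \<omega>\<^sub>E"
    using O_p'_idempotent_factorization[OF assms(2)] a by blast
qed

end
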